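(* Let $n\geq 2$. There exists a constant $C(n)>0$, depending only on $n$, such that for every bounded Lipschitz domain $\Omega\subset\mathbb{R}^n$ and every $k\in\mathbb{N}$, \[ D(\Omega)\,\sigma_k(\Omega)\leq C(n)\,k . \] Moreover, the exponent $1$ of $k$ is optimal: if $\alpha\in\mathbb{R}$ and there is a constant $C>0$ (depending only on $n$ and $\alpha$) such that $D(\Omega)\sigma_k(\Omega)\leq C k^{\alpha}$ for all bounded Lipschitz domains $\Omega\subset\mathbb{R}^n$ and all $k\in\mathbb{N}$, then $\alpha\geq 1$.
   Context: $\mathbb{N}=\{1,2,3,\ldots\}$. A bounded Lipschitz domain is a bounded, connected, nonempty open subset of $\mathbb{R}^n$ with Lipschitz boundary. $D(\Omega)=\sup\{|x-y|:x,y\in\Omega\}$ is the diameter. The Steklov eigenvalues of $\Omega$ are the numbers $\sigma$ for which $\Delta u=0$ in $\Omega$, $\partial_\nu u=\sigma u$ on $\partial\Omega$ has a nonzero solution ($\nu$ the outward unit normal), listed with multiplicity as $0=\sigma_0(\Omega)<\sigma_1(\Omega)\leq\sigma_2(\Omega)\leq\cdots\nearrow\infty$. They satisfy \[ \sigma_k(\Omega)=\min_{S\in S_{k+1}}\max_{u\in S\setminus\{0\}}\frac{\int_\Omega|\nabla u|^2dx}{\int_{\partial\Omega}u^2d\sigma}, \] where $S_{k+1}$ is the family of $(k+1)$-dimensional subspaces of $H^1(\Omega)$, $d\sigma$ is the surface area measure on $\partial\Omega$, and boundary values are taken in the sense of traces (the quotient is $+\infty$ when the trace of $u\neq 0$ vanishes).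 *)

theory Defs
  imports "HOL-Analysis.Analysis"
begin

subsection \<open>Bounded Lipschitz domains\<close>

(* Near each boundary point, in suitable orthonormal coordinates whose last axis is e, the domain
   is the set lying strictly above the graph of a Lipschitz function.  The point
   x - (x \<bullet> e) *\<^sub>R e is the orthogonal projection of x to the hyperplane {y. y \<bullet> e = 0}. *)
definition bounded_lipschitz_domain :: "'a::euclidean_space set \<Rightarrow> bool" where
  "bounded_lipschitz_domain \<Omega> \<longleftrightarrow>
     bounded \<Omega> \<and> connected \<Omega> \<and> \<Omega> \<noteq> {} \<and> open \<Omega> \<and>
     (\<forall>p\<in>frontier \<Omega>. \<exists>r>0. \<exists>e L. \<exists>\<gamma> :: 'a \<Rightarrow> real.
        norm e = 1 \<and> lipschitz_on L {y. y \<bullet> e = 0} \<gamma> \<and>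
        \<Omega> \<inter> ball p r = {x \<in> ball p r. \<gamma> (x - (x \<bullet> e) *\<^sub>R e) < x \<bullet> e})"


subsection \<open>Surface measure\<close>

(* d-dimensional Hausdorff measure, with the factor for which it agrees with Lebesgue measure
   in d-dimensional Euclidean space.  The library's diameter is meaningful only for bounded sets,
   so the covering sets are required to be bounded. *)
definition hausdorff_content :: "nat \<Rightarrow> real \<Rightarrow> 'a::metric_space set \<Rightarrow> ennreal" where
  "hausdorff_content d \<delta> A =
     (INF C \<in> {C :: nat \<Rightarrow> 'a set. A \<subseteq> (\<Union>i. C i) \<and> (\<forall>i. bounded (C i) \<and> diameter (C i) \<le> \<delta>)}.
        \<Sum>i. ennreal (unit_ball_vol (real d) * (diameter (C i) / 2) ^ d))"

definition hausdorff_outer :: "nat \<Rightarrow> 'a::metric_space set \<Rightarrow> ennreal" where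
  "hausdorff_outer d A = (SUP \<delta>\<in>{0<..}. hausdorff_content d \<delta> A)"

definition hausdorff_measure :: "nat \<Rightarrow> 'a::metric_space measure" where
  "hausdorff_measure d = measure_of UNIV (sets borel) (hausdorff_outer d)"

definition surface_measure :: "'a::euclidean_space set \<Rightarrow> 'a measure" where
  "surface_measure \<Omega> = restrict_space (hausdorff_measure (DIM('a) - 1)) (frontier \<Omega>)"


subsection \<open>The Sobolev space $H^1$ and traces\<close>

definition square_integrable :: "'a measure \<Rightarrow> ('a \<Rightarrow> 'b::euclidean_space) \<Rightarrow> bool" where
  "square_integrable M f \<longleftrightarrow> f \<in> borel_measurable M \<and> integrable M (\<lambda>x. (norm (f x))\<^sup>2)"

definition C1_with_gradient :: "('a::euclidean_space \<Rightarrow> real) \<Rightarrow> ('a \<Rightarrow> 'a) \<Rightarrow> bool" where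
  "C1_with_gradient \<phi> D\<phi> \<longleftrightarrow> (\<forall>x. GDERIV \<phi> x :> D\<phi> x) \<and> continuous_on UNIV D\<phi>"

definition test_function :: "'a::euclidean_space set \<Rightarrow> ('a \<Rightarrow> real) \<Rightarrow> ('a \<Rightarrow> 'a) \<Rightarrow> bool" where
  "test_function \<Omega> \<phi> D\<phi> \<longleftrightarrow>
     C1_with_gradient \<phi> D\<phi> \<and> (\<exists>K. compact K \<and> K \<subseteq> \<Omega> \<and> (\<forall>x. x \<notin> K \<longrightarrow> \<phi> x = 0))"

(* u belongs to H^1(\<Omega>) and Du is its weak gradient.  Functions are not identified when they agree
   almost everywhere, so u and Du are arbitrary representatives; their values outside \<Omega> play
   no role. *)
definition H1_with_gradient :: "'a::euclidean_space set \<Rightarrow> ('a \<Rightarrow> real) \<Rightarrow> ('a \<Rightarrow> 'a) \<Rightarrow> bool" where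
  "H1_with_gradient \<Omega> u Du \<longleftrightarrow>
     square_integrable (lebesgue_on \<Omega>) u \<and> square_integrable (lebesgue_on \<Omega>) Du \<and>
     (\<forall>\<phi> D\<phi>. test_function \<Omega> \<phi> D\<phi> \<longrightarrow>
        (\<integral>x. u x *\<^sub>R D\<phi> x \<partial>lebesgue_on \<Omega>) = - (\<integral>x. \<phi> x *\<^sub>R Du x \<partial>lebesgue_on \<Omega>))"

(* The trace is the continuous extension to H^1(\<Omega>) of the restriction of functions that are C^1 up
   to the boundary to \<partial>\<Omega>; these functions are dense in H^1(\<Omega>) when \<Omega> is a bounded Lipschitz
   domain. *)
definition has_trace :: "'a::euclidean_space set \<Rightarrow> ('a \<Rightarrow> real) \<Rightarrow> ('a \<Rightarrow> real) \<Rightarrow> bool" where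
  "has_trace \<Omega> u g \<longleftrightarrow>
     square_integrable (surface_measure \<Omega>) g \<and>
     (\<exists>Du \<phi> D\<phi>. H1_with_gradient \<Omega> u Du \<and>
        (\<forall>j::nat. C1_with_gradient (\<phi> j) (D\<phi> j)) \<and>
        (\<lambda>j. \<integral>\<^sup>+x. ennreal ((u x - \<phi> j x)\<^sup>2 + (norm (Du x - D\<phi> j x))\<^sup>2) \<partial>lebesgue_on \<Omega>) \<longlonglongrightarrow> 0 \<and>
        (\<lambda>j. \<integral>\<^sup>+x. ennreal ((g x - \<phi> j x)\<^sup>2) \<partial>surface_measure \<Omega>) \<longlonglongrightarrow> 0)"


subsection \<open>The Steklov problem\<close>

definition weakly_harmonic :: "'a::euclidean_space set \<Rightarrow> ('a \<Rightarrow> real) \<Rightarrow> bool" where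
  "weakly_harmonic \<Omega> u \<longleftrightarrow>
     (\<exists>Du. H1_with_gradient \<Omega> u Du \<and>
        (\<forall>\<phi> D\<phi>. test_function \<Omega> \<phi> D\<phi> \<longrightarrow> (\<integral>x. Du x \<bullet> D\<phi> x \<partial>lebesgue_on \<Omega>) = 0))"

(* For weakly harmonic u in H^1(\<Omega>), the outward normal derivative on \<partial>\<Omega> is given by Green's formula
     \<integral>\<^bsub>\<Omega>\<^esub> Du \<bullet> Dv dx = \<integral>\<^bsub>\<partial>\<Omega>\<^esub> (normal derivative of u) v d\<sigma>   for all v in H^1(\<Omega>),
   the term with the Laplacian of u being zero. *)
definition harmonic_normal_derivative ::
    "'a::euclidean_space set \<Rightarrow> ('a \<Rightarrow> real) \<Rightarrow> ('a \<Rightarrow> real) \<Rightarrow> bool" where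
  "harmonic_normal_derivative \<Omega> u h \<longleftrightarrow>
     weakly_harmonic \<Omega> u \<and> square_integrable (surface_measure \<Omega>) h \<and>
     (\<exists>Du. H1_with_gradient \<Omega> u Du \<and>
        (\<forall>v Dv g. H1_with_gradient \<Omega> v Dv \<and> has_trace \<Omega> v g \<longrightarrow>
           (\<integral>x. Du x \<bullet> Dv x \<partial>lebesgue_on \<Omega>) = (\<integral>x. h x * g x \<partial>surface_measure \<Omega>)))"

definition steklov_solution :: "'a::euclidean_space set \<Rightarrow> real \<Rightarrow> ('a \<Rightarrow> real) \<Rightarrow> bool" where
  "steklov_solution \<Omega> t u \<longleftrightarrow>
     weakly_harmonic \<Omega> u \<and>
     (\<exists>g. has_trace \<Omega> u g \<and> harmonic_normal_derivative \<Omega> u (\<lambda>x. t * g x))"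

(* Linear independence of the classes, modulo equality almost everywhere in \<Omega>, of
   u 0, ..., u (m - 1). *)
definition ae_independent :: "'a::euclidean_space set \<Rightarrow> nat \<Rightarrow> (nat \<Rightarrow> 'a \<Rightarrow> real) \<Rightarrow> bool" where
  "ae_independent \<Omega> m u \<longleftrightarrow>
     (\<forall>c :: nat \<Rightarrow> real.
        (AE x in lebesgue_on \<Omega>. (\<Sum>i<m. c i * u i x) = 0) \<longrightarrow> (\<forall>i<m. c i = 0))"

(* The dimension of the space of solutions; t is an eigenvalue if and only if it is nonzero. *)
definition steklov_multiplicity :: "'a::euclidean_space set \<Rightarrow> real \<Rightarrow> enat" where
  "steklov_multiplicity \<Omega> t =
     Sup {enat m | m. \<exists>u. (\<forall>i<m. steklov_solution \<Omega> t (u i)) \<and> ae_independent \<Omega> m u}"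

definition steklov_listing :: "'a::euclidean_space set \<Rightarrow> (nat \<Rightarrow> real) \<Rightarrow> bool" where
  "steklov_listing \<Omega> s \<longleftrightarrow>
     incseq s \<and> filterlim s at_top sequentially \<and>
     (\<forall>t. enat (card {k. s k = t}) = steklov_multiplicity \<Omega> t)"

(* Indexed from 0.  A bounded Lipschitz domain (in dimension at least 2) has exactly one listing. *)
definition steklov_eigenvalue :: "'a::euclidean_space set \<Rightarrow> nat \<Rightarrow> real" where
  "steklov_eigenvalue \<Omega> = (THE s. steklov_listing \<Omega> s)"

end

theory Submission
  imports Defs "HOL-Library.Function_Algebras" "HOL-Library.Diagonal_Subsequence"
begin

text \<open>On the closure \<open>W\<close> of \<open>C\<^sup>1\<close> functions, paired with their traces, Dirichlet energy \<open>A\<close> and boundary mass \<open>B\<close>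
  are quadratic forms, and \<open>B\<close> is compact with respect to \<open>A + B\<close>: a Friedrichs inequality bounds the interior
  mass, and near the boundary the trace is controlled by finitely many means up to a small multiple of \<open>A\<close>.
  So \<open>A\<close> has an eigenbasis relative to \<open>B\<close>, and its eigenvalues are the Steklov eigenvalues.

  For the upper bound, cut a diameter into \<open>k + 1\<close> slabs of width \<open>2r\<close>, \<open>r\<close> of order \<open>D / k\<close>. Each slab
  contains a ball of radius \<open>s \<le> r\<close> with volume of \<open>\<Omega>\<close> at most \<open>const (s\<^sup>2 / r)\<close> times the area of its boundary in the
  concentric half ball. This follows from a relative isoperimetric inequality once \<open>\<Omega>\<close> fills a fixed proportion
  of the ball, up to moving the centre out of \<open>\<Omega>\<close>. Bumps on the \<open>k + 1\<close> disjoint balls have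
  Rayleigh quotients of order \<open>1 / r\<close>.

  Optimality comes from boxes of length \<open>1\<close> and width \<open>1 / k\<close>, where \<open>k\<close> mean value conditions force the Rayleigh
  quotient to be at least of order \<open>k\<close>.\<close>

subsection \<open>Hausdorff measure\<close>

text \<open>The constant may depend on n alone, so Lipschitz charts may enter the upper bound only
  qualitatively, through the compactness that yields the eigenbasis. Quantitatively the boundary is
  seen only through volumes of sweeps, whose bound holds for every compact set. A bump of radius s
  has Rayleigh quotient of order V / (s^2 a), where V is the volume of \<Omega> in its ball and a
  the boundary area in the half ball; this is where the demand on V comes from. A ball of prescribed
  centre and radius may be full of \<Omega> or almost free of it, hence the freedom in both.
  Eigenvalues are defined by counting weak solutions, not by min-max, so the min-max bounds need an
  eigenbasis that provably exhausts all solutions. Boundary mass vanishes on fields supported inside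
  \<Omega>, which is why the spectral theory concerns a pair of semidefinite forms. Hausdorff and
  Lebesgue measure meet in just two inequalities for sets, sweep at most area and area at most tube,
  lifted to functions by slicing into layers.\<close>

text \<open>Caratheodory's criterion. For closed F the part of T off F is cut into shells around F.
  Shells of equal parity have positive mutual distance, so all shells together have measure at most
  2 f T. Hence the shells close to F are negligible, and T - F may be replaced by
  \<open>S n\<close>, which is far from F.\<close>

lemma metric_outer_measure_borel:
  fixes f :: "'a::metric_space set \<Rightarrow> ennreal"
  assumes oms: "outer_measure_space (Pow UNIV) f"
    and metric: "\<And>A B \<eta>. 0 < \<eta> \<Longrightarrow> (\<And>x y. x \<in> A \<Longrightarrow> y \<in> B \<Longrightarrow> \<eta> \<le> dist x y)
                   \<Longrightarrow> f A + f B \<le> f (A \<union> B)"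
  shows "sets borel \<subseteq> lambda_system UNIV (Pow UNIV) f"
proof -
  interpret P: sigma_algebra "UNIV :: 'a set" "Pow UNIV" by (rule sigma_algebra_Pow)
  have pos: "f {} = 0" and inc: "\<And>A B. A \<subseteq> B \<Longrightarrow> f A \<le> f B"
    and cs: "\<And>A :: nat \<Rightarrow> 'a set. disjoint_family A \<Longrightarrow> f (\<Union>i. A i) \<le> (\<Sum>i. f (A i))"
    using oms by (auto simp: outer_measure_space_def positive_def increasing_def countably_subadditive_def)
  have sub: "f (A \<union> B) \<le> f A + f B" if "A \<inter> B = {}" for A B
    using P.countably_subadditive_subadditive[of f] oms that
    by (auto simp: outer_measure_space_def subadditive_def)
  have sub': "f (A \<union> B) \<le> f A + f B" for A B
    using sub[of A "B - A"] inc[of "B - A" B] by (metis Diff_disjoint Diff_subset Un_Diff_cancel add_left_mono order_trans)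
  have sa: "sigma_algebra UNIV (lambda_system UNIV (Pow UNIV) f)"
    using P.caratheodory_lemma[OF oms] by (simp add: measure_space_def)
  have "F \<in> lambda_system UNIV (Pow UNIV) f" if F: "closed F" for F
  proof (cases "F = {}")
    case True
    then show ?thesis
      using P.lambda_system_empty[of f] oms by (simp add: outer_measure_space_def)
  next
    case ne: False
    have "f (T \<inter> F) + f (T - F) \<le> f T" for T
    proof (cases "f T = \<infinity>")
      case fin: False
      define R where "R m = {x \<in> T. 1 / real (m + 2) \<le> infdist x F \<and> infdist x F < 1 / real (m + 1)}" for m
      define S where "S n = {x \<in> T. 1 / real (n + 1) \<le> infdist x F}" for n
      have far: "infdist x F - infdist y F \<le> dist x y" for x y
        using infdist_triangle[of x F y] by (simp add: dist_commute)
      have odd_even: "(\<Sum>i<k. f (R (2 * i + c))) \<le> f (\<Union>i<k. R (2 * i + c))" for k c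
      proof (induction k)
        case (Suc k)
        have "f (\<Union>i<k. R (2 * i + c)) + f (R (2 * k + c)) \<le> f ((\<Union>i<k. R (2 * i + c)) \<union> R (2 * k + c))"
        proof (cases "k = 0")
          case False
          show ?thesis
          proof (rule metric)
            show "0 < 1 / real (2 * k + c) - 1 / real (2 * k + c + 1)"
              using divide_strict_left_mono[of "real (2 * k + c)" "real (2 * k + c + 1)" 1] False by simp
            fix x y assume "x \<in> (\<Union>i<k. R (2 * i + c))" "y \<in> R (2 * k + c)"
            then obtain i where i: "i < k" "1 / real (2 * i + c + 2) \<le> infdist x F"
              "infdist y F < 1 / real (2 * k + c + 1)" by (auto simp: R_def)
            have "1 / real (2 * k + c) \<le> 1 / real (2 * i + c + 2)"
              using i(1) by (intro divide_left_mono) auto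
            then show "1 / real (2 * k + c) - 1 / real (2 * k + c + 1) \<le> dist x y"
              using i far[of x y] by linarith
          qed
        qed (simp add: pos)
        then show ?case using Suc
          by (simp add: lessThan_Suc Un_commute) (metis (no_types, lifting) add.commute add_left_mono order_trans)
      qed (simp add: pos)
      have bd: "(\<Sum>i<k. f (R (2 * i + c))) \<le> f T" for k c
      proof -
        have "(\<Union>i<k. R (2 * i + c)) \<subseteq> T" unfolding R_def by blast
        then show ?thesis using odd_even order_trans inc by blast
      qed
      have "(\<Sum>i<2*k. f (R i)) = (\<Sum>i<k. f (R (2 * i))) + (\<Sum>i<k. f (R (2 * i + 1)))" for k
        by (induction k) (auto simp: algebra_simps)
      then have "(\<Sum>i<2*k. f (R i)) \<le> f T + f T" for k
        using add_mono[OF bd[of 0 k] bd[of 1 k]] by simp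
      moreover have "(\<Sum>i<k. f (R i)) \<le> (\<Sum>i<2*k. f (R i))" for k
        by (rule sum_mono2) auto
      ultimately have "(\<Sum>i<k. f (R i)) \<le> f T + f T" for k
        using order_trans by blast
      then have "(\<Sum>i. f (R i)) \<le> f T + f T"
        by (intro suminf_le_const summableI) 
      then have sfin: "(\<Sum>i. f (R i)) \<noteq> \<infinity>" using fin by (auto simp: top_unique)
      \<comment> \<open>The partial sum stays on the left and the full sum on the right, so that
        nothing has to be subtracted in \<open>ennreal\<close>; the finite total is cancelled after
        the supremum over n.\<close>
      have main: "(\<Sum>i<n. f (R i)) + (f (T \<inter> F) + f (T - F)) \<le> f T + (\<Sum>i. f (R i))" for n
      proof -
        have "f (T \<inter> F) + f (S n) \<le> f ((T \<inter> F) \<union> S n)"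
        proof (rule metric)
          show "0 < 1 / real (n + 1)" by simp
          fix x y assume "x \<in> T \<inter> F" "y \<in> S n"
          then show "1 / real (n + 1) \<le> dist x y"
            using far[of y x] by (auto simp: S_def infdist_zero dist_commute)
        qed
        also have "... \<le> f T" by (rule inc) (auto simp: S_def)
        finally have 1: "f (T \<inter> F) + f (S n) \<le> f T" .
        have "T - F \<subseteq> S n \<union> (\<Union>m. R (m + n))"
        proof
          fix x assume x: "x \<in> T - F"
          then have p: "0 < infdist x F" using infdist_pos_not_in_closed[OF F ne] by auto
          show "x \<in> S n \<union> (\<Union>m. R (m + n))"
          proof (cases "1 / real (n + 1) \<le> infdist x F")
            case False
            obtain m0 where m0: "1 / real (m0 + 1) \<le> infdist x F"
              using p by (metis less_imp_le nat_approx_posE Suc_eq_plus1)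
            define m where "m = (LEAST m. 1 / real (m + 1) \<le> infdist x F)"
            have m: "1 / real (m + 1) \<le> infdist x F"
              unfolding m_def by (rule LeastI[where P="\<lambda>m. 1 / real (m + 1) \<le> infdist x F", OF m0])
            have l: "\<not> (1 / real (j + 1) \<le> infdist x F)" if "j < m" for j
              using not_less_Least[OF that[unfolded m_def]] .
            have "m > n"
            proof (rule ccontr)
              assume "\<not> m > n"
              then have "1 / real (n + 1) \<le> 1 / real (m + 1)" by (intro divide_left_mono) auto
              then show False using m False by linarith
            qed
            then have "x \<in> R ((m - 1 - n) + n)"
              using m l[of "m - 1"] x by (auto simp: R_def)
            then show ?thesis by blast
          qed (use x in \<open>auto simp: S_def\<close>)
        qed
        then have "f (T - F) \<le> f (S n \<union> (\<Union>m. R (m + n)))" by (rule inc)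
        also have "... \<le> f (S n) + f (\<Union>m. R (m + n))" by (rule sub')
        also have "f (\<Union>m. R (m + n)) \<le> (\<Sum>m. f (R (m + n)))"
        proof (rule cs, unfold disjoint_family_on_def, intro ballI impI)
          have *: "R a \<inter> R b = {}" if "a < b" for a b
          proof -
            have "1 / real (b + 1) \<le> 1 / real (a + 2)" using that by (intro divide_left_mono) auto
            then show ?thesis by (auto simp: R_def)
          qed
          fix a b :: nat assume "a \<noteq> b"
          then show "R (a + n) \<inter> R (b + n) = {}"
            using *[of "a + n" "b + n"] *[of "b + n" "a + n"] by (cases "a < b") (auto simp: Int_commute)
        qed
        finally have 2: "f (T - F) \<le> f (S n) + (\<Sum>m. f (R (m + n)))" by (simp add: add_left_mono)
        have 3: "(\<Sum>m. f (R m)) = (\<Sum>m. f (R (m + n))) + (\<Sum>i<n. f (R i))"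
          by (rule suminf_offset) (rule summableI)
        have "(\<Sum>i<n. f (R i)) + (f (T \<inter> F) + f (T - F))
            \<le> (\<Sum>i<n. f (R i)) + (f (T \<inter> F) + (f (S n) + (\<Sum>m. f (R (m + n)))))"
          using 2 by (intro add_left_mono)
        also have "... = (f (T \<inter> F) + f (S n)) + (\<Sum>m. f (R m))" by (simp add: 3 ac_simps)
        also have "... \<le> f T + (\<Sum>m. f (R m))" using 1 by (rule add_right_mono)
        finally show ?thesis .
      qed
      have "(\<Sum>i. f (R i)) + (f (T \<inter> F) + f (T - F)) \<le> f T + (\<Sum>i. f (R i))"
        by (rule ennreal_suminf_bound_add) (rule main)
      then have "(f (T \<inter> F) + f (T - F)) + (\<Sum>i. f (R i)) \<le> f T + (\<Sum>i. f (R i))"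
        by (simp only: ac_simps)
      then show ?thesis
        using sfin by (metis ennreal_add_left_cancel_le add.commute)
    qed simp
    moreover have "f T \<le> f (T \<inter> F) + f (T - F)" for T
      using sub'[of "T \<inter> F" "T - F"] by (simp add: Int_Diff_Un)
    ultimately show ?thesis
      by (auto simp: P.lambda_system_eq simp del: Pow_UNIV intro: antisym)
  qed
  then have "sigma_sets UNIV (Collect closed) \<subseteq> lambda_system UNIV (Pow UNIV) f"
    by (intro sigma_algebra.sigma_sets_subset[OF sa]) auto
  then show ?thesis
    by (simp add: borel_eq_closed)
qed

lemma hausdorff_content_mono: "A \<subseteq> B \<Longrightarrow> hausdorff_content d \<delta> A \<le> hausdorff_content d \<delta> B"
  unfolding hausdorff_content_def by (rule INF_superset_mono) auto

lemma hausdorff_content_antimono: "\<delta> \<le> \<epsilon> \<Longrightarrow> hausdorff_content d \<epsilon> A \<le> hausdorff_content d \<delta> A"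
  unfolding hausdorff_content_def by (rule INF_superset_mono) (auto intro: order_trans)

lemma hausdorff_content_le_outer: "0 < \<delta> \<Longrightarrow> hausdorff_content d \<delta> A \<le> hausdorff_outer d A"
  unfolding hausdorff_outer_def by (rule SUP_upper) auto

lemma hausdorff_content_subadditive:
  "hausdorff_content d \<delta> (\<Union>i. A i) \<le> (\<Sum>i::nat. hausdorff_content d \<delta> (A i))"
proof (cases "(\<Sum>i::nat. hausdorff_content d \<delta> (A i)) = \<infinity>")
  case False
  let ?v = "\<lambda>S. ennreal (unit_ball_vol (real d) * (diameter S / 2) ^ d)"
  show ?thesis
  proof (rule ennreal_le_epsilon)
    fix e :: real assume e: "0 < e"
    have fin: "hausdorff_content d \<delta> (A i) < \<infinity>" for i
      using ennreal_suminf_lessD[of "\<lambda>i. hausdorff_content d \<delta> (A i)" \<infinity>] False by (simp add: less_top)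
    have "\<exists>C. A i \<subseteq> (\<Union>j. C j) \<and> (\<forall>j. bounded (C j) \<and> diameter (C j) \<le> \<delta>) \<and>
             (\<Sum>j::nat. ?v (C j)) < hausdorff_content d \<delta> (A i) + ennreal (e * (1/2) ^ Suc i)" for i
    proof -
      have "hausdorff_content d \<delta> (A i) < hausdorff_content d \<delta> (A i) + ennreal (e * (1/2) ^ Suc i)"
        using fin[of i] e by (metis add_0 add.commute ennreal_add_left_cancel_less ennreal_less_zero_iff
            infinity_ennreal_def less_irrefl mult_pos_pos zero_less_divide_1_iff zero_less_numeral zero_less_power)
      then show ?thesis
        by (subst (asm) (1) hausdorff_content_def) (auto simp: INF_less_iff)
    qed
    then obtain C where C: "\<And>i. A i \<subseteq> (\<Union>j. C i j)" "\<And>i j. bounded (C i j) \<and> diameter (C i j) \<le> \<delta>"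
      "\<And>i. (\<Sum>j::nat. ?v (C i j)) < hausdorff_content d \<delta> (A i) + ennreal (e * (1/2) ^ Suc i)"
      by metis
    define E where "E n = (case prod_decode n of (i, j) \<Rightarrow> C i j)" for n
    have "hausdorff_content d \<delta> (\<Union>i. A i) \<le> (\<Sum>n. ?v (E n))"
      unfolding hausdorff_content_def
    proof (rule INF_lower, safe)
      fix x i assume "x \<in> A i"
      then obtain j where "x \<in> C i j" using C(1) by blast
      then have "x \<in> E (prod_encode (i, j))" by (simp add: E_def)
      then show "x \<in> (\<Union>i. E i)" by blast
    qed (use C(2) in \<open>auto simp: E_def split: prod.split\<close>)
    also have "... = (\<Sum>i. \<Sum>j. ?v (C i j))"
      using suminf_ennreal_2dimen[of "\<lambda>i. \<Sum>j. ?v (C i j)" "\<lambda>(i, j). ?v (C i j)"]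
      by (simp add: E_def case_prod_unfold)
    also have "... \<le> (\<Sum>i. hausdorff_content d \<delta> (A i) + ennreal (e * (1/2) ^ Suc i))"
      using C(3) by (intro suminf_le summableI) (auto intro: less_imp_le)
    also have "... = (\<Sum>i. hausdorff_content d \<delta> (A i)) + (\<Sum>i. ennreal (e * (1/2) ^ Suc i))"
      by (rule suminf_add[symmetric]) (rule summableI)+
    also have "(\<Sum>i. ennreal (e * (1/2) ^ Suc i)) = ennreal e"
    proof -
      have "(\<lambda>i. e * (1/2) ^ Suc i) sums (e * 1)" by (intro sums_mult power_half_series)
      then have "(\<lambda>i. ennreal (e * (1/2) ^ Suc i)) sums ennreal (e * 1)"
        using e by (subst sums_ennreal) (auto simp del: power_Suc)
      then show ?thesis by (simp add: sums_iff del: power_Suc)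
    qed
    finally show "hausdorff_content d \<delta> (\<Union>i. A i) \<le> (\<Sum>i. hausdorff_content d \<delta> (A i)) + ennreal e" .
  qed
qed simp

text \<open>For d = 0 every empty covering set would still cost 0^0 = 1; this is where 1 \<le> d
  enters.\<close>

lemma hausdorff_content_empty: "1 \<le> d \<Longrightarrow> 0 \<le> \<delta> \<Longrightarrow> hausdorff_content d \<delta> {} = 0"
  unfolding hausdorff_content_def
  by (rule antisym[OF INF_lower2[of "\<lambda>_. {}"]]) (auto simp: power_0_left)

lemma outer_measure_space_hausdorff:
  assumes "1 \<le> d"
  shows "outer_measure_space (Pow UNIV) (hausdorff_outer d :: 'a::metric_space set \<Rightarrow> ennreal)"
  unfolding outer_measure_space_def
proof (intro conjI)
  show "positive (Pow UNIV) (hausdorff_outer d)"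
    using assms by (auto simp: positive_def hausdorff_outer_def hausdorff_content_empty)
  show "increasing (Pow UNIV) (hausdorff_outer d)"
    unfolding increasing_def hausdorff_outer_def
    by (auto intro!: SUP_mono hausdorff_content_mono)
  have "hausdorff_outer d (\<Union>i. A i) \<le> (\<Sum>i. hausdorff_outer d (A i))"
    for A :: "nat \<Rightarrow> 'a::metric_space set"
    unfolding hausdorff_outer_def[of d "\<Union>i. A i"]
    by (rule SUP_least) (auto intro!: order_trans[OF hausdorff_content_subadditive] suminf_le summableI hausdorff_content_le_outer)
  then show "countably_subadditive (Pow UNIV) (hausdorff_outer d :: 'a set \<Rightarrow> ennreal)"
    by (auto simp: countably_subadditive_def)
qed

text \<open>Covering sets of diameter below \<eta> meet at most one of A and B. Replacing the sets
  that miss A, respectively B, by the empty set splits a cover of the union into two covers without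
  raising the total cost.\<close>

lemma hausdorff_outer_metric:
  assumes d: "1 \<le> d" and \<eta>: "0 < \<eta>" and sep: "\<And>x y. x \<in> A \<Longrightarrow> y \<in> B \<Longrightarrow> \<eta> \<le> dist x y"
  shows "hausdorff_outer d A + hausdorff_outer d B \<le> hausdorff_outer d (A \<union> B)"
proof -
  let ?v = "\<lambda>S. ennreal (unit_ball_vol (real d) * (diameter S / 2) ^ d)"
  have *: "hausdorff_content d \<delta> A + hausdorff_content d \<delta> B \<le> hausdorff_content d \<delta> (A \<union> B)"
    if \<delta>: "0 < \<delta>" "\<delta> < \<eta>" for \<delta>
    unfolding hausdorff_content_def[of d \<delta> "A \<union> B"]
  proof (rule INF_greatest, clarify)
    fix C :: "nat \<Rightarrow> 'a set"
    assume cov: "A \<union> B \<subseteq> \<Union> (range C)" and C: "\<forall>i. bounded (C i) \<and> diameter (C i) \<le> \<delta>"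
    have v0: "?v {} = 0" using d by (simp add: power_0_left)
    have disj: "C i \<inter> A = {} \<or> C i \<inter> B = {}" for i
    proof (rule ccontr)
      assume "\<not> ?thesis"
      then obtain x y where "x \<in> C i" "x \<in> A" "y \<in> C i" "y \<in> B" by auto
      then show False
        using sep[of x y] diameter_bounded_bound[of "C i" x y] C[rule_format, of i] \<delta> by simp
    qed
    have part: "hausdorff_content d \<delta> X \<le> (\<Sum>i. ?v (if C i \<inter> X = {} then {} else C i))" if "X \<subseteq> A \<union> B" for X
      unfolding hausdorff_content_def
      by (rule INF_lower) (use that cov C \<delta> in \<open>auto split: if_splits\<close>, blast?)
    have "hausdorff_content d \<delta> A + hausdorff_content d \<delta> B
        \<le> (\<Sum>i. ?v (if C i \<inter> A = {} then {} else C i)) + (\<Sum>i. ?v (if C i \<inter> B = {} then {} else C i))"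
      by (intro add_mono part) auto
    also have "... = (\<Sum>i. ?v (if C i \<inter> A = {} then {} else C i) + ?v (if C i \<inter> B = {} then {} else C i))"
      by (rule suminf_add) (rule summableI)+
    also have "... \<le> (\<Sum>i. ?v (C i))"
    proof (intro suminf_le summableI)
      fix i
      show "?v (if C i \<inter> A = {} then {} else C i) + ?v (if C i \<inter> B = {} then {} else C i) \<le> ?v (C i)"
        using disj[of i] v0 by (auto simp del: diameter_empty)
    qed
    finally show "hausdorff_content d \<delta> A + hausdorff_content d \<delta> B \<le> (\<Sum>i. ?v (C i))" .
  qed
  \<comment> \<open>Two meshes, because the suprema for A and for B are taken independently; a
    common smaller mesh below \<eta> dominates both.\<close>
  have "hausdorff_content d \<delta> A + hausdorff_content d \<epsilon> B \<le> hausdorff_outer d (A \<union> B)"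
    if "0 < \<delta>" "0 < \<epsilon>" for \<delta> \<epsilon>
  proof -
    define r where "r = min (\<eta> / 2) (min \<delta> \<epsilon>)"
    have r: "0 < r" "r < \<eta>" "r \<le> \<delta>" "r \<le> \<epsilon>" using that \<eta> by (auto simp: r_def min_def)
    have "hausdorff_content d \<delta> A + hausdorff_content d \<epsilon> B \<le> hausdorff_content d r A + hausdorff_content d r B"
      using r by (intro add_mono hausdorff_content_antimono)
    also have "... \<le> hausdorff_outer d (A \<union> B)"
      using *[OF r(1,2)] hausdorff_content_le_outer[OF r(1)] order_trans by blast
    finally show ?thesis .
  qed
  then have "hausdorff_content d \<delta> A + hausdorff_outer d B \<le> hausdorff_outer d (A \<union> B)" if "0 < \<delta>" for \<delta>
    using that unfolding hausdorff_outer_def[of d B]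
    by (subst ennreal_SUP_add_right) (auto intro!: SUP_least)
  then have "(SUP \<delta>\<in>{0<..}. hausdorff_content d \<delta> A + hausdorff_outer d B) \<le> hausdorff_outer d (A \<union> B)"
    by (intro SUP_least) auto
  moreover have "(SUP \<delta>\<in>{0<..}. hausdorff_content d \<delta> A + hausdorff_outer d B) = hausdorff_outer d A + hausdorff_outer d B"
    unfolding hausdorff_outer_def[of d A] by (rule ennreal_SUP_add_left) (auto intro: exI[of _ 1])
  ultimately show ?thesis by simp
qed

text \<open>\<open>measure_of\<close> falls back to the zero measure unless its set function is a
  measure on the given sets, so this fact is what gives \<open>hausdorff_measure\<close> its
  values.\<close>

lemma measure_space_hausdorff:
  assumes "1 \<le> d"
  shows "measure_space UNIV (sets borel) (hausdorff_outer d :: 'a::metric_space set \<Rightarrow> ennreal)"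
proof (rule measure_down)
  note oms = outer_measure_space_hausdorff[OF assms, where ?'a = 'a]
  show "measure_space UNIV (lambda_system UNIV (Pow UNIV) (hausdorff_outer d)) (hausdorff_outer d :: 'a set \<Rightarrow> ennreal)"
    by (rule sigma_algebra.caratheodory_lemma[OF sigma_algebra_Pow oms])
  show "sigma_algebra UNIV (sets (borel :: 'a measure))"
    using sets.sigma_algebra_axioms[of "borel :: 'a measure"] by simp
  show "sets borel \<subseteq> lambda_system UNIV (Pow UNIV) (hausdorff_outer d :: 'a set \<Rightarrow> ennreal)"
    by (rule metric_outer_measure_borel[OF oms]) (rule hausdorff_outer_metric[OF assms])
qed

lemma sets_hausdorff_measure [simp, measurable_cong]: "sets (hausdorff_measure d) = sets borel"
  by (simp add: hausdorff_measure_def sets.sigma_sets_eq[of borel, simplified])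

lemma space_hausdorff_measure [simp]: "space (hausdorff_measure d) = UNIV"
  by (simp add: hausdorff_measure_def)

lemma emeasure_hausdorff_measure:
  fixes A :: "'a::metric_space set"
  assumes "1 \<le> d" "A \<in> sets borel"
  shows "emeasure (hausdorff_measure d) A = hausdorff_outer d A"
  unfolding hausdorff_measure_def
  using measure_space_hausdorff[OF assms(1), where ?'a = 'a] assms(2)
  by (intro emeasure_measure_of_sigma) (auto simp: measure_space_def)

lemma ennreal_mult_INF_le:
  fixes c :: ennreal
  assumes "\<And>i. i \<in> I \<Longrightarrow> a \<le> c * f i" and c: "c \<noteq> 0" "c \<noteq> \<infinity>"
  shows "a \<le> c * (INF i\<in>I. f i)"
proof -
  have "a / c \<le> (INF i\<in>I. f i)"
  proof (rule INF_greatest)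
    fix i assume "i \<in> I"
    then show "a / c \<le> f i"
      using assms divide_le_posI_ennreal[of c a "f i"] by (simp add: zero_less_iff_neq_zero mult.commute)
  qed
  then have "c * (a / c) \<le> c * (INF i\<in>I. f i)" by (rule mult_left_mono) simp
  moreover have "c * (a / c) = a"
    using c by (metis ennreal_divide_times ennreal_mult_divide_eq mult.commute infinity_ennreal_def ennreal_times_divide)
  ultimately show ?thesis by simp
qed

section \<open>Volume of sweeps against Hausdorff measure\<close>

text \<open>Oriented so that x belongs to it exactly when the segment from x to x + z meets A: if A
  separates x from x + z, then x lies in the sweep.\<close>

definition sweep :: "'a::euclidean_space \<Rightarrow> 'a set \<Rightarrow> 'a set" where
  "sweep z A = {x. \<exists>t\<in>{0..1}. x + t *\<^sub>R z \<in> A}"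

lemma compact_sweep: "compact A \<Longrightarrow> compact (sweep z A)"
proof -
  assume "compact A"
  then have "compact ((\<lambda>(a, t). a - t *\<^sub>R z) ` (A \<times> {0..1::real}))"
    by (intro compact_continuous_image compact_Times) (auto intro!: continuous_intros simp: case_prod_unfold)
  also have "(\<lambda>(a, t). a - t *\<^sub>R z) ` (A \<times> {0..1::real}) = sweep z A"
    unfolding sweep_def image_def by (auto simp: algebra_simps)
  finally show ?thesis .
qed

text \<open>A covering set of diameter D has a sweep inside at most 3 |z| / D balls of radius 2 D.
  Their volume, divided by |z| and by the cost of the set in the Hausdorff content, is this
  number.\<close>

definition proj_const :: "nat \<Rightarrow> real" where
  "proj_const n = 3 * 2 ^ n * 2 ^ (n - 1) * unit_ball_vol n / unit_ball_vol (n - 1)"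

lemma proj_const_pos: "0 < proj_const n"
  by (auto simp: proj_const_def intro!: mult_pos_pos divide_pos_pos)

text \<open>The sweep of a small set is a thin cylinder of length |z|, covered by balls strung along
  its axis. A Borel superset U is produced because X is an arbitrary covering set and its sweep need
  not be measurable.\<close>

lemma sweep_bound_piece:
  fixes z :: "'a::euclidean_space"
  assumes n: "2 \<le> DIM('a)" and z: "z \<noteq> 0" and X: "bounded X" "diameter X \<le> norm z"
  shows "\<exists>U\<in>sets lborel. sweep z X \<subseteq> U \<and>
    emeasure lborel U \<le> ennreal (proj_const (DIM('a)) * norm z) *
      ennreal (unit_ball_vol (real (DIM('a) - 1)) * (diameter X / 2) ^ (DIM('a) - 1))"
proof (cases "X = {}")
  case True
  then show ?thesis by (intro bexI[of _ "{}"]) (auto simp: sweep_def)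
next
  case False
  then obtain x0 where x0: "x0 \<in> X" by auto
  have near: "dist x0 x \<le> diameter X" if "x \<in> X" for x
    using diameter_bounded_bound[OF X(1) x0 that] .
  let ?D = "diameter X"
  have D0: "0 \<le> ?D" using diameter_ge_0[OF X(1)] .
  show ?thesis
  proof (cases "?D = 0")
    case True
    \<comment> \<open>A one-point set costs nothing in the content, so its sweep, a segment, must be
      null; this needs dimension at least 2.\<close>
    have "x = x0" if "x \<in> X" for x using near[OF that] True by simp
    then have "X = {x0}" using x0 by blast
    then have "sweep z X \<subseteq> closed_segment (x0 - z) x0"
    proof (intro subsetI)
      fix x assume "x \<in> sweep z X"
      then obtain t where t: "0 \<le> t" "t \<le> 1" "x + t *\<^sub>R z = x0" using \<open>X = {x0}\<close> by (auto simp: sweep_def)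
      then have "x = (1 - (1 - t)) *\<^sub>R (x0 - z) + (1 - t) *\<^sub>R x0" by (auto simp: algebra_simps)
      then show "x \<in> closed_segment (x0 - z) x0"
        using t unfolding closed_segment_def by (auto intro!: exI[of _ "1 - t"])
    qed
    moreover have "emeasure lborel (closed_segment (x0 - z) x0) = 0"
    proof -
      have "negligible (closed_segment (x0 - z) x0)"
        using negligible_convex_interior[of "closed_segment (x0 - z) x0"] interior_closed_segment_ge2[OF n]
        by auto
      then show ?thesis
        using negligible_iff_emeasure0[of "closed_segment (x0 - z) x0"]
        by (simp add: borel_compact)
    qed
    ultimately show ?thesis by (intro bexI[of _ "closed_segment (x0 - z) x0"]) auto
  next
    case False
    then have D: "0 < ?D" using D0 by simp
    define m where "m = nat \<lceil>norm z / ?D\<rceil>"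
    have "1 \<le> norm z / ?D" using X(2) D by simp
    have m: "norm z / ?D \<le> real m" "real m \<le> norm z / ?D + 1"
      unfolding m_def using \<open>1 \<le> norm z / ?D\<close> by linarith+
    have m0: "0 < m" using m \<open>1 \<le> norm z / ?D\<close> by (cases m) auto
    \<comment> \<open>One D of the radius accounts for the position inside X, the other for rounding
      t to j / m, since |z| / m \<le> D.\<close>
    let ?U = "\<Union>j\<in>{..m}. cball (x0 - (real j / real m) *\<^sub>R z) (2 * ?D)"
    have "sweep z X \<subseteq> ?U"
    proof
      fix x assume "x \<in> sweep z X"
      then obtain t where t: "0 \<le> t" "t \<le> 1" "x + t *\<^sub>R z \<in> X" by (auto simp: sweep_def)
      define j where "j = nat \<lfloor>t * real m\<rfloor>"
      have j: "real j \<le> t * real m" "t * real m < real j + 1"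
        unfolding j_def using t by (auto simp: of_nat_nat)
      have "t * real m \<le> real m" using t by (simp add: mult_left_le_one_le)
      then have jm: "j \<le> m" using j by linarith
      have "\<bar>t - real j / real m\<bar> \<le> 1 / real m"
      proof -
        have "t - real j / real m = (t * real m - real j) / real m" using m0 by (simp add: field_simps)
        then show ?thesis using j m0 by (simp add: divide_right_mono)
      qed
      then have "norm ((t - real j / real m) *\<^sub>R z) \<le> norm z / real m"
        using mult_right_mono[of "\<bar>t - real j / real m\<bar>" "1 / real m" "norm z"] by simp
      also have "... \<le> ?D" using m(1) m0 D by (simp add: field_simps)
      finally have 1: "norm ((t - real j / real m) *\<^sub>R z) \<le> ?D" .
      have 2: "norm (x0 - (x + t *\<^sub>R z)) \<le> ?D" using near[OF t(3)] by (simp add: dist_norm)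
      have "x0 - (real j / real m) *\<^sub>R z - x = (x0 - (x + t *\<^sub>R z)) + (t - real j / real m) *\<^sub>R z"
        by (simp add: algebra_simps)
      then have "dist (x0 - (real j / real m) *\<^sub>R z) x \<le> 2 * ?D"
        using norm_triangle_mono[OF 2 1] by (simp only: dist_norm)
      then show "x \<in> ?U" using jm by auto
    qed
    moreover have "?U \<in> sets lborel" by auto
    moreover have "emeasure lborel ?U \<le> ennreal (proj_const (DIM('a)) * norm z) *
      ennreal (unit_ball_vol (real (DIM('a) - 1)) * (?D / 2) ^ (DIM('a) - 1))"
    proof -
      have "emeasure lborel ?U \<le> (\<Sum>j\<in>{..m}. emeasure lborel (cball (x0 - (real j / real m) *\<^sub>R z) (2 * ?D)))"
        by (rule emeasure_subadditive_finite) auto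
      also have "... = ennreal ((real m + 1) * (unit_ball_vol (DIM('a)) * (2 * ?D) ^ DIM('a)))"
        using D0 by (simp add: emeasure_cball ennreal_of_nat_eq_real_of_nat ennreal_mult' add.commute)
      also have "... \<le> ennreal (3 * norm z / ?D * (unit_ball_vol (DIM('a)) * (2 * ?D) ^ DIM('a)))"
        using m \<open>1 \<le> norm z / ?D\<close> D0
        by (intro ennreal_leI mult_right_mono) auto
      also have "3 * norm z / ?D * (unit_ball_vol (DIM('a)) * (2 * ?D) ^ DIM('a))
        = (proj_const (DIM('a)) * norm z) * (unit_ball_vol (real (DIM('a) - 1)) * (?D / 2) ^ (DIM('a) - 1))"
      proof -
        obtain k where k: "DIM('a) = Suc k" using n by (cases "DIM('a)") auto
        have "unit_ball_vol (real k) \<noteq> 0" using unit_ball_vol_pos[of "real k"] by linarith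
        then show ?thesis
          using D unfolding proj_const_def k by (simp add: field_simps power_mult_distrib)
      qed
      finally show ?thesis
        using D0 proj_const_pos[of "DIM('a)"] by (simp add: ennreal_mult less_imp_le)
    qed
    ultimately show ?thesis by blast
  qed
qed

text \<open>The projection of \<open>A\<close> along \<open>z\<close> has at most the Hausdorff measure of \<open>A\<close>; thickening by the
  length of \<open>z\<close> avoids measures on hyperplanes.\<close>

lemma emeasure_sweep_le:
  fixes z :: "'a::euclidean_space"
  assumes n: "2 \<le> DIM('a)" and A: "compact A"
  shows "emeasure lborel (sweep z A) \<le> ennreal (proj_const (DIM('a)) * norm z) * emeasure (hausdorff_measure (DIM('a) - 1)) A
     \<or> z = 0"
proof (rule disjCI)
  assume z: "z \<noteq> 0"
  let ?d = "DIM('a) - 1" and ?c = "ennreal (proj_const (DIM('a)) * norm z)"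
  let ?v = "\<lambda>S. ennreal (unit_ball_vol (real ?d) * (diameter S / 2) ^ ?d)"
  \<comment> \<open>Mesh |z| is the coarsest that \<open>sweep_bound_piece\<close> admits, and the
    content at any mesh is below the outer measure.\<close>
  have "emeasure lborel (sweep z A) \<le> ?c * hausdorff_content ?d (norm z) A"
    unfolding hausdorff_content_def
  proof (rule ennreal_mult_INF_le)
    fix C :: "nat \<Rightarrow> 'a set"
    assume C: "C \<in> {C. A \<subseteq> (\<Union>i. C i) \<and> (\<forall>i. bounded (C i) \<and> diameter (C i) \<le> norm z)}"
    have "\<forall>i. \<exists>U\<in>sets lborel. sweep z (C i) \<subseteq> U \<and> emeasure lborel U \<le> ?c * ?v (C i)"
      using C sweep_bound_piece[OF n z] by blast
    then obtain U where U: "\<And>i. U i \<in> sets lborel" "\<And>i. sweep z (C i) \<subseteq> U i"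
      "\<And>i. emeasure lborel (U i) \<le> ?c * ?v (C i)" by metis
    have "sweep z A \<subseteq> (\<Union>i. U i)"
    proof
      fix x assume "x \<in> sweep z A"
      then obtain t where t: "t \<in> {0..1}" "x + t *\<^sub>R z \<in> A" by (auto simp: sweep_def)
      then obtain i where "x + t *\<^sub>R z \<in> C i" using C by auto
      then have "x \<in> sweep z (C i)" using t by (auto simp: sweep_def)
      then show "x \<in> (\<Union>i. U i)" using U(2) by auto
    qed
    then have "emeasure lborel (sweep z A) \<le> emeasure lborel (\<Union>i. U i)"
      using U(1) by (intro emeasure_mono) auto
    also have "... \<le> (\<Sum>i. emeasure lborel (U i))"
      using U(1) by (intro emeasure_subadditive_countably) auto
    also have "... \<le> (\<Sum>i. ?c * ?v (C i))" using U(3) by (intro suminf_le summableI) auto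
    finally show "emeasure lborel (sweep z A) \<le> ?c * (\<Sum>i. ?v (C i))" by simp
  qed (use z proj_const_pos[of "DIM('a)"] in auto)
  also have "... \<le> ?c * hausdorff_outer ?d A"
    by (intro mult_left_mono hausdorff_content_le_outer) (use z in auto)
  also have "hausdorff_outer ?d A = emeasure (hausdorff_measure ?d) A"
    using n A by (subst emeasure_hausdorff_measure) (auto intro: borel_compact)
  finally show "emeasure lborel (sweep z A) \<le> ?c * emeasure (hausdorff_measure ?d) A" .
qed

section \<open>Hausdorff measure of Lipschitz graphs against volume of tubes\<close>

text \<open>A separated set of largest cardinality. Each ball of a finite cover by radius \<delta>/2
  holds at most one of its points, which bounds the cardinality, and maximality makes it
  \<delta>-dense.\<close>

lemma maximal_separated_net:
  fixes K :: "'a::euclidean_space set"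
  assumes K: "compact K" and \<delta>: "0 < \<delta>"
  obtains X where "finite X" "X \<subseteq> K" "\<And>x y. x \<in> X \<Longrightarrow> y \<in> X \<Longrightarrow> x \<noteq> y \<Longrightarrow> \<delta> \<le> dist x y"
    "K \<subseteq> (\<Union>x\<in>X. ball x \<delta>)"
proof -
  let ?P = "\<lambda>X. finite X \<and> X \<subseteq> K \<and> (\<forall>x\<in>X. \<forall>y\<in>X. x \<noteq> y \<longrightarrow> \<delta> \<le> dist x y)"
  obtain Y where Y: "finite Y" "K \<subseteq> (\<Union>y\<in>Y. ball y (\<delta>/2))"
  proof -
    have c: "K \<subseteq> (\<Union>y\<in>K. ball y (\<delta>/2))" using \<delta> by auto
    obtain Y where "Y \<subseteq> K" "finite Y" "K \<subseteq> (\<Union>y\<in>Y. ball y (\<delta>/2))"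
      by (rule compactE_image[OF K _ c]) auto
    then show ?thesis by (intro that)
  qed
  have bound: "card X \<le> card Y" if X: "?P X" for X
  proof -
    have "\<forall>x\<in>X. \<exists>y\<in>Y. dist y x < \<delta>/2" using X Y(2) by (auto simp: subset_iff)
    then obtain g where g: "\<And>x. x \<in> X \<Longrightarrow> g x \<in> Y \<and> dist (g x) x < \<delta>/2" by metis
    have "inj_on g X"
    proof (rule inj_onI, rule ccontr)
      fix x x' assume h: "x \<in> X" "x' \<in> X" "g x = g x'" "x \<noteq> x'"
      then have "\<delta> \<le> dist x x'" using X by auto
      also have "... \<le> dist (g x) x + dist (g x) x'" by (metis dist_commute dist_triangle)
      also have "... < \<delta>" using g[OF h(1)] g[OF h(2)] h(3) by simp
      finally show False by simp
    qed
    then show ?thesis using g Y(1) by (intro card_inj_on_le[of g]) auto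
  qed
  obtain X where X: "?P X" and mx: "\<And>X'. ?P X' \<Longrightarrow> card X' \<le> card X"
  proof -
    have "\<forall>X. ?P X \<longrightarrow> card X < Suc (card Y)" using bound less_Suc_eq_le by blast
    moreover have "?P {}" by simp
    ultimately have "\<exists>X. ?P X \<and> (\<forall>X'. ?P X' \<longrightarrow> card X' \<le> card X)"
      using ex_has_greatest_nat[of ?P "{}" card "Suc (card Y)"] by blast
    then show ?thesis using that by blast
  qed
  have "K \<subseteq> (\<Union>x\<in>X. ball x \<delta>)"
  proof (rule ccontr)
    assume "\<not> ?thesis"
    then obtain y where y: "y \<in> K" "\<And>x. x \<in> X \<Longrightarrow> \<delta> \<le> dist x y" by (auto simp: subset_iff not_less)
    then have "?P (insert y X)" using X by (auto simp: dist_commute)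
    moreover have "y \<notin> X" using y(2)[of y] \<delta> by auto
    ultimately show False using mx[of "insert y X"] X by auto
  qed
  then show ?thesis using that X by auto
qed

text \<open>K is part of an L-Lipschitz graph over the hyperplane orthogonal to e. Stating this for
  pairs of points needs no chart function and passes to subsets, in particular to superlevel
  sets.\<close>

definition flat_over :: "real \<Rightarrow> 'a::euclidean_space \<Rightarrow> 'a set \<Rightarrow> bool" where
  "flat_over L e K \<longleftrightarrow> (\<forall>x\<in>K. \<forall>y\<in>K. \<bar>(x - y) \<bullet> e\<bar> \<le> L * norm ((x - y) - ((x - y) \<bullet> e) *\<^sub>R e))"

definition tube :: "'a::euclidean_space \<Rightarrow> real \<Rightarrow> real \<Rightarrow> 'a set \<Rightarrow> 'a set" where
  "tube e a b K = (\<lambda>(x, t). x + t *\<^sub>R e) ` (K \<times> {a..b})"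

lemma compact_tube: "compact K \<Longrightarrow> compact (tube e a b K)"
  unfolding tube_def
  by (intro compact_continuous_image compact_Times) (auto intro!: continuous_intros simp: case_prod_unfold)

text \<open>Each point of a \<delta>-net costs the volume of a \<delta>-ball in dimension n - 1.
  Above it stand at least h / (2 \<rho>) disjoint balls of radius \<rho> = \<delta> / (2 (1 + L)).
  The quotient of cost and volume is this number over h, free of \<delta>.\<close>

definition graph_const :: "nat \<Rightarrow> real \<Rightarrow> real" where
  "graph_const n L = 2 * unit_ball_vol (n - 1) * (2 * (1 + L)) ^ (n - 1) / unit_ball_vol n"

lemma graph_const_pos: "0 \<le> L \<Longrightarrow> 0 < graph_const n L"
  by (auto simp: graph_const_def intro!: mult_pos_pos divide_pos_pos)

lemma norm_orth_le:
  fixes v e :: "'a::euclidean_space"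
  assumes "norm e = 1"
  shows "norm (v - (v \<bullet> e) *\<^sub>R e) \<le> norm v"
proof -
  have "e \<bullet> e = 1" using assms by (simp add: dot_square_norm)
  then have "norm (v - (v \<bullet> e) *\<^sub>R e) ^ 2 = norm v ^ 2 - (v \<bullet> e) ^ 2"
    unfolding power2_norm_eq_inner by (simp add: inner_diff_left inner_diff_right inner_commute power2_eq_square)
  then have "norm (v - (v \<bullet> e) *\<^sub>R e) ^ 2 \<le> norm v ^ 2"
    using zero_le_power2[of "v \<bullet> e"] by linarith
  then show ?thesis by (rule power2_le_imp_le) simp
qed

text \<open>Disjoint small balls above a separated net in \<open>K\<close> fill a fixed proportion of the tube.\<close>

lemma hausdorff_content_le_tube_neighbourhood:
  fixes e :: "'a::euclidean_space"
  assumes n: "2 \<le> DIM('a)" and e: "norm e = 1" and L: "0 \<le> L" and K: "compact K" "flat_over L e K"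
    and h: "0 < h" and \<delta>: "0 < \<delta>"
  shows "hausdorff_content (DIM('a) - 1) (2 * \<delta>) K
    \<le> ennreal (graph_const (DIM('a)) L / h) * emeasure lborel (\<Union>y\<in>tube e h (2 * h) K. cball y \<delta>)"
proof -
  obtain X where X: "finite X" "X \<subseteq> K" "\<And>x y. x \<in> X \<Longrightarrow> y \<in> X \<Longrightarrow> x \<noteq> y \<Longrightarrow> \<delta> \<le> dist x y"
    "K \<subseteq> (\<Union>x\<in>X. ball x \<delta>)"
    using maximal_separated_net[OF K(1) \<delta>] by metis
  let ?d = "DIM('a) - 1"
  \<comment> \<open>Points of the net are \<delta> apart, hence their projections along e are at
    least \<delta> / (1 + L) = 2 \<rho> apart.\<close>
  define \<rho> where "\<rho> = \<delta> / (2 * (1 + L))"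
  have "\<delta> / (2 * (1 + L)) \<le> \<delta> / 1" using \<delta> L by (intro divide_left_mono) auto
  then have \<rho>: "0 < \<rho>" "\<rho> \<le> \<delta>" using \<delta> L by (auto simp: \<rho>_def)
  define m where "m = nat \<lfloor>h / (2 * \<rho>)\<rfloor>"
  have q0: "0 \<le> h / (2 * \<rho>)" using h \<rho> by simp
  have m: "real m \<le> h / (2 * \<rho>)" "h / (2 * \<rho>) \<le> real m + 1"
    unfolding m_def using q0 by linarith+
  let ?b = "\<lambda>(x, i::nat). ball (x + (h + 2 * \<rho> * real i) *\<^sub>R e) \<rho>"
  have ee: "e \<bullet> e = 1" using e by (simp add: dot_square_norm)
  have disj: "disjoint_family_on ?b (X \<times> {..m})"
    unfolding disjoint_family_on_def
  proof (clarsimp simp del: mem_ball)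
    fix x y and i j :: nat assume xy: "x \<in> X" "y \<in> X" and ne: "x = y \<longrightarrow> i \<noteq> j"
    let ?p = "x + (h + 2 * \<rho> * real i) *\<^sub>R e" and ?q = "y + (h + 2 * \<rho> * real j) *\<^sub>R e"
    have "2 * \<rho> \<le> dist ?p ?q"
    proof (cases "x = y")
      case True
      then have "1 \<le> \<bar>real i - real j\<bar>" using ne by linarith
      then have "2 * \<rho> * 1 \<le> 2 * \<rho> * \<bar>real i - real j\<bar>" using \<rho> by (intro mult_left_mono) auto
      also have "... = norm ((2 * \<rho> * (real i - real j)) *\<^sub>R e)"
        using e \<rho> by (simp add: abs_mult)
      also have "(2 * \<rho> * (real i - real j)) *\<^sub>R e = ?p - ?q" using True by (simp add: algebra_simps)
      finally show ?thesis by (simp add: dist_norm)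
    next
      case False
      \<comment> \<open>w is the difference of the projections. Vertical shifts do not change it, so
        columns above different net points stay disjoint at all heights.\<close>
      define w where "w = (x - y) - ((x - y) \<bullet> e) *\<^sub>R e"
      have "\<delta> \<le> norm (x - y)" using X(3)[OF xy False] by (simp add: dist_norm)
      also have "... = norm (w + ((x - y) \<bullet> e) *\<^sub>R e)" by (simp add: w_def)
      also have "... \<le> norm w + \<bar>(x - y) \<bullet> e\<bar>" using norm_triangle_ineq[of w "((x - y) \<bullet> e) *\<^sub>R e"] e by simp
      also have "... \<le> norm w + L * norm w" using K(2) xy X(2) unfolding flat_over_def w_def by (auto simp: subset_iff)
      finally have "\<delta> \<le> (1 + L) * norm w" by (simp add: algebra_simps)
      then have 1: "2 * \<rho> \<le> norm w" using L by (simp add: \<rho>_def field_simps)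
      have weq: "w = (?p - ?q) - ((?p - ?q) \<bullet> e) *\<^sub>R e"
        by (simp add: w_def inner_simps ee algebra_simps)
      have "norm w \<le> norm (?p - ?q)" unfolding weq by (rule norm_orth_le[OF e])
      then show ?thesis using 1 by (simp add: dist_norm)
    qed
    then show "ball ?p \<rho> \<inter> ball ?q \<rho> = {}"
      by (intro disjoint_ballI) simp
  qed
  have sub: "(\<Union>p\<in>X \<times> {..m}. ?b p) \<subseteq> (\<Union>y\<in>tube e h (2 * h) K. cball y \<delta>)"
  proof clarify
    fix u x i assume x: "x \<in> X" and i: "i \<le> m" and u: "u \<in> ball (x + (h + 2 * \<rho> * real i) *\<^sub>R e) \<rho>"
    have "2 * \<rho> * real i \<le> 2 * \<rho> * real m" using i \<rho> by simp
    also have "... \<le> h" using m(1) \<rho> by (simp add: field_simps)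
    finally have "x + (h + 2 * \<rho> * real i) *\<^sub>R e \<in> tube e h (2 * h) K"
      unfolding tube_def using x X(2) \<rho> by (intro image_eqI[of _ _ "(x, h + 2 * \<rho> * real i)"]) auto
    moreover have "u \<in> cball (x + (h + 2 * \<rho> * real i) *\<^sub>R e) \<delta>" using u \<rho> by auto
    ultimately show "u \<in> (\<Union>y\<in>tube e h (2 * h) K. cball y \<delta>)" by blast
  qed
  have "(\<Union>y\<in>tube e h (2 * h) K. cball y \<delta>) = (\<lambda>(y, v). y + v) ` (tube e h (2 * h) K \<times> cball 0 \<delta>)"
  proof -
    have "u \<in> (\<lambda>(y, v). y + v) ` (tube e h (2 * h) K \<times> cball 0 \<delta>)" if "y \<in> tube e h (2 * h) K" "u \<in> cball y \<delta>" for u y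
      using that by (intro image_eqI[of _ _ "(y, u - y)"]) (auto simp: dist_norm norm_minus_commute)
    then show ?thesis by (auto simp: dist_norm)
  qed
  moreover have "compact ((\<lambda>(y, v). y + v) ` (tube e h (2 * h) K \<times> cball 0 \<delta>))"
    by (intro compact_continuous_image compact_Times compact_tube[OF K(1)] compact_cball)
      (auto intro!: continuous_intros simp: case_prod_unfold)
  ultimately have cpt: "compact (\<Union>y\<in>tube e h (2 * h) K. cball y \<delta>)" by simp
  have "ennreal (real (card X) * (h / (2 * \<rho>)) * (unit_ball_vol (DIM('a)) * \<rho> ^ DIM('a)))
      \<le> ennreal (real (card X) * (real m + 1) * (unit_ball_vol (DIM('a)) * \<rho> ^ DIM('a)))"
    using m \<rho> by (intro ennreal_leI mult_right_mono mult_left_mono) auto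
  also have "... = (\<Sum>p\<in>X \<times> {..m}. emeasure lborel (?b p))"
    using \<rho> by (simp add: case_prod_unfold emeasure_ball card_cartesian_product ennreal_of_nat_eq_real_of_nat
        ennreal_mult algebra_simps)
  also have "... = emeasure lborel (\<Union>p\<in>X \<times> {..m}. ?b p)"
    using X(1) disj by (intro sum_emeasure) (auto simp: case_prod_unfold)
  also have "... \<le> emeasure lborel (\<Union>y\<in>tube e h (2 * h) K. cball y \<delta>)"
    using sub cpt by (intro emeasure_mono) (auto intro: borel_compact)
  finally have vol: "ennreal (real (card X) * (h / (2 * \<rho>)) * (unit_ball_vol (DIM('a)) * \<rho> ^ DIM('a)))
      \<le> emeasure lborel (\<Union>y\<in>tube e h (2 * h) K. cball y \<delta>)" .
  obtain g where g: "bij_betw g {..<card X} X" using ex_bij_betw_nat_finite[OF X(1)] by (auto simp: atLeast0LessThan)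
  let ?C = "\<lambda>i. if i < card X then ball (g i) \<delta> else {}"
  have "hausdorff_content ?d (2 * \<delta>) K \<le> (\<Sum>i. ennreal (unit_ball_vol (real ?d) * (diameter (?C i) / 2) ^ ?d))"
    unfolding hausdorff_content_def
  proof (rule INF_lower, safe)
    fix x assume "x \<in> K"
    then obtain y where y: "y \<in> X" "x \<in> ball y \<delta>" using X(4) by auto
    have "y \<in> g ` {..<card X}" using g y(1) by (simp add: bij_betw_def)
    then obtain i where "i < card X" "g i = y" by auto
    then show "x \<in> (\<Union>i. ?C i)" using \<open>x \<in> ball y \<delta>\<close> by auto
  qed (use \<delta> in auto)
  also have "... = (\<Sum>i<card X. ennreal (unit_ball_vol (real ?d) * \<delta> ^ ?d))"
    using n \<delta> by (subst suminf_finite[of "{..<card X}"]) (auto simp: power_0_left)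
  also have "... = ennreal (real (card X) * (unit_ball_vol (real ?d) * \<delta> ^ ?d))"
    by (simp add: ennreal_of_nat_eq_real_of_nat ennreal_mult')
  also have "real (card X) * (unit_ball_vol (real ?d) * \<delta> ^ ?d) =
      graph_const (DIM('a)) L / h * (real (card X) * (h / (2 * \<rho>)) * (unit_ball_vol (DIM('a)) * \<rho> ^ DIM('a)))"
  proof -
    obtain k where k: "DIM('a) = Suc k" using n by (cases "DIM('a)") auto
    have "unit_ball_vol (real (Suc k)) \<noteq> 0" using unit_ball_vol_pos[of "real (Suc k)"] by linarith
    moreover have "\<delta> = \<rho> * (2 * (1 + L))" using L by (simp add: \<rho>_def)
    ultimately show ?thesis
      using \<rho> h unfolding graph_const_def k by (simp add: power_mult_distrib)
  qed
  also have "ennreal ... = ennreal (graph_const (DIM('a)) L / h) *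
      ennreal (real (card X) * (h / (2 * \<rho>)) * (unit_ball_vol (DIM('a)) * \<rho> ^ DIM('a)))"
    using graph_const_pos[OF L, of "DIM('a)"] h \<rho> by (intro ennreal_mult) (auto simp: less_imp_le)
  also have "... \<le> ennreal (graph_const (DIM('a)) L / h) * emeasure lborel (\<Union>y\<in>tube e h (2 * h) K. cball y \<delta>)"
    using vol by (rule mult_left_mono) simp
  finally show ?thesis .
qed

text \<open>At mesh 2 \<delta> the content is bounded by the volume of the \<delta>-neighbourhood of
  the tube. The tube is compact, so these neighbourhoods shrink to it as \<delta> tends to
  0.\<close>

lemma emeasure_graph_le_tube:
  fixes e :: "'a::euclidean_space"
  assumes n: "2 \<le> DIM('a)" and e: "norm e = 1" and L: "0 \<le> L" and K: "compact K" "flat_over L e K"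
    and h: "0 < h"
  shows "emeasure (hausdorff_measure (DIM('a) - 1)) K
    \<le> ennreal (graph_const (DIM('a)) L / h) * emeasure lborel (tube e h (2 * h) K)"
proof -
  let ?d = "DIM('a) - 1" and ?c = "ennreal (graph_const (DIM('a)) L / h)"
  let ?T = "tube e h (2 * h) K"
  define N where "N \<delta> = (\<Union>y\<in>?T. cball y \<delta>)" for \<delta>
  have T: "compact ?T" by (rule compact_tube[OF K(1)])
  have Neq: "N \<delta> = {x. infdist x ?T \<le> \<delta>}" if "?T \<noteq> {}" for \<delta>
  proof -
    have "\<exists>y\<in>?T. dist y x \<le> \<delta>" if "infdist x ?T \<le> \<delta>" for x
      using infdist_attains_inf[OF compact_imp_closed[OF T] \<open>?T \<noteq> {}\<close>, of x] that by (metis dist_commute)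
    moreover have "infdist x ?T \<le> \<delta>" if "y \<in> ?T" "dist y x \<le> \<delta>" for x y
      using infdist_le2[OF that(1)] that by (auto simp: dist_commute)
    ultimately show ?thesis unfolding N_def by auto
  qed
  have lim: "(\<lambda>k. emeasure lborel (N (1 / real (Suc k)))) \<longlonglongrightarrow> emeasure lborel ?T"
  proof (cases "?T = {}")
    case ne: False
    have cl: "closed (N \<delta>)" for \<delta>
      unfolding Neq[OF ne] by (intro closed_Collect_le continuous_intros)
    have "bounded ?T" using T compact_imp_bounded by blast
    then obtain b where b: "?T \<subseteq> ball 0 b" using bounded_subset_ballD by blast
    have fin: "emeasure lborel (N (1 / real (Suc k))) \<noteq> \<infinity>" for k
    proof -
      have "N (1 / real (Suc k)) \<subseteq> ball 0 (b + 1 + 1)"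
      proof
        fix x assume "x \<in> N (1 / real (Suc k))"
        then obtain y where y: "y \<in> ?T" "dist y x \<le> 1 / real (Suc k)" by (auto simp: N_def)
        have "1 / real (Suc k) \<le> 1" by simp
        moreover have "norm y < b" using b y by auto
        moreover have "norm x \<le> norm y + dist y x"
          using norm_triangle_sub[of x y] by (simp only: dist_norm norm_minus_commute)
        ultimately have "norm x < b + 1 + 1" using y(2) by linarith
        then show "x \<in> ball 0 (b + 1 + 1)" by simp
      qed
      then have "emeasure lborel (N (1 / real (Suc k))) \<le> emeasure lborel (ball (0::'a) (b + 1 + 1))"
        by (intro emeasure_mono) auto
      also have "... < \<infinity>" by (rule emeasure_lborel_ball_finite)
      finally show ?thesis by simp
    qed
    have "(\<lambda>k. emeasure lborel (N (1 / real (Suc k)))) \<longlonglongrightarrow> emeasure lborel (\<Inter>k. N (1 / real (Suc k)))"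
    proof (rule Lim_emeasure_decseq[OF _ _ fin])
      show "decseq (\<lambda>k. N (1 / real (Suc k)))"
      proof (rule antimonoI)
        fix i j :: nat assume "i \<le> j"
        then have "1 / real (Suc j) \<le> 1 / real (Suc i)" by (simp add: field_simps)
        then show "N (1 / real (Suc j)) \<subseteq> N (1 / real (Suc i))" unfolding N_def by fastforce
      qed
    qed (use cl in \<open>auto intro: borel_closed\<close>)
    also have "(\<Inter>k. N (1 / real (Suc k))) = ?T"
    proof
      show "?T \<subseteq> (\<Inter>k. N (1 / real (Suc k)))" unfolding N_def by auto
      show "(\<Inter>k. N (1 / real (Suc k))) \<subseteq> ?T"
      proof
        fix x assume x: "x \<in> (\<Inter>k. N (1 / real (Suc k)))"
        have "infdist x ?T \<le> 0"
        proof (rule LIMSEQ_le_const[OF LIMSEQ_Suc[OF lim_inverse_n']])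
          show "\<exists>k0. \<forall>k\<ge>k0. infdist x ?T \<le> 1 / real (Suc k)" using x Neq[OF ne] by auto
        qed
        then show "x \<in> ?T"
          using in_closed_iff_infdist_zero[OF compact_imp_closed[OF T] ne] infdist_nonneg[of x ?T] by auto
      qed
    qed
    finally show ?thesis .
  qed (simp add: N_def)
  have "hausdorff_content ?d \<epsilon> K \<le> ?c * emeasure lborel ?T" if \<epsilon>: "0 < \<epsilon>" for \<epsilon>
  proof (rule LIMSEQ_le_const)
    show "(\<lambda>k. ?c * emeasure lborel (N (1 / real (Suc k)))) \<longlonglongrightarrow> ?c * emeasure lborel ?T"
      by (intro ennreal_tendsto_cmult lim) simp
    obtain k0 where k0: "1 / real (Suc k0) < \<epsilon> / 2" using \<epsilon> nat_approx_posE[of "\<epsilon> / 2"] by auto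
    show "\<exists>k0. \<forall>k\<ge>k0. hausdorff_content ?d \<epsilon> K \<le> ?c * emeasure lborel (N (1 / real (Suc k)))"
    proof (intro exI allI impI)
      fix k assume "k0 \<le> k"
      then have "1 / real (Suc k) \<le> 1 / real (Suc k0)" by (simp add: field_simps)
      then have "hausdorff_content ?d \<epsilon> K \<le> hausdorff_content ?d (2 * (1 / real (Suc k))) K"
        using k0 by (intro hausdorff_content_antimono) linarith
      also have "... \<le> ?c * emeasure lborel (N (1 / real (Suc k)))"
        unfolding N_def by (rule hausdorff_content_le_tube_neighbourhood[OF n e L K h]) simp
      finally show "hausdorff_content ?d \<epsilon> K \<le> ?c * emeasure lborel (N (1 / real (Suc k)))" .
    qed
  qed
  then have "hausdorff_outer ?d K \<le> ?c * emeasure lborel ?T"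
    unfolding hausdorff_outer_def by (intro SUP_least) auto
  then show ?thesis
    using n K(1) by (subst emeasure_hausdorff_measure) (auto intro: borel_compact)
qed

subsection \<open>Square integrable functions\<close>

lemma square_integrable_iff_nn:
  "square_integrable M f \<longleftrightarrow> f \<in> borel_measurable M \<and> (\<integral>\<^sup>+x. ennreal ((norm (f x))\<^sup>2) \<partial>M) < \<infinity>"
  unfolding square_integrable_def by (auto simp: integrable_iff_bounded)

lemma square_integrable_nn_eq:
  "square_integrable M f \<Longrightarrow> (\<integral>\<^sup>+x. ennreal ((norm (f x))\<^sup>2) \<partial>M) = ennreal (\<integral>x. (norm (f x))\<^sup>2 \<partial>M)"
  unfolding square_integrable_def by (intro nn_integral_eq_integral) auto

lemma norm_add_power2_le:
  fixes a b :: "'a::real_normed_vector"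
  shows "(norm (a + b))\<^sup>2 \<le> 2 * (norm a)\<^sup>2 + 2 * (norm b)\<^sup>2"
proof -
  have "(norm (a + b))\<^sup>2 \<le> (norm a + norm b)\<^sup>2" by (intro power_mono norm_triangle_ineq) auto
  also have "... \<le> 2 * (norm a)\<^sup>2 + 2 * (norm b)\<^sup>2"
    using zero_le_power2[of "norm a - norm b"] by (simp add: power2_sum power2_diff)
  finally show ?thesis .
qed

lemma square_integrable_add:
  assumes "square_integrable M f" "square_integrable M g"
  shows "square_integrable M (\<lambda>x. f x + g x)"
  unfolding square_integrable_def
proof (intro conjI)
  show "(\<lambda>x. f x + g x) \<in> borel_measurable M"
    using assms by (auto simp: square_integrable_def)
  show "integrable M (\<lambda>x. (norm (f x + g x))\<^sup>2)"
  proof (rule Bochner_Integration.integrable_bound)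
    show "integrable M (\<lambda>x. 2 * (norm (f x))\<^sup>2 + 2 * (norm (g x))\<^sup>2)"
      using assms by (auto simp: square_integrable_def)
    show "(\<lambda>x. (norm (f x + g x))\<^sup>2) \<in> borel_measurable M"
      using assms by (auto simp: square_integrable_def)
    show "AE x in M. norm ((norm (f x + g x))\<^sup>2) \<le> norm (2 * (norm (f x))\<^sup>2 + 2 * (norm (g x))\<^sup>2)"
    proof (intro always_eventually allI)
      fix x
      show "norm ((norm (f x + g x))\<^sup>2) \<le> norm (2 * (norm (f x))\<^sup>2 + 2 * (norm (g x))\<^sup>2)"
        using norm_add_power2_le[of "f x" "g x"] by simp
    qed
  qed
qed

lemma square_integrable_scaleR:
  "square_integrable M f \<Longrightarrow> square_integrable M (\<lambda>x. c *\<^sub>R f x)"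
  by (auto simp: square_integrable_def power_mult_distrib)

lemma square_integrable_mult:
  fixes f :: "'a \<Rightarrow> real"
  shows "square_integrable M f \<Longrightarrow> square_integrable M (\<lambda>x. c * f x)"
  using square_integrable_scaleR[of M f c] by simp

lemma square_integrable_diff:
  assumes "square_integrable M f" "square_integrable M g"
  shows "square_integrable M (\<lambda>x. f x - g x)"
  using square_integrable_add[OF assms(1) square_integrable_scaleR[OF assms(2), of "-1"]] by simp

lemma square_integrable_zero: "square_integrable M (\<lambda>x. 0)"
  by (simp add: square_integrable_def)

lemma square_integrable_inner:
  assumes "square_integrable M f" "square_integrable M g"
  shows "integrable M (\<lambda>x. f x \<bullet> g x)"
proof (rule Bochner_Integration.integrable_bound)
  show "integrable M (\<lambda>x. (norm (f x))\<^sup>2 + (norm (g x))\<^sup>2)"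
    using assms by (auto simp: square_integrable_def)
  show "(\<lambda>x. f x \<bullet> g x) \<in> borel_measurable M"
    using assms by (auto simp: square_integrable_def)
  have "\<bar>a \<bullet> b\<bar> \<le> (norm a)\<^sup>2 + (norm b)\<^sup>2" for a b :: 'b
  proof -
    have "\<bar>a \<bullet> b\<bar> \<le> norm a * norm b" by (rule Cauchy_Schwarz_ineq2)
    also have "... \<le> (norm a)\<^sup>2 + (norm b)\<^sup>2"
    proof -
      have "0 \<le> norm a * norm b" by simp
      moreover have "0 \<le> (norm a)\<^sup>2 + (norm b)\<^sup>2 - 2 * (norm a * norm b)"
        using zero_le_power2[of "norm a - norm b"] by (simp add: power2_diff algebra_simps)
      ultimately show ?thesis by linarith
    qed
    finally show ?thesis .
  qed
  then show "AE x in M. norm (f x \<bullet> g x) \<le> norm ((norm (f x))\<^sup>2 + (norm (g x))\<^sup>2)"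
    by (intro always_eventually allI) (simp add: abs_of_nonneg)
qed

lemma square_integrable_times:
  fixes f g :: "'a \<Rightarrow> real"
  shows "square_integrable M f \<Longrightarrow> square_integrable M g \<Longrightarrow> integrable M (\<lambda>x. f x * g x)"
  using square_integrable_inner[of M f g] by simp

text \<open>Besides Cauchy-Schwarz this serves with F = 0, where it forces I = 0: the vanishing
  first variation at a minimizer.\<close>

lemma quadratic_nonneg_discriminant:
  fixes F G I :: real
  assumes G: "0 \<le> G" and q: "\<And>t. 0 \<le> F - 2 * t * I + t\<^sup>2 * G"
  shows "I\<^sup>2 \<le> F * G"
proof (cases "G = 0")
  case True
  have "I = 0"
  proof (rule ccontr)
    assume "I \<noteq> 0"
    \<comment> \<open>At this t the linear term is F + 1, so the expression equals -1.\<close>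
    then show False using q[of "(F + 1) / (2 * I)"] True by (simp add: field_simps)
  qed
  then show ?thesis using True by simp
next
  case False
  then show ?thesis
    using G q[of "I / G"] by (simp add: field_simps power2_eq_square)
qed

lemma square_integrable_Cauchy_Schwarz:
  assumes f: "square_integrable M f" and g: "square_integrable M g"
  shows "(\<integral>x. f x \<bullet> g x \<partial>M)\<^sup>2 \<le> (\<integral>x. (norm (f x))\<^sup>2 \<partial>M) * (\<integral>x. (norm (g x))\<^sup>2 \<partial>M)"
proof (rule quadratic_nonneg_discriminant)
  fix t :: real
  have i: "integrable M (\<lambda>x. (norm (f x))\<^sup>2)" "integrable M (\<lambda>x. (norm (g x))\<^sup>2)" "integrable M (\<lambda>x. f x \<bullet> g x)"
    using assms square_integrable_inner by (auto simp: square_integrable_def)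
  have "0 \<le> (\<integral>x. (norm (f x - t *\<^sub>R g x))\<^sup>2 \<partial>M)" by simp
  also have "(\<lambda>x. (norm (f x - t *\<^sub>R g x))\<^sup>2) = (\<lambda>x. (norm (f x))\<^sup>2 - 2 * t * (f x \<bullet> g x) + t\<^sup>2 * (norm (g x))\<^sup>2)"
    by (simp add: fun_eq_iff power2_norm_eq_inner inner_diff_left inner_diff_right inner_commute) (simp add: power2_eq_square)
  finally show "0 \<le> (\<integral>x. (norm (f x))\<^sup>2 \<partial>M) - 2 * t * (\<integral>x. f x \<bullet> g x \<partial>M) + t\<^sup>2 * (\<integral>x. (norm (g x))\<^sup>2 \<partial>M)"
    using i by simp
qed simp

text \<open>Riesz-Fischer, for vector values and an arbitrary measure, since it is needed for
  functions, gradients and traces alike. A fast subsequence converges almost everywhere; Fatou's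
  lemma identifies its limit as the limit in L^2.\<close>

lemma square_integrable_complete:
  fixes f :: "nat \<Rightarrow> 'a \<Rightarrow> 'b::euclidean_space"
  assumes f: "\<And>m. square_integrable M (f m)"
    and cauchy: "\<And>e. 0 < e \<Longrightarrow> \<exists>N. \<forall>m\<ge>N. \<forall>n\<ge>N. (\<integral>x. (norm (f m x - f n x))\<^sup>2 \<partial>M) < e"
  shows "\<exists>g. square_integrable M g \<and> (\<lambda>m. \<integral>x. (norm (f m x - g x))\<^sup>2 \<partial>M) \<longlonglongrightarrow> 0"
proof -
  have [measurable]: "f m \<in> borel_measurable M" for m
    using f by (simp add: square_integrable_def)
  have nn: "(\<integral>\<^sup>+x. ennreal ((norm (f m x - f n x))\<^sup>2) \<partial>M) = ennreal (\<integral>x. (norm (f m x - f n x))\<^sup>2 \<partial>M)" for m n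
    using square_integrable_nn_eq[OF square_integrable_diff[OF f f]] .
  have "\<exists>N. \<forall>m\<ge>N. \<forall>n\<ge>N. (\<integral>x. (norm (f m x - f n x))\<^sup>2 \<partial>M) < (1/4) ^ k" for k :: nat
    by (rule cauchy) simp
  then obtain N where N: "\<And>k m n. N k \<le> m \<Longrightarrow> N k \<le> n \<Longrightarrow> (\<integral>x. (norm (f m x - f n x))\<^sup>2 \<partial>M) < (1/4) ^ k"
    by metis
  \<comment> \<open>The sum makes r dominate each N k and also r k \<le> r (k + 1), and the summand
    k makes r unbounded.\<close>
  define r where "r k = k + (\<Sum>i\<le>k. N i)" for k
  have rN: "N k \<le> r k" for k using member_le_sum[of k "{..k}" N] by (simp add: r_def trans_le_add2)
  have rmono: "N k \<le> r (Suc k)" for k using rN[of k] by (simp add: r_def)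
  define g where "g k x = (norm (f (r (Suc k)) x - f (r k) x))\<^sup>2" for k x
  have [measurable]: "g k \<in> borel_measurable M" for k unfolding g_def by measurable
  \<comment> \<open>Squared increments are below 4^-k, so weights 2^k keep the sum integrable. Where
    it is finite, the increments are bounded by a constant times q^k with q^2 = 1/2.\<close>
  have "(\<integral>\<^sup>+x. (\<Sum>k. ennreal (2 ^ k * g k x)) \<partial>M) = (\<Sum>k. \<integral>\<^sup>+x. ennreal (2 ^ k * g k x) \<partial>M)"
    by (rule nn_integral_suminf) measurable
  also have "... \<le> (\<Sum>k. ennreal ((1/2) ^ k))"
  proof (intro suminf_le summableI)
    fix k
    have "(\<integral>\<^sup>+x. ennreal (2 ^ k * g k x) \<partial>M) = ennreal (2 ^ k) * (\<integral>\<^sup>+x. ennreal (g k x) \<partial>M)"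
      by (simp add: ennreal_mult nn_integral_cmult g_def)
    also have "... \<le> ennreal (2 ^ k) * ennreal ((1/4) ^ k)"
      unfolding g_def nn using N[OF rmono rN, of k] by (intro mult_left_mono ennreal_leI) auto
    also have "... = ennreal ((1/2) ^ k)"
    proof -
      have "(2::real) ^ k * (1/4) ^ k = (2 * (1/4)) ^ k" by (simp only: power_mult_distrib)
      then show ?thesis by (simp add: ennreal_mult[symmetric])
    qed
    finally show "(\<integral>\<^sup>+x. ennreal (2 ^ k * g k x) \<partial>M) \<le> ennreal ((1/2) ^ k)" .
  qed
  also have "... < \<infinity>"
  proof -
    have "(\<Sum>k. ennreal ((1/2) ^ k)) \<noteq> top"
      by (rule ennreal_suminf_neq_top) (auto intro!: summable_geometric)
    then show ?thesis unfolding infinity_ennreal_def by (rule less_top[THEN iffD1])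
  qed
  finally have "AE x in M. (\<Sum>k. ennreal (2 ^ k * g k x)) \<noteq> \<infinity>"
    by (intro nn_integral_PInf_AE) auto
  then have conv: "AE x in M. convergent (\<lambda>k. f (r k) x)"
  proof eventually_elim
    fix x assume fin: "(\<Sum>k. ennreal (2 ^ k * g k x)) \<noteq> \<infinity>"
    obtain S where S: "(\<Sum>k. ennreal (2 ^ k * g k x)) = ennreal S" "0 \<le> S"
      using fin by (cases "(\<Sum>k. ennreal (2 ^ k * g k x))") auto
    have gS: "2 ^ k * g k x \<le> S" for k
    proof -
      have "ennreal (2 ^ k * g k x) \<le> (\<Sum>k. ennreal (2 ^ k * g k x))"
        using sum_le_suminf[OF summableI, of "{k}" "\<lambda>k. ennreal (2 ^ k * g k x)"] by simp
      then show ?thesis using S by (simp add: ennreal_le_iff)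
    qed
    obtain q :: real where q: "0 < q" "q < 1" "q\<^sup>2 = 1 / 2"
      by (rule that[of "sqrt (1/2)"]) (auto simp: real_sqrt_less_iff)
    have b: "norm (f (r (Suc k)) x - f (r k) x) \<le> sqrt S * q ^ k" for k
    proof (rule power2_le_imp_le)
      have "(norm (f (r (Suc k)) x - f (r k) x))\<^sup>2 \<le> S / 2 ^ k"
        using gS[of k] by (simp add: g_def field_simps)
      also have "S / 2 ^ k = (sqrt S)\<^sup>2 * (q\<^sup>2) ^ k"
        unfolding q(3) using S(2) by (simp add: power_divide)
      also have "... = (sqrt S * q ^ k)\<^sup>2"
        by (simp only: power_mult_distrib power_mult[symmetric] mult.commute[of k 2])
      finally show "(norm (f (r (Suc k)) x - f (r k) x))\<^sup>2 \<le> (sqrt S * q ^ k)\<^sup>2" .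
      show "0 \<le> sqrt S * q ^ k" by (intro mult_nonneg_nonneg zero_le_power real_sqrt_ge_zero S(2) less_imp_le q)
    qed
    have "summable (\<lambda>k. q ^ k)" using q by (intro summable_geometric) simp
    then have sg: "summable (\<lambda>k. sqrt S * q ^ k)" by (rule summable_mult)
    have "summable (\<lambda>k. f (r (Suc k)) x - f (r k) x)"
      by (rule summable_comparison_test'[OF sg, where N=0]) (rule b)
    then have "(\<lambda>n. \<Sum>k<n. f (r (Suc k)) x - f (r k) x) \<longlonglongrightarrow> (\<Sum>k. f (r (Suc k)) x - f (r k) x)"
      by (rule summable_LIMSEQ)
    moreover have "(\<lambda>n. \<Sum>k<n. f (r (Suc k)) x - f (r k) x) = (\<lambda>n. f (r n) x - f (r 0) x)"
      by (rule ext) (rule sum_lessThan_telescope)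
    ultimately obtain l where "(\<lambda>n. f (r n) x - f (r 0) x) \<longlonglongrightarrow> l" by metis
    from tendsto_add[OF this tendsto_const[of "f (r 0) x"]]
    have "(\<lambda>n. f (r n) x) \<longlonglongrightarrow> l + f (r 0) x" by simp
    then show "convergent (\<lambda>k. f (r k) x)" by (auto simp: convergent_def)
  qed
  define h where "h x = lim (\<lambda>k. f (r k) x)" for x
  have [measurable]: "h \<in> borel_measurable M" unfolding h_def by measurable
  have lim: "AE x in M. (\<lambda>k. f (r k) x) \<longlonglongrightarrow> h x"
    using conv by eventually_elim (simp add: h_def convergent_LIMSEQ_iff)
  have bound: "\<exists>K. \<forall>m\<ge>K. (\<integral>\<^sup>+x. ennreal ((norm (f m x - h x))\<^sup>2) \<partial>M) \<le> ennreal e" if e: "0 < e" for e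
  proof -
    obtain K where K: "\<And>m n. K \<le> m \<Longrightarrow> K \<le> n \<Longrightarrow> (\<integral>x. (norm (f m x - f n x))\<^sup>2 \<partial>M) < e"
      using cauchy[OF e] by auto
    show ?thesis
    proof (intro exI[of _ K] allI impI)
      fix m assume m: "K \<le> m"
      have "(\<integral>\<^sup>+x. ennreal ((norm (f m x - h x))\<^sup>2) \<partial>M)
        = (\<integral>\<^sup>+x. liminf (\<lambda>k. ennreal ((norm (f m x - f (r k) x))\<^sup>2)) \<partial>M)"
        using lim
        by (intro nn_integral_cong_AE, eventually_elim)
          (intro lim_imp_Liminf[symmetric] tendsto_ennrealI tendsto_power tendsto_norm tendsto_diff tendsto_const, auto)
      also have "... \<le> liminf (\<lambda>k. \<integral>\<^sup>+x. ennreal ((norm (f m x - f (r k) x))\<^sup>2) \<partial>M)"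
        by (rule nn_integral_liminf) measurable
      also have "... \<le> limsup (\<lambda>k. \<integral>\<^sup>+x. ennreal ((norm (f m x - f (r k) x))\<^sup>2) \<partial>M)"
        by (rule Liminf_le_Limsup) simp
      also have "... \<le> ennreal e"
      proof (rule Limsup_bounded)
        show "\<forall>\<^sub>F k in sequentially. (\<integral>\<^sup>+x. ennreal ((norm (f m x - f (r k) x))\<^sup>2) \<partial>M) \<le> ennreal e"
          unfolding nn using K[OF m]
          by (intro eventually_sequentiallyI[of K] ennreal_leI less_imp_le) (simp add: r_def trans_le_add1)
      qed
      finally show "(\<integral>\<^sup>+x. ennreal ((norm (f m x - h x))\<^sup>2) \<partial>M) \<le> ennreal e" .
    qed
  qed
  obtain K where K: "(\<integral>\<^sup>+x. ennreal ((norm (f K x - h x))\<^sup>2) \<partial>M) \<le> ennreal 1"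
    using bound[of 1] by auto
  have sd: "square_integrable M (\<lambda>x. f K x - h x)"
    unfolding square_integrable_iff_nn using K le_less_trans[OF K ennreal_less_top] by auto
  have h: "square_integrable M h"
    using square_integrable_diff[OF f[of K] sd] by simp
  have "(\<lambda>m. \<integral>x. (norm (f m x - h x))\<^sup>2 \<partial>M) \<longlonglongrightarrow> 0"
  proof (rule LIMSEQ_I)
    fix e :: real assume e: "0 < e"
    obtain K where K: "\<And>m. K \<le> m \<Longrightarrow> (\<integral>\<^sup>+x. ennreal ((norm (f m x - h x))\<^sup>2) \<partial>M) \<le> ennreal (e / 2)"
      using bound[of "e / 2"] e by auto
    have "(\<integral>x. (norm (f m x - h x))\<^sup>2 \<partial>M) \<le> e / 2" if "K \<le> m" for m
      using K[OF that] e unfolding square_integrable_nn_eq[OF square_integrable_diff[OF f h]] by (simp add: ennreal_le_iff)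
    then show "\<exists>no. \<forall>n\<ge>no. norm ((\<integral>x. (norm (f n x - h x))\<^sup>2 \<partial>M) - 0) < e"
    proof (intro exI[of _ K] allI impI)
      fix n assume "K \<le> n"
      then have "(\<integral>x. (norm (f n x - h x))\<^sup>2 \<partial>M) \<le> e / 2"
        using \<open>\<And>m. K \<le> m \<Longrightarrow> (\<integral>x. (norm (f m x - h x))\<^sup>2 \<partial>M) \<le> e / 2\<close> by blast
      moreover have "0 \<le> (\<integral>x. (norm (f n x - h x))\<^sup>2 \<partial>M)" by simp
      ultimately show "norm ((\<integral>x. (norm (f n x - h x))\<^sup>2 \<partial>M) - 0) < e" using e by simp
    qed
  qed
  then show ?thesis using h by auto
qed

subsection \<open>Functions of class $C^1$ and traces\<close>

abbreviation square_int :: "'a::euclidean_space set \<Rightarrow> ('a \<Rightarrow> real) \<Rightarrow> ennreal" where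
  "square_int S f \<equiv> \<integral>\<^sup>+x\<in>S. ennreal ((f x)\<^sup>2) \<partial>lborel"

abbreviation dirichlet_int :: "'a::euclidean_space set \<Rightarrow> ('a \<Rightarrow> 'a) \<Rightarrow> ennreal" where
  "dirichlet_int S F \<equiv> \<integral>\<^sup>+x\<in>S. ennreal ((norm (F x))\<^sup>2) \<partial>lborel"

abbreviation surface_int :: "'a::euclidean_space set \<Rightarrow> ('a \<Rightarrow> real) \<Rightarrow> ennreal" where
  "surface_int S f \<equiv> \<integral>\<^sup>+x\<in>S. ennreal ((f x)\<^sup>2) \<partial>hausdorff_measure (DIM('a) - 1)"

lemma C1_continuous: "C1_with_gradient \<phi> D \<Longrightarrow> continuous_on UNIV \<phi>"
  unfolding C1_with_gradient_def gderiv_def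
  by (intro continuous_at_imp_continuous_on ballI has_derivative_continuous) auto

lemma C1_gradient_continuous: "C1_with_gradient \<phi> D \<Longrightarrow> continuous_on UNIV D"
  by (simp add: C1_with_gradient_def)

lemma C1_measurable: "C1_with_gradient \<phi> D \<Longrightarrow> \<phi> \<in> borel_measurable borel"
  by (intro borel_measurable_continuous_onI C1_continuous)

lemma C1_measurable_hausdorff: "C1_with_gradient \<phi> D \<Longrightarrow> \<phi> \<in> borel_measurable (hausdorff_measure d)"
  using C1_measurable by (simp add: measurable_cong_sets[OF sets_hausdorff_measure refl])

lemma C1_gradient_measurable: "C1_with_gradient \<phi> D \<Longrightarrow> D \<in> borel_measurable borel"
  by (intro borel_measurable_continuous_onI C1_gradient_continuous)

text \<open>The fundamental theorem of calculus along the segment and Cauchy-Schwarz. The parameter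
  interval on the right is open because in the applications an end of the segment may lie on the
  boundary, where energy over \<Omega> is not counted.\<close>

lemma C1_segment_inequality:
  fixes \<phi> :: "'a::euclidean_space \<Rightarrow> real"
  assumes C1: "C1_with_gradient \<phi> D" and \<tau>: "0 \<le> \<tau>"
  shows "ennreal ((\<phi> (x + \<tau> *\<^sub>R v) - \<phi> x)\<^sup>2)
    \<le> ennreal (\<tau> * (norm v)\<^sup>2) * (\<integral>\<^sup>+t\<in>{0<..<\<tau>}. ennreal ((norm (D (x + t *\<^sub>R v)))\<^sup>2) \<partial>lborel)"
proof -
  define f where "f t = v \<bullet> D (x + t *\<^sub>R v)" for t
  have cD: "continuous_on S (\<lambda>t. D (x + t *\<^sub>R v))" for S
    by (rule continuous_on_compose2[OF C1_gradient_continuous[OF C1]]) (auto intro!: continuous_intros)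
  have cf: "continuous_on S f" for S unfolding f_def by (intro continuous_intros cD)
  have der: "((\<lambda>t. \<phi> (x + t *\<^sub>R v)) has_vector_derivative f t) (at t within {0..\<tau>})" for t
  proof -
    have 1: "(\<phi> has_derivative (\<lambda>h. h \<bullet> D (x + t *\<^sub>R v))) (at (x + t *\<^sub>R v))"
      using C1 by (auto simp: C1_with_gradient_def gderiv_def)
    have 2: "((\<lambda>t. x + t *\<^sub>R v) has_derivative (\<lambda>h. h *\<^sub>R v)) (at t within {0..\<tau>})"
      by (auto intro!: derivative_eq_intros)
    show ?thesis
      using has_derivative_compose[OF 2 1]
      by (simp add: has_vector_derivative_def f_def)
  qed
  define c where "c = \<phi> (x + \<tau> *\<^sub>R v) - \<phi> x"
  have I: "(f has_integral c) {0..\<tau>}"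
    unfolding c_def using fundamental_theorem_of_calculus[OF \<tau> der] by simp
  define E where "E = integral {0..\<tau>} (\<lambda>t. (f t)\<^sup>2)"
  have E: "((\<lambda>t. (f t)\<^sup>2) has_integral E) {0..\<tau>}"
    unfolding E_def by (intro integrable_integral integrable_continuous_real continuous_intros cf)
  have "c\<^sup>2 \<le> \<tau> * E"
  proof (cases "\<tau> = 0")
    case True
    then show ?thesis by (simp add: c_def)
  next
    case False
    then have tp: "0 < \<tau>" using \<tau> by simp
    have k: "((\<lambda>t. (c / \<tau>)\<^sup>2) has_integral (c / \<tau>)\<^sup>2 * \<tau>) {0..\<tau>}"
      using has_integral_const_real[of "(c / \<tau>)\<^sup>2" 0 \<tau>] tp by (simp add: mult.commute)
    \<comment> \<open>The integrand is (f t - c / \<tau>)^2 and its integral is E - c^2 / \<tau>;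
      nonnegativity is the Cauchy-Schwarz inequality wanted.\<close>
    have hi: "((\<lambda>t. (f t)\<^sup>2 - 2 * (c / \<tau>) * f t + (c / \<tau>)\<^sup>2) has_integral (E - 2 * (c / \<tau>) * c + (c / \<tau>)\<^sup>2 * \<tau>)) {0..\<tau>}"
      by (rule has_integral_add[OF has_integral_diff[OF E has_integral_mult_right[OF I]] k])
    have nn: "0 \<le> (f t)\<^sup>2 - 2 * (c / \<tau>) * f t + (c / \<tau>)\<^sup>2" for t
    proof -
      have "0 \<le> (f t - c / \<tau>)\<^sup>2" by simp
      also have "... = (f t)\<^sup>2 - 2 * (c / \<tau>) * f t + (c / \<tau>)\<^sup>2" by (simp only: power2_diff ac_simps)
      finally show ?thesis .
    qed
    have "0 \<le> E - 2 * (c / \<tau>) * c + (c / \<tau>)\<^sup>2 * \<tau>"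
      by (rule has_integral_nonneg[OF hi]) (rule nn)
    also have "... = E - c\<^sup>2 / \<tau>" using tp by (simp add: field_simps power2_eq_square)
    finally show ?thesis using tp by (simp add: field_simps)
  qed
  then have "ennreal (c\<^sup>2) \<le> ennreal (\<tau> * E)" by (rule ennreal_leI)
  also have "... = ennreal \<tau> * ennreal E"
    by (rule ennreal_mult[OF \<tau>]) (unfold E_def, rule integral_nonneg, auto intro!: integrable_continuous_real continuous_intros cf)
  also have "ennreal E = (\<integral>\<^sup>+t. ennreal (indicator {0..\<tau>} t * (f t)\<^sup>2) \<partial>lborel)"
  proof (rule nn_integral_has_integral_lborel[symmetric])
    show "((\<lambda>t. indicator {0..\<tau>} t * (f t)\<^sup>2) has_integral E) UNIV"
    proof -
      have "(\<lambda>t. indicator {0..\<tau>} t * (f t)\<^sup>2) = (\<lambda>t. if t \<in> {0..\<tau>} then (f t)\<^sup>2 else 0)"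
        by (auto simp: indicator_def fun_eq_iff)
      then show ?thesis using has_integral_restrict_UNIV[of "{0..\<tau>}" "\<lambda>t. (f t)\<^sup>2" E] E by metis
    qed
    have [measurable]: "f \<in> borel_measurable borel" using cf by (rule borel_measurable_continuous_onI)
    show "(\<lambda>t. indicator {0..\<tau>} t * (f t)\<^sup>2) \<in> borel_measurable borel" by measurable
  qed simp
  also have "... \<le> (\<integral>\<^sup>+t. ennreal ((norm v)\<^sup>2) * (ennreal ((norm (D (x + t *\<^sub>R v)))\<^sup>2) * indicator {0<..<\<tau>} t) \<partial>lborel)"
  proof (rule nn_integral_mono_AE)
    have "AE t in lborel. t \<noteq> 0 \<and> t \<noteq> \<tau>"
      using AE_lborel_singleton[of 0] AE_lborel_singleton[of \<tau>] by eventually_elim auto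
    then show "AE t in lborel. ennreal (indicator {0..\<tau>} t * (f t)\<^sup>2)
      \<le> ennreal ((norm v)\<^sup>2) * (ennreal ((norm (D (x + t *\<^sub>R v)))\<^sup>2) * indicator {0<..<\<tau>} t)"
    proof eventually_elim
      fix t assume t: "t \<noteq> 0 \<and> t \<noteq> \<tau>"
      have "(f t)\<^sup>2 \<le> (norm v * norm (D (x + t *\<^sub>R v)))\<^sup>2"
        unfolding f_def by (rule abs_le_square_iff[THEN iffD1]) (simp add: Cauchy_Schwarz_ineq2)
      then have "(f t)\<^sup>2 \<le> (norm v)\<^sup>2 * (norm (D (x + t *\<^sub>R v)))\<^sup>2" by (simp only: power_mult_distrib)
      then have "ennreal ((f t)\<^sup>2) \<le> ennreal ((norm v)\<^sup>2) * ennreal ((norm (D (x + t *\<^sub>R v)))\<^sup>2)"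
        by (subst ennreal_mult[symmetric]) (auto intro: ennreal_leI)
      then show "ennreal (indicator {0..\<tau>} t * (f t)\<^sup>2)
        \<le> ennreal ((norm v)\<^sup>2) * (ennreal ((norm (D (x + t *\<^sub>R v)))\<^sup>2) * indicator {0<..<\<tau>} t)"
        using t by (auto simp: indicator_def)
    qed
  qed
  also have "... = ennreal ((norm v)\<^sup>2) * (\<integral>\<^sup>+t\<in>{0<..<\<tau>}. ennreal ((norm (D (x + t *\<^sub>R v)))\<^sup>2) \<partial>lborel)"
  proof (rule nn_integral_cmult)
    have "(\<lambda>t. D (x + t *\<^sub>R v)) \<in> borel_measurable borel"
      using cD[of UNIV] by (rule borel_measurable_continuous_onI)
    then show "(\<lambda>t. ennreal ((norm (D (x + t *\<^sub>R v)))\<^sup>2) * indicator {0<..<\<tau>} t) \<in> borel_measurable lborel"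
      by measurable
  qed
  finally have "ennreal (c\<^sup>2) \<le> ennreal \<tau> * (ennreal ((norm v)\<^sup>2) * (\<integral>\<^sup>+t\<in>{0<..<\<tau>}. ennreal ((norm (D (x + t *\<^sub>R v)))\<^sup>2) \<partial>lborel))"
    by (simp add: mult_left_mono)
  then show ?thesis using \<tau> by (simp add: c_def ennreal_mult mult.assoc)
qed

lemma power2_le_2_add: "(a::real)\<^sup>2 \<le> 2 * b\<^sup>2 + 2 * (a - b)\<^sup>2"
  using zero_le_power2[of "a - 2 * b"] by (simp add: power2_eq_square algebra_simps)

lemma nn_integral_lborel_shift:
  fixes f :: "'a::euclidean_space \<Rightarrow> ennreal"
  assumes [measurable]: "f \<in> borel_measurable borel"
  shows "(\<integral>\<^sup>+x. f (x + c) \<partial>lborel) = (\<integral>\<^sup>+x. f x \<partial>lborel)"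
proof -
  have "(\<integral>\<^sup>+x. f x \<partial>lborel) = (\<integral>\<^sup>+x. f x \<partial>distr lborel borel ((+) c))" by (simp add: lborel_distr_plus)
  also have "... = (\<integral>\<^sup>+x. f (x + c) \<partial>lborel)" by (subst nn_integral_distr) (auto simp: add.commute)
  finally show ?thesis by simp
qed

text \<open>The Jacobian is c^n, at least 2^-n. Of the two weights t and 1 - t of a convex
  combination one is always at least 1/2.\<close>

lemma nn_integral_lborel_affine_le:
  fixes f :: "'a::euclidean_space \<Rightarrow> ennreal"
  assumes [measurable]: "f \<in> borel_measurable borel" and c: "1 / 2 \<le> c"
  shows "(\<integral>\<^sup>+x. f (t + c *\<^sub>R x) \<partial>lborel) \<le> 2 ^ DIM('a) * (\<integral>\<^sup>+x. f x \<partial>lborel)"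
proof -
  let ?I = "\<integral>\<^sup>+x. f (t + c *\<^sub>R x) \<partial>lborel"
  have "(\<integral>\<^sup>+x. f x \<partial>lborel) = (\<integral>\<^sup>+x. f x \<partial>density (distr lborel borel (\<lambda>x. t + c *\<^sub>R x)) (\<lambda>_. \<bar>c\<bar>^DIM('a)))"
    using c by (subst lborel_affine[of c t]) auto
  also have "... = ennreal (\<bar>c\<bar>^DIM('a)) * ?I"
    by (subst nn_integral_density) (auto simp: nn_integral_distr nn_integral_cmult)
  finally have eq: "(\<integral>\<^sup>+x. f x \<partial>lborel) = ennreal (\<bar>c\<bar>^DIM('a)) * ?I" .
  have "1 \<le> (2 * c) ^ DIM('a)" using c by (intro one_le_power) auto
  then have "1 \<le> 2 ^ DIM('a) * \<bar>c\<bar>^DIM('a)" using c by (simp add: power_mult_distrib)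
  then have "ennreal 1 \<le> ennreal (2 ^ DIM('a) * \<bar>c\<bar>^DIM('a))" by (rule ennreal_leI)
  then have "1 * ?I \<le> ennreal (2 ^ DIM('a) * \<bar>c\<bar>^DIM('a)) * ?I" by (intro mult_right_mono) auto
  also have "... = 2 ^ DIM('a) * (\<integral>\<^sup>+x. f x \<partial>lborel)"
    unfolding eq by (simp add: ennreal_mult ennreal_power[symmetric] mult.assoc)
  finally show ?thesis by simp
qed

section \<open>Layers: from inequalities for sets to inequalities for functions\<close>

text \<open>A discrete layer-cake formula: \<eta> times the number of positive multiples of \<eta>
  below v recovers v up to an error of at most \<eta>. Finite sums suffice because the functions are
  bounded on compact sets.\<close>

lemma layer_count:
  fixes \<eta> v :: real
  assumes "0 < \<eta>" "0 \<le> v"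
  shows "\<eta> * (\<Sum>j=1..J. if real j * \<eta> \<le> v then 1 else 0) \<le> v" (is ?A)
    and "v \<le> real J * \<eta> \<Longrightarrow> v \<le> \<eta> + \<eta> * (\<Sum>j=1..J. if real j * \<eta> \<le> v then 1 else 0)" (is "_ \<Longrightarrow> ?B")
proof -
  define k where "k = nat \<lfloor>v / \<eta>\<rfloor>"
  have k: "real k \<le> v / \<eta>" "v / \<eta> < real k + 1" unfolding k_def using assms by auto
  have iff: "real j * \<eta> \<le> v \<longleftrightarrow> j \<le> k" for j
  proof
    assume "real j * \<eta> \<le> v"
    then have "real j \<le> v / \<eta>" using assms by (simp add: field_simps)
    then show "j \<le> k" using k by linarith
  next
    assume "j \<le> k"
    then have "real j \<le> v / \<eta>" using k by linarith
    then show "real j * \<eta> \<le> v" using assms by (simp add: field_simps)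
  qed
  have "(\<Sum>j=1..J. if real j * \<eta> \<le> v then 1 else 0) = (\<Sum>j\<in>{1..J} \<inter> {j. j \<le> k}. 1::real)"
    unfolding iff by (simp add: sum.If_cases)
  also have "{1..J} \<inter> {j. j \<le> k} = {1..min J k}" by auto
  finally have eq: "(\<Sum>j=1..J. if real j * \<eta> \<le> v then 1 else 0) = real (min J k)" by simp
  have "real (min J k) \<le> v / \<eta>" using k by (simp add: min_def)
  then show ?A unfolding eq using assms by (simp add: field_simps)
  show ?B if "v \<le> real J * \<eta>"
  proof -
    have "v / \<eta> \<le> real J" using that assms by (simp add: field_simps)
    then have "v / \<eta> \<le> 1 + real (min J k)" using k by (simp add: min_def)
    then show ?thesis unfolding eq using assms by (simp add: field_simps)
  qed
qed

lemma layer_count_ennreal: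
  fixes f :: "'a \<Rightarrow> real"
  assumes "0 < \<eta>" "0 \<le> f y" "y \<in> K"
  shows "ennreal \<eta> * (\<Sum>j=1..J. indicator {y \<in> K. real j * \<eta> \<le> f y} y) \<le> ennreal (f y)"
    and "f y \<le> real J * \<eta> \<Longrightarrow> ennreal (f y) \<le> ennreal \<eta> + ennreal \<eta> * (\<Sum>j=1..J. indicator {y \<in> K. real j * \<eta> \<le> f y} y)"
proof -
  have eq: "(\<Sum>j=1..J. indicator {y \<in> K. real j * \<eta> \<le> f y} y) = ennreal (\<Sum>j=1..J. if real j * \<eta> \<le> f y then 1 else 0)"
  proof -
    have "ennreal (\<Sum>j=1..J. if real j * \<eta> \<le> f y then 1 else 0) = (\<Sum>j=1..J. ennreal (if real j * \<eta> \<le> f y then 1 else 0))"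
      by (rule sum_ennreal[symmetric]) auto
    also have "... = (\<Sum>j=1..J. indicator {y \<in> K. real j * \<eta> \<le> f y} y)"
      using assms(3) by (intro sum.cong) auto
    finally show ?thesis by simp
  qed
  have nn: "0 \<le> (\<Sum>j=1..J. if real j * \<eta> \<le> f y then 1 else 0 :: real)" by (intro sum_nonneg) auto
  show "ennreal \<eta> * (\<Sum>j=1..J. indicator {y \<in> K. real j * \<eta> \<le> f y} y) \<le> ennreal (f y)"
    unfolding eq using layer_count(1)[OF assms(1,2)] assms(1) nn
    by (subst ennreal_mult[symmetric]) (auto intro: ennreal_leI)
  show "ennreal (f y) \<le> ennreal \<eta> + ennreal \<eta> * (\<Sum>j=1..J. indicator {y \<in> K. real j * \<eta> \<le> f y} y)"
    if "f y \<le> real J * \<eta>"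
  proof -
    let ?s = "\<Sum>j=1..J. if real j * \<eta> \<le> f y then 1 else 0 :: real"
    have "ennreal (f y) \<le> ennreal (\<eta> + \<eta> * ?s)"
      by (rule ennreal_leI) (rule layer_count(2)[OF assms(1,2) that])
    also have "... = ennreal \<eta> + ennreal (\<eta> * ?s)"
      using assms(1) nn by (intro ennreal_plus) auto
    also have "ennreal (\<eta> * ?s) = ennreal \<eta> * ennreal ?s"
      using assms(1) nn by (intro ennreal_mult) auto
    finally show ?thesis unfolding eq .
  qed
qed

text \<open>An inequality between the measure of a set and the measure of the set related to it by \<open>R\<close>
  passes from superlevel sets to functions.\<close>

lemma layer_le_related:
  fixes f :: "'a \<Rightarrow> real" and G :: "'b \<Rightarrow> ennreal"
  assumes K: "K \<in> sets N" "emeasure N K < \<infinity>" and f: "\<And>y. y \<in> K \<Longrightarrow> 0 \<le> f y \<and> f y \<le> B"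
    and A: "\<And>l. {y \<in> K. l \<le> f y} \<in> sets N"
    and S: "\<And>l. {x. \<exists>y\<in>{y \<in> K. l \<le> f y}. R x y} \<in> sets M"
    and SK: "{x. \<exists>y\<in>K. R x y} \<in> sets M"
    and le: "\<And>l. emeasure N {y \<in> K. l \<le> f y} \<le> c * emeasure M {x. \<exists>y\<in>{y \<in> K. l \<le> f y}. R x y}"
    and G [measurable]: "G \<in> borel_measurable M"
    and fG: "\<And>x y. y \<in> K \<Longrightarrow> R x y \<Longrightarrow> ennreal (f y) \<le> G x"
  shows "(\<integral>\<^sup>+y\<in>K. ennreal (f y) \<partial>N) \<le> c * (\<integral>\<^sup>+x\<in>{x. \<exists>y\<in>K. R x y}. G x \<partial>M)"
proof (rule ennreal_le_epsilon)
  fix e :: real assume e: "0 < e"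
  obtain m where m: "emeasure N K = ennreal m" "0 \<le> m" using K(2) by (cases "emeasure N K") auto
  \<comment> \<open>The discretization error is \<eta> times the measure of K and must stay below
    e.\<close>
  define \<eta> where "\<eta> = e / (m + 1)"
  have \<eta>: "0 < \<eta>" "\<eta> * m \<le> e" using e m by (auto simp: \<eta>_def field_simps)
  define J where "J = nat \<lceil>B / \<eta>\<rceil>"
  have "B / \<eta> \<le> real J" unfolding J_def by linarith
  then have J: "B \<le> real J * \<eta>" using \<eta> by (simp add: field_simps)
  define P where "P j = {y \<in> K. real j * \<eta> \<le> f y}" for j :: nat
  define S' where "S' j = {x. \<exists>y\<in>P j. R x y}" for j
  have [measurable]: "P j \<in> sets N" "S' j \<in> sets M" for j
    unfolding S'_def P_def by (rule A, rule S)
  note [measurable] = SK K(1)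
  have "(\<integral>\<^sup>+y\<in>K. ennreal (f y) \<partial>N) \<le> (\<integral>\<^sup>+y. ennreal \<eta> * indicator K y + ennreal \<eta> * (\<Sum>j=1..J. indicator (P j) y) \<partial>N)"
  proof (rule nn_integral_mono)
    fix y
    show "ennreal (f y) * indicator K y \<le> ennreal \<eta> * indicator K y + ennreal \<eta> * (\<Sum>j=1..J. indicator (P j) y)"
    proof (cases "y \<in> K")
      case True
      have "f y \<le> real J * \<eta>" using f[OF True] J by linarith
      then show ?thesis using layer_count_ennreal(2)[OF \<eta>(1) _ True, of f J, folded P_def] f[OF True] True by simp
    qed simp
  qed
  also have "... = ennreal \<eta> * emeasure N K + ennreal \<eta> * (\<Sum>j=1..J. emeasure N (P j))"
    by (subst nn_integral_add) (auto simp: nn_integral_cmult nn_integral_sum)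
  also have "... \<le> ennreal e + ennreal \<eta> * (\<Sum>j=1..J. c * emeasure M (S' j))"
  proof (intro add_mono mult_left_mono sum_mono)
    show "ennreal \<eta> * emeasure N K \<le> ennreal e"
      using \<eta> m by (simp add: ennreal_mult[symmetric] ennreal_leI)
    show "emeasure N (P j) \<le> c * emeasure M (S' j)" for j
      unfolding S'_def P_def by (rule le)
  qed simp
  also have "ennreal \<eta> * (\<Sum>j=1..J. c * emeasure M (S' j)) = c * (ennreal \<eta> * (\<Sum>j=1..J. emeasure M (S' j)))"
    by (simp add: sum_distrib_left[symmetric] ac_simps)
  also have "ennreal \<eta> * (\<Sum>j=1..J. emeasure M (S' j)) = (\<integral>\<^sup>+x. ennreal \<eta> * (\<Sum>j=1..J. indicator (S' j) x) \<partial>M)"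
    by (auto simp: nn_integral_cmult nn_integral_sum)
  also have "... \<le> (\<integral>\<^sup>+x\<in>{x. \<exists>y\<in>K. R x y}. G x \<partial>M)"
  proof (rule nn_integral_mono)
    fix x
    \<comment> \<open>Different levels may be met through different y. The y of the highest level
      suffices: the number of levels met is at most that level, so \<eta> times it is at most f
      y.\<close>
    define Q where "Q = {j \<in> {1..J}. x \<in> S' j}"
    have fin: "finite Q" by (simp add: Q_def)
    have sumP: "(\<Sum>j=1..J. indicator (S' j) x) = (of_nat (card Q) :: ennreal)"
      unfolding indicator_def of_bool_def Q_def by (simp add: sum.If_cases Int_def)
    show "ennreal \<eta> * (\<Sum>j=1..J. indicator (S' j) x) \<le> G x * indicator {x. \<exists>y\<in>K. R x y} x"
    proof (cases "Q = {}")
      case False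
      then have "Max Q \<in> Q" using fin by simp
      then obtain y where y: "y \<in> K" "real (Max Q) * \<eta> \<le> f y" "R x y" by (auto simp: Q_def S'_def P_def)
      have "Q \<subseteq> {1..Max Q}" using fin by (auto simp: Q_def)
      then have "card Q \<le> Max Q" using card_mono[of "{1..Max Q}" Q] by simp
      then have "real (card Q) * \<eta> \<le> f y" using y(2) \<eta>(1)
        by (meson mult_right_mono less_imp_le of_nat_mono order_trans)
      then have "ennreal \<eta> * of_nat (card Q) \<le> ennreal (f y)"
        using \<eta>(1) by (simp add: ennreal_of_nat_eq_real_of_nat ennreal_mult[symmetric] mult.commute ennreal_leI)
      also have "... \<le> G x" using fG[OF y(1,3)] .
      finally have "ennreal \<eta> * of_nat (card Q) \<le> G x" .
      moreover have "x \<in> {x. \<exists>y\<in>K. R x y}" using y by auto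
      ultimately show ?thesis by (simp only: sumP indicator_simps mult_1_right)
    next
      case True
      then show ?thesis unfolding sumP by simp
    qed
  qed
  finally show "(\<integral>\<^sup>+y\<in>K. ennreal (f y) \<partial>N) \<le> c * (\<integral>\<^sup>+x\<in>{x. \<exists>y\<in>K. R x y}. G x \<partial>M) + ennreal e"
    by (simp add: mult_left_mono add.commute add_left_mono)
qed

text \<open>The same slicing in the opposite direction: sets of points x are bounded by superlevel
  sets of f. The summand I carries the change from y to x, which for the Friedrichs inequality is an
  integral of the gradient.\<close>

lemma related_le_layer:
  fixes f :: "'a \<Rightarrow> real" and g I :: "'b \<Rightarrow> ennreal"
  assumes X: "X \<in> sets M" "emeasure M X < \<infinity>" and f: "\<And>y. y \<in> K \<Longrightarrow> 0 \<le> f y \<and> f y \<le> B"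
    and A: "\<And>l. {y \<in> K. l \<le> f y} \<in> sets N"
    and S: "\<And>l. {x. \<exists>y\<in>{y \<in> K. l \<le> f y}. R x y} \<in> sets M"
    and le: "\<And>l. emeasure M {x. \<exists>y\<in>{y \<in> K. l \<le> f y}. R x y} \<le> c * emeasure N {y \<in> K. l \<le> f y}"
    and I [measurable]: "I \<in> borel_measurable M"
    and gf: "\<And>x. x \<in> X \<Longrightarrow> \<exists>y\<in>K. R x y \<and> g x \<le> ennreal (f y) + I x"
  shows "(\<integral>\<^sup>+x\<in>X. g x \<partial>M) \<le> c * (\<integral>\<^sup>+y\<in>K. ennreal (f y) \<partial>N) + (\<integral>\<^sup>+x\<in>X. I x \<partial>M)"
proof (rule ennreal_le_epsilon)
  fix e :: real assume e: "0 < e"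
  obtain m where m: "emeasure M X = ennreal m" "0 \<le> m" using X(2) by (cases "emeasure M X") auto
  define \<eta> where "\<eta> = e / (m + 1)"
  have \<eta>: "0 < \<eta>" "\<eta> * m \<le> e" using e m by (auto simp: \<eta>_def field_simps)
  define J where "J = nat \<lceil>B / \<eta>\<rceil>"
  have "B / \<eta> \<le> real J" unfolding J_def by linarith
  then have J: "B \<le> real J * \<eta>" using \<eta> by (simp add: field_simps)
  define P where "P j = {y \<in> K. real j * \<eta> \<le> f y}" for j :: nat
  define S' where "S' j = {x. \<exists>y\<in>P j. R x y}" for j
  have [measurable]: "P j \<in> sets N" "S' j \<in> sets M" for j
    unfolding S'_def P_def by (rule A, rule S)
  note [measurable] = X(1)
  have "(\<integral>\<^sup>+x\<in>X. g x \<partial>M) \<le> (\<integral>\<^sup>+x. ennreal \<eta> * indicator X x + (ennreal \<eta> * (\<Sum>j=1..J. indicator (S' j) x) + I x * indicator X x) \<partial>M)"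
  proof (rule nn_integral_mono)
    fix x
    show "g x * indicator X x \<le> ennreal \<eta> * indicator X x + (ennreal \<eta> * (\<Sum>j=1..J. indicator (S' j) x) + I x * indicator X x)"
    proof (cases "x \<in> X")
      case True
      then obtain y where y: "y \<in> K" "R x y" "g x \<le> ennreal (f y) + I x" using gf by blast
      have "f y \<le> real J * \<eta>" using f[OF y(1)] J by linarith
      then have "ennreal (f y) \<le> ennreal \<eta> + ennreal \<eta> * (\<Sum>j=1..J. indicator (P j) y)"
        using layer_count_ennreal(2)[OF \<eta>(1) _ y(1), of f J, folded P_def] f[OF y(1)] by simp
      also have "... \<le> ennreal \<eta> + ennreal \<eta> * (\<Sum>j=1..J. indicator (S' j) x)"
        using y by (intro add_left_mono mult_left_mono sum_mono) (auto simp: indicator_def S'_def)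
      finally have "ennreal (f y) + I x \<le> ennreal \<eta> + ennreal \<eta> * (\<Sum>j=1..J. indicator (S' j) x) + I x"
        by (rule add_right_mono)
      then show ?thesis using True order_trans[OF y(3)] by (simp add: add.assoc)
    qed simp
  qed
  also have "... = ennreal \<eta> * emeasure M X + (ennreal \<eta> * (\<Sum>j=1..J. emeasure M (S' j)) + (\<integral>\<^sup>+x\<in>X. I x \<partial>M))"
    by (subst nn_integral_add, measurable, subst nn_integral_add) (auto simp: nn_integral_cmult nn_integral_sum)
  also have "... \<le> ennreal e + (ennreal \<eta> * (\<Sum>j=1..J. c * emeasure N (P j)) + (\<integral>\<^sup>+x\<in>X. I x \<partial>M))"
  proof (intro add_mono mult_left_mono sum_mono order_refl)
    show "ennreal \<eta> * emeasure M X \<le> ennreal e"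
      using \<eta> m by (simp add: ennreal_mult[symmetric] ennreal_leI)
    show "emeasure M (S' j) \<le> c * emeasure N (P j)" for j
      unfolding S'_def P_def by (rule le)
  qed simp
  also have "ennreal \<eta> * (\<Sum>j=1..J. c * emeasure N (P j)) = c * (ennreal \<eta> * (\<Sum>j=1..J. emeasure N (P j)))"
    by (simp add: sum_distrib_left[symmetric] ac_simps)
  also have "ennreal \<eta> * (\<Sum>j=1..J. emeasure N (P j)) = (\<integral>\<^sup>+y. ennreal \<eta> * (\<Sum>j=1..J. indicator (P j) y) \<partial>N)"
    by (auto simp: nn_integral_cmult nn_integral_sum)
  also have "c * ... \<le> c * (\<integral>\<^sup>+y\<in>K. ennreal (f y) \<partial>N)"
  proof (intro mult_left_mono nn_integral_mono)
    fix y
    show "ennreal \<eta> * (\<Sum>j=1..J. indicator (P j) y) \<le> ennreal (f y) * indicator K y"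
      using P_def layer_count_ennreal(1)[OF \<eta>(1) _, of f y K J, folded P_def] f[of y] by (cases "y \<in> K") auto
  qed simp
  finally show "(\<integral>\<^sup>+x\<in>X. g x \<partial>M) \<le> c * (\<integral>\<^sup>+y\<in>K. ennreal (f y) \<partial>N) + (\<integral>\<^sup>+x\<in>X. I x \<partial>M) + ennreal e"
    by (simp add: ac_simps add_left_mono)
qed

section \<open>Trace, Friedrichs and double-difference inequalities for C^1 functions\<close>

lemma C1_energy_measurable:
  assumes "C1_with_gradient \<phi> D"
  shows "(\<lambda>x. ennreal ((norm (D x))\<^sup>2)) \<in> borel_measurable borel"
  using C1_gradient_measurable[OF assms] by measurable

lemma superlevel_compact:
  fixes f :: "'a::euclidean_space \<Rightarrow> real"
  assumes "compact K" "continuous_on UNIV f"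
  shows "compact {y \<in> K. l \<le> f y}"
proof -
  have "closed {y. l \<le> f y}" using assms(2) by (intro closed_Collect_le continuous_intros)
  then have "compact (K \<inter> {y. l \<le> f y})" using assms(1) by (rule compact_Int_closed[rotated])
  then show ?thesis by (simp add: Int_def)
qed

lemma continuous_compact_bound:
  fixes f :: "'a::euclidean_space \<Rightarrow> real"
  assumes "compact K" "continuous_on UNIV f"
  obtains B where "\<And>y. y \<in> K \<Longrightarrow> f y \<le> B"
proof -
  have "compact (f ` K)" using assms by (intro compact_continuous_image) (auto intro: continuous_on_subset)
  then have "bdd_above (f ` K)" by (intro bounded_imp_bdd_above compact_imp_bounded)
  then show ?thesis using that by (auto simp: bdd_above_def)
qed

lemma tube_eq_related: "tube e a b A = {x. \<exists>y\<in>A. \<exists>t\<in>{a..b}. x = y + t *\<^sub>R e}"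
  unfolding tube_def by auto

lemma sweep_eq_related: "sweep z A = {x. \<exists>y\<in>A. \<exists>t\<in>{0..1}. y = x + t *\<^sub>R z}"
  unfolding sweep_def by auto

lemma flat_over_subset: "flat_over L e K \<Longrightarrow> A \<subseteq> K \<Longrightarrow> flat_over L e A"
  unfolding flat_over_def by blast

lemma emeasure_hausdorff_graph_finite:
  fixes e :: "'a::euclidean_space"
  assumes n: "2 \<le> DIM('a)" and e: "norm e = 1" and L: "0 \<le> L" and K: "compact K" "flat_over L e K"
  shows "emeasure (hausdorff_measure (DIM('a) - 1)) K < \<infinity>"
proof -
  have "emeasure (hausdorff_measure (DIM('a) - 1)) K
      \<le> ennreal (graph_const (DIM('a)) L / 1) * emeasure lborel (tube e 1 (2 * 1) K)"
    by (rule emeasure_graph_le_tube[OF n e L K]) simp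
  also have "... < \<infinity>"
    using emeasure_bounded_finite[OF compact_imp_bounded[OF compact_tube[OF K(1), of e 1 2]]]
    by (simp add: ennreal_mult_less_top)
  finally show ?thesis .
qed

text \<open>Each value on \<open>K\<close> is compared with the values in the tube above it, which has positive distance
  from \<open>K\<close>.\<close>

lemma trace_le_tube:
  fixes e :: "'a::euclidean_space"
  assumes n: "2 \<le> DIM('a)" and e: "norm e = 1" and L: "0 \<le> L" and K: "compact K" "flat_over L e K"
    and h: "0 < h" and C1: "C1_with_gradient \<phi> D" and \<Omega>: "\<Omega> \<in> sets borel"
    and above: "\<And>y t. y \<in> K \<Longrightarrow> 0 < t \<Longrightarrow> t \<le> 2 * h \<Longrightarrow> y + t *\<^sub>R e \<in> \<Omega>"
  shows "surface_int K \<phi>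
    \<le> ennreal (graph_const (DIM('a)) L / h) *
      (2 * square_int (tube e h (2 * h) K) \<phi>
        + ennreal (8 * h\<^sup>2) * dirichlet_int \<Omega> D)"
proof -
  let ?H = "hausdorff_measure (DIM('a) - 1) :: 'a measure"
  let ?c = "ennreal (graph_const (DIM('a)) L / h)"
  let ?T = "tube e h (2 * h) K"
  define g where "g x = ennreal ((norm (D x))\<^sup>2) * indicator \<Omega> x" for x
  have [measurable]: "g \<in> borel_measurable borel" "\<phi> \<in> borel_measurable borel"
    unfolding g_def using C1_energy_measurable[OF C1] C1_measurable[OF C1] \<Omega> by measurable
  \<comment> \<open>The parameter t at which x is reached depends on y. Integrating over the full
    window {0..2 * h}, with the energy cut off outside \<Omega>, gives a majorant depending on x
    alone.\<close>
  define G where "G x = 2 * ennreal ((\<phi> x)\<^sup>2) + ennreal (4 * h) * (\<integral>\<^sup>+s\<in>{0..2 * h}. g (x + s *\<^sub>R - e) \<partial>lborel)" for x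
  have [measurable]: "G \<in> borel_measurable borel" unfolding G_def by measurable
  obtain B where B: "\<And>y. y \<in> K \<Longrightarrow> (\<phi> y)\<^sup>2 \<le> B"
    using continuous_compact_bound[OF K(1), of "\<lambda>y. (\<phi> y)\<^sup>2"] C1_continuous[OF C1]
    by (auto intro: continuous_intros)
  have sc: "compact {y \<in> K. l \<le> (\<phi> y)\<^sup>2}" for l
    using C1_continuous[OF C1] by (intro superlevel_compact[OF K(1)] continuous_intros)
  have T: "compact ?T" by (rule compact_tube[OF K(1)])
  have key: "surface_int K \<phi> \<le> ?c * (\<integral>\<^sup>+x\<in>?T. G x \<partial>lborel)"
    unfolding tube_eq_related[of e h "2 * h" K]
  proof (rule layer_le_related[where B = B])
    show "K \<in> sets ?H" using K(1) by (simp add: borel_compact)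
    show "emeasure ?H K < \<infinity>" by (rule emeasure_hausdorff_graph_finite[OF n e L K])
    show "{y \<in> K. l \<le> (\<phi> y)\<^sup>2} \<in> sets ?H" for l using sc[of l] by (simp add: borel_compact)
    show "{x. \<exists>y\<in>{y \<in> K. l \<le> (\<phi> y)\<^sup>2}. \<exists>t\<in>{h..2 * h}. x = y + t *\<^sub>R e} \<in> sets lborel" for l
      unfolding tube_eq_related[symmetric] using compact_tube[OF sc[of l], of e h "2 * h"] by (simp add: borel_compact)
    show "{x. \<exists>y\<in>K. \<exists>t\<in>{h..2 * h}. x = y + t *\<^sub>R e} \<in> sets lborel"
      unfolding tube_eq_related[symmetric] using T by (simp add: borel_compact)
    show "emeasure ?H {y \<in> K. l \<le> (\<phi> y)\<^sup>2}
      \<le> ?c * emeasure lborel {x. \<exists>y\<in>{y \<in> K. l \<le> (\<phi> y)\<^sup>2}. \<exists>t\<in>{h..2 * h}. x = y + t *\<^sub>R e}" for l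
      unfolding tube_eq_related[symmetric]
      by (rule emeasure_graph_le_tube[OF n e L sc flat_over_subset[OF K(2)] h]) auto
    show "G \<in> borel_measurable lborel" by measurable
    show "0 \<le> (\<phi> y)\<^sup>2 \<and> (\<phi> y)\<^sup>2 \<le> B" if "y \<in> K" for y using B[OF that] by simp
    show "ennreal ((\<phi> y)\<^sup>2) \<le> G x" if y: "y \<in> K" and yt: "\<exists>t\<in>{h..2 * h}. x = y + t *\<^sub>R e" for x y
    proof -
      obtain t where t: "h \<le> t" "t \<le> 2 * h" "x = y + t *\<^sub>R e" using yt by auto
      have yx: "y = x + t *\<^sub>R - e" using t by simp
      have "ennreal ((\<phi> y - \<phi> x)\<^sup>2) \<le> ennreal (t * (norm (- e))\<^sup>2) * (\<integral>\<^sup>+s\<in>{0<..<t}. ennreal ((norm (D (x + s *\<^sub>R - e)))\<^sup>2) \<partial>lborel)"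
        unfolding yx using C1_segment_inequality[OF C1, of t x "- e"] t h by simp
      also have "... \<le> ennreal (2 * h) * (\<integral>\<^sup>+s\<in>{0..2 * h}. g (x + s *\<^sub>R - e) \<partial>lborel)"
      proof (rule mult_mono, goal_cases)
        case 1
        show ?case using e t by (auto intro: ennreal_leI)
      next
        case 2
        show ?case
        proof (rule nn_integral_mono)
        fix s
        have "x + s *\<^sub>R - e \<in> \<Omega>" if "s \<in> {0<..<t}"
          using above[OF y, of "t - s"] that t by (simp add: algebra_simps)
        then show "ennreal ((norm (D (x + s *\<^sub>R - e)))\<^sup>2) * indicator {0<..<t} s \<le> g (x + s *\<^sub>R - e) * indicator {0..2 * h} s"
          using t unfolding g_def by (auto simp: indicator_def)
        qed
      qed auto
      finally have 1: "ennreal ((\<phi> y - \<phi> x)\<^sup>2) \<le> ennreal (2 * h) * (\<integral>\<^sup>+s\<in>{0..2 * h}. g (x + s *\<^sub>R - e) \<partial>lborel)" .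
      have "ennreal ((\<phi> y)\<^sup>2) \<le> ennreal (2 * (\<phi> x)\<^sup>2 + 2 * (\<phi> y - \<phi> x)\<^sup>2)"
        by (rule ennreal_leI) (rule power2_le_2_add)
      also have "... = 2 * ennreal ((\<phi> x)\<^sup>2) + 2 * ennreal ((\<phi> y - \<phi> x)\<^sup>2)"
        by (simp add: ennreal_mult)
      also have "... \<le> 2 * ennreal ((\<phi> x)\<^sup>2) + 2 * (ennreal (2 * h) * (\<integral>\<^sup>+s\<in>{0..2 * h}. g (x + s *\<^sub>R - e) \<partial>lborel))"
        using 1 by (intro add_left_mono mult_left_mono) auto
      also have "... = G x"
      proof -
        have "ennreal (4 * h) = 2 * ennreal (2 * h)"
          using h ennreal_mult[of 2 "2 * h"] by simp
        then show ?thesis by (simp only: G_def mult.assoc)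
      qed
      finally show ?thesis .
    qed
  qed
  have [measurable]: "?T \<in> sets borel" using T by (simp add: borel_compact)
  have "(\<integral>\<^sup>+x\<in>?T. G x \<partial>lborel) \<le> (\<integral>\<^sup>+x. 2 * (ennreal ((\<phi> x)\<^sup>2) * indicator ?T x)
      + ennreal (4 * h) * (\<integral>\<^sup>+s\<in>{0..2 * h}. g (x + s *\<^sub>R - e) \<partial>lborel) \<partial>lborel)"
    unfolding G_def by (intro nn_integral_mono) (auto simp: indicator_def)
  also have "... = 2 * square_int ?T \<phi>
      + ennreal (4 * h) * (\<integral>\<^sup>+x. (\<integral>\<^sup>+s\<in>{0..2 * h}. g (x + s *\<^sub>R - e) \<partial>lborel) \<partial>lborel)"
    by (subst nn_integral_add) (auto simp: nn_integral_cmult)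
  \<comment> \<open>By Fubini, each translate carries the same total energy, so the window
    contributes its length 2 h and the constant becomes 4 h times 2 h.\<close>
  also have "(\<integral>\<^sup>+x. (\<integral>\<^sup>+s\<in>{0..2 * h}. g (x + s *\<^sub>R - e) \<partial>lborel) \<partial>lborel)
      = (\<integral>\<^sup>+s. (\<integral>\<^sup>+x. g (x + s *\<^sub>R - e) * indicator {0..2 * h} s \<partial>lborel) \<partial>lborel)"
    by (rule lborel_pair.Fubini') measurable
  also have "... = (\<integral>\<^sup>+s. (\<integral>\<^sup>+x. g x \<partial>lborel) * indicator {0..2 * h} s \<partial>lborel)"
    by (intro nn_integral_cong) (subst nn_integral_multc, measurable, subst nn_integral_lborel_shift, auto)
  also have "... = ennreal (2 * h) * (\<integral>\<^sup>+x. g x \<partial>lborel)"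
    using h by (simp add: nn_integral_cmult mult.commute)
  also have "ennreal (4 * h) * (ennreal (2 * h) * (\<integral>\<^sup>+x. g x \<partial>lborel)) = ennreal (8 * h\<^sup>2) * (\<integral>\<^sup>+x. g x \<partial>lborel)"
    using h by (simp add: mult.assoc[symmetric] ennreal_mult[symmetric] power2_eq_square)
  finally have "(\<integral>\<^sup>+x\<in>?T. G x \<partial>lborel) \<le> 2 * square_int ?T \<phi>
      + ennreal (8 * h\<^sup>2) * (\<integral>\<^sup>+x. g x \<partial>lborel)" .
  from order_trans[OF key mult_left_mono[OF this zero_le]] show ?thesis unfolding g_def .
qed

lemma exists_exit_point:
  fixes z :: "'a::euclidean_space"
  assumes \<Omega>: "open \<Omega>" "x \<in> \<Omega>" "x + z \<notin> \<Omega>"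
  obtains t where "0 < t" "t \<le> 1" "x + t *\<^sub>R z \<in> frontier \<Omega>" "\<And>s. 0 \<le> s \<Longrightarrow> s < t \<Longrightarrow> x + s *\<^sub>R z \<in> \<Omega>"
proof -
  let ?S = "{0..1} \<inter> (\<lambda>t. x + t *\<^sub>R z) -` (- \<Omega>)"
  have "closed ?S"
    using \<Omega>(1) by (intro continuous_closed_preimage continuous_intros) auto
  then have "compact ?S" by (metis Int_lower1 bounded_closed_interval bounded_subset compact_eq_bounded_closed)
  moreover have "1 \<in> ?S" using \<Omega> by simp
  ultimately obtain t where t: "t \<in> ?S" "\<And>s. s \<in> ?S \<Longrightarrow> t \<le> s"
    using compact_attains_inf[of ?S] by blast
  have in\<Omega>: "x + s *\<^sub>R z \<in> \<Omega>" if "0 \<le> s" "s < t" for s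
    using t(2)[of s] t(1) that by fastforce
  have "t \<noteq> 0" using t(1) \<Omega>(2) by auto
  then have t0: "0 < t" using t(1) by auto
  have "x + t *\<^sub>R z \<in> closure \<Omega>"
  proof (rule closure_sequential[THEN iffD2], intro exI conjI allI)
    show "x + (t - t / real (Suc k)) *\<^sub>R z \<in> \<Omega>" for k
      using t0 by (intro in\<Omega>) (auto simp: field_simps)
    have "(\<lambda>k. 1 / real (Suc k)) \<longlonglongrightarrow> 0" by (rule LIMSEQ_Suc[OF lim_inverse_n'])
    then have "(\<lambda>k. x + (t - t * (1 / real (Suc k))) *\<^sub>R z) \<longlonglongrightarrow> x + (t - t * 0) *\<^sub>R z" by (intro tendsto_intros)
    then show "(\<lambda>k. x + (t - t / real (Suc k)) *\<^sub>R z) \<longlonglongrightarrow> x + t *\<^sub>R z" by simp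
  qed
  moreover have "x + t *\<^sub>R z \<notin> interior \<Omega>" using t(1) interior_subset by auto
  ultimately show ?thesis using that[OF t0 _ _ in\<Omega>] t(1) by (auto simp: frontier_def)
qed

text \<open>The vector z is longer than the diameter, so from each x in \<Omega> the segment along z
  leaves \<Omega> at a boundary point y, and \<phi> x is compared with \<phi> y. Points led to a
  superlevel set on the boundary lie in its sweep, whose volume is bounded by its area.\<close>

lemma friedrichs:
  fixes \<Omega> :: "'a::euclidean_space set" and z :: 'a
  assumes n: "2 \<le> DIM('a)" and \<Omega>: "open \<Omega>" "bounded \<Omega>" and C1: "C1_with_gradient \<phi> D"
    and z: "norm z = diameter \<Omega> + 1"
  shows "square_int \<Omega> \<phi>
    \<le> ennreal (proj_const (DIM('a)) * norm z) * (\<integral>\<^sup>+y\<in>frontier \<Omega>. ennreal (2 * (\<phi> y)\<^sup>2) \<partial>hausdorff_measure (DIM('a) - 1))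
      + ennreal (2 * (norm z)\<^sup>2) * dirichlet_int \<Omega> D"
proof -
  let ?H = "hausdorff_measure (DIM('a) - 1) :: 'a measure"
  let ?c = "ennreal (proj_const (DIM('a)) * norm z)"
  have z0: "z \<noteq> 0" using z diameter_ge_0[OF \<Omega>(2)] by auto
  have out: "x + z \<notin> \<Omega>" if "x \<in> \<Omega>" for x
    using diameter_bounded_bound[OF \<Omega>(2) that, of "x + z"] z by (auto simp: dist_norm)
  define g where "g x = ennreal ((norm (D x))\<^sup>2) * indicator \<Omega> x" for x
  have [measurable]: "\<Omega> \<in> sets borel" using \<Omega> by simp
  have [measurable]: "g \<in> borel_measurable borel" "\<phi> \<in> borel_measurable borel"
    unfolding g_def using C1_energy_measurable[OF C1] C1_measurable[OF C1] by measurable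
  define I where "I x = ennreal (2 * (norm z)\<^sup>2) * (\<integral>\<^sup>+s\<in>{0..1}. g (x + s *\<^sub>R z) \<partial>lborel)" for x
  have [measurable]: "I \<in> borel_measurable borel" unfolding I_def by measurable
  have K: "compact (frontier \<Omega>)" using \<Omega>(2) by (rule compact_frontier_bounded)
  have c\<phi>: "continuous_on UNIV (\<lambda>y. 2 * (\<phi> y)\<^sup>2)" using C1_continuous[OF C1] by (intro continuous_intros)
  obtain B where B: "\<And>y. y \<in> frontier \<Omega> \<Longrightarrow> 2 * (\<phi> y)\<^sup>2 \<le> B"
    using continuous_compact_bound[OF K c\<phi>] by blast
  note sc = superlevel_compact[OF K c\<phi>]
  have "square_int \<Omega> \<phi>
    \<le> ?c * (\<integral>\<^sup>+y\<in>frontier \<Omega>. ennreal (2 * (\<phi> y)\<^sup>2) \<partial>?H) + (\<integral>\<^sup>+x\<in>\<Omega>. I x \<partial>lborel)"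
  proof (rule related_le_layer[where B = B and R = "\<lambda>x y. \<exists>t\<in>{0..1}. y = x + t *\<^sub>R z"])
    show "emeasure lborel \<Omega> < \<infinity>" using \<Omega>(2) by (rule emeasure_bounded_finite)
    show "{y \<in> frontier \<Omega>. l \<le> 2 * (\<phi> y)\<^sup>2} \<in> sets ?H" for l using sc[of l] by (simp add: borel_compact)
    show "{x. \<exists>y\<in>{y \<in> frontier \<Omega>. l \<le> 2 * (\<phi> y)\<^sup>2}. \<exists>t\<in>{0..1}. y = x + t *\<^sub>R z} \<in> sets lborel" for l
      unfolding sweep_eq_related[symmetric] using compact_sweep[OF sc[of l], of z] by (simp add: borel_compact)
    show "emeasure lborel {x. \<exists>y\<in>{y \<in> frontier \<Omega>. l \<le> 2 * (\<phi> y)\<^sup>2}. \<exists>t\<in>{0..1}. y = x + t *\<^sub>R z}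
      \<le> ?c * emeasure ?H {y \<in> frontier \<Omega>. l \<le> 2 * (\<phi> y)\<^sup>2}" for l
      unfolding sweep_eq_related[symmetric] using emeasure_sweep_le[OF n sc[of l], of z] z0 by auto
    show "0 \<le> 2 * (\<phi> y)\<^sup>2 \<and> 2 * (\<phi> y)\<^sup>2 \<le> B" if "y \<in> frontier \<Omega>" for y using B[OF that] by simp
    show "\<exists>y\<in>frontier \<Omega>. (\<exists>t\<in>{0..1}. y = x + t *\<^sub>R z) \<and> ennreal ((\<phi> x)\<^sup>2) \<le> ennreal (2 * (\<phi> y)\<^sup>2) + I x"
      if x: "x \<in> \<Omega>" for x
    proof -
      obtain t where t: "0 < t" "t \<le> 1" "x + t *\<^sub>R z \<in> frontier \<Omega>" "\<And>s. 0 \<le> s \<Longrightarrow> s < t \<Longrightarrow> x + s *\<^sub>R z \<in> \<Omega>"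
        using exists_exit_point[OF \<Omega>(1) x out[OF x]] by metis
      let ?y = "x + t *\<^sub>R z"
      have "ennreal ((\<phi> ?y - \<phi> x)\<^sup>2) \<le> ennreal (t * (norm z)\<^sup>2) * (\<integral>\<^sup>+s\<in>{0<..<t}. ennreal ((norm (D (x + s *\<^sub>R z)))\<^sup>2) \<partial>lborel)"
        using C1_segment_inequality[OF C1, of t x z] t by simp
      also have "... \<le> ennreal ((norm z)\<^sup>2) * (\<integral>\<^sup>+s\<in>{0..1}. g (x + s *\<^sub>R z) \<partial>lborel)"
      proof (rule mult_mono, goal_cases)
        case 1
        show ?case using t by (intro ennreal_leI) (simp add: mult_left_le_one_le)
      next
        case 2
        show ?case
        proof (rule nn_integral_mono)
        fix s
        show "ennreal ((norm (D (x + s *\<^sub>R z)))\<^sup>2) * indicator {0<..<t} s \<le> g (x + s *\<^sub>R z) * indicator {0..1} s"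
          using t unfolding g_def by (auto simp: indicator_def)
        qed
      qed auto
      finally have 1: "ennreal ((\<phi> ?y - \<phi> x)\<^sup>2) \<le> ennreal ((norm z)\<^sup>2) * (\<integral>\<^sup>+s\<in>{0..1}. g (x + s *\<^sub>R z) \<partial>lborel)" .
      have "(\<phi> x)\<^sup>2 \<le> 2 * (\<phi> ?y)\<^sup>2 + 2 * (\<phi> ?y - \<phi> x)\<^sup>2"
        using power2_le_2_add[of "\<phi> x" "\<phi> ?y"] by (simp add: power2_commute)
      then have "ennreal ((\<phi> x)\<^sup>2) \<le> ennreal (2 * (\<phi> ?y)\<^sup>2 + 2 * (\<phi> ?y - \<phi> x)\<^sup>2)" by (rule ennreal_leI)
      also have "... = ennreal (2 * (\<phi> ?y)\<^sup>2) + 2 * ennreal ((\<phi> ?y - \<phi> x)\<^sup>2)"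
        by (simp add: ennreal_mult)
      also have "... \<le> ennreal (2 * (\<phi> ?y)\<^sup>2) + 2 * (ennreal ((norm z)\<^sup>2) * (\<integral>\<^sup>+s\<in>{0..1}. g (x + s *\<^sub>R z) \<partial>lborel))"
        using 1 by (intro add_left_mono mult_left_mono) auto
      also have "2 * (ennreal ((norm z)\<^sup>2) * (\<integral>\<^sup>+s\<in>{0..1}. g (x + s *\<^sub>R z) \<partial>lborel)) = I x"
        unfolding I_def by (simp add: ennreal_mult mult.assoc)
      finally show ?thesis using t by (intro bexI[of _ ?y] conjI bexI[of _ t]) auto
    qed
  qed auto
  also have "(\<integral>\<^sup>+x\<in>\<Omega>. I x \<partial>lborel) \<le> (\<integral>\<^sup>+x. I x \<partial>lborel)"
    by (intro nn_integral_mono) (auto simp: indicator_def)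
  also have "(\<integral>\<^sup>+x. I x \<partial>lborel) = ennreal (2 * (norm z)\<^sup>2) * (\<integral>\<^sup>+x. (\<integral>\<^sup>+s\<in>{0..1}. g (x + s *\<^sub>R z) \<partial>lborel) \<partial>lborel)"
    unfolding I_def by (rule nn_integral_cmult) measurable
  also have "(\<integral>\<^sup>+x. (\<integral>\<^sup>+s\<in>{0..1}. g (x + s *\<^sub>R z) \<partial>lborel) \<partial>lborel)
      = (\<integral>\<^sup>+s. (\<integral>\<^sup>+x. g (x + s *\<^sub>R z) * indicator {0..1} s \<partial>lborel) \<partial>lborel)"
    by (rule lborel_pair.Fubini') measurable
  also have "... = (\<integral>\<^sup>+s. (\<integral>\<^sup>+x. g x \<partial>lborel) * indicator {0..1} (s::real) \<partial>lborel)"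
    by (simp add: nn_integral_multc nn_integral_lborel_shift)
  also have "... = (\<integral>\<^sup>+x. g x \<partial>lborel)"
    by (simp add: nn_integral_cmult)
  finally show ?thesis unfolding g_def by (simp add: add_left_mono)
qed

text \<open>The segment inequality is integrated over all pairs in Q and the order of integration
  exchanged. For fixed t the point x + t (y - x) is an affine image of y and also of x; substituting
  for the one with the larger weight costs at most 2^n.\<close>

lemma double_difference_le:
  fixes Q :: "'a::euclidean_space set"
  assumes Q: "convex Q" "Q \<in> sets borel" and d: "\<And>x y. x \<in> Q \<Longrightarrow> y \<in> Q \<Longrightarrow> norm (y - x) \<le> d"
    and C1: "C1_with_gradient \<phi> D"
  shows "(\<integral>\<^sup>+x\<in>Q. (\<integral>\<^sup>+y\<in>Q. ennreal ((\<phi> y - \<phi> x)\<^sup>2) \<partial>lborel) \<partial>lborel)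
    \<le> ennreal (d\<^sup>2) * (2 ^ DIM('a) * emeasure lborel Q * dirichlet_int Q D)"
proof -
  define g where "g x = ennreal ((norm (D x))\<^sup>2) * indicator Q x" for x
  note [measurable] = Q(2)
  have [measurable]: "g \<in> borel_measurable borel" "\<phi> \<in> borel_measurable borel"
    unfolding g_def using C1_energy_measurable[OF C1] C1_measurable[OF C1] by measurable
  let ?E = "\<integral>\<^sup>+x. g x \<partial>lborel"
  let ?F = "\<lambda>x y t. g (x + t *\<^sub>R (y - x)) * (indicator Q x * indicator Q y * indicator {0<..<1::real} t)"
  have "(\<integral>\<^sup>+x\<in>Q. (\<integral>\<^sup>+y\<in>Q. ennreal ((\<phi> y - \<phi> x)\<^sup>2) \<partial>lborel) \<partial>lborel)
     \<le> (\<integral>\<^sup>+x. (\<integral>\<^sup>+y. ennreal (d\<^sup>2) * (\<integral>\<^sup>+t. ?F x y t \<partial>lborel) \<partial>lborel) \<partial>lborel)"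
  proof (rule nn_integral_mono)
    fix x
    have "(\<integral>\<^sup>+y\<in>Q. ennreal ((\<phi> y - \<phi> x)\<^sup>2) \<partial>lborel) * indicator Q x
      = (\<integral>\<^sup>+y. ennreal ((\<phi> y - \<phi> x)\<^sup>2) * indicator Q y * indicator Q x \<partial>lborel)"
      by (rule nn_integral_multc[symmetric]) measurable
    also have "... \<le> (\<integral>\<^sup>+y. ennreal (d\<^sup>2) * (\<integral>\<^sup>+t. ?F x y t \<partial>lborel) \<partial>lborel)"
    proof (rule nn_integral_mono)
    fix y
    show "ennreal ((\<phi> y - \<phi> x)\<^sup>2) * indicator Q y * indicator Q x \<le> ennreal (d\<^sup>2) * (\<integral>\<^sup>+t. ?F x y t \<partial>lborel)"
    proof (cases "x \<in> Q \<and> y \<in> Q")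
      case True
      have "ennreal ((\<phi> (x + 1 *\<^sub>R (y - x)) - \<phi> x)\<^sup>2) \<le> ennreal (1 * (norm (y - x))\<^sup>2) *
        (\<integral>\<^sup>+t\<in>{0<..<1}. ennreal ((norm (D (x + t *\<^sub>R (y - x))))\<^sup>2) \<partial>lborel)"
        by (rule C1_segment_inequality[OF C1]) simp
      also have "... \<le> ennreal (d\<^sup>2) * (\<integral>\<^sup>+t. ?F x y t \<partial>lborel)"
      proof (rule mult_mono, goal_cases)
        case 1
        show ?case using d[of x y] True by (intro ennreal_leI) (simp add: power_mono)
      next
        case 2
        show ?case
        proof (rule nn_integral_mono)
        fix t :: real
        have "x + t *\<^sub>R (y - x) \<in> Q" if "t \<in> {0<..<1}"
        proof -
          have "(1 - t) *\<^sub>R x + t *\<^sub>R y \<in> Q" using True that by (intro convexD[OF Q(1)]) auto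
          then show ?thesis by (simp add: algebra_simps)
        qed
        then show "ennreal ((norm (D (x + t *\<^sub>R (y - x))))\<^sup>2) * indicator {0<..<1} t \<le> ?F x y t"
          using True unfolding g_def by (auto simp: indicator_def)
        qed
      qed auto
      finally show ?thesis using True by simp
    qed auto
    qed
    finally show "(\<integral>\<^sup>+y\<in>Q. ennreal ((\<phi> y - \<phi> x)\<^sup>2) \<partial>lborel) * indicator Q x
      \<le> (\<integral>\<^sup>+y. ennreal (d\<^sup>2) * (\<integral>\<^sup>+t. ?F x y t \<partial>lborel) \<partial>lborel)" .
  qed
  also have "... = ennreal (d\<^sup>2) * (\<integral>\<^sup>+x. (\<integral>\<^sup>+y. (\<integral>\<^sup>+t. ?F x y t \<partial>lborel) \<partial>lborel) \<partial>lborel)"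
    by (simp add: nn_integral_cmult)
  also have "(\<integral>\<^sup>+x. (\<integral>\<^sup>+y. (\<integral>\<^sup>+t. ?F x y t \<partial>lborel) \<partial>lborel) \<partial>lborel)
      = (\<integral>\<^sup>+x. (\<integral>\<^sup>+t. (\<integral>\<^sup>+y. ?F x y t \<partial>lborel) \<partial>lborel) \<partial>lborel)"
    by (intro nn_integral_cong lborel_pair.Fubini') measurable
  also have "... = (\<integral>\<^sup>+t. (\<integral>\<^sup>+x. (\<integral>\<^sup>+y. ?F x y t \<partial>lborel) \<partial>lborel) \<partial>lborel)"
    by (intro lborel_pair.Fubini') measurable
  also have "... \<le> (\<integral>\<^sup>+t. 2 ^ DIM('a) * emeasure lborel Q * ?E * indicator {0<..<1::real} t \<partial>lborel)"
  proof (rule nn_integral_mono)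
    fix t :: real
    let ?J = "\<integral>\<^sup>+x. (\<integral>\<^sup>+y. ?F x y t \<partial>lborel) \<partial>lborel"
    show "?J \<le> 2 ^ DIM('a) * emeasure lborel Q * ?E * indicator {0<..<1} t"
    proof (cases "t \<in> {0<..<1}")
      case True
      have int: "(\<integral>\<^sup>+x. 2 ^ DIM('a) * ?E * indicator Q x \<partial>lborel) = 2 ^ DIM('a) * emeasure lborel Q * ?E"
        by (subst nn_integral_cmult_indicator) (auto simp: ac_simps)
      show ?thesis
      \<comment> \<open>For t at least 1/2 the substitution is made in y, otherwise in x, whose
        weight is 1 - t.\<close>
      proof (cases "1 / 2 \<le> t")
        case t: True
        have "(\<integral>\<^sup>+y. ?F x y t \<partial>lborel) \<le> 2 ^ DIM('a) * ?E * indicator Q x" for x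
        proof -
          have "(\<integral>\<^sup>+y. ?F x y t \<partial>lborel) \<le> (\<integral>\<^sup>+y. g ((x - t *\<^sub>R x) + t *\<^sub>R y) * indicator Q x \<partial>lborel)"
            by (intro nn_integral_mono) (auto simp: indicator_def algebra_simps)
          also have "... \<le> 2 ^ DIM('a) * ?E * indicator Q x"
            by (subst nn_integral_multc) (auto intro!: mult_right_mono nn_integral_lborel_affine_le t)
          finally show ?thesis .
        qed
        then have "?J \<le> (\<integral>\<^sup>+x. 2 ^ DIM('a) * ?E * indicator Q x \<partial>lborel)" by (intro nn_integral_mono)
        then show ?thesis using True int by simp
      next
        case False
        have "(\<integral>\<^sup>+x. ?F x y t \<partial>lborel) \<le> 2 ^ DIM('a) * ?E * indicator Q y" for y
        proof -
          have "(\<integral>\<^sup>+x. ?F x y t \<partial>lborel) \<le> (\<integral>\<^sup>+x. g (t *\<^sub>R y + (1 - t) *\<^sub>R x) * indicator Q y \<partial>lborel)"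
            by (intro nn_integral_mono) (auto simp: indicator_def algebra_simps)
          also have "... \<le> 2 ^ DIM('a) * ?E * indicator Q y"
            using False by (subst nn_integral_multc) (auto intro!: mult_right_mono nn_integral_lborel_affine_le)
          finally show ?thesis .
        qed
        then have "(\<integral>\<^sup>+y. (\<integral>\<^sup>+x. ?F x y t \<partial>lborel) \<partial>lborel) \<le> (\<integral>\<^sup>+x. 2 ^ DIM('a) * ?E * indicator Q x \<partial>lborel)"
          by (intro nn_integral_mono)
        moreover have "?J = (\<integral>\<^sup>+y. (\<integral>\<^sup>+x. ?F x y t \<partial>lborel) \<partial>lborel)"
          by (intro lborel_pair.Fubini') measurable
        ultimately show ?thesis using True int by simp
      qed
    qed simp
  qed
  also have "... = 2 ^ DIM('a) * emeasure lborel Q * ?E"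
    by (simp add: nn_integral_cmult)
  finally show ?thesis unfolding g_def by (simp add: mult_left_mono)
qed

subsection \<open>Weak gradients\<close>

lemma borel_measurable_lebesgue_on:
  "f \<in> borel_measurable borel \<Longrightarrow> f \<in> borel_measurable (lebesgue_on \<Omega>)"
  by (intro measurable_restrict_space1 measurable_completion) simp

lemma nn_integral_lebesgue_on:
  "\<Omega> \<in> sets borel \<Longrightarrow> (\<integral>\<^sup>+x. f x \<partial>lebesgue_on \<Omega>) = (\<integral>\<^sup>+x\<in>\<Omega>. f x \<partial>lborel)"
  by (subst nn_integral_restrict_space) (auto simp: nn_integral_completion)

lemma integral_lebesgue_on_lborel:
  fixes f :: "'a::euclidean_space \<Rightarrow> 'b::euclidean_space"
  assumes "\<Omega> \<in> sets borel" "f \<in> borel_measurable borel"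
  shows "(\<integral>x. f x \<partial>lebesgue_on \<Omega>) = (\<integral>x. indicator \<Omega> x *\<^sub>R f x \<partial>lborel)"
  using assms by (subst integral_restrict_space) (auto simp: integral_completion)

lemma finite_measure_lebesgue_on:
  fixes \<Omega> :: "'a::euclidean_space set"
  shows "open \<Omega> \<Longrightarrow> bounded \<Omega> \<Longrightarrow> finite_measure (lebesgue_on \<Omega>)"
  using emeasure_bounded_finite[of \<Omega>]
  by (intro finite_measureI) (auto simp: emeasure_restrict_space space_restrict_space)

lemma continuous_integrable_lebesgue_on:
  fixes f :: "'a::euclidean_space \<Rightarrow> 'b::euclidean_space"
  assumes \<Omega>: "open \<Omega>" "bounded \<Omega>" and f: "continuous_on UNIV f"
  shows "integrable (lebesgue_on \<Omega>) f"
proof -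
  interpret finite_measure "lebesgue_on \<Omega>" by (rule finite_measure_lebesgue_on[OF \<Omega>])
  have "compact (closure \<Omega>)" using \<Omega> by simp
  then obtain B where B: "\<And>y. y \<in> closure \<Omega> \<Longrightarrow> norm (f y) \<le> B"
    using continuous_compact_bound[of "closure \<Omega>" "\<lambda>y. norm (f y)"] continuous_on_norm[OF f] by blast
  show ?thesis
  proof (rule integrable_const_bound[where B = B])
    show "AE x in lebesgue_on \<Omega>. norm (f x) \<le> B"
      using B closure_subset by (intro AE_I2) (auto simp: space_restrict_space)
    show "f \<in> borel_measurable (lebesgue_on \<Omega>)"
      using f by (intro borel_measurable_lebesgue_on borel_measurable_continuous_onI)
  qed
qed

lemma continuous_square_integrable:
  fixes f :: "'a::euclidean_space \<Rightarrow> 'b::euclidean_space"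
  assumes \<Omega>: "open \<Omega>" "bounded \<Omega>" and f: "continuous_on UNIV f"
  shows "square_integrable (lebesgue_on \<Omega>) f"
  unfolding square_integrable_def
  using f by (intro conjI borel_measurable_lebesgue_on borel_measurable_continuous_onI
      continuous_integrable_lebesgue_on[OF \<Omega>] continuous_intros)

section \<open>Integration by parts against test functions\<close>

lemma gradient_zero_on_open:
  assumes "open S" "x \<in> S" "\<And>y. y \<in> S \<Longrightarrow> F y = 0" "GDERIV F x :> D"
  shows "D = 0"
proof -
  have "((\<lambda>_. 0) has_derivative (\<lambda>h. h \<bullet> D)) (at x)"
    using assms(4) unfolding gderiv_def
    by (rule has_derivative_transform_within_open[OF _ assms(1,2)]) (use assms(3) in auto)
  from has_derivative_unique[OF this has_derivative_const] have "D \<bullet> D = 0" by metis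
  then show ?thesis by simp
qed

lemma C1_gradient_zero_off:
  assumes "C1_with_gradient F D" "closed K" "\<And>x. x \<notin> K \<Longrightarrow> F x = 0" "x \<notin> K"
  shows "D x = 0"
  using assms by (intro gradient_zero_on_open[of "- K" x F]) (auto simp: C1_with_gradient_def)

lemma integral_lborel_shift:
  fixes f :: "'a::euclidean_space \<Rightarrow> real"
  assumes "integrable lborel f"
  shows "integrable lborel (\<lambda>x. f (x + c))" "(\<integral>x. f (x + c) \<partial>lborel) = (\<integral>x. f x \<partial>lborel)"
proof -
  have [measurable]: "f \<in> borel_measurable borel" using assms by auto
  have "integrable (distr lborel borel ((+) c)) f" using assms by (simp add: lborel_distr_plus)
  then show "integrable lborel (\<lambda>x. f (x + c))"
    by (subst (asm) integrable_distr_eq) (auto simp: add.commute)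
  have "(\<integral>x. f x \<partial>lborel) = (\<integral>x. f x \<partial>distr lborel borel ((+) c))" by (simp add: lborel_distr_plus)
  then show "(\<integral>x. f (x + c) \<partial>lborel) = (\<integral>x. f x \<partial>lborel)"
    by (subst (asm) integral_distr) (auto simp: add.commute)
qed

lemma continuous_compact_support_integrable:
  fixes f :: "'a::euclidean_space \<Rightarrow> 'b::euclidean_space"
  assumes "continuous_on UNIV f" "compact K" "\<And>x. x \<notin> K \<Longrightarrow> f x = 0"
  shows "integrable lborel f"
proof -
  have "integrable lborel (\<lambda>x. indicator K x *\<^sub>R f x)"
    by (intro borel_integrable_compact assms(2) continuous_on_subset[OF assms(1)]) auto
  also have "(\<lambda>x. indicator K x *\<^sub>R f x) = f" using assms(3) by (auto simp: indicator_def fun_eq_iff)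
  finally show ?thesis .
qed

text \<open>By translation invariance all difference quotients of F have integral 0. They are
  bounded by the Lipschitz constant and supported in one fixed ball, so dominated convergence passes
  this on to the partial derivatives.\<close>

lemma integral_gradient_zero:
  fixes F :: "'a::euclidean_space \<Rightarrow> real"
  assumes C1: "C1_with_gradient F D" and K: "compact K" "\<And>x. x \<notin> K \<Longrightarrow> F x = 0"
  shows "(\<integral>x. D x \<partial>lborel) = 0"
proof -
  have D0: "D x = 0" if "x \<notin> K" for x
    using C1_gradient_zero_off[OF C1 compact_imp_closed[OF K(1)] K(2) that] .
  have intD: "integrable lborel D"
    by (rule continuous_compact_support_integrable[OF C1_gradient_continuous[OF C1] K(1) D0])
  have intF: "integrable lborel F"
    by (rule continuous_compact_support_integrable[OF C1_continuous[OF C1] K])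
  obtain M0 where M0: "\<And>y. y \<in> K \<Longrightarrow> norm (D y) \<le> M0"
    using continuous_compact_bound[OF K(1) continuous_on_norm[OF C1_gradient_continuous[OF C1]]] by blast
  define M where "M = max M0 0"
  have M: "norm (D y) \<le> M" for y using M0[of y] D0[of y] by (cases "y \<in> K") (auto simp: M_def)
  have lip: "norm (F x - F y) \<le> M * norm (x - y)" for x y
  proof (rule differentiable_bound[of UNIV F "\<lambda>x h. h \<bullet> D x"])
    fix x
    show "(F has_derivative (\<lambda>h. h \<bullet> D x)) (at x within UNIV)"
      using C1 by (simp add: C1_with_gradient_def gderiv_def)
    show "onorm (\<lambda>h. h \<bullet> D x) \<le> M"
    proof (rule onorm_le)
      fix h
      have "norm (h \<bullet> D x) \<le> norm h * norm (D x)" by (simp add: Cauchy_Schwarz_ineq2)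
      also have "... \<le> M * norm h" using mult_left_mono[OF M[of x] norm_ge_zero[of h]] by (simp add: mult.commute)
      finally show "norm (h \<bullet> D x) \<le> M * norm h" .
    qed
  qed auto
  obtain R where R: "\<And>x. x \<in> K \<Longrightarrow> norm x \<le> R"
    using compact_imp_bounded[OF K(1)] by (auto simp: bounded_iff)
  have "(\<integral>x. D x \<partial>lborel) \<bullet> b = 0 \<bullet> b" if b: "b \<in> Basis" for b
  proof -
    let ?h = "\<lambda>k. 1 / real (Suc k)"
    define s where "s k x = (F (x + ?h k *\<^sub>R b) - F x) / ?h k" for k x
    have hlim: "?h \<longlonglongrightarrow> 0" by (rule LIMSEQ_Suc[OF lim_inverse_n'])
    have "(\<lambda>k. \<integral>x. s k x \<partial>lborel) \<longlonglongrightarrow> (\<integral>x. D x \<bullet> b \<partial>lborel)"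
    proof (rule integral_dominated_convergence)
      have [measurable]: "F \<in> borel_measurable borel" using intF by auto
      show "s k \<in> borel_measurable lborel" for k unfolding s_def by measurable
      show "(\<lambda>x. D x \<bullet> b) \<in> borel_measurable lborel" using intD by auto
      \<comment> \<open>Steps have length at most 1, so the quotients vanish outside the ball of
        radius R + 1.\<close>
      show "integrable lborel (\<lambda>x::'a. M * indicator (cball 0 (R + 1)) x :: real)"
        using emeasure_bounded_finite[OF bounded_cball[of "0::'a" "R + 1"]]
        by (intro integrable_mult_right integrable_real_indicator) auto
      show "AE x in lborel. (\<lambda>k. s k x) \<longlonglongrightarrow> D x \<bullet> b"
      proof (rule AE_I2)
        fix x
        have 1: "(F has_derivative (\<lambda>h. h \<bullet> D x)) (at (x + 0 *\<^sub>R b))"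
          using C1 by (auto simp: C1_with_gradient_def gderiv_def)
        have 2: "((\<lambda>t. x + t *\<^sub>R b) has_derivative (\<lambda>h. h *\<^sub>R b)) (at 0)"
          by (auto intro!: derivative_eq_intros)
        have "((\<lambda>t. F (x + t *\<^sub>R b)) has_field_derivative (D x \<bullet> b)) (at 0)"
        proof -
          have "(\<lambda>h. (h *\<^sub>R b) \<bullet> D x) = (*) (D x \<bullet> b)"
            by (rule ext) (simp add: inner_commute[of b "D x"])
          then show ?thesis
            using has_derivative_compose[OF 2 1] unfolding has_field_derivative_def by metis
        qed
        then have "(\<lambda>t. (F (x + t *\<^sub>R b) - F x) / t) \<midarrow>0\<rightarrow> D x \<bullet> b"
          by (simp add: DERIV_def)
        then show "(\<lambda>k. s k x) \<longlonglongrightarrow> D x \<bullet> b"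
          unfolding s_def by (rule filterlim_compose) (use hlim in \<open>auto intro!: filterlim_atI\<close>)
      qed
      show "AE x in lborel. norm (s k x) \<le> M * indicator (cball 0 (R + 1)) x" for k
      proof (rule AE_I2)
        fix x
        show "norm (s k x) \<le> M * indicator (cball 0 (R + 1)) x"
        proof (cases "x \<in> cball 0 (R + 1)")
          case True
          have hp: "0 < ?h k" by simp
          have le: "norm (F (x + ?h k *\<^sub>R b) - F x) \<le> M * ?h k"
          proof -
            have "norm (?h k *\<^sub>R b) = ?h k" using b hp by (simp only: norm_scaleR norm_Basis abs_of_pos mult_1_right)
            then show ?thesis using lip[of "x + ?h k *\<^sub>R b" x] by (simp only: add_diff_cancel_left')
          qed
          have "norm (s k x) = norm (F (x + ?h k *\<^sub>R b) - F x) / ?h k"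
            unfolding s_def using hp by (simp only: real_norm_def abs_divide abs_of_pos)
          also have "... \<le> M" using le hp by (simp only: pos_divide_le_eq)
          finally show ?thesis using True by simp
        next
          case False
          have h1: "norm (?h k *\<^sub>R b) \<le> 1" using b by simp
          have "R + 1 < norm x" using False by simp
          moreover have "norm x \<le> norm (x + ?h k *\<^sub>R b) + norm (?h k *\<^sub>R b)"
            using norm_triangle_ineq4[of "x + ?h k *\<^sub>R b" "?h k *\<^sub>R b"] by simp
          ultimately have "x \<notin> K" "x + ?h k *\<^sub>R b \<notin> K" using h1 R[of x] R[of "x + ?h k *\<^sub>R b"] by linarith+
          then show ?thesis using K(2) False by (simp add: s_def)
        qed
      qed
    qed
    moreover have "(\<integral>x. s k x \<partial>lborel) = 0" for k
      unfolding s_def using integral_lborel_shift[OF intF, of "?h k *\<^sub>R b"] intF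
      by (simp del: of_nat_Suc)
    ultimately have "(\<integral>x. D x \<bullet> b \<partial>lborel) = 0" by (simp add: LIMSEQ_const_iff)
    then show ?thesis using integral_inner_left[OF intD, of b] by simp
  qed
  then show ?thesis by (rule euclidean_eqI)
qed

lemma C1_mult:
  assumes "C1_with_gradient \<phi> D" "C1_with_gradient \<psi> E"
  shows "C1_with_gradient (\<lambda>x. \<phi> x * \<psi> x) (\<lambda>x. \<phi> x *\<^sub>R E x + \<psi> x *\<^sub>R D x)"
  using assms C1_continuous[OF assms(1)] C1_continuous[OF assms(2)]
  unfolding C1_with_gradient_def by (auto intro!: GDERIV_mult continuous_intros)

lemma C1_add:
  assumes "C1_with_gradient \<phi> D" "C1_with_gradient \<psi> E"
  shows "C1_with_gradient (\<lambda>x. \<phi> x + \<psi> x) (\<lambda>x. D x + E x)"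
  using assms unfolding C1_with_gradient_def by (auto intro!: GDERIV_add continuous_intros)

lemma C1_const: "C1_with_gradient (\<lambda>x. c) (\<lambda>x. 0)"
  unfolding C1_with_gradient_def by (auto intro!: GDERIV_const continuous_intros)

lemma C1_scale:
  assumes "C1_with_gradient \<phi> D"
  shows "C1_with_gradient (\<lambda>x. c * \<phi> x) (\<lambda>x. c *\<^sub>R D x)"
  using C1_mult[OF C1_const[of c] assms] by simp

lemma C1_diff:
  assumes "C1_with_gradient \<phi> D" "C1_with_gradient \<psi> E"
  shows "C1_with_gradient (\<lambda>x. \<phi> x - \<psi> x) (\<lambda>x. D x - E x)"
  using C1_add[OF assms(1) C1_scale[OF assms(2), of "-1"]] by simp

lemma C1_compose:
  assumes "C1_with_gradient \<phi> D" "\<And>t. (q has_real_derivative q' t) (at t)" "continuous_on UNIV q'"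
  shows "C1_with_gradient (\<lambda>x. q (\<phi> x)) (\<lambda>x. q' (\<phi> x) *\<^sub>R D x)"
  unfolding C1_with_gradient_def
proof (intro conjI allI)
  show "GDERIV (\<lambda>x. q (\<phi> x)) x :> q' (\<phi> x) *\<^sub>R D x" for x
    using assms(1,2) by (intro GDERIV_DERIV_compose) (auto simp: C1_with_gradient_def)
  show "continuous_on UNIV (\<lambda>x. q' (\<phi> x) *\<^sub>R D x)"
    using C1_continuous[OF assms(1)] C1_gradient_continuous[OF assms(1)]
    by (intro continuous_intros continuous_on_compose2[OF assms(3)]) auto
qed

lemma test_functionI:
  "C1_with_gradient \<psi> E \<Longrightarrow> compact K \<Longrightarrow> K \<subseteq> \<Omega> \<Longrightarrow> (\<And>x. x \<notin> K \<Longrightarrow> \<psi> x = 0) \<Longrightarrow> test_function \<Omega> \<psi> E"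
  unfolding test_function_def by blast

text \<open>The product of \<phi> and \<psi> is C^1 with compact support inside \<Omega>, so its
  gradient integrates to 0 over the whole space.\<close>

lemma test_function_integration_by_parts:
  assumes \<Omega>: "open \<Omega>" and \<phi>: "C1_with_gradient \<phi> D" and \<psi>: "test_function \<Omega> \<psi> E"
  shows "(\<integral>x. \<phi> x *\<^sub>R E x \<partial>lebesgue_on \<Omega>) = - (\<integral>x. \<psi> x *\<^sub>R D x \<partial>lebesgue_on \<Omega>)"
proof -
  obtain K where K: "compact K" "K \<subseteq> \<Omega>" "\<And>x. x \<notin> K \<Longrightarrow> \<psi> x = 0" and C\<psi>: "C1_with_gradient \<psi> E"
    using \<psi> by (auto simp: test_function_def)
  have E0: "E x = 0" if "x \<notin> K" for x
    using C1_gradient_zero_off[OF C\<psi> compact_imp_closed[OF K(1)] K(3) that] .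
  have c1: "continuous_on UNIV (\<lambda>x. \<phi> x *\<^sub>R E x)" and c2: "continuous_on UNIV (\<lambda>x. \<psi> x *\<^sub>R D x)"
    using C1_continuous[OF \<phi>] C1_continuous[OF C\<psi>] C1_gradient_continuous[OF \<phi>] C1_gradient_continuous[OF C\<psi>]
    by (auto intro!: continuous_intros)
  have i1: "integrable lborel (\<lambda>x. \<phi> x *\<^sub>R E x)" and i2: "integrable lborel (\<lambda>x. \<psi> x *\<^sub>R D x)"
    using continuous_compact_support_integrable[OF c1 K(1)] continuous_compact_support_integrable[OF c2 K(1)] E0 K(3) by auto
  have "(\<integral>x. \<phi> x *\<^sub>R E x + \<psi> x *\<^sub>R D x \<partial>lborel) = 0"
    using K(3) by (intro integral_gradient_zero[OF C1_mult[OF \<phi> C\<psi>] K(1)]) auto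
  then have "(\<integral>x. \<phi> x *\<^sub>R E x \<partial>lborel) + (\<integral>x. \<psi> x *\<^sub>R D x \<partial>lborel) = 0"
    using i1 i2 by simp
  moreover have "(\<integral>x. \<phi> x *\<^sub>R E x \<partial>lebesgue_on \<Omega>) = (\<integral>x. \<phi> x *\<^sub>R E x \<partial>lborel)"
  proof -
    have "(\<lambda>x. indicator \<Omega> x *\<^sub>R (\<phi> x *\<^sub>R E x)) = (\<lambda>x. \<phi> x *\<^sub>R E x)"
      using E0 K(2) by (auto simp: fun_eq_iff indicator_def)
    then show ?thesis
      using \<Omega> borel_measurable_continuous_onI[OF c1] by (simp add: integral_lebesgue_on_lborel)
  qed
  moreover have "(\<integral>x. \<psi> x *\<^sub>R D x \<partial>lebesgue_on \<Omega>) = (\<integral>x. \<psi> x *\<^sub>R D x \<partial>lborel)"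
  proof -
    have "(\<lambda>x. indicator \<Omega> x *\<^sub>R (\<psi> x *\<^sub>R D x)) = (\<lambda>x. \<psi> x *\<^sub>R D x)"
      using K(2,3) by (auto simp: fun_eq_iff indicator_def)
    then show ?thesis
      using \<Omega> borel_measurable_continuous_onI[OF c2] by (simp add: integral_lebesgue_on_lborel)
  qed
  ultimately show ?thesis by (simp add: eq_neg_iff_add_eq_0)
qed

lemma C1_H1:
  assumes \<Omega>: "open \<Omega>" "bounded \<Omega>" and \<phi>: "C1_with_gradient \<phi> D"
  shows "H1_with_gradient \<Omega> \<phi> D"
  unfolding H1_with_gradient_def
  by (intro conjI allI impI continuous_square_integrable[OF \<Omega>] C1_continuous[OF \<phi>] C1_gradient_continuous[OF \<phi>]
      test_function_integration_by_parts[OF \<Omega>(1) \<phi>])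

section \<open>C^1 cutoffs and the fundamental lemma of the calculus of variations\<close>

lemma has_real_derivative_pos_part_square:
  "((\<lambda>t::real. (max 0 t)\<^sup>2) has_real_derivative 2 * max 0 t) (at t)"
proof -
  consider "0 < t" | "t < 0" | "t = 0" by linarith
  then show ?thesis
  proof cases
    case 1
    have "((\<lambda>t::real. t\<^sup>2) has_real_derivative 2 * max 0 t) (at t)"
      using 1 by (auto intro!: derivative_eq_intros)
    then show ?thesis
      by (rule DERIV_cong_ev[THEN iffD1, rotated -1])
        (use 1 in \<open>auto intro!: eventually_mono[OF eventually_nhds_in_open[of "{0<..}" t]]\<close>)
  next
    case 2
    have "((\<lambda>t::real. 0) has_real_derivative 2 * max 0 t) (at t)"
      using 2 by (auto intro!: derivative_eq_intros)
    then show ?thesis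
      by (rule DERIV_cong_ev[THEN iffD1, rotated -1])
        (use 2 in \<open>auto intro!: eventually_mono[OF eventually_nhds_in_open[of "{..<0}" t]]\<close>)
  next
    case 3
    have "((\<lambda>h::real. max 0 h) \<longlongrightarrow> max 0 0) (at 0)" by (intro tendsto_intros)
    moreover have "\<forall>\<^sub>F h::real in at 0. max 0 h = (max 0 (0 + h))\<^sup>2 / h"
      by (auto simp: eventually_at_filter max_def power2_eq_square)
    ultimately have "((\<lambda>h::real. (max 0 (0 + h))\<^sup>2 / h) \<longlongrightarrow> 0) (at 0)"
      using tendsto_cong[of "\<lambda>h::real. max 0 h" "\<lambda>h. (max 0 (0 + h))\<^sup>2 / h" "at 0" 0] by simp
    then show ?thesis using 3 by (simp add: DERIV_def)
  qed
qed

text \<open>A bump positive exactly on the open ball. The squared norm is smooth at the centre and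
  the outer square makes the function C^1 across the sphere. It serves for approximating indicators
  and again as test field for the upper bound.\<close>

definition pos_ball :: "'a::euclidean_space \<Rightarrow> real \<Rightarrow> 'a \<Rightarrow> real" where
  "pos_ball c r x = (max 0 (r\<^sup>2 - (norm (x - c))\<^sup>2))\<^sup>2"

definition pos_ball_gradient :: "'a::euclidean_space \<Rightarrow> real \<Rightarrow> 'a \<Rightarrow> 'a" where
  "pos_ball_gradient c r x = (- 4 * max 0 (r\<^sup>2 - (norm (x - c))\<^sup>2)) *\<^sub>R (x - c)"

lemma C1_pos_ball: "C1_with_gradient (pos_ball c r) (pos_ball_gradient c r)"
proof -
  have "C1_with_gradient (\<lambda>x. r\<^sup>2 - (norm (x - c))\<^sup>2) (\<lambda>x. - 2 *\<^sub>R (x - c))"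
    unfolding C1_with_gradient_def gderiv_def power2_norm_eq_inner
    by (auto intro!: derivative_eq_intros continuous_intros simp: inner_commute algebra_simps)
  moreover have "continuous_on UNIV (\<lambda>t::real. 2 * max 0 t)" by (intro continuous_intros)
  ultimately have "C1_with_gradient (\<lambda>x. (max 0 (r\<^sup>2 - (norm (x - c))\<^sup>2))\<^sup>2)
      (\<lambda>x. (2 * max 0 (r\<^sup>2 - (norm (x - c))\<^sup>2)) *\<^sub>R (- 2 *\<^sub>R (x - c)))"
    by (intro C1_compose[OF _ has_real_derivative_pos_part_square])
  then show ?thesis unfolding pos_ball_def pos_ball_gradient_def by simp
qed

lemma pos_ball_pos_iff: "0 \<le> r \<Longrightarrow> 0 < pos_ball c r x \<longleftrightarrow> x \<in> ball c r"
proof -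
  assume r: "0 \<le> r"
  have "0 < pos_ball c r x \<longleftrightarrow> (norm (x - c))\<^sup>2 < r\<^sup>2" by (auto simp: pos_ball_def max_def)
  also have "... \<longleftrightarrow> norm (x - c) < r" using r by (metis norm_ge_zero power2_less_imp_less power_strict_mono zero_less_numeral)
  finally show ?thesis by (simp add: dist_norm norm_minus_commute)
qed

lemma pos_ball_nonneg: "0 \<le> pos_ball c r x" by (simp add: pos_ball_def)

text \<open>Bounded pointwise limits are exactly what dominated convergence needs to turn
  orthogonality to all test functions into a vanishing integral over U.\<close>

definition approximable :: "'a::euclidean_space set \<Rightarrow> 'a set \<Rightarrow> bool" where
  "approximable \<Omega> U \<longleftrightarrow> (\<exists>\<psi> E. (\<forall>m::nat. test_function \<Omega> (\<psi> m) (E m) \<and> (\<forall>x. 0 \<le> \<psi> m x \<and> \<psi> m x \<le> 1))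
     \<and> (\<forall>x. (\<lambda>m. \<psi> m x) \<longlonglongrightarrow> indicator U x))"

text \<open>With p the bump of the ball, 1 - 1 / (1 + m p) is 0 where p = 0 and tends to 1 where p >
  0. Its support lies in the closed ball, which must therefore be inside \<Omega>.\<close>

lemma approximable_ball:
  assumes r: "0 < r" "cball c r \<subseteq> \<Omega>"
  shows "approximable \<Omega> (ball c r)"
proof -
  let ?p = "pos_ball c r"
  have "\<exists>E. test_function \<Omega> (\<lambda>x. 1 - inverse (1 + real m * ?p x)) E" for m :: nat
  proof -
    have d: "1 + real m * ?p x \<noteq> 0" for x
      using pos_ball_nonneg[of c r x] by (metis add_pos_nonneg less_irrefl mult_nonneg_nonneg of_nat_0_le_iff zero_less_one)
    have "C1_with_gradient (\<lambda>x. 1 + real m * ?p x) (\<lambda>x. 0 + real m *\<^sub>R pos_ball_gradient c r x)"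
      by (intro C1_add C1_const C1_scale C1_pos_ball)
    then have "C1_with_gradient (\<lambda>x. inverse (1 + real m * ?p x))
        (\<lambda>x. - (inverse (1 + real m * ?p x))\<^sup>2 *\<^sub>R (0 + real m *\<^sub>R pos_ball_gradient c r x))"
      unfolding C1_with_gradient_def
    proof (intro conjI allI GDERIV_inverse d)
      show "continuous_on UNIV (\<lambda>x. - (inverse (1 + real m * ?p x))\<^sup>2 *\<^sub>R (0 + real m *\<^sub>R pos_ball_gradient c r x))"
        using d by (intro continuous_intros C1_continuous[OF C1_pos_ball] C1_gradient_continuous[OF C1_pos_ball]) auto
    qed auto
    note C = C1_diff[OF C1_const[of 1] this]
    show ?thesis
    proof (rule exI, rule test_functionI[OF C compact_cball r(2)])
      fix x assume "x \<notin> cball c r"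
      then have "r \<le> norm (x - c)" by (simp add: dist_norm norm_minus_commute)
      then have "r\<^sup>2 \<le> (norm (x - c))\<^sup>2" using r by (intro power_mono) auto
      then show "1 - inverse (1 + real m * ?p x) = 0" by (simp add: pos_ball_def)
    qed
  qed
  then obtain E where E: "\<And>m. test_function \<Omega> (\<lambda>x. 1 - inverse (1 + real m * ?p x)) (E m)" by metis
  have "0 \<le> 1 - inverse (1 + real m * ?p x) \<and> 1 - inverse (1 + real m * ?p x) \<le> 1" for m x
  proof -
    have "1 \<le> 1 + real m * ?p x" using pos_ball_nonneg[of c r x] by simp
    then show ?thesis using inverse_le_1_iff[of "1 + real m * ?p x"] by (auto intro!: inverse_nonnegative_iff_nonnegative[THEN iffD2])
  qed
  moreover have "(\<lambda>m. 1 - inverse (1 + real m * ?p x)) \<longlonglongrightarrow> indicator (ball c r) x" for x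
  proof (cases "x \<in> ball c r")
    case True
    then have p: "0 < ?p x" using pos_ball_pos_iff[of r c x] r by auto
    have "filterlim (\<lambda>m. 1 + ?p x * real m) at_top sequentially"
      by (rule filterlim_tendsto_add_at_top[OF tendsto_const
          filterlim_tendsto_pos_mult_at_top[OF tendsto_const p filterlim_real_sequentially]])
    then have "filterlim (\<lambda>m. 1 + real m * ?p x) at_top sequentially" by (simp only: mult.commute)
    then have "(\<lambda>m. inverse (1 + real m * ?p x)) \<longlonglongrightarrow> 0"
      by (rule tendsto_inverse_0_at_top)
    then have "(\<lambda>m. 1 - inverse (1 + real m * ?p x)) \<longlonglongrightarrow> 1 - 0" by (intro tendsto_intros)
    then show ?thesis using True by simp
  next
    case False
    then have "?p x = 0" using pos_ball_pos_iff[of r c x] pos_ball_nonneg[of c r x] r by auto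
    then show ?thesis using False by simp
  qed
  ultimately show ?thesis unfolding approximable_def using E
    by (intro exI[of _ "\<lambda>m x. 1 - inverse (1 + real m * ?p x)"] exI[of _ E]) auto
qed

text \<open>The combination is 1 - (1 - \<psi>) (1 - \<theta>), which stays in the unit
  interval.\<close>

lemma approximable_Un:
  assumes "approximable \<Omega> U" "approximable \<Omega> V"
  shows "approximable \<Omega> (U \<union> V)"
proof -
  obtain \<psi> E where p: "\<And>m::nat. test_function \<Omega> (\<psi> m) (E m)" "\<And>m x. 0 \<le> \<psi> m x \<and> \<psi> m x \<le> 1"
    "\<And>x. (\<lambda>m. \<psi> m x) \<longlonglongrightarrow> indicator U x" using assms(1) unfolding approximable_def by metis
  obtain \<theta> F where c: "\<And>m::nat. test_function \<Omega> (\<theta> m) (F m)" "\<And>m x. 0 \<le> \<theta> m x \<and> \<theta> m x \<le> 1"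
    "\<And>x. (\<lambda>m. \<theta> m x) \<longlonglongrightarrow> indicator V x" using assms(2) unfolding approximable_def by metis
  let ?f = "\<lambda>m x. \<psi> m x + \<theta> m x - \<psi> m x * \<theta> m x"
  have "\<exists>G. test_function \<Omega> (?f m) G" for m
  proof -
    obtain K where K: "compact K" "K \<subseteq> \<Omega>" "\<And>x. x \<notin> K \<Longrightarrow> \<psi> m x = 0" using p(1)[of m] by (auto simp: test_function_def)
    obtain K' where K': "compact K'" "K' \<subseteq> \<Omega>" "\<And>x. x \<notin> K' \<Longrightarrow> \<theta> m x = 0" using c(1)[of m] by (auto simp: test_function_def)
    have "C1_with_gradient (\<psi> m) (E m)" "C1_with_gradient (\<theta> m) (F m)" using p(1) c(1) by (auto simp: test_function_def)
    note C = C1_diff[OF C1_add[OF this] C1_mult[OF this]]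
    show ?thesis
      by (rule exI, rule test_functionI[OF C compact_Un[OF K(1) K'(1)]]) (use K K' in auto)
  qed
  then obtain G where "\<And>m. test_function \<Omega> (?f m) (G m)" by metis
  moreover have "0 \<le> ?f m x \<and> ?f m x \<le> 1" for m x
  proof -
    have "0 \<le> \<psi> m x * (1 - \<theta> m x)" "0 \<le> (1 - \<psi> m x) * (1 - \<theta> m x)" using p(2)[of m x] c(2)[of m x] by auto
    then show ?thesis using p(2)[of m x] c(2)[of m x] by (simp add: algebra_simps)
  qed
  moreover have "(\<lambda>m. ?f m x) \<longlonglongrightarrow> indicator (U \<union> V) x" for x
  proof -
    have "(\<lambda>m. ?f m x) \<longlonglongrightarrow> indicator U x + indicator V x - indicator U x * indicator V x"
      by (intro tendsto_intros p(3) c(3))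
    also have "indicator U x + indicator V x - indicator U x * indicator V x = (indicator (U \<union> V) x :: real)"
      by (auto simp: indicator_def)
    finally show ?thesis .
  qed
  ultimately show ?thesis unfolding approximable_def by (intro exI[of _ ?f] exI[of _ G]) auto
qed

lemma approximable_empty: "approximable \<Omega> {}"
  unfolding approximable_def test_function_def
  by (intro exI[of _ "\<lambda>_ _. 0"]) (auto intro: C1_const)

lemma integral_approximable_zero:
  fixes f :: "'a::euclidean_space \<Rightarrow> real"
  assumes f: "integrable (lebesgue_on \<Omega>) f" and U: "approximable \<Omega> U"
    and z: "\<And>\<psi> E. test_function \<Omega> \<psi> E \<Longrightarrow> (\<integral>x. \<psi> x * f x \<partial>lebesgue_on \<Omega>) = 0"
  shows "(\<integral>x. indicator U x * f x \<partial>lebesgue_on \<Omega>) = 0"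
proof -
  obtain \<psi> E where p: "\<And>m::nat. test_function \<Omega> (\<psi> m) (E m)" "\<And>m x. 0 \<le> \<psi> m x \<and> \<psi> m x \<le> 1"
    "\<And>x. (\<lambda>m. \<psi> m x) \<longlonglongrightarrow> indicator U x" using U unfolding approximable_def by metis
  have m: "\<psi> m \<in> borel_measurable borel" for m
    using p(1)[of m] by (auto simp: test_function_def intro: C1_measurable)
  have mU: "(indicator U :: 'a \<Rightarrow> real) \<in> borel_measurable borel"
    by (rule borel_measurable_LIMSEQ_real[OF p(3) m])
  have "(\<lambda>m. \<integral>x. \<psi> m x * f x \<partial>lebesgue_on \<Omega>) \<longlonglongrightarrow> (\<integral>x. indicator U x * f x \<partial>lebesgue_on \<Omega>)"
  proof (rule integral_dominated_convergence[where w = "\<lambda>x. \<bar>f x\<bar>"])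
    show "AE x in lebesgue_on \<Omega>. norm (\<psi> m x * f x) \<le> \<bar>f x\<bar>" for m
      using p(2) by (intro AE_I2) (simp add: abs_mult mult_left_le_one_le)
    show "AE x in lebesgue_on \<Omega>. (\<lambda>m. \<psi> m x * f x) \<longlonglongrightarrow> indicator U x * f x"
      by (intro AE_I2 tendsto_intros p(3))
  qed (use f borel_measurable_lebesgue_on[OF m] borel_measurable_lebesgue_on[OF mU] in auto)
  then show ?thesis using z[OF p(1)] by (simp add: LIMSEQ_const_iff)
qed

text \<open>By Lindelof, U is a countable union of balls whose closures it contains; finite unions
  of them are approximable and increase to U.\<close>

lemma integral_open_zero:
  fixes f :: "'a::euclidean_space \<Rightarrow> real"
  assumes f: "integrable (lebesgue_on \<Omega>) f" and U: "open U" "U \<subseteq> \<Omega>"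
    and z: "\<And>\<psi> E. test_function \<Omega> \<psi> E \<Longrightarrow> (\<integral>x. \<psi> x * f x \<partial>lebesgue_on \<Omega>) = 0"
  shows "(\<integral>x. indicator U x * f x \<partial>lebesgue_on \<Omega>) = 0"
proof -
  define F where "F = {ball x r | x r. 0 < r \<and> cball x r \<subseteq> U}"
  have UF: "U = \<Union>F"
  proof
    show "U \<subseteq> \<Union>F"
    proof
      fix x assume "x \<in> U"
      then obtain r where "0 < r" "cball x r \<subseteq> U" using U(1) open_contains_cball by blast
      then have "ball x r \<in> F" "x \<in> ball x r" by (auto simp: F_def)
      then show "x \<in> \<Union>F" by blast
    qed
    show "\<Union>F \<subseteq> U" using ball_subset_cball by (fastforce simp: F_def)
  qed
  obtain F' where F': "F' \<subseteq> F" "countable F'" "\<Union>F' = \<Union>F"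
    using Lindelof[of F] by (auto simp: F_def)
  define B where "B = from_nat_into (insert {} F')"
  have rB: "range B = insert {} F'" unfolding B_def using F'(2) by (intro range_from_nat_into) auto
  define W where "W N = (\<Union>i<N. B i)" for N :: nat
  have apB: "approximable \<Omega> (B i)" for i
  proof -
    have "B i \<in> insert {} F'" using rB by auto
    then have "B i = {} \<or> B i \<in> F'" by simp
    then show ?thesis
    proof (rule disjE)
      assume "B i \<in> F'"
      then obtain x r where "B i = ball x r" "0 < r" "cball x r \<subseteq> U" using F'(1) by (auto simp: F_def)
      then show ?thesis using U(2) by (auto intro!: approximable_ball)
    qed (simp add: approximable_empty)
  qed
  have apW: "approximable \<Omega> (W N)" for N
  proof (induction N)
    case (Suc N)
    have "W (Suc N) = W N \<union> B N" by (auto simp: W_def less_Suc_eq)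
    then show ?case using approximable_Un[OF Suc apB] by simp
  qed (simp add: W_def approximable_empty)
  have mB: "open (B i)" for i
  proof -
    have "B i \<in> insert {} F'" using rB by auto
    then show ?thesis using F'(1) by (auto simp: F_def)
  qed
  then have mW: "open (W N)" for N unfolding W_def by (intro open_UN) auto
  have UW: "U = (\<Union>N. W N)" 
  proof -
    have "(\<Union>N. W N) = (\<Union>i. B i)" unfolding W_def by auto
    also have "... = \<Union>F'" using rB by auto
    finally show ?thesis using F'(3) UF by simp
  qed
  have "(\<lambda>N. \<integral>x. indicator (W N) x * f x \<partial>lebesgue_on \<Omega>) \<longlonglongrightarrow> (\<integral>x. indicator U x * f x \<partial>lebesgue_on \<Omega>)"
  proof (rule integral_dominated_convergence[where w = "\<lambda>x. \<bar>f x\<bar>"])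
    show "AE x in lebesgue_on \<Omega>. norm (indicator (W N) x * f x) \<le> \<bar>f x\<bar>" for N
      by (intro AE_I2) (simp add: indicator_def)
    show "AE x in lebesgue_on \<Omega>. (\<lambda>N. indicator (W N) x * f x) \<longlonglongrightarrow> indicator U x * f x"
    proof (intro AE_I2 tendsto_intros)
      fix x
      have "incseq W" unfolding W_def by (intro incseq_SucI) (auto simp: less_Suc_eq)
      then show "(\<lambda>N. indicator (W N) x :: real) \<longlonglongrightarrow> indicator U x"
        unfolding UW by (rule LIMSEQ_indicator_incseq)
    qed
    show "(\<lambda>x. indicator (W N) x * f x) \<in> borel_measurable (lebesgue_on \<Omega>)" for N
      using f mW[of N] by (intro borel_measurable_times borel_measurable_lebesgue_on[where f = "indicator (W N)"]) auto
    show "(\<lambda>x. indicator U x * f x) \<in> borel_measurable (lebesgue_on \<Omega>)"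
      using f U(1) by (intro borel_measurable_times borel_measurable_lebesgue_on[where f = "indicator U"]) auto
  qed (use f in auto)
  then show ?thesis using integral_approximable_zero[OF f apW z] by (simp add: LIMSEQ_const_iff)
qed

text \<open>Let S be the set where f > 0 and T an open superset with T - S small. The integral over
  T within \<Omega> vanishes, so the integral over S is minus that over a small set, and
  Cauchy-Schwarz makes it arbitrarily small. A positive function with integral 0 over S forces S to
  be null.\<close>

lemma fundamental_lemma_nonpos:
  fixes f :: "'a::euclidean_space \<Rightarrow> real"
  assumes \<Omega>: "open \<Omega>" "bounded \<Omega>" and f: "square_integrable (lebesgue_on \<Omega>) f"
    and z: "\<And>\<psi> E. test_function \<Omega> \<psi> E \<Longrightarrow> (\<integral>x. \<psi> x * f x \<partial>lebesgue_on \<Omega>) = 0"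
  shows "AE x in lebesgue_on \<Omega>. f x \<le> 0"
proof -
  let ?M = "lebesgue_on \<Omega>"
  interpret finite_measure ?M by (rule finite_measure_lebesgue_on[OF \<Omega>])
  have \<Omega>l: "\<Omega> \<in> sets lebesgue" using \<Omega> by auto
  have one: "square_integrable ?M (\<lambda>x. 1 :: real)" by (simp add: square_integrable_def)
  have ifn: "integrable ?M f" using square_integrable_times[OF one f] by simp
  have [measurable]: "f \<in> borel_measurable ?M" using ifn by auto
  define S where "S = {x \<in> space ?M. 0 < f x}"
  have SM [measurable]: "S \<in> sets ?M" unfolding S_def by measurable
  then have SL: "S \<in> sets lebesgue" using \<Omega>l by (auto simp: sets_restrict_space_iff)
  have S\<Omega>: "S \<subseteq> \<Omega>" by (auto simp: S_def space_restrict_space)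
  define F where "F = (\<integral>x. (norm (f x))\<^sup>2 \<partial>?M)"
  have F0: "0 \<le> F" unfolding F_def by simp
  have small: "(\<integral>x. indicator S x * f x \<partial>?M)\<^sup>2 \<le> e * F" if e: "0 < e" for e
  proof -
    obtain T where T: "open T" "S \<subseteq> T" "T - S \<in> lmeasurable" "emeasure lebesgue (T - S) < ennreal e"
      using sets_lebesgue_outer_open[OF SL e] by metis
    define N where "N = T \<inter> \<Omega> - S"
    have N\<Omega>: "N \<inter> \<Omega> = N" by (auto simp: N_def)
    have NM [measurable]: "N \<in> sets ?M"
      using T(1) \<Omega>l SL \<Omega> unfolding N_def by (auto simp: sets_restrict_space_iff)
    have "(\<integral>x. indicator (T \<inter> \<Omega>) x * f x \<partial>?M) = 0"
      by (rule integral_open_zero[OF ifn _ _ z]) (use T \<Omega> in auto)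
    moreover have "(\<integral>x. indicator (T \<inter> \<Omega>) x * f x \<partial>?M) = (\<integral>x. indicator S x * f x + indicator N x * f x \<partial>?M)"
      using T(2) S\<Omega> by (intro Bochner_Integration.integral_cong refl) (auto simp: indicator_def N_def)
    moreover have "... = (\<integral>x. indicator S x * f x \<partial>?M) + (\<integral>x. indicator N x * f x \<partial>?M)"
      using integrable_real_mult_indicator[OF SM ifn] integrable_real_mult_indicator[OF NM ifn]
      by (intro Bochner_Integration.integral_add) (auto simp: mult.commute)
    ultimately have "(\<integral>x. indicator S x * f x \<partial>?M) = - (\<integral>x. indicator N x * f x \<partial>?M)" by simp
    then have "(\<integral>x. indicator S x * f x \<partial>?M)\<^sup>2 = (\<integral>x. indicator N x * f x \<partial>?M)\<^sup>2" by simp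
    also have "... \<le> (\<integral>x. (norm (indicator N x :: real))\<^sup>2 \<partial>?M) * F"
    proof -
      have "integrable ?M (indicator N :: 'a \<Rightarrow> real)"
        using NM by (intro integrable_real_indicator) (auto simp: less_top[symmetric])
      moreover have "(\<lambda>x. (norm (indicator N x :: real))\<^sup>2) = indicator N" by (auto simp: indicator_def fun_eq_iff)
      ultimately have "square_integrable ?M (indicator N :: 'a \<Rightarrow> real)"
        unfolding square_integrable_def by auto
      from square_integrable_Cauchy_Schwarz[OF this f] show ?thesis by (simp add: F_def)
    qed
    also have "(\<lambda>x. (norm (indicator N x :: real))\<^sup>2) = indicator N" by (auto simp: indicator_def fun_eq_iff)
    also have "(\<integral>x. indicator N x \<partial>?M) * F \<le> e * F"
    proof (rule mult_right_mono)
      have "emeasure ?M N = emeasure lebesgue N"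
        using \<Omega>l by (intro emeasure_restrict_space) (auto simp: N_def)
      also have "... \<le> emeasure lebesgue (T - S)"
        using T(3) by (intro emeasure_mono) (auto simp: N_def)
      also have "... < ennreal e" by (rule T(4))
      finally have "measure ?M N \<le> e"
        using e by (metis emeasure_eq_measure ennreal_less_iff less_imp_le measure_nonneg)
      then show "(\<integral>x. indicator N x \<partial>?M) \<le> e" by (simp add: N\<Omega>)
    qed (simp add: F_def)
    finally show ?thesis .
  qed
  have "(\<integral>x. indicator S x * f x \<partial>?M)\<^sup>2 \<le> 0"
  proof (rule field_le_epsilon)
    fix e :: real assume e: "0 < e"
    have "(\<integral>x. indicator S x * f x \<partial>?M)\<^sup>2 \<le> (e / (F + 1)) * F"
      using e F0 by (intro small divide_pos_pos) auto
    also have "... \<le> e" using e F0 by (simp add: field_simps)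
    finally show "(\<integral>x. indicator S x * f x \<partial>?M)\<^sup>2 \<le> 0 + e" by simp
  qed
  then have "(\<integral>x. indicator S x * f x \<partial>?M) = 0" by simp
  moreover have "AE x in ?M. 0 \<le> indicator S x * f x" by (intro AE_I2) (auto simp: S_def indicator_def)
  moreover have "integrable ?M (\<lambda>x. indicator S x * f x)"
    using integrable_real_mult_indicator[OF SM ifn] by (simp add: mult.commute)
  ultimately have "AE x in ?M. indicator S x * f x = 0"
    using integral_nonneg_eq_0_iff_AE[of ?M "\<lambda>x. indicator S x * f x"] by blast
  moreover have "AE x in ?M. x \<in> space ?M" by (rule AE_space)
  ultimately show ?thesis by eventually_elim (auto simp: S_def indicator_def not_less)
qed

lemma fundamental_lemma:
  fixes w :: "'a::euclidean_space \<Rightarrow> 'a"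
  assumes \<Omega>: "open \<Omega>" "bounded \<Omega>" and w: "square_integrable (lebesgue_on \<Omega>) w"
    and z: "\<And>\<psi> E. test_function \<Omega> \<psi> E \<Longrightarrow> (\<integral>x. \<psi> x *\<^sub>R w x \<partial>lebesgue_on \<Omega>) = 0"
  shows "AE x in lebesgue_on \<Omega>. w x = 0"
proof -
  have comp: "AE x in lebesgue_on \<Omega>. w x \<bullet> v \<le> 0" for v
  proof (rule fundamental_lemma_nonpos[OF \<Omega>])
    show "square_integrable (lebesgue_on \<Omega>) (\<lambda>x. w x \<bullet> v)"
      unfolding square_integrable_def
    proof
      show m: "(\<lambda>x. w x \<bullet> v) \<in> borel_measurable (lebesgue_on \<Omega>)"
        using w by (auto simp: square_integrable_def)
      show "integrable (lebesgue_on \<Omega>) (\<lambda>x. (norm (w x \<bullet> v))\<^sup>2)"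
      proof (rule Bochner_Integration.integrable_bound)
        show "integrable (lebesgue_on \<Omega>) (\<lambda>x. (norm (w x))\<^sup>2 * (norm v)\<^sup>2)"
          using w by (auto simp: square_integrable_def)
        show "AE x in lebesgue_on \<Omega>. norm ((norm (w x \<bullet> v))\<^sup>2) \<le> norm ((norm (w x))\<^sup>2 * (norm v)\<^sup>2)"
        proof (rule AE_I2)
          fix x
          have "(norm (w x \<bullet> v))\<^sup>2 \<le> (norm (w x) * norm v)\<^sup>2"
            using Cauchy_Schwarz_ineq2[of "w x" v] by (intro power_mono) auto
          then show "norm ((norm (w x \<bullet> v))\<^sup>2) \<le> norm ((norm (w x))\<^sup>2 * (norm v)\<^sup>2)"
            by (simp add: power_mult_distrib)
        qed
      qed (use m in measurable)
    qed
    fix \<psi> E assume t: "test_function \<Omega> \<psi> E"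
    then have c: "continuous_on UNIV \<psi>" by (auto simp: test_function_def intro: C1_continuous)
    obtain K where K: "compact K" "\<And>x. x \<notin> K \<Longrightarrow> \<psi> x = 0" using t by (auto simp: test_function_def)
    obtain B where B: "\<And>x. x \<in> K \<Longrightarrow> norm (\<psi> x) \<le> B"
      using continuous_compact_bound[OF K(1) continuous_on_norm[OF c]] by blast
    interpret finite_measure "lebesgue_on \<Omega>" by (rule finite_measure_lebesgue_on[OF \<Omega>])
    have "square_integrable (lebesgue_on \<Omega>) (\<lambda>x. 1 :: real)" by (simp add: square_integrable_def)
    have iw: "integrable (lebesgue_on \<Omega>) (\<lambda>x. \<psi> x *\<^sub>R w x)"
    proof (rule Bochner_Integration.integrable_bound)
      show "integrable (lebesgue_on \<Omega>) (\<lambda>x. (\<psi> x)\<^sup>2 + (norm (w x))\<^sup>2)"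
        using continuous_square_integrable[OF \<Omega> c] w by (auto simp: square_integrable_def)
      show "(\<lambda>x. \<psi> x *\<^sub>R w x) \<in> borel_measurable (lebesgue_on \<Omega>)"
        using w borel_measurable_lebesgue_on[OF borel_measurable_continuous_onI[OF c]]
        by (auto simp: square_integrable_def)
      show "AE x in lebesgue_on \<Omega>. norm (\<psi> x *\<^sub>R w x) \<le> norm ((\<psi> x)\<^sup>2 + (norm (w x))\<^sup>2)"
      proof (rule AE_I2)
        fix x
        have "0 \<le> (\<bar>\<psi> x\<bar> - norm (w x))\<^sup>2" "0 \<le> \<bar>\<psi> x\<bar> * norm (w x)" by simp_all
        then have "\<bar>\<psi> x\<bar> * norm (w x) \<le> (\<psi> x)\<^sup>2 + (norm (w x))\<^sup>2"
          unfolding power2_diff power2_abs by linarith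
        then show "norm (\<psi> x *\<^sub>R w x) \<le> norm ((\<psi> x)\<^sup>2 + (norm (w x))\<^sup>2)" by simp
      qed
    qed
    have "(\<integral>x. \<psi> x * (w x \<bullet> v) \<partial>lebesgue_on \<Omega>) = (\<integral>x. \<psi> x *\<^sub>R w x \<partial>lebesgue_on \<Omega>) \<bullet> v"
      using integral_inner_left[OF iw, of v] by simp
    then show "(\<integral>x. \<psi> x * (w x \<bullet> v) \<partial>lebesgue_on \<Omega>) = 0" using z[OF t] by simp
  qed
  have "AE x in lebesgue_on \<Omega>. \<forall>b\<in>Basis. w x \<bullet> b = 0"
  proof (rule AE_finite_allI[OF finite_Basis])
    fix b
    show "AE x in lebesgue_on \<Omega>. w x \<bullet> b = 0"
      using comp[of b] comp[of "- b"] by eventually_elim simp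
  qed
  then show ?thesis
  proof eventually_elim
    fix x assume a: "\<forall>b\<in>Basis. w x \<bullet> b = 0"
    show "w x = 0" by (rule euclidean_eqI) (use a in simp)
  qed
qed

text \<open>Representatives are not identified, so uniqueness is stated for two functions that agree
  almost everywhere; with v = 0 it gives the vanishing gradient of a null function.\<close>

lemma weak_gradient_unique:
  assumes \<Omega>: "open \<Omega>" "bounded \<Omega>"
    and 1: "H1_with_gradient \<Omega> u D" and 2: "H1_with_gradient \<Omega> v E"
    and uv: "AE x in lebesgue_on \<Omega>. u x = v x"
  shows "AE x in lebesgue_on \<Omega>. D x = E x"
proof -
  let ?M = "lebesgue_on \<Omega>"
  have sq: "square_integrable ?M u" "square_integrable ?M v" "square_integrable ?M D" "square_integrable ?M E"
    using 1 2 by (auto simp: H1_with_gradient_def)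
  have "AE x in ?M. D x - E x = 0"
  proof (rule fundamental_lemma[OF \<Omega> square_integrable_diff[OF sq(3,4)]])
    fix \<psi> G assume t: "test_function \<Omega> \<psi> G"
    then have "C1_with_gradient \<psi> G" by (simp add: test_function_def)
    then have s: "square_integrable ?M \<psi>" by (intro continuous_square_integrable[OF \<Omega>] C1_continuous)
    have i: "integrable ?M (\<lambda>x. \<psi> x *\<^sub>R d x)" if d: "square_integrable ?M d" for d :: "'a \<Rightarrow> 'a"
    proof (rule integrable_norm_cancel)
      have nd: "square_integrable ?M (\<lambda>x. norm (d x))" "square_integrable ?M (\<lambda>x. \<bar>\<psi> x\<bar>)"
        using d s by (auto simp: square_integrable_def)
      show "integrable ?M (\<lambda>x. norm (\<psi> x *\<^sub>R d x))" using square_integrable_times[OF nd(2,1)] by simp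
      show "(\<lambda>x. \<psi> x *\<^sub>R d x) \<in> borel_measurable ?M" using d s by (auto simp: square_integrable_def)
    qed
    have "(\<integral>x. u x *\<^sub>R G x \<partial>?M) = (\<integral>x. v x *\<^sub>R G x \<partial>?M)"
    proof (rule integral_cong_AE)
      show "AE x in ?M. u x *\<^sub>R G x = v x *\<^sub>R G x" using uv by eventually_elim simp
      have "G \<in> borel_measurable ?M"
        using t by (intro borel_measurable_lebesgue_on C1_gradient_measurable) (auto simp: test_function_def)
      then show "(\<lambda>x. u x *\<^sub>R G x) \<in> borel_measurable ?M" "(\<lambda>x. v x *\<^sub>R G x) \<in> borel_measurable ?M"
        using sq by (auto simp: square_integrable_def)
    qed
    moreover have "(\<integral>x. u x *\<^sub>R G x \<partial>?M) = - (\<integral>x. \<psi> x *\<^sub>R D x \<partial>?M)"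
      using 1 t unfolding H1_with_gradient_def by blast
    moreover have "(\<integral>x. v x *\<^sub>R G x \<partial>?M) = - (\<integral>x. \<psi> x *\<^sub>R E x \<partial>?M)"
      using 2 t unfolding H1_with_gradient_def by blast
    ultimately have "(\<integral>x. \<psi> x *\<^sub>R D x \<partial>?M) = (\<integral>x. \<psi> x *\<^sub>R E x \<partial>?M)" by simp
    moreover have "(\<integral>x. \<psi> x *\<^sub>R (D x - E x) \<partial>?M) = (\<integral>x. \<psi> x *\<^sub>R D x \<partial>?M) - (\<integral>x. \<psi> x *\<^sub>R E x \<partial>?M)"
      unfolding scaleR_diff_right by (rule Bochner_Integration.integral_diff[OF i[OF sq(3)] i[OF sq(4)]])
    ultimately show "(\<integral>x. \<psi> x *\<^sub>R (D x - E x) \<partial>?M) = 0" by simp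
  qed
  then show ?thesis by eventually_elim simp
qed

subsection \<open>Eigenvalues of a pair of quadratic forms\<close>

text \<open>The dimension count behind every min-max argument below: fewer equations than unknowns.
  Gaussian elimination, by induction on the number of equations.\<close>

lemma homogeneous_system_solution:
  fixes a :: "'j \<Rightarrow> 'i \<Rightarrow> real"
  assumes "finite J" "finite I" "card J < card I"
  shows "\<exists>c. (\<exists>i\<in>I. c i \<noteq> 0) \<and> (\<forall>j\<in>J. (\<Sum>i\<in>I. c i * a j i) = 0)"
  using assms
proof (induction J arbitrary: I a rule: finite_induct)
  case empty
  then have "I \<noteq> {}" by auto
  then show ?case by (intro exI[of _ "\<lambda>_. 1"]) auto
next
  case (insert j0 J)
  show ?case
  proof (cases "\<forall>i\<in>I. a j0 i = 0")
    case True
    have "card J < card I" using insert by simp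
    from insert.IH[OF insert.prems(1) this, of a]
    obtain c where c: "\<exists>i\<in>I. c i \<noteq> 0" "\<forall>j\<in>J. (\<Sum>i\<in>I. c i * a j i) = 0" by blast
    have "(\<Sum>i\<in>I. c i * a j0 i) = 0" using True by simp
    then show ?thesis using c by (intro exI[of _ c] conjI) auto
  next
    case False
    then obtain p where p: "p \<in> I" "a j0 p \<noteq> 0" by auto
    let ?a = "\<lambda>j i. a j i - a j p * a j0 i / a j0 p"
    have "card J < card (I - {p})" using insert p by simp
    then obtain c where c: "\<exists>i\<in>I - {p}. c i \<noteq> 0" "\<And>j. j \<in> J \<Longrightarrow> (\<Sum>i\<in>I - {p}. c i * ?a j i) = 0"
      using insert.IH[of "I - {p}" ?a] insert.prems(1) by auto
    \<comment> \<open>The remaining equations were reduced by multiples of equation j0 so as not to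
      contain the unknown p; its value is now read off from j0.\<close>
    define c' where "c' = c(p := - (\<Sum>i\<in>I - {p}. c i * a j0 i) / a j0 p)"
    have split: "(\<Sum>i\<in>I. c' i * a j i) = c' p * a j p + (\<Sum>i\<in>I - {p}. c i * a j i)" for j
      using insert.prems(1) p(1) by (subst sum.remove[of _ p]) (auto simp: c'_def intro!: sum.cong)
    have "(\<Sum>i\<in>I. c' i * a j0 i) = 0" unfolding split using p(2) by (simp add: c'_def)
    moreover have "(\<Sum>i\<in>I. c' i * a j i) = 0" if "j \<in> J" for j
    proof -
      have "0 = (\<Sum>i\<in>I - {p}. c i * a j i - (a j p / a j0 p) * (c i * a j0 i))"
        using c(2)[OF that] by (simp add: right_diff_distrib mult.assoc mult.left_commute)
      also have "... = (\<Sum>i\<in>I - {p}. c i * a j i) - (a j p / a j0 p) * (\<Sum>i\<in>I - {p}. c i * a j0 i)"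
        by (simp add: sum_subtractf sum_distrib_left)
      finally show ?thesis unfolding split by (simp add: c'_def)
    qed
    moreover have "\<exists>i\<in>I. c' i \<noteq> 0" using c(1) by (auto simp: c'_def)
    ultimately show ?thesis by (intro exI[of _ c']) auto
  qed
qed

section \<open>Semidefinite forms and successive minimization\<close>

text \<open>Only semidefinite, since fields that agree almost everywhere are not identified and
  boundary mass ignores the interior. The carrier W is a set because several forms live on a large
  space and are restricted to a subspace of it.\<close>

locale psd_form =
  fixes W :: "'v::real_vector set" and A :: "'v \<Rightarrow> 'v \<Rightarrow> real"
  assumes W: "subspace W"
    and add_left: "x \<in> W \<Longrightarrow> y \<in> W \<Longrightarrow> z \<in> W \<Longrightarrow> A (x + y) z = A x z + A y z"
    and scale_left: "x \<in> W \<Longrightarrow> y \<in> W \<Longrightarrow> A (c *\<^sub>R x) y = c * A x y"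
    and sym: "x \<in> W \<Longrightarrow> y \<in> W \<Longrightarrow> A x y = A y x"
    and nonneg: "x \<in> W \<Longrightarrow> 0 \<le> A x x"
begin

lemma in_W: "0 \<in> W" "x \<in> W \<Longrightarrow> y \<in> W \<Longrightarrow> x + y \<in> W" "x \<in> W \<Longrightarrow> y \<in> W \<Longrightarrow> x - y \<in> W"
  "x \<in> W \<Longrightarrow> c *\<^sub>R x \<in> W" "(\<And>i. i \<in> I \<Longrightarrow> f i \<in> W) \<Longrightarrow> (\<Sum>i\<in>I. f i) \<in> W"
  using W by (auto intro: subspace_0 subspace_add subspace_diff subspace_scale subspace_sum)

lemma diff_left: "x \<in> W \<Longrightarrow> y \<in> W \<Longrightarrow> z \<in> W \<Longrightarrow> A (x - y) z = A x z - A y z"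
  using add_left[of x "(- 1) *\<^sub>R y" z] scale_left[of y z "- 1"] in_W(4)[of y "- 1"] by simp

lemma add_right: "x \<in> W \<Longrightarrow> y \<in> W \<Longrightarrow> z \<in> W \<Longrightarrow> A x (y + z) = A x y + A x z"
  using add_left[of y z x] sym in_W(2) by metis

lemma diff_right: "x \<in> W \<Longrightarrow> y \<in> W \<Longrightarrow> z \<in> W \<Longrightarrow> A x (y - z) = A x y - A x z"
  using diff_left[of y z x] sym in_W(3) by metis

lemma scale_right: "x \<in> W \<Longrightarrow> y \<in> W \<Longrightarrow> A x (c *\<^sub>R y) = c * A x y"
  using scale_left[of y x c] sym in_W(4) by metis

lemma zero_left: "y \<in> W \<Longrightarrow> A 0 y = 0"
  using scale_left[of 0 y 0] in_W(1) by simp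

lemma sum_left:
  "finite I \<Longrightarrow> (\<And>i. i \<in> I \<Longrightarrow> f i \<in> W) \<Longrightarrow> y \<in> W \<Longrightarrow> A (\<Sum>i\<in>I. c i *\<^sub>R f i) y = (\<Sum>i\<in>I. c i * A (f i) y)"
proof (induction I rule: finite_induct)
  case (insert i I)
  have "(\<Sum>i\<in>I. c i *\<^sub>R f i) \<in> W" using insert by (intro in_W) auto
  then show ?case using insert by (simp add: add_left scale_left in_W)
qed (simp add: zero_left)

lemma quad_add: "x \<in> W \<Longrightarrow> y \<in> W \<Longrightarrow> A (x + y) (x + y) = A x x + 2 * A x y + A y y"
  using sym[of x y] by (simp add: add_left add_right in_W)

lemma quad_diff: "x \<in> W \<Longrightarrow> y \<in> W \<Longrightarrow> A (x - y) (x - y) = A x x - 2 * A x y + A y y"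
  using sym[of x y] by (simp add: diff_left diff_right in_W)

lemma quad_scale: "x \<in> W \<Longrightarrow> A (c *\<^sub>R x) (c *\<^sub>R x) = c\<^sup>2 * A x x"
  by (simp add: scale_left scale_right in_W power2_eq_square)

lemma Cauchy_Schwarz: "x \<in> W \<Longrightarrow> y \<in> W \<Longrightarrow> (A x y)\<^sup>2 \<le> A x x * A y y"
proof (rule quadratic_nonneg_discriminant)
  fix t assume xy: "x \<in> W" "y \<in> W"
  have "0 \<le> A (x - t *\<^sub>R y) (x - t *\<^sub>R y)" using xy by (intro nonneg in_W)
  also have "... = A x x - 2 * t * A x y + t\<^sup>2 * A y y"
    using xy by (simp add: quad_diff scale_left scale_right in_W power2_eq_square)
  finally show "0 \<le> A x x - 2 * t * A x y + t\<^sup>2 * A y y" .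
qed (rule nonneg)

lemma tendsto_form:
  assumes w: "\<And>m. w m \<in> W" "l \<in> W" and lim: "(\<lambda>m. A (w m - l) (w m - l)) \<longlonglongrightarrow> 0" and y: "y \<in> W"
  shows "(\<lambda>m. A (w m) y) \<longlonglongrightarrow> A l y"
proof -
  have "(\<lambda>m. sqrt (A (w m - l) (w m - l) * A y y)) \<longlonglongrightarrow> sqrt (0 * A y y)"
    by (intro tendsto_intros lim)
  then have s: "(\<lambda>m. sqrt (A (w m - l) (w m - l) * A y y)) \<longlonglongrightarrow> 0" by simp
  have "(\<lambda>m. A (w m) y - A l y) \<longlonglongrightarrow> 0"
  proof (rule tendsto_rabs_zero_cancel, rule tendsto_sandwich[OF _ _ tendsto_const s])
    show "\<forall>\<^sub>F m in sequentially. \<bar>A (w m) y - A l y\<bar> \<le> sqrt (A (w m - l) (w m - l) * A y y)"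
    proof (rule always_eventually, rule allI)
      fix m
      have "(A (w m - l) y)\<^sup>2 \<le> A (w m - l) (w m - l) * A y y"
        using w y by (intro Cauchy_Schwarz in_W)
      then have "\<bar>A (w m - l) y\<bar> \<le> sqrt (A (w m - l) (w m - l) * A y y)"
        by (rule real_le_rsqrt[of "\<bar>A (w m - l) y\<bar>", simplified])
      then show "\<bar>A (w m) y - A l y\<bar> \<le> sqrt (A (w m - l) (w m - l) * A y y)"
        using w y by (simp add: diff_left)
    qed
  qed auto
  then show ?thesis by (simp add: LIM_zero_iff)
qed

lemma tendsto_quad:
  assumes w: "\<And>m. w m \<in> W" "l \<in> W" and lim: "(\<lambda>m. A (w m - l) (w m - l)) \<longlonglongrightarrow> 0"
  shows "(\<lambda>m. A (w m) (w m)) \<longlonglongrightarrow> A l l"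
proof -
  have "(\<lambda>m. A (w m - l) (w m - l) + 2 * A (w m) l - A l l) \<longlonglongrightarrow> 0 + 2 * A l l - A l l"
    by (intro tendsto_intros lim tendsto_form[OF w lim w(2)])
  moreover have "A (w m - l) (w m - l) + 2 * A (w m) l - A l l = A (w m) (w m)" for m
    using w by (simp add: quad_diff)
  ultimately show ?thesis by simp
qed

end

text \<open>The abstract Steklov setting: W is complete for A + B, B is compact relative to A + B,
  and B has infinite rank, without which the minimization would end after finitely many steps.
  Limits are unique only up to null vectors, so none are chosen canonically.\<close>

locale compact_form_pair = A: psd_form W A + B: psd_form W B
  for W :: "'v::real_vector set" and A B +
  assumes complete: "(\<And>m::nat. w m \<in> W) \<Longrightarrow>
      (\<And>e. 0 < e \<Longrightarrow> \<exists>N. \<forall>i\<ge>N. \<forall>j\<ge>N. A (w i - w j) (w i - w j) + B (w i - w j) (w i - w j) < e) \<Longrightarrow>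
      \<exists>l\<in>W. (\<lambda>m. A (w m - l) (w m - l)) \<longlonglongrightarrow> 0 \<and> (\<lambda>m. B (w m - l) (w m - l)) \<longlonglongrightarrow> 0"
    and compact: "(\<And>m::nat. w m \<in> W) \<Longrightarrow> (\<And>m. A (w m) (w m) + B (w m) (w m) \<le> C) \<Longrightarrow>
      \<exists>r :: nat \<Rightarrow> nat. strict_mono r \<and> (\<forall>e>0. \<exists>N. \<forall>i\<ge>N. \<forall>j\<ge>N. B (w (r i) - w (r j)) (w (r i) - w (r j)) < e)"
    and infinite: "\<exists>f. \<forall>i\<le>k::nat. f i \<in> W \<and> 0 < B (f i) (f i) \<and> (\<forall>j\<le>k. i \<noteq> j \<longrightarrow> B (f i) (f j) = 0)"
begin

definition orth :: "'v set \<Rightarrow> 'v set" where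
  "orth X = {w \<in> W. \<forall>x\<in>X. B w x = 0}"

lemma orth_nontrivial:
  assumes X: "finite X" "X \<subseteq> W"
  shows "\<exists>w\<in>orth X. 0 < B w w"
proof -
  define k where "k = card X"
  obtain f where f: "\<And>i. i \<le> k \<Longrightarrow> f i \<in> W" "\<And>i. i \<le> k \<Longrightarrow> 0 < B (f i) (f i)"
    "\<And>i j. i \<le> k \<Longrightarrow> j \<le> k \<Longrightarrow> i \<noteq> j \<Longrightarrow> B (f i) (f j) = 0"
    using infinite[of k] by metis
  obtain c where c: "\<exists>i\<in>{..k}. c i \<noteq> 0" "\<And>x. x \<in> X \<Longrightarrow> (\<Sum>i\<in>{..k}. c i * B (f i) x) = 0"
    using homogeneous_system_solution[OF X(1), of "{..k}" "\<lambda>x i. B (f i) x"] by (auto simp: k_def)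
  define w where "w = (\<Sum>i\<in>{..k}. c i *\<^sub>R f i)"
  have w: "w \<in> W" unfolding w_def using f(1) by (intro B.in_W) auto
  have wl: "B w y = (\<Sum>i\<in>{..k}. c i * B (f i) y)" if "y \<in> W" for y
    unfolding w_def using f(1) that by (intro B.sum_left) auto
  have "B w (f j) = c j * B (f j) (f j)" if "j \<le> k" for j
  proof -
    have "B w (f j) = (\<Sum>i\<in>{..k}. if i = j then c j * B (f j) (f j) else 0)"
      unfolding wl[OF f(1)[OF that]] using f(3) that by (intro sum.cong) auto
    then show ?thesis using that by simp
  qed
  then have "B (f i) w = c i * B (f i) (f i)" if "i \<le> k" for i
    using B.sym[OF w f(1)[OF that]] that by simp
  then have "B w w = (\<Sum>i\<in>{..k}. (c i)\<^sup>2 * B (f i) (f i))"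
    unfolding wl[OF w] by (intro sum.cong refl) (simp add: power2_eq_square)
  also have "0 < ..."
  proof -
    obtain i where "i \<le> k" "c i \<noteq> 0" using c(1) by auto
    then show ?thesis
      using f(2) by (intro sum_pos2[of _ i]) (auto simp: less_imp_le)
  qed
  finally have "0 < B w w" .
  moreover have "w \<in> orth X" using c(2) X(2) w wl by (auto simp: orth_def subset_iff)
  ultimately show ?thesis by blast
qed

text \<open>The direct method. Compactness makes a minimizing sequence Cauchy for B, the
  parallelogram law upgrades this to A, and completeness gives the limit. The infimum is recorded as
  A u u.\<close>

lemma minimizer_exists:
  assumes X: "finite X" "X \<subseteq> W"
  shows "\<exists>u\<in>orth X. B u u = 1 \<and> (\<forall>w\<in>orth X. A u u * B w w \<le> A w w)"
proof -
  define V where "V = orth X"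
  have VW: "V \<subseteq> W" by (auto simp: V_def orth_def)
  have Vadd: "x + y \<in> V" if "x \<in> V" "y \<in> V" for x y
    using that X(2) by (auto simp: V_def orth_def B.in_W B.add_left subset_iff)
  have Vscale: "c *\<^sub>R x \<in> V" if "x \<in> V" for x c
    using that X(2) by (auto simp: V_def orth_def B.in_W B.scale_left subset_iff)
  obtain w0 where w0: "w0 \<in> V" "0 < B w0 w0" using orth_nontrivial[OF X] by (auto simp: V_def)
  define S where "S = {A w w | w. w \<in> V \<and> B w w = 1}"
  have norm1: "\<exists>c. c\<^sup>2 = 1 / B w w \<and> (c *\<^sub>R w \<in> V \<and> B (c *\<^sub>R w) (c *\<^sub>R w) = 1 \<and> A (c *\<^sub>R w) (c *\<^sub>R w) = A w w / B w w)"
    if w: "w \<in> V" "0 < B w w" for w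
  proof -
    have "(sqrt (1 / B w w))\<^sup>2 = 1 / B w w" using w by simp
    moreover have "w \<in> W" using w VW by auto
    ultimately show ?thesis using w
      by (intro exI[of _ "sqrt (1 / B w w)"]) (simp only: A.quad_scale B.quad_scale Vscale, simp)
  qed
  have S0: "S \<noteq> {}" using norm1[OF w0] by (auto simp: S_def)
  have Sb: "bdd_below S" using A.nonneg VW by (intro bdd_belowI[of _ 0]) (auto simp: S_def)
  define \<mu> where "\<mu> = Inf S"
  have \<mu>0: "0 \<le> \<mu>" unfolding \<mu>_def using S0 A.nonneg VW by (intro cInf_greatest) (auto simp: S_def)
  have low: "\<mu> * B w w \<le> A w w" if w: "w \<in> V" for w
  proof (cases "0 < B w w")
    case True
    obtain c where "c *\<^sub>R w \<in> V" "B (c *\<^sub>R w) (c *\<^sub>R w) = 1" "A (c *\<^sub>R w) (c *\<^sub>R w) = A w w / B w w"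
      using norm1[OF w True] by blast
    then have "A w w / B w w \<in> S" unfolding S_def by (auto intro!: exI[of _ "c *\<^sub>R w"])
    then have "\<mu> \<le> A w w / B w w" unfolding \<mu>_def using Sb by (rule cInf_lower)
    then show ?thesis using True by (simp add: field_simps)
  next
    case False
    then have "B w w = 0" using B.nonneg[of w] w VW by auto
    then show ?thesis using A.nonneg[of w] w VW by auto
  qed
  have "\<exists>w\<in>V. B w w = 1 \<and> A w w < \<mu> + 1 / real (Suc m)" for m
  proof -
    have "Inf S < \<mu> + 1 / real (Suc m)" by (simp add: \<mu>_def)
    then obtain a where "a \<in> S" "a < \<mu> + 1 / real (Suc m)" using cInf_lessD[OF S0] by blast
    then show ?thesis by (auto simp: S_def)
  qed
  then obtain w where w: "\<And>m. w m \<in> V" "\<And>m. B (w m) (w m) = 1" "\<And>m. A (w m) (w m) < \<mu> + 1 / real (Suc m)" by metis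
  have wW: "w m \<in> W" for m using w(1) VW by auto
  have "A (w m) (w m) + B (w m) (w m) \<le> \<mu> + 2" for m
  proof -
    have "1 / real (Suc m) \<le> 1" by simp
    then show ?thesis using w(2,3)[of m] by linarith
  qed
  from compact[of w, OF wW this] obtain r :: "nat \<Rightarrow> nat" where r: "strict_mono r"
    "\<forall>e>0. \<exists>N. \<forall>i\<ge>N. \<forall>j\<ge>N. B (w (r i) - w (r j)) (w (r i) - w (r j)) < e"
    by (elim exE conjE) (rule that; assumption)
  \<comment> \<open>The parallelogram law for A, with A (w i + w j) bounded below by the infimum
    \<mu> times B, and then the parallelogram law for B.\<close>
  have par: "A (w i - w j) (w i - w j) \<le> 2 / real (Suc i) + 2 / real (Suc j) + \<mu> * B (w i - w j) (w i - w j)" for i j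
  proof -
    have "A (w i - w j) (w i - w j) = 2 * A (w i) (w i) + 2 * A (w j) (w j) - A (w i + w j) (w i + w j)"
      using wW by (simp add: A.quad_add A.quad_diff)
    also have "... \<le> 2 * A (w i) (w i) + 2 * A (w j) (w j) - \<mu> * B (w i + w j) (w i + w j)"
      using low[OF Vadd[OF w(1) w(1)], of i j] by simp
    also have "B (w i + w j) (w i + w j) = 4 - B (w i - w j) (w i - w j)"
      using wW w(2) by (simp add: B.quad_add B.quad_diff)
    finally show ?thesis using w(3)[of i] w(3)[of j] by (simp add: algebra_simps)
  qed
  have "\<exists>l\<in>W. (\<lambda>m. A (w (r m) - l) (w (r m) - l)) \<longlonglongrightarrow> 0 \<and> (\<lambda>m. B (w (r m) - l) (w (r m) - l)) \<longlonglongrightarrow> 0"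
  proof (rule complete)
    fix e :: real assume e: "0 < e"
    define d where "d = e / (4 * (\<mu> + 1))"
    have d: "0 < d" using e \<mu>0 by (simp add: d_def)
    obtain N1 where N1: "\<And>i j. N1 \<le> i \<Longrightarrow> N1 \<le> j \<Longrightarrow> B (w (r i) - w (r j)) (w (r i) - w (r j)) < d"
      using r(2)[rule_format, OF d] by blast
    obtain N2 where N2: "1 / real (Suc N2) < e / 8" using e nat_approx_posE[of "e / 8"] by auto
    have "A (w (r i) - w (r j)) (w (r i) - w (r j)) + B (w (r i) - w (r j)) (w (r i) - w (r j)) < e"
      if ij: "max N1 N2 \<le> i" "max N1 N2 \<le> j" for i j
    proof -
      have "2 / real (Suc (r i)) \<le> e / 4" if "max N1 N2 \<le> i" for i
      proof -
        have "N2 \<le> r i" using that seq_suble[OF r(1), of i] by linarith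
        then have "1 / real (Suc (r i)) \<le> 1 / real (Suc N2)" by (intro divide_left_mono) auto
        then show ?thesis using N2 by linarith
      qed
      note two = this[OF ij(1)] this[OF ij(2)]
      let ?b = "B (w (r i) - w (r j)) (w (r i) - w (r j))"
      have b: "?b < d" using N1 ij by auto
      have "A (w (r i) - w (r j)) (w (r i) - w (r j)) + ?b \<le> e / 4 + e / 4 + (\<mu> * ?b + ?b)"
        using par[of "r i" "r j"] two by linarith
      also have "\<mu> * ?b + ?b = (\<mu> + 1) * ?b" by (simp add: algebra_simps)
      also have "(\<mu> + 1) * ?b \<le> (\<mu> + 1) * d" using b \<mu>0 by (intro mult_left_mono) auto
      also have "(\<mu> + 1) * d = e / 4" using \<mu>0 by (simp add: d_def field_simps)
      finally show ?thesis using e by linarith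
    qed
    then show "\<exists>N. \<forall>i\<ge>N. \<forall>j\<ge>N. A (w (r i) - w (r j)) (w (r i) - w (r j)) + B (w (r i) - w (r j)) (w (r i) - w (r j)) < e"
      by blast
  qed (rule wW)
  then obtain l where l: "l \<in> W" "(\<lambda>m. A (w (r m) - l) (w (r m) - l)) \<longlonglongrightarrow> 0" "(\<lambda>m. B (w (r m) - l) (w (r m) - l)) \<longlonglongrightarrow> 0"
    by blast
  have Bl: "B l l = 1"
    using B.tendsto_quad[OF wW l(1,3)] w(2) by (simp add: LIMSEQ_const_iff)
  have lV: "l \<in> V"
  proof -
    have "B l x = 0" if x: "x \<in> X" for x
    proof -
      have "(\<lambda>m. B (w (r m)) x) \<longlonglongrightarrow> B l x" using B.tendsto_form[OF wW l(1,3)] x X(2) by auto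
      moreover have "B (w (r m)) x = 0" for m using w(1)[of "r m"] x by (auto simp: V_def orth_def)
      ultimately show ?thesis by (simp add: LIMSEQ_const_iff)
    qed
    then show ?thesis using l(1) by (auto simp: V_def orth_def)
  qed
  have "A l l \<le> \<mu>"
  proof (rule LIMSEQ_le[OF A.tendsto_quad[OF wW l(1,2)]])
    have "(\<lambda>m. \<mu> + 1 / real (Suc m)) \<longlonglongrightarrow> \<mu> + 0"
      by (intro tendsto_intros) (rule LIMSEQ_Suc[OF lim_inverse_n'])
    then show "(\<lambda>m. \<mu> + 1 / real (Suc m)) \<longlonglongrightarrow> \<mu>" by simp
    have "A (w (r m)) (w (r m)) \<le> \<mu> + 1 / real (Suc m)" for m
    proof -
      have "1 / real (Suc (r m)) \<le> 1 / real (Suc m)" using seq_suble[OF r(1), of m] by (intro divide_left_mono) auto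
      then show ?thesis using w(3)[of "r m"] by linarith
    qed
    then show "\<exists>N. \<forall>m\<ge>N. A (w (r m)) (w (r m)) \<le> \<mu> + 1 / real (Suc m)" by blast
  qed
  then have "A l l * B w w \<le> A w w" if "w \<in> V" for w
  proof -
    have "A l l * B w w \<le> \<mu> * B w w" using \<open>A l l \<le> \<mu>\<close> B.nonneg[of w] that VW by (intro mult_right_mono) auto
    then show ?thesis using low[OF that] by linarith
  qed
  then show ?thesis using lV Bl unfolding V_def by blast
qed

text \<open>The form A - A u u * B is nonnegative on \<open>orth X\<close> and vanishes at u, so by
  Cauchy-Schwarz for that form u lies in its kernel.\<close>

lemma minimizer_stationary:
  assumes X: "X \<subseteq> W" and u: "u \<in> orth X" "B u u = 1" "\<And>w. w \<in> orth X \<Longrightarrow> A u u * B w w \<le> A w w"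
    and w: "w \<in> orth X"
  shows "A u w = A u u * B u w"
proof -
  have uW: "u \<in> W" and wW: "w \<in> W" using u w by (auto simp: orth_def)
  have "(A u w - A u u * B u w)\<^sup>2 \<le> 0 * (A w w - A u u * B w w)"
  proof (rule quadratic_nonneg_discriminant)
    show "0 \<le> A w w - A u u * B w w" using u(3)[OF w] by simp
    fix t :: real
    have "u - t *\<^sub>R w \<in> orth X"
      using u(1) w X by (auto simp: orth_def B.in_W B.diff_left B.scale_left subset_iff)
    then have "0 \<le> A (u - t *\<^sub>R w) (u - t *\<^sub>R w) - A u u * B (u - t *\<^sub>R w) (u - t *\<^sub>R w)"
      using u(3) by simp
    also have "A (u - t *\<^sub>R w) (u - t *\<^sub>R w) = A u u - 2 * t * A u w + t\<^sup>2 * A w w"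
      using uW wW by (simp add: A.quad_diff A.scale_left A.scale_right A.in_W power2_eq_square)
    also have "B (u - t *\<^sub>R w) (u - t *\<^sub>R w) = 1 - 2 * t * B u w + t\<^sup>2 * B w w"
      using uW wW u(2) by (simp add: B.quad_diff B.scale_left B.scale_right B.in_W power2_eq_square)
    finally show "0 \<le> 0 - 2 * t * (A u w - A u u * B u w) + t\<^sup>2 * (A w w - A u u * B w w)"
      by (simp add: algebra_simps)
  qed
  then show ?thesis by simp
qed

definition good :: "'v list \<Rightarrow> 'v \<Rightarrow> bool" where
  "good L u \<longleftrightarrow> u \<in> orth (set L) \<and> B u u = 1 \<and> (\<forall>w\<in>orth (set L). A u u * B w w \<le> A w w)"

text \<open>Repeated minimization of A relative to B on the complement of the vectors found so far.
  The last conclusion, the minimality of each s k, is what the bounds on eigenvalues use.\<close>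

lemma eigensystem_exists:
  "\<exists>v s. (\<forall>k::nat. v k \<in> W) \<and> (\<forall>i j. B (v i) (v j) = (if i = j then 1 else 0)) \<and>
     (\<forall>k. \<forall>w\<in>W. A (v k) w = s k * B (v k) w) \<and> incseq s \<and> filterlim s at_top sequentially \<and>
     (\<forall>k. \<forall>w\<in>W. (\<forall>i<k. B w (v i) = 0) \<longrightarrow> s k * B w w \<le> A w w)"
proof -
  \<comment> \<open>The next minimizer depends on all earlier ones, so the state handed through
    dependent choice is the list of them.\<close>
  have "\<exists>F. \<forall>n. (length (F n) = n \<and> set (F n) \<subseteq> W) \<and> (\<exists>u. F (Suc n) = F n @ [u] \<and> good (F n) u)"
  proof (rule dependent_nat_choice)
    fix L :: "'v list" and n :: nat
    assume L: "length L = n \<and> set L \<subseteq> W"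
    then obtain u where "good L u" using minimizer_exists[of "set L"] by (auto simp: good_def)
    then show "\<exists>y. (length y = Suc n \<and> set y \<subseteq> W) \<and> (\<exists>u. y = L @ [u] \<and> good L u)"
      using L by (intro exI[of _ "L @ [u]"]) (auto simp: good_def orth_def)
  qed auto
  then obtain F where F: "\<And>n. length (F n) = n" "\<And>n. set (F n) \<subseteq> W"
    "\<And>n. \<exists>u. F (Suc n) = F n @ [u] \<and> good (F n) u" by metis
  define v where "v n = F (Suc n) ! n" for n
  have Fs: "F (Suc n) = F n @ [v n] \<and> good (F n) (v n)" for n
    using F(3)[of n] F(1)[of n] by (auto simp: v_def nth_append)
  have Fmap: "F n = map v [0..<n]" for n
    by (induction n) (use F(1)[of 0] Fs in auto)
  have setF: "set (F n) = v ` {..<n}" for n by (auto simp: Fmap)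
  define s where "s k = A (v k) (v k)" for k
  have g: "v k \<in> orth (v ` {..<k})" "B (v k) (v k) = 1" "\<And>w. w \<in> orth (v ` {..<k}) \<Longrightarrow> s k * B w w \<le> A w w" for k
    using Fs[of k] unfolding good_def setF s_def by auto
  have vW: "v k \<in> W" for k using g(1)[of k] by (auto simp: orth_def)
  have lt: "B (v j) (v i) = 0" if "i < j" for i j using g(1)[of j] that by (auto simp: orth_def)
  have on: "B (v i) (v j) = (if i = j then 1 else 0)" for i j
    using g(2) lt[of i j] lt[of j i] B.sym[OF vW vW, of i j] by (cases i j rule: linorder_cases) auto
  have low: "s k * B w w \<le> A w w" if "w \<in> W" "\<forall>i<k. B w (v i) = 0" for k w
    using g(3)[of w k] that by (auto simp: orth_def)
  have eig: "\<forall>w\<in>W. A (v k) w = s k * B (v k) w" for k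
  proof (induction k rule: less_induct)
    case (less k)
    show ?case
    proof
      fix w assume w: "w \<in> W"
      \<comment> \<open>Stationarity holds only against vectors orthogonal to the earlier v i. The
        B-projection p of w onto their span is A-orthogonal to v k by the equations already proved
        for them, so the equation extends to all w.\<close>
      define p where "p = (\<Sum>i\<in>{..<k}. B w (v i) *\<^sub>R v i)"
      have pW: "p \<in> W" unfolding p_def using vW by (intro B.in_W) auto
      have Bp: "B p y = (\<Sum>i\<in>{..<k}. B w (v i) * B (v i) y)" if "y \<in> W" for y
        unfolding p_def using vW that by (intro B.sum_left) auto
      have "B (w - p) (v j) = 0" if "j < k" for j
      proof -
        have "B p (v j) = (\<Sum>i\<in>{..<k}. if i = j then B w (v j) else 0)"
          unfolding Bp[OF vW] by (intro sum.cong) (auto simp: on)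
        also have "... = B w (v j)" using that by simp
        finally show ?thesis using w pW vW by (simp add: B.diff_left)
      qed
      then have o: "w - p \<in> orth (v ` {..<k})" using w pW B.in_W by (auto simp: orth_def)
      have st: "A (v k) (w - p) = s k * B (v k) (w - p)"
        using minimizer_stationary[OF _ g(1,2) _ o] g(3)[of _ k] vW unfolding s_def by blast
      have "A p (v k) = (\<Sum>i\<in>{..<k}. B w (v i) * A (v i) (v k))"
        unfolding p_def using vW by (intro A.sum_left) auto
      also have "... = 0" using less vW by (intro sum.neutral) (auto simp: on)
      finally have "A (v k) p = 0" using A.sym[OF pW vW] by simp
      moreover have "B (v k) p = 0"
        using Bp[OF vW, of k] B.sym[OF pW vW, of k] by (simp add: on)
      ultimately show "A (v k) w = s k * B (v k) w"
        using st w pW vW by (simp add: A.diff_right B.diff_right)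
    qed
  qed
  have inc: "incseq s"
  proof (rule incseq_SucI)
    fix k
    have "s k * B (v (Suc k)) (v (Suc k)) \<le> A (v (Suc k)) (v (Suc k))"
      using vW by (intro low) (auto simp: on)
    then show "s k \<le> s (Suc k)" by (simp add: on s_def)
  qed
  \<comment> \<open>Otherwise the v k would be bounded for A + B; a subsequence would be Cauchy for
    B, yet distinct orthonormal vectors have squared distance 2.\<close>
  have "filterlim s at_top sequentially"
  proof (rule ccontr)
    assume n: "\<not> ?thesis"
    have "\<exists>C. \<forall>k. s k \<le> C"
    proof (rule ccontr)
      assume "\<not> ?thesis"
      then have u: "\<exists>k. C < s k" for C by (auto simp: not_le)
      have "filterlim s at_top sequentially"
        unfolding filterlim_at_top
      proof
        fix Z
        obtain k where "Z < s k" using u by blast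
        then show "\<forall>\<^sub>F x in sequentially. Z \<le> s x"
          using inc by (intro eventually_sequentiallyI[of k]) (auto dest: incseqD intro: order_trans less_imp_le)
      qed
      then show False using n by simp
    qed
    then obtain C where "\<And>k. s k \<le> C" by blast
    then have "A (v k) (v k) + B (v k) (v k) \<le> C + 1" for k by (simp add: s_def on)
    from compact[of v, OF vW this] obtain r :: "nat \<Rightarrow> nat" where r: "strict_mono r"
      "\<forall>e>0. \<exists>N. \<forall>i\<ge>N. \<forall>j\<ge>N. B (v (r i) - v (r j)) (v (r i) - v (r j)) < e"
      by (elim exE conjE) (rule that; assumption)
    then obtain N where N: "\<And>i j. N \<le> i \<Longrightarrow> N \<le> j \<Longrightarrow> B (v (r i) - v (r j)) (v (r i) - v (r j)) < 1"
      by (metis zero_less_one)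
    have "r N \<noteq> r (Suc N)" using r(1) by (metis strict_mono_eq n_not_Suc_n)
    then have "B (v (r N) - v (r (Suc N))) (v (r N) - v (r (Suc N))) = 2"
      using vW by (simp add: B.quad_diff on)
    then show False using N[of N "Suc N"] by simp
  qed
  then show ?thesis using vW on eig inc low by blast
qed

text \<open>By symmetry w is B-orthogonal to each v k of another eigenvalue, and by assumption to
  those of eigenvalue t, hence to all. Minimality then gives s k * B w w \<le> t * B w w for every
  k, impossible for unbounded s unless B w w = 0.\<close>

lemma eigenspace_complete:
  assumes v: "\<And>k::nat. v k \<in> W" and eig: "\<And>k w. w \<in> W \<Longrightarrow> A (v k) w = s k * B (v k) w"
    and lim: "filterlim s at_top sequentially"
    and low: "\<And>k w. w \<in> W \<Longrightarrow> (\<And>i. i < k \<Longrightarrow> B w (v i) = 0) \<Longrightarrow> s k * B w w \<le> A w w"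
    and w: "w \<in> W" "\<And>x. x \<in> W \<Longrightarrow> A w x = t * B w x"
    and o: "\<And>k. s k = t \<Longrightarrow> B w (v k) = 0"
  shows "B w w = 0" "A w w = 0"
proof -
  have z: "B w (v k) = 0" for k
  proof (cases "s k = t")
    case False
    have "t * B w (v k) = s k * B w (v k)"
      using w(2)[OF v] eig[OF w(1), of k] A.sym[OF w(1) v] B.sym[OF w(1) v] by metis
    then show ?thesis using False by simp
  qed (rule o)
  show B0: "B w w = 0"
  proof (rule ccontr)
    assume "B w w \<noteq> 0"
    then have p: "0 < B w w" using B.nonneg[OF w(1)] by simp
    have "s k \<le> t" for k
    proof -
      have "s k * B w w \<le> t * B w w" using low[OF w(1), of k] z w(2)[OF w(1)] by simp
      then show ?thesis using p by simp
    qed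
    moreover obtain k where "t + 1 \<le> s k"
      using lim unfolding filterlim_at_top eventually_sequentially by blast
    ultimately show False by (metis add_le_same_cancel1 not_one_le_zero order_trans)
  qed
  show "A w w = 0" using w(2)[OF w(1)] B0 by simp
qed

end

subsection \<open>Compactness of the trace\<close>

lemma continuous_bounded_integrable:
  fixes f :: "'a::euclidean_space \<Rightarrow> real"
  assumes "bounded Q" "Q \<in> sets borel" "continuous_on UNIV f"
  shows "integrable lborel (\<lambda>x. indicator Q x * f x)"
proof -
  have "compact (closure Q)" using assms(1) by simp
  then have "integrable lborel (\<lambda>x. indicator (closure Q) x *\<^sub>R f x)"
    by (intro borel_integrable_compact continuous_on_subset[OF assms(3)]) auto
  then have "integrable lborel (\<lambda>x. indicator Q x *\<^sub>R (indicator (closure Q) x *\<^sub>R f x))"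
    by (rule integrable_mult_indicator[rotated]) (use assms(2) in simp)
  also have "(\<lambda>x. indicator Q x *\<^sub>R (indicator (closure Q) x *\<^sub>R f x)) = (\<lambda>x. indicator Q x * f x)"
    using closure_subset[of Q] by (auto simp: indicator_def fun_eq_iff)
  finally show ?thesis .
qed

lemma set_nn_integral_continuous:
  fixes f :: "'a::euclidean_space \<Rightarrow> real"
  assumes "bounded Q" "Q \<in> sets borel" "continuous_on UNIV f" "\<And>x. x \<in> Q \<Longrightarrow> 0 \<le> f x"
  shows "(\<integral>\<^sup>+x\<in>Q. ennreal (f x) \<partial>lborel) = ennreal (\<integral>x. indicator Q x * f x \<partial>lborel)"
proof -
  have "(\<integral>\<^sup>+x\<in>Q. ennreal (f x) \<partial>lborel) = (\<integral>\<^sup>+x. ennreal (indicator Q x * f x) \<partial>lborel)"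
    by (intro nn_integral_cong) (auto simp: indicator_def)
  also have "... = ennreal (\<integral>x. indicator Q x * f x \<partial>lborel)"
    using continuous_bounded_integrable[OF assms(1,2,3)] assms(4)
    by (intro nn_integral_eq_integral) (auto simp: indicator_def)
  finally show ?thesis .
qed

text \<open>With q the volume, M the integral of \<phi>^2 and S that of \<phi>, the double
  difference over Q equals 2 q M - 2 S^2. The mean is kept as a separate term, because it becomes
  one of finitely many functionals.\<close>

lemma poincare:
  fixes Q :: "'a::euclidean_space set"
  assumes Q: "convex Q" "Q \<in> sets borel" "bounded Q" and d: "\<And>x y. x \<in> Q \<Longrightarrow> y \<in> Q \<Longrightarrow> norm (y - x) \<le> d"
    and C1: "C1_with_gradient \<phi> D"
  shows "square_int Q \<phi>
    \<le> ennreal (d\<^sup>2 * 2 ^ DIM('a)) * dirichlet_int Q D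
      + ennreal ((\<integral>x. indicator Q x * \<phi> x \<partial>lborel)\<^sup>2 / measure lborel Q)"
proof -
  have c: "continuous_on UNIV \<phi>" "continuous_on UNIV (\<lambda>x. (\<phi> x)\<^sup>2)" "continuous_on UNIV (\<lambda>x. (norm (D x))\<^sup>2)"
    using C1_continuous[OF C1] C1_gradient_continuous[OF C1] by (auto intro!: continuous_intros)
  define M where "M = (\<integral>x. indicator Q x * (\<phi> x)\<^sup>2 \<partial>lborel)"
  define S where "S = (\<integral>x. indicator Q x * \<phi> x \<partial>lborel)"
  define E where "E = (\<integral>x. indicator Q x * (norm (D x))\<^sup>2 \<partial>lborel)"
  define q where "q = measure lborel Q"
  have q: "emeasure lborel Q = ennreal q" "0 \<le> q"
    using emeasure_bounded_finite[OF Q(3)] by (auto simp: q_def emeasure_eq_ennreal_measure)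
  have nM: "square_int Q \<phi> = ennreal M" unfolding M_def
    by (rule set_nn_integral_continuous[OF Q(3,2) c(2)]) simp
  have nE: "dirichlet_int Q D = ennreal E" unfolding E_def
    by (rule set_nn_integral_continuous[OF Q(3,2) c(3)]) simp
  have E0: "0 \<le> E" and M0: "0 \<le> M" unfolding E_def M_def by (auto intro!: integral_nonneg_AE)
  have i1: "integrable lborel (\<lambda>x. indicator Q x * \<phi> x)" and i2: "integrable lborel (\<lambda>x. indicator Q x * (\<phi> x)\<^sup>2)"
    using continuous_bounded_integrable[OF Q(3,2)] c by auto
  have i0: "integrable lborel (indicator Q :: 'a \<Rightarrow> real)" using Q(2) q(1) by (intro integrable_real_indicator) auto
  have int0: "(\<integral>x. indicator Q x \<partial>lborel) = q" by (simp add: q_def)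
  have inner: "(\<integral>\<^sup>+y\<in>Q. ennreal ((\<phi> y - \<phi> x)\<^sup>2) \<partial>lborel) = ennreal (M - 2 * \<phi> x * S + (\<phi> x)\<^sup>2 * q)" for x
  proof -
    have "(\<integral>\<^sup>+y\<in>Q. ennreal ((\<phi> y - \<phi> x)\<^sup>2) \<partial>lborel) = ennreal (\<integral>y. indicator Q y * (\<phi> y - \<phi> x)\<^sup>2 \<partial>lborel)"
      using c(1) by (intro set_nn_integral_continuous[OF Q(3,2)] continuous_intros) auto
    also have "(\<integral>y. indicator Q y * (\<phi> y - \<phi> x)\<^sup>2 \<partial>lborel)
        = (\<integral>y. indicator Q y * (\<phi> y)\<^sup>2 - 2 * \<phi> x * (indicator Q y * \<phi> y) + (\<phi> x)\<^sup>2 * indicator Q y \<partial>lborel)"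
      by (intro Bochner_Integration.integral_cong refl) (simp add: power2_diff algebra_simps)
    also have "... = M - 2 * \<phi> x * S + (\<phi> x)\<^sup>2 * q"
      using i0 i1 i2 int0 by (simp add: M_def S_def)
    finally show ?thesis .
  qed
  have pos: "0 \<le> M - 2 * \<phi> x * S + (\<phi> x)\<^sup>2 * q" for x
  proof -
    have "M - 2 * \<phi> x * S + (\<phi> x)\<^sup>2 * q = (\<integral>y. indicator Q y * (\<phi> y)\<^sup>2 - 2 * \<phi> x * (indicator Q y * \<phi> y) + (\<phi> x)\<^sup>2 * indicator Q y \<partial>lborel)"
      using i0 i1 i2 int0 by (simp add: M_def S_def)
    also have "... = (\<integral>y. indicator Q y * (\<phi> y - \<phi> x)\<^sup>2 \<partial>lborel)"
      by (intro Bochner_Integration.integral_cong refl) (simp add: power2_diff algebra_simps)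
    also have "0 \<le> ..." by (auto intro!: integral_nonneg_AE)
    finally show ?thesis .
  qed
  have "(\<integral>\<^sup>+x\<in>Q. (\<integral>\<^sup>+y\<in>Q. ennreal ((\<phi> y - \<phi> x)\<^sup>2) \<partial>lborel) \<partial>lborel)
      = ennreal (\<integral>x. indicator Q x * (M - 2 * \<phi> x * S + (\<phi> x)\<^sup>2 * q) \<partial>lborel)"
    unfolding inner using c(1) pos by (intro set_nn_integral_continuous[OF Q(3,2)] continuous_intros) auto
  also have "(\<integral>x. indicator Q x * (M - 2 * \<phi> x * S + (\<phi> x)\<^sup>2 * q) \<partial>lborel)
      = (\<integral>x. M * indicator Q x - 2 * S * (indicator Q x * \<phi> x) + q * (indicator Q x * (\<phi> x)\<^sup>2) \<partial>lborel)"
    by (intro Bochner_Integration.integral_cong refl) (simp add: algebra_simps)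
  also have "... = M * q - 2 * S * S + q * M"
    using i0 i1 i2 int0 by (simp add: M_def S_def)
  finally have "ennreal (M * q - 2 * S * S + q * M) \<le> ennreal (d\<^sup>2) * (2 ^ DIM('a) * ennreal q * ennreal E)"
    using double_difference_le[OF Q(1,2) d C1] unfolding nE q(1) by simp
  also have "... = ennreal (d\<^sup>2 * 2 ^ DIM('a) * q * E)"
    using q E0 by (simp add: ennreal_mult ennreal_power[symmetric] mult.assoc)
  finally have "ennreal (M * q - 2 * S * S + q * M) \<le> ennreal (d\<^sup>2 * 2 ^ DIM('a) * q * E)" .
  then have main: "2 * q * M \<le> 2 * S\<^sup>2 + d\<^sup>2 * 2 ^ DIM('a) * q * E"
  proof -
    have "0 \<le> d\<^sup>2 * 2 ^ DIM('a) * q * E" using q E0 by (intro mult_nonneg_nonneg) auto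
    from ennreal_le_iff[OF this, THEN iffD1, OF \<open>ennreal (M * q - 2 * S * S + q * M) \<le> ennreal (d\<^sup>2 * 2 ^ DIM('a) * q * E)\<close>]
    show ?thesis by (simp add: power2_eq_square algebra_simps)
  qed
  have "M \<le> d\<^sup>2 * 2 ^ DIM('a) * E + S\<^sup>2 / q"
  \<comment> \<open>For a null set the quotient by q is 0 by convention, and so is M.\<close>
  proof (cases "q = 0")
    case True
    have "square_int Q \<phi> = 0"
      using True q(1) Q(2) by (intro nn_integral_null_set) auto
    then have "M = 0" using nM M0 by simp
    then show ?thesis using True E0 by simp
  next
    case False
    then have q0: "0 < q" using q by simp
    have "M \<le> (2 * S\<^sup>2 + d\<^sup>2 * 2 ^ DIM('a) * q * E) / (2 * q)" using main q0 by (simp add: field_simps)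
    also have "... = S\<^sup>2 / q + d\<^sup>2 * 2 ^ DIM('a) * E / 2" using q0 by (simp add: field_simps)
    also have "d\<^sup>2 * 2 ^ DIM('a) * E / 2 \<le> d\<^sup>2 * 2 ^ DIM('a) * E" using E0 by simp
    finally show ?thesis by simp
  qed
  then have "ennreal M \<le> ennreal (d\<^sup>2 * 2 ^ DIM('a) * E + S\<^sup>2 / q)" by (rule ennreal_leI)
  also have "... = ennreal (d\<^sup>2 * 2 ^ DIM('a)) * ennreal E + ennreal (S\<^sup>2 / q)"
    using E0 q by (simp add: ennreal_mult)
  finally show ?thesis unfolding nM nE S_def q_def .
qed

section \<open>Grid cells and an Ehrling inequality in the interior\<close>

text \<open>Rounding down gives half-open cells, which partition the space. Restriction to
  \<open>Basis\<close> makes the index determined by finitely many integers, so that a bounded set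
  meets finitely many cells.\<close>

definition cell_index :: "real \<Rightarrow> 'a::euclidean_space \<Rightarrow> 'a \<Rightarrow> int" where
  "cell_index s x = (\<lambda>b\<in>Basis. \<lfloor>x \<bullet> b / s\<rfloor>)"

definition grid_cell :: "real \<Rightarrow> ('a::euclidean_space \<Rightarrow> int) \<Rightarrow> 'a set" where
  "grid_cell s i = {x. cell_index s x = i}"

lemma grid_cell_eq:
  assumes s: "0 < s"
  shows "grid_cell s (cell_index s x) = (\<Inter>b\<in>Basis. {y. real_of_int \<lfloor>x \<bullet> b / s\<rfloor> * s \<le> b \<bullet> y} \<inter> {y. b \<bullet> y < (real_of_int \<lfloor>x \<bullet> b / s\<rfloor> + 1) * s})"
proof -
  have "\<lfloor>y \<bullet> b / s\<rfloor> = m \<longleftrightarrow> real_of_int m * s \<le> b \<bullet> y \<and> b \<bullet> y < (real_of_int m + 1) * s" for y b :: 'a and m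
    using s by (simp add: floor_eq_iff field_simps inner_commute)
  then show ?thesis
    by (auto simp: grid_cell_def cell_index_def fun_eq_iff restrict_def)
qed

lemma grid_cell_props:
  fixes x :: "'a::euclidean_space"
  assumes s: "0 < s"
  shows "convex (grid_cell s (cell_index s x))" (is ?A)
    and "grid_cell s (cell_index s x) \<in> sets borel" (is ?B)
    and "y \<in> grid_cell s (cell_index s x) \<Longrightarrow> z \<in> grid_cell s (cell_index s x) \<Longrightarrow> norm (z - y) \<le> s * DIM('a)"
    and "bounded (grid_cell s (cell_index s x))" (is ?C)
proof -
  show ?A unfolding grid_cell_eq[OF s]
    by (intro convex_INT convex_Int convex_halfspace_ge convex_halfspace_lt)
  show ?B unfolding grid_cell_eq[OF s]
    by (intro sets.finite_INT sets.Int borel_closed borel_open closed_halfspace_ge open_halfspace_lt finite_Basis) auto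
  show d: "norm (z - y) \<le> s * DIM('a)" if "y \<in> grid_cell s (cell_index s x)" "z \<in> grid_cell s (cell_index s x)" for y z
  proof -
    have "\<bar>(z - y) \<bullet> b\<bar> \<le> s" if b: "b \<in> Basis" for b
    proof -
      let ?m = "real_of_int \<lfloor>x \<bullet> b / s\<rfloor>"
      have "?m * s \<le> b \<bullet> y" "b \<bullet> y < (?m + 1) * s" "?m * s \<le> b \<bullet> z" "b \<bullet> z < (?m + 1) * s"
        using that \<open>y \<in> _\<close> \<open>z \<in> _\<close> b unfolding grid_cell_eq[OF s] by auto
      then have "\<bar>b \<bullet> z - b \<bullet> y\<bar> \<le> s" by (simp add: algebra_simps abs_le_iff)
      then show ?thesis by (simp only: inner_diff_left inner_commute[of z b] inner_commute[of y b])
    qed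
    then have "(\<Sum>b\<in>Basis. \<bar>(z - y) \<bullet> b\<bar>) \<le> (\<Sum>b\<in>(Basis::'a set). s)" by (intro sum_mono)
    then show ?thesis using norm_le_l1[of "z - y"] by (simp add: mult.commute)
  qed
  show ?C
  proof (cases "grid_cell s (cell_index s x) = {}")
    case False
    then obtain y where "y \<in> grid_cell s (cell_index s x)" by auto
    then show ?thesis using d by (intro boundedI[of _ "norm y + s * DIM('a)"]) (smt (verit) norm_triangle_sub)
  qed simp
qed

lemma finite_cell_indices:
  fixes T :: "'a::euclidean_space set"
  assumes "bounded T" "0 < s"
  shows "finite (cell_index s ` T)"
proof -
  obtain R where R: "\<And>x. x \<in> T \<Longrightarrow> norm x \<le> R" using assms(1) by (auto simp: bounded_iff)
  have "cell_index s ` T \<subseteq> (\<Pi>\<^sub>E b\<in>Basis. {\<lfloor>- R / s\<rfloor>..\<lfloor>R / s\<rfloor>})"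
  proof (clarsimp simp: cell_index_def)
    fix x b :: 'a assume "x \<in> T" "b \<in> Basis"
    then have "\<bar>x \<bullet> b\<bar> \<le> R" using Basis_le_norm[of b x] R[of x] by linarith
    then show "\<lfloor>- (R / s)\<rfloor> \<le> \<lfloor>x \<bullet> b / s\<rfloor> \<and> \<lfloor>x \<bullet> b / s\<rfloor> \<le> \<lfloor>R / s\<rfloor>"
      using assms(2) by (intro conjI floor_mono) (auto simp: field_simps)
  qed
  then show ?thesis by (rule finite_subset) (auto intro!: finite_PiE)
qed

text \<open>The Poincare inequality on every cell of a fine grid that meets T: the energy gets a
  factor of the order of the squared cell size, and the means over the finitely many cells
  remain.\<close>

lemma interior_ehrling:
  fixes T \<Omega> :: "'a::euclidean_space set"
  assumes T: "compact T" "T \<subseteq> \<Omega>" and \<Omega>: "open \<Omega>" and \<epsilon>: "0 < \<epsilon>"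
  obtains I :: "'a set set" and c :: real where "finite I" "0 \<le> c"
    "\<And>Q. Q \<in> I \<Longrightarrow> Q \<in> sets borel \<and> bounded Q \<and> Q \<subseteq> \<Omega>"
    "\<And>\<phi> D. C1_with_gradient \<phi> D \<Longrightarrow> (square_int T \<phi>)
      \<le> ennreal \<epsilon> * dirichlet_int \<Omega> D
        + ennreal (c * (\<Sum>Q\<in>I. (\<integral>x. indicator Q x * \<phi> x \<partial>lborel)\<^sup>2))"
proof -
  obtain \<delta> where \<delta>: "0 < \<delta>" "(\<Union>x\<in>T. cball x \<delta>) \<subseteq> \<Omega>"
    using compact_subset_open_imp_cball_epsilon_subset[OF T(1) \<Omega> T(2)] by blast
  \<comment> \<open>The first bound keeps cells that meet T inside \<Omega>, the second makes the
    Poincare constant at most \<epsilon>.\<close>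
  define s where "s = min (\<delta> / DIM('a)) (sqrt (\<epsilon> / 2 ^ DIM('a)) / DIM('a))"
  have s: "0 < s" using \<delta> \<epsilon> by (simp add: s_def)
  have s1: "s * DIM('a) \<le> \<delta>" by (simp add: s_def min_def field_simps)
  have "s * DIM('a) \<le> sqrt (\<epsilon> / 2 ^ DIM('a))" by (simp add: s_def min_def field_simps)
  then have "(s * DIM('a))\<^sup>2 \<le> (sqrt (\<epsilon> / 2 ^ DIM('a)))\<^sup>2" using s by (intro power_mono) auto
  then have s2: "(s * DIM('a))\<^sup>2 * 2 ^ DIM('a) \<le> \<epsilon>" using \<epsilon> by (simp add: field_simps)
  define J where "J = cell_index s ` T"
  have J: "finite J" unfolding J_def using T(1) s by (intro finite_cell_indices compact_imp_bounded)
  define I where "I = grid_cell s ` J"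
  have I: "Q \<in> sets borel \<and> bounded Q \<and> convex Q \<and> Q \<subseteq> \<Omega> \<and> (\<forall>x\<in>Q. \<forall>y\<in>Q. norm (y - x) \<le> s * DIM('a))"
    if Q: "Q \<in> I" for Q
  proof -
    obtain x where x: "x \<in> T" "Q = grid_cell s (cell_index s x)" using Q by (auto simp: I_def J_def)
    have "Q \<subseteq> \<Omega>"
    proof
      fix y assume y: "y \<in> Q"
      have "x \<in> Q" unfolding x(2) by (simp add: grid_cell_def)
      then have "norm (y - x) \<le> s * DIM('a)" using grid_cell_props(3)[OF s] y x(2) by blast
      then have "y \<in> cball x \<delta>" using s1 by (simp add: dist_norm norm_minus_commute)
      then show "y \<in> \<Omega>" using \<delta>(2) x(1) by blast
    qed
    then show ?thesis using grid_cell_props[OF s] unfolding x(2) by blast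
  qed
  have fI: "finite I" using J by (simp add: I_def)
  have disj: "Q = Q'" if "Q \<in> I" "Q' \<in> I" "x \<in> Q" "x \<in> Q'" for Q Q' x
    using that by (auto simp: I_def grid_cell_def)
  have cover: "T \<subseteq> \<Union>I" by (auto simp: I_def J_def grid_cell_def)
  \<comment> \<open>A common bound for the factors 1 / measure of the individual cells; its size is
    irrelevant for compactness.\<close>
  define c where "c = (\<Sum>Q\<in>I. 1 / measure lborel Q)"
  have c0: "0 \<le> c" unfolding c_def by (intro sum_nonneg) auto
  have "square_int T \<phi>
      \<le> ennreal \<epsilon> * dirichlet_int \<Omega> D
        + ennreal (c * (\<Sum>Q\<in>I. (\<integral>x. indicator Q x * \<phi> x \<partial>lborel)\<^sup>2))" if C1: "C1_with_gradient \<phi> D" for \<phi> D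
  proof -
    have [measurable]: "(\<lambda>x. ennreal ((norm (D x))\<^sup>2)) \<in> borel_measurable borel" "\<phi> \<in> borel_measurable borel"
      using C1_energy_measurable[OF C1] C1_measurable[OF C1] by auto
    have [measurable]: "Q \<in> sets borel" if "Q \<in> I" for Q using I[OF that] by simp
    let ?lf = "\<lambda>Q. (\<integral>x. indicator Q x * \<phi> x \<partial>lborel)\<^sup>2"
    have "square_int T \<phi> \<le> (\<integral>\<^sup>+x. (\<Sum>Q\<in>I. ennreal ((\<phi> x)\<^sup>2) * indicator Q x) \<partial>lborel)"
    proof (rule nn_integral_mono)
      fix x
      show "ennreal ((\<phi> x)\<^sup>2) * indicator T x \<le> (\<Sum>Q\<in>I. ennreal ((\<phi> x)\<^sup>2) * indicator Q x)"
      proof (cases "x \<in> T")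
        case True
        then obtain Q where "Q \<in> I" "x \<in> Q" using cover by auto
        then show ?thesis using member_le_sum[of Q I "\<lambda>Q. ennreal ((\<phi> x)\<^sup>2) * indicator Q x"] fI True by simp
      qed simp
    qed
    also have "... = (\<Sum>Q\<in>I. square_int Q \<phi>)"
      by (rule nn_integral_sum) measurable
    also have "... \<le> (\<Sum>Q\<in>I. ennreal \<epsilon> * dirichlet_int Q D + ennreal (c * ?lf Q))"
    proof (rule sum_mono)
      fix Q assume Q: "Q \<in> I"
      have "square_int Q \<phi>
        \<le> ennreal ((s * DIM('a))\<^sup>2 * 2 ^ DIM('a)) * dirichlet_int Q D + ennreal (?lf Q / measure lborel Q)"
        using I[OF Q] by (intro poincare[OF _ _ _ _ C1]) auto
      also have "... \<le> ennreal \<epsilon> * dirichlet_int Q D + ennreal (c * ?lf Q)"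
      proof (intro add_mono mult_right_mono ennreal_leI s2)
        have "1 / measure lborel Q \<le> c"
          unfolding c_def using Q fI by (intro member_le_sum) auto
        then have "(1 / measure lborel Q) * ?lf Q \<le> c * ?lf Q" by (rule mult_right_mono) simp
        then show "?lf Q / measure lborel Q \<le> c * ?lf Q" by simp
      qed auto
      finally show "square_int Q \<phi> \<le> ennreal \<epsilon> * dirichlet_int Q D + ennreal (c * ?lf Q)" .
    qed
    also have "... = ennreal \<epsilon> * (\<Sum>Q\<in>I. dirichlet_int Q D) + ennreal (c * (\<Sum>Q\<in>I. ?lf Q))"
      using c0 by (simp add: sum.distrib sum_distrib_left sum_nonneg)
    also have "(\<Sum>Q\<in>I. dirichlet_int Q D) = (\<integral>\<^sup>+x. (\<Sum>Q\<in>I. ennreal ((norm (D x))\<^sup>2) * indicator Q x) \<partial>lborel)"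
      by (rule nn_integral_sum[symmetric]) measurable
    also have "... \<le> dirichlet_int \<Omega> D"
    proof (rule nn_integral_mono)
      fix x
      show "(\<Sum>Q\<in>I. ennreal ((norm (D x))\<^sup>2) * indicator Q x) \<le> ennreal ((norm (D x))\<^sup>2) * indicator \<Omega> x"
      proof (cases "x \<in> \<Union>I")
        case True
        then obtain Q where Q: "Q \<in> I" "x \<in> Q" by auto
        have "(\<Sum>Q'\<in>I. ennreal ((norm (D x))\<^sup>2) * indicator Q' x) = (\<Sum>Q'\<in>I. if Q' = Q then ennreal ((norm (D x))\<^sup>2) else 0)"
          using Q disj by (intro sum.cong) (auto simp: indicator_def)
        also have "... = ennreal ((norm (D x))\<^sup>2)" using Q fI by simp
        finally have "(\<Sum>Q'\<in>I. ennreal ((norm (D x))\<^sup>2) * indicator Q' x) = ennreal ((norm (D x))\<^sup>2)" .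
        moreover have "x \<in> \<Omega>" using Q I by blast
        ultimately show ?thesis by simp
      next
        case False
        then have "(\<Sum>Q\<in>I. ennreal ((norm (D x))\<^sup>2) * indicator Q x) = 0" by (intro sum.neutral) auto
        then show ?thesis by simp
      qed
    qed
    finally show ?thesis by (simp add: mult_left_mono add_right_mono)
  qed
  then show ?thesis using that[of I c] fI c0 I by blast
qed

section \<open>Lipschitz charts and the trace inequality\<close>

text \<open>The two geometric facts wanted from a chart: the boundary near p is a Lipschitz graph,
  and short segments upwards from it enter \<Omega>. Radius and height r / 4 together stay inside
  the ball of radius r in which the chart describes \<Omega>.\<close>

lemma lipschitz_domain_chart:
  fixes \<Omega> :: "'a::euclidean_space set"
  assumes \<Omega>: "open \<Omega>" and r: "0 < r" and e: "norm e = 1" and lip: "lipschitz_on L {y. y \<bullet> e = 0} \<gamma>"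
    and eq: "\<Omega> \<inter> ball p r = {x \<in> ball p r. \<gamma> (x - (x \<bullet> e) *\<^sub>R e) < x \<bullet> e}"
  shows "0 \<le> L" "flat_over L e (frontier \<Omega> \<inter> cball p (r / 4))"
    "\<And>y t. y \<in> frontier \<Omega> \<inter> cball p (r / 4) \<Longrightarrow> 0 < t \<Longrightarrow> t \<le> r / 4 \<Longrightarrow> y + t *\<^sub>R e \<in> \<Omega>"
proof -
  show L: "0 \<le> L" using lip by (rule lipschitz_on_nonneg)
  have ee: "e \<bullet> e = 1" using e by (simp add: dot_square_norm)
  define G where "G x = \<gamma> (x - (x \<bullet> e) *\<^sub>R e)" for x
  have GL: "\<bar>G x - G y\<bar> \<le> L * norm ((x - y) - ((x - y) \<bullet> e) *\<^sub>R e)" for x y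
  proof -
    have "dist (G x) (G y) \<le> L * dist (x - (x \<bullet> e) *\<^sub>R e) (y - (y \<bullet> e) *\<^sub>R e)"
      unfolding G_def by (rule lipschitz_onD[OF lip]) (auto simp: inner_diff_left ee)
    moreover have "(x - (x \<bullet> e) *\<^sub>R e) - (y - (y \<bullet> e) *\<^sub>R e) = (x - y) - ((x - y) \<bullet> e) *\<^sub>R e"
      by (simp add: inner_diff_left algebra_simps)
    ultimately show ?thesis by (simp add: dist_norm)
  qed
  have "\<bar>G x - G y\<bar> \<le> L * norm (x - y)" for x y
    using order_trans[OF GL mult_left_mono[OF norm_orth_le[OF e] L]] .
  then have "lipschitz_on L UNIV G" using L by (intro lipschitz_onI) (auto simp: dist_norm)
  then have Gc: "continuous_on UNIV G" by (rule lipschitz_on_continuous_on)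
  \<comment> \<open>A boundary point is a limit of points above the graph, and it is not itself
    above it because \<Omega> is open.\<close>
  have graph: "G x = x \<bullet> e" if x: "x \<in> frontier \<Omega>" "x \<in> ball p r" for x
  proof (rule antisym)
    have cl: "closed {x. G x \<le> x \<bullet> e}" by (intro closed_Collect_le Gc continuous_intros)
    have "x \<in> closure \<Omega> \<inter> ball p r" using x by (auto simp: frontier_def)
    then have "x \<in> closure (\<Omega> \<inter> ball p r)" using open_Int_closure_subset[of "ball p r" \<Omega>] by (auto simp: Int_commute)
    also have "... \<subseteq> closure {x. G x \<le> x \<bullet> e}" unfolding eq by (intro closure_mono) (auto simp: G_def)
    also have "... = {x. G x \<le> x \<bullet> e}" using cl by (rule closure_closed)
    finally show "G x \<le> x \<bullet> e" by simp
    have "x \<notin> \<Omega>" using x(1) \<Omega> by (simp add: frontier_def interior_open)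
    then have "x \<notin> \<Omega> \<inter> ball p r" by simp
    then show "x \<bullet> e \<le> G x" using x(2) unfolding eq by (simp add: G_def)
  qed
  have sub: "cball p (r / 4) \<subseteq> ball p r" using r by (intro cball_subset_ball_iff[THEN iffD2]) auto
  show "flat_over L e (frontier \<Omega> \<inter> cball p (r / 4))"
    unfolding flat_over_def
  proof (intro ballI)
    fix x y assume "x \<in> frontier \<Omega> \<inter> cball p (r / 4)" "y \<in> frontier \<Omega> \<inter> cball p (r / 4)"
    then have "G x = x \<bullet> e" "G y = y \<bullet> e" using graph sub by auto
    then show "\<bar>(x - y) \<bullet> e\<bar> \<le> L * norm (x - y - ((x - y) \<bullet> e) *\<^sub>R e)"
      using GL[of x y] by (simp add: inner_diff_left)
  qed
  fix y t assume y: "y \<in> frontier \<Omega> \<inter> cball p (r / 4)" and t: "0 < t" "t \<le> r / 4"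
  have "norm (t *\<^sub>R e) \<le> r / 4" using t e by simp
  moreover have "norm (y - p) \<le> r / 4" using y by (simp add: dist_norm norm_minus_commute)
  ultimately have "norm (y - p + t *\<^sub>R e) \<le> r / 4 + r / 4" by (intro norm_triangle_mono)
  then have "norm (p - (y + t *\<^sub>R e)) < r" using r by (simp add: norm_minus_commute algebra_simps)
  then have b: "y + t *\<^sub>R e \<in> ball p r" by (simp add: dist_norm)
  have "y + t *\<^sub>R e - ((y + t *\<^sub>R e) \<bullet> e) *\<^sub>R e = y - (y \<bullet> e) *\<^sub>R e"
    by (simp add: inner_add_left ee algebra_simps)
  then have "G (y + t *\<^sub>R e) = G y" unfolding G_def by (simp only:)
  also have "... = y \<bullet> e" using graph[of y] y sub by auto
  also have "... < (y + t *\<^sub>R e) \<bullet> e" using t by (simp add: inner_add_left ee)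
  finally have "y + t *\<^sub>R e \<in> {x \<in> ball p r. \<gamma> (x - (x \<bullet> e) *\<^sub>R e) < x \<bullet> e}" using b by (simp add: G_def)
  then show "y + t *\<^sub>R e \<in> \<Omega>" unfolding eq[symmetric] by simp
qed

text \<open>\<open>trace_le_tube\<close> on finitely many charts. The tubes form a compact subset T
  of \<Omega> at height of order h, and the energy carries the factor h. Taking h small makes the
  energy term small and leaves only an interior integral.\<close>

lemma lipschitz_trace:
  fixes \<Omega> :: "'a::euclidean_space set"
  assumes n: "2 \<le> DIM('a)" and \<Omega>: "bounded_lipschitz_domain \<Omega>"
  obtains C h0 where "0 < C" "0 < h0"
    "\<And>h. 0 < h \<Longrightarrow> h \<le> h0 \<Longrightarrow> \<exists>T. compact T \<and> T \<subseteq> \<Omega> \<and> (\<forall>\<phi> D. C1_with_gradient \<phi> D \<longrightarrow>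
      surface_int (frontier \<Omega>) \<phi>
        \<le> ennreal (C / h) * square_int T \<phi>
          + ennreal (C * h) * dirichlet_int \<Omega> D)"
proof -
  have op: "open \<Omega>" and bd: "bounded \<Omega>" using \<Omega> by (auto simp: bounded_lipschitz_domain_def)
  have cpt: "compact (frontier \<Omega>)" using bd by (rule compact_frontier_bounded)
  let ?H = "hausdorff_measure (DIM('a) - 1) :: 'a measure"
  define chart where "chart p r e L \<longleftrightarrow> 0 < r \<and> norm e = 1 \<and> 0 \<le> L \<and> flat_over L e (frontier \<Omega> \<inter> cball p (r / 4)) \<and>
      (\<forall>y t. y \<in> frontier \<Omega> \<inter> cball p (r / 4) \<longrightarrow> 0 < t \<longrightarrow> t \<le> r / 4 \<longrightarrow> y + t *\<^sub>R e \<in> \<Omega>)" for p r e L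
  have "\<forall>p\<in>frontier \<Omega>. \<exists>r e L. chart p r e L"
  proof
    fix p assume "p \<in> frontier \<Omega>"
    then have "\<exists>r>0. \<exists>e L. \<exists>\<gamma> :: 'a \<Rightarrow> real. norm e = 1 \<and> lipschitz_on L {y. y \<bullet> e = 0} \<gamma> \<and>
        \<Omega> \<inter> ball p r = {x \<in> ball p r. \<gamma> (x - (x \<bullet> e) *\<^sub>R e) < x \<bullet> e}"
      using \<Omega> by (simp add: bounded_lipschitz_domain_def)
    then obtain r e L and \<gamma> :: "'a \<Rightarrow> real" where g: "0 < r" "norm e = 1" "lipschitz_on L {y. y \<bullet> e = 0} \<gamma>"
      "\<Omega> \<inter> ball p r = {x \<in> ball p r. \<gamma> (x - (x \<bullet> e) *\<^sub>R e) < x \<bullet> e}"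
      by blast
    note ch = lipschitz_domain_chart[OF op g]
    show "\<exists>r e L. chart p r e L"
      using g(1,2) ch unfolding chart_def by (intro exI[of _ r] exI[of _ e] exI[of _ L]) auto
  qed
  then obtain r e L where "\<And>p. p \<in> frontier \<Omega> \<Longrightarrow> chart p (r p) (e p) (L p)" by metis
  then have ch: "\<And>p. p \<in> frontier \<Omega> \<Longrightarrow> 0 < r p" "\<And>p. p \<in> frontier \<Omega> \<Longrightarrow> norm (e p) = 1"
    "\<And>p. p \<in> frontier \<Omega> \<Longrightarrow> 0 \<le> L p" "\<And>p. p \<in> frontier \<Omega> \<Longrightarrow> flat_over (L p) (e p) (frontier \<Omega> \<inter> cball p (r p / 4))"
    "\<And>p y t. p \<in> frontier \<Omega> \<Longrightarrow> y \<in> frontier \<Omega> \<inter> cball p (r p / 4) \<Longrightarrow> 0 < t \<Longrightarrow> t \<le> r p / 4 \<Longrightarrow> y + t *\<^sub>R e p \<in> \<Omega>"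
    unfolding chart_def by blast+
  have "frontier \<Omega> \<subseteq> (\<Union>p\<in>frontier \<Omega>. ball p (r p / 4))" using ch(1) by auto
  then obtain P where P: "P \<subseteq> frontier \<Omega>" "finite P" "frontier \<Omega> \<subseteq> (\<Union>p\<in>P. ball p (r p / 4))"
    using compactE_image[OF cpt, of "frontier \<Omega>" "\<lambda>p. ball p (r p / 4)"] by auto
  \<comment> \<open>The bound r p / 8 keeps the tube height 2 h below r p / 4; the element 1 makes
    the minimum meaningful for every P.\<close>
  define h0 where "h0 = Min (insert 1 ((\<lambda>p. r p / 8) ` P))"
  have h0: "0 < h0" unfolding h0_def using P ch(1) by (subst Min_gr_iff) auto
  have h0r: "h0 \<le> r p / 8" if "p \<in> P" for p unfolding h0_def using P(2) that by (intro Min_le) auto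
  \<comment> \<open>The factor 8 dominates both coefficients 2 and 8 of
    \<open>trace_le_tube\<close>; the added 1 makes C positive whatever P is.\<close>
  define C where "C = 8 * (\<Sum>p\<in>P. graph_const (DIM('a)) (L p)) + 1"
  have gc: "0 < graph_const (DIM('a)) (L p)" if "p \<in> P" for p using ch(3) P(1) that by (intro graph_const_pos) auto
  have sgc: "0 \<le> (\<Sum>p\<in>P. graph_const (DIM('a)) (L p))" using gc by (intro sum_nonneg) (auto intro: less_imp_le)
  have C: "0 < C" using sgc by (simp add: C_def)
  have "\<exists>T. compact T \<and> T \<subseteq> \<Omega> \<and> (\<forall>\<phi> D. C1_with_gradient \<phi> D \<longrightarrow>
      surface_int (frontier \<Omega>) \<phi>
        \<le> ennreal (C / h) * square_int T \<phi>
          + ennreal (C * h) * dirichlet_int \<Omega> D)" if h: "0 < h" "h \<le> h0" for h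
  proof -
    let ?K = "\<lambda>p. frontier \<Omega> \<inter> cball p (r p / 4)"
    have Kc: "compact (?K p)" for p using cpt by (intro compact_Int_closed) auto
    define T where "T = (\<Union>p\<in>P. tube (e p) h (2 * h) (?K p))"
    have Tc: "compact T" unfolding T_def using P(2) Kc by (intro compact_UN compact_tube)
    have abv: "y + t *\<^sub>R e p \<in> \<Omega>" if "p \<in> P" "y \<in> ?K p" "0 < t" "t \<le> 2 * h" for p y t
      using ch(5)[of p y t] that P(1) h0r[of p] h by auto
    have TO: "T \<subseteq> \<Omega>" unfolding T_def tube_def using abv h by (auto simp: subset_iff)
    have "surface_int (frontier \<Omega>) \<phi>
        \<le> ennreal (C / h) * square_int T \<phi>
          + ennreal (C * h) * dirichlet_int \<Omega> D" if C1: "C1_with_gradient \<phi> D" for \<phi> D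
    proof -
      let ?IT = "square_int T \<phi>" and ?E = "dirichlet_int \<Omega> D"
      have [measurable]: "\<phi> \<in> borel_measurable borel" using C1_measurable[OF C1] .
      have [measurable]: "?K p \<in> sets borel" for p using Kc[of p] by (rule borel_compact)
      have "surface_int (frontier \<Omega>) \<phi> \<le> (\<integral>\<^sup>+y. (\<Sum>p\<in>P. ennreal ((\<phi> y)\<^sup>2) * indicator (?K p) y) \<partial>?H)"
      proof (rule nn_integral_mono)
        fix y
        show "ennreal ((\<phi> y)\<^sup>2) * indicator (frontier \<Omega>) y \<le> (\<Sum>p\<in>P. ennreal ((\<phi> y)\<^sup>2) * indicator (?K p) y)"
        proof (cases "y \<in> frontier \<Omega>")
          case True
          then obtain p where p: "p \<in> P" "y \<in> ball p (r p / 4)" using P(3) by auto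
          then have "y \<in> ?K p" using True by auto
          then show ?thesis
            using member_le_sum[of p P "\<lambda>p. ennreal ((\<phi> y)\<^sup>2) * indicator (?K p) y"] p P(2) True by simp
        qed simp
      qed
      also have "... = (\<Sum>p\<in>P. surface_int (?K p) \<phi>)"
        by (rule nn_integral_sum) measurable
      also have "... \<le> (\<Sum>p\<in>P. ennreal (graph_const (DIM('a)) (L p)) * (ennreal (8 / h) * ?IT + ennreal (8 * h) * ?E))"
      proof (rule sum_mono)
        fix p assume p: "p \<in> P"
        then have pf: "p \<in> frontier \<Omega>" using P(1) by auto
        have "surface_int (?K p) \<phi>
          \<le> ennreal (graph_const (DIM('a)) (L p) / h) *
            (2 * square_int (tube (e p) h (2 * h) (?K p)) \<phi> + ennreal (8 * h\<^sup>2) * ?E)"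
          by (rule trace_le_tube[OF n ch(2,3)[OF pf] Kc ch(4)[OF pf] h(1) C1 _ abv[OF p]]) (use op in auto)
        also have "... \<le> ennreal (graph_const (DIM('a)) (L p) / h) * (ennreal 8 * ?IT + ennreal (8 * h\<^sup>2) * ?E)"
        proof (intro mult_left_mono add_right_mono)
          have "square_int (tube (e p) h (2 * h) (?K p)) \<phi> \<le> ?IT"
            using p by (intro nn_integral_mono) (auto simp: indicator_def T_def)
          then show "2 * square_int (tube (e p) h (2 * h) (?K p)) \<phi> \<le> ennreal 8 * ?IT"
            by (intro mult_mono) auto
        qed auto
        also have "... = ennreal (graph_const (DIM('a)) (L p)) * (ennreal (8 / h) * ?IT + ennreal (8 * h) * ?E)"
        proof -
          have 1: "ennreal (graph_const (DIM('a)) (L p) / h) = ennreal (graph_const (DIM('a)) (L p)) * ennreal (1 / h)"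
            using gc[OF p] h by (subst ennreal_mult[symmetric]) auto
          have 2: "ennreal (1 / h) * ennreal 8 = ennreal (8 / h)" "ennreal (1 / h) * ennreal (8 * h\<^sup>2) = ennreal (8 * h)"
            by (rule trans[OF ennreal_mult[symmetric]]; use h in \<open>auto simp: power2_eq_square\<close>)+
          show ?thesis unfolding 1 by (simp only: mult.assoc distrib_left 2[symmetric])
        qed
        finally show "surface_int (?K p) \<phi>
          \<le> ennreal (graph_const (DIM('a)) (L p)) * (ennreal (8 / h) * ?IT + ennreal (8 * h) * ?E)" .
      qed
      also have "... = ennreal (\<Sum>p\<in>P. graph_const (DIM('a)) (L p)) * (ennreal (8 / h) * ?IT + ennreal (8 * h) * ?E)"
      proof -
        have "ennreal (\<Sum>p\<in>P. graph_const (DIM('a)) (L p)) = (\<Sum>p\<in>P. ennreal (graph_const (DIM('a)) (L p)))"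
          by (rule sum_ennreal[symmetric]) (use gc in \<open>auto intro: less_imp_le\<close>)
        then show ?thesis by (simp only: sum_distrib_right)
      qed
      also have "... = ennreal ((\<Sum>p\<in>P. graph_const (DIM('a)) (L p)) * (8 / h)) * ?IT + ennreal ((\<Sum>p\<in>P. graph_const (DIM('a)) (L p)) * (8 * h)) * ?E"
      proof -
        let ?S = "\<Sum>p\<in>P. graph_const (DIM('a)) (L p)"
        have "ennreal ?S * ennreal (8 / h) = ennreal (?S * (8 / h))" "ennreal ?S * ennreal (8 * h) = ennreal (?S * (8 * h))"
          using sgc h by (intro ennreal_mult[symmetric]; simp)+
        then show ?thesis by (simp only: distrib_left mult.assoc[symmetric])
      qed
      also have "... \<le> ennreal (C / h) * ?IT + ennreal (C * h) * ?E"
      proof (intro add_mono mult_right_mono ennreal_leI)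
        show "(\<Sum>p\<in>P. graph_const (DIM('a)) (L p)) * (8 / h) \<le> C / h"
          using h by (simp add: C_def divide_right_mono)
        have "(8 * (\<Sum>p\<in>P. graph_const (DIM('a)) (L p))) * h \<le> C * h"
          using h by (intro mult_right_mono) (auto simp: C_def)
        then show "(\<Sum>p\<in>P. graph_const (DIM('a)) (L p)) * (8 * h) \<le> C * h" by (simp add: ac_simps)
      qed auto
      finally show ?thesis .
    qed
    then show ?thesis using Tc TO by (intro exI[of _ T]) auto
  qed
  then show ?thesis using that[OF C h0] by blast
qed

subsection \<open>Isoperimetry and test functions\<close>

text \<open>Averaging over all translations \<open>z\<close> of length at most \<open>\<rho>\<close>: every pair \<open>x\<close>, \<open>x + z\<close> separated by
  \<open>A\<close> has \<open>x\<close> in the sweep of \<open>A\<close>.\<close>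

lemma crossing_pairs:
  fixes A E F :: "'a::euclidean_space set"
  assumes n: "2 \<le> DIM('a)" and \<rho>: "0 \<le> \<rho>" and A: "compact A" and E: "E \<in> sets borel" and F: "F \<in> sets borel"
    and EF: "E \<inter> F = {}"
    and cross: "\<And>x y. x \<in> E \<Longrightarrow> y \<in> F \<Longrightarrow> norm (y - x) \<le> \<rho> \<Longrightarrow> \<exists>t\<in>{0..1}. x + t *\<^sub>R (y - x) \<in> A"
  shows "(\<integral>\<^sup>+x\<in>E. emeasure lborel (F \<inter> cball x \<rho>) \<partial>lborel)
    \<le> ennreal (unit_ball_vol (DIM('a)) * \<rho> ^ DIM('a)) * (ennreal (proj_const (DIM('a)) * \<rho>) * emeasure (hausdorff_measure (DIM('a) - 1)) A)"
proof -
  note [measurable] = E F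
  have [measurable]: "cball (0 :: 'a) \<rho> \<in> sets borel" by simp
  let ?H = "emeasure (hausdorff_measure (DIM('a) - 1)) A"
  let ?f = "\<lambda>x z. (indicator E x * indicator F (z + x) * indicator (cball 0 \<rho>) z :: ennreal)"
  have "(\<integral>\<^sup>+x\<in>E. emeasure lborel (F \<inter> cball x \<rho>) \<partial>lborel) = (\<integral>\<^sup>+x. (\<integral>\<^sup>+z. ?f x z \<partial>lborel) \<partial>lborel)"
  proof (rule nn_integral_cong)
    fix x :: 'a
    have "emeasure lborel (F \<inter> cball x \<rho>) = (\<integral>\<^sup>+y. indicator F y * indicator (cball x \<rho>) y \<partial>lborel)"
    proof -
      have "(\<integral>\<^sup>+y. indicator F y * indicator (cball x \<rho>) y \<partial>lborel) = (\<integral>\<^sup>+y. indicator (F \<inter> cball x \<rho>) y \<partial>lborel)"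
        by (intro nn_integral_cong) (auto simp: indicator_def)
      then show ?thesis by simp
    qed
    also have "... = (\<integral>\<^sup>+z. indicator F (z + x) * indicator (cball x \<rho>) (z + x) \<partial>lborel)"
    proof (rule nn_integral_lborel_shift[symmetric])
      show "(\<lambda>y. indicator F y * indicator (cball x \<rho>) y :: ennreal) \<in> borel_measurable borel"
        using F by (intro borel_measurable_times_ennreal borel_measurable_indicator) auto
    qed
    also have "... = (\<integral>\<^sup>+z. indicator F (z + x) * indicator (cball 0 \<rho>) z \<partial>lborel)"
      by (intro nn_integral_cong) (auto simp: indicator_def dist_norm)
    finally have "emeasure lborel (F \<inter> cball x \<rho>) = (\<integral>\<^sup>+z. indicator F (z + x) * indicator (cball 0 \<rho>) z \<partial>lborel)" .
    then show "emeasure lborel (F \<inter> cball x \<rho>) * indicator E x = (\<integral>\<^sup>+z. ?f x z \<partial>lborel)"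
      by (cases "x \<in> E") (auto simp: mult.assoc)
  qed
  also have "... = (\<integral>\<^sup>+z. (\<integral>\<^sup>+x. ?f x z \<partial>lborel) \<partial>lborel)"
    by (intro lborel_pair.Fubini') measurable
  also have "... \<le> (\<integral>\<^sup>+z. (ennreal (proj_const (DIM('a)) * \<rho>) * ?H) * indicator (cball 0 \<rho>) (z :: 'a) \<partial>lborel)"
  proof (rule nn_integral_mono)
    fix z :: 'a
    show "(\<integral>\<^sup>+x. ?f x z \<partial>lborel) \<le> (ennreal (proj_const (DIM('a)) * \<rho>) * ?H) * indicator (cball 0 \<rho>) z"
    proof (cases "norm z \<le> \<rho> \<and> z \<noteq> 0")
      case True
      have "(\<integral>\<^sup>+x. ?f x z \<partial>lborel) \<le> (\<integral>\<^sup>+x. indicator (sweep z A) x \<partial>lborel)"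
      proof (rule nn_integral_mono)
        fix x
        show "?f x z \<le> indicator (sweep z A) x"
          using cross[of x "z + x"] True by (auto simp: indicator_def sweep_def)
      qed
      also have "... = emeasure lborel (sweep z A)"
        using compact_sweep[OF A, of z] by (intro nn_integral_indicator) (auto intro: borel_compact)
      also have "... \<le> ennreal (proj_const (DIM('a)) * norm z) * ?H"
        using emeasure_sweep_le[OF n A, of z] True by auto
      also have "... \<le> ennreal (proj_const (DIM('a)) * \<rho>) * ?H"
        using True proj_const_pos[of "DIM('a)"] by (intro mult_right_mono ennreal_leI mult_left_mono) auto
      finally show ?thesis using True by simp
    next
      case False
      have "?f x z = 0" for x
      proof (cases "z = 0")
        case True
        then show ?thesis using EF by (auto simp: indicator_def)
      next
        case z: False
        then show ?thesis using False by (auto simp: indicator_def)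
      qed
      then have "(\<integral>\<^sup>+x. ?f x z \<partial>lborel) = 0" by (simp only: nn_integral_const) simp
      then show ?thesis by simp
    qed
  qed
  also have "... = ennreal (unit_ball_vol (DIM('a)) * \<rho> ^ DIM('a)) * (ennreal (proj_const (DIM('a)) * \<rho>) * ?H)"
    using \<rho> by (subst nn_integral_cmult_indicator) (auto simp: emeasure_cball mult.commute)
  finally show ?thesis .
qed

lemma frontier_crossing:
  fixes \<Omega> :: "'a::euclidean_space set"
  assumes "open \<Omega>" "x \<in> \<Omega> \<inter> cball q s" "y \<in> cball q s - \<Omega>"
  shows "\<exists>t\<in>{0..1}. x + t *\<^sub>R (y - x) \<in> frontier \<Omega> \<inter> cball q s"
proof -
  have "x + (y - x) \<notin> \<Omega>" using assms by simp
  then obtain t where t: "0 < t" "t \<le> 1" "x + t *\<^sub>R (y - x) \<in> frontier \<Omega>"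
    using exists_exit_point[of \<Omega> x "y - x"] assms by auto
  have "(1 - t) *\<^sub>R x + t *\<^sub>R y \<in> cball q s"
    using assms t by (intro convexD[OF convex_cball]) auto
  then have "x + t *\<^sub>R (y - x) \<in> cball q s" by (simp add: algebra_simps)
  then show ?thesis using t by (intro bexI[of _ t]) auto
qed

section \<open>Relative isoperimetric inequalities and the choice of balls\<close>

definition inner_volume :: "'a::euclidean_space set \<Rightarrow> 'a \<Rightarrow> real \<Rightarrow> real" where
  "inner_volume \<Omega> q s = measure lborel (\<Omega> \<inter> cball q s)"

definition boundary_area :: "'a::euclidean_space set \<Rightarrow> 'a \<Rightarrow> real \<Rightarrow> ennreal" where
  "boundary_area \<Omega> q s = emeasure (hausdorff_measure (DIM('a) - 1)) (frontier \<Omega> \<inter> cball q s)"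

lemma emeasure_inner_volume:
  fixes \<Omega> :: "'a::euclidean_space set"
  shows "emeasure lborel (\<Omega> \<inter> cball q s) = ennreal (inner_volume \<Omega> q s)"
  using emeasure_bounded_finite[of "\<Omega> \<inter> cball q s"] by (simp add: inner_volume_def emeasure_eq_ennreal_measure less_top bounded_Int)

lemma inner_volume_nonneg: "0 \<le> inner_volume \<Omega> q s" by (simp add: inner_volume_def)

lemma inner_volume_mono:
  fixes \<Omega> :: "'a::euclidean_space set"
  assumes "open \<Omega>" "cball q s \<subseteq> cball q' s'"
  shows "inner_volume \<Omega> q s \<le> inner_volume \<Omega> q' s'"
proof -
  have "ennreal (inner_volume \<Omega> q s) \<le> ennreal (inner_volume \<Omega> q' s')"
    unfolding emeasure_inner_volume[symmetric] using assms by (intro emeasure_mono) auto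
  then show ?thesis using inner_volume_nonneg[of \<Omega> q' s'] by (simp add: ennreal_le_iff)
qed

lemma inner_volume_le_ball:
  fixes \<Omega> :: "'a::euclidean_space set"
  assumes "open \<Omega>" "0 \<le> s"
  shows "inner_volume \<Omega> q s \<le> unit_ball_vol (DIM('a)) * s ^ DIM('a)"
proof -
  have "ennreal (inner_volume \<Omega> q s) \<le> emeasure lborel (cball q s)"
    unfolding emeasure_inner_volume[symmetric] using assms by (intro emeasure_mono) auto
  then show ?thesis using assms by (simp add: emeasure_cball ennreal_le_iff)
qed

lemma outer_volume:
  fixes \<Omega> :: "'a::euclidean_space set"
  assumes "open \<Omega>" "0 \<le> s"
  shows "emeasure lborel (cball q s - \<Omega>) = ennreal (unit_ball_vol (DIM('a)) * s ^ DIM('a) - inner_volume \<Omega> q s)"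
proof -
  have "emeasure lborel (cball q s - (\<Omega> \<inter> cball q s)) = emeasure lborel (cball q s) - emeasure lborel (\<Omega> \<inter> cball q s)"
    using assms by (intro emeasure_Diff) (auto simp: emeasure_inner_volume)
  moreover have "cball q s - (\<Omega> \<inter> cball q s) = cball q s - \<Omega>" by auto
  ultimately have "emeasure lborel (cball q s - \<Omega>) = emeasure lborel (cball q s) - emeasure lborel (\<Omega> \<inter> cball q s)"
    by simp
  then show ?thesis using assms inner_volume_nonneg[of \<Omega> q s]
    by (simp add: emeasure_inner_volume emeasure_cball ennreal_minus)
qed

lemma ennreal_two_halves: "0 < w \<Longrightarrow> 0 \<le> v \<Longrightarrow> ennreal (2 / w) * (ennreal v * ennreal (w / 2)) = ennreal v"
  by (simp add: ennreal_mult[symmetric])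

lemma ennreal_scale_le:
  assumes "0 \<le> k" "0 \<le> c" "ennreal x \<le> ennreal c * H"
  shows "ennreal (k * x) \<le> ennreal (k * c) * H"
  using mult_left_mono[OF assms(3), of "ennreal k"] assms(1,2) by (simp add: ennreal_mult' ennreal_mult mult.assoc)

text \<open>A ball of radius \<rho> around a point of the half ball stays in the ball of radius s,
  and at least half of it lies outside \<Omega>. So every point of \<Omega> in the half ball takes
  part in many crossing pairs at distance at most \<rho>, which gives the gain of a factor \<rho>
  instead of s.\<close>

lemma isoperimetric_small:
  fixes \<Omega> :: "'a::euclidean_space set"
  assumes n: "2 \<le> DIM('a)" and \<Omega>: "open \<Omega>" "bounded \<Omega>" and \<rho>: "0 < \<rho>" "\<rho> \<le> s / 2"
    and small: "2 * inner_volume \<Omega> q s \<le> unit_ball_vol (DIM('a)) * \<rho> ^ DIM('a)"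
  shows "ennreal (inner_volume \<Omega> q (s / 2)) \<le> ennreal (2 * proj_const (DIM('a)) * \<rho>) * boundary_area \<Omega> q s"
proof -
  let ?w = "unit_ball_vol (DIM('a)) * \<rho> ^ DIM('a)" and ?A = "frontier \<Omega> \<inter> cball q s"
  have w0: "0 < ?w" using \<rho> by simp
  have s0: "0 \<le> s" using \<rho> by simp
  have K: "compact ?A" using \<Omega>(2) by (intro compact_Int_closed compact_frontier_bounded) auto
  have sub: "cball q (s / 2) \<subseteq> cball q s" using s0 by (intro subset_cball) auto
  have lower: "ennreal (?w / 2) \<le> emeasure lborel ((cball q s - \<Omega>) \<inter> cball x \<rho>)" if x: "x \<in> \<Omega> \<inter> cball q (s / 2)" for x
  proof -
    have xs: "cball x \<rho> \<subseteq> cball q s"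
    proof
      fix y assume "y \<in> cball x \<rho>"
      then show "y \<in> cball q s" using x \<rho>(2) dist_triangle[of q y x] by (auto simp: dist_commute)
    qed
    have "?w / 2 \<le> ?w - inner_volume \<Omega> x \<rho>"
      using small inner_volume_mono[OF \<Omega>(1) xs] by simp
    then have "ennreal (?w / 2) \<le> emeasure lborel (cball x \<rho> - \<Omega>)"
      using \<rho> by (subst outer_volume[OF \<Omega>(1)]) (auto intro: ennreal_leI)
    also have "cball x \<rho> - \<Omega> = (cball q s - \<Omega>) \<inter> cball x \<rho>" using xs by auto
    finally show ?thesis .
  qed
  have "ennreal (inner_volume \<Omega> q (s / 2)) * ennreal (?w / 2) = (\<integral>\<^sup>+x\<in>\<Omega> \<inter> cball q (s / 2). ennreal (?w / 2) \<partial>lborel)"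
    using \<Omega>(1) by (subst nn_integral_cmult_indicator) (auto simp: emeasure_inner_volume mult.commute)
  also have "... \<le> (\<integral>\<^sup>+x\<in>\<Omega> \<inter> cball q (s / 2). emeasure lborel ((cball q s - \<Omega>) \<inter> cball x \<rho>) \<partial>lborel)"
    using lower by (intro nn_integral_mono) (auto simp: indicator_def)
  also have "... \<le> ennreal ?w * (ennreal (proj_const (DIM('a)) * \<rho>) * boundary_area \<Omega> q s)"
    unfolding boundary_area_def
  proof (rule crossing_pairs[OF n _ K])
    fix x y assume "x \<in> \<Omega> \<inter> cball q (s / 2)" "y \<in> cball q s - \<Omega>"
    then show "\<exists>t\<in>{0..1}. x + t *\<^sub>R (y - x) \<in> frontier \<Omega> \<inter> cball q s"
      using sub by (intro frontier_crossing[OF \<Omega>(1)]) auto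
  qed (use \<rho> \<Omega> in auto)
  finally have "ennreal (2 / ?w) * (ennreal (inner_volume \<Omega> q (s / 2)) * ennreal (?w / 2))
      \<le> ennreal (2 / ?w) * (ennreal ?w * (ennreal (proj_const (DIM('a)) * \<rho>) * boundary_area \<Omega> q s))"
    by (rule mult_left_mono) simp
  moreover have "ennreal (2 / ?w) * (ennreal (inner_volume \<Omega> q (s / 2)) * ennreal (?w / 2)) = ennreal (inner_volume \<Omega> q (s / 2))"
    by (rule ennreal_two_halves[OF w0 inner_volume_nonneg])
  moreover have "ennreal (2 / ?w) * (ennreal ?w * (ennreal (proj_const (DIM('a)) * \<rho>) * boundary_area \<Omega> q s))
      = ennreal (2 * proj_const (DIM('a)) * \<rho>) * boundary_area \<Omega> q s"
  proof -
    have "ennreal (2 / w) * ennreal w = ennreal 2" if "0 < w" for w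
      by (rule trans[OF ennreal_mult[symmetric]]) (use that in auto)
    from this[OF w0] have "ennreal (2 / ?w) * ennreal ?w = ennreal 2" .
    moreover have "ennreal 2 * ennreal (proj_const (DIM('a)) * \<rho>) = ennreal (2 * proj_const (DIM('a)) * \<rho>)"
      by (rule trans[OF ennreal_mult[symmetric]]) (use \<rho> proj_const_pos[of "DIM('a)"] in auto)
    ultimately show ?thesis by (simp only: mult.assoc[symmetric])
  qed
  ultimately show ?thesis by simp
qed

text \<open>The product on the left is the measure of the set of all pairs with one point inside and
  one outside \<Omega>; each is at distance at most 2 s and crosses the boundary inside the convex
  ball.\<close>

lemma isoperimetric_half:
  fixes \<Omega> :: "'a::euclidean_space set"
  assumes n: "2 \<le> DIM('a)" and \<Omega>: "open \<Omega>" "bounded \<Omega>" and s: "0 < s"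
  shows "ennreal (inner_volume \<Omega> q s * (unit_ball_vol (DIM('a)) * s ^ DIM('a) - inner_volume \<Omega> q s))
    \<le> ennreal (unit_ball_vol (DIM('a)) * (2 * s) ^ DIM('a) * (proj_const (DIM('a)) * (2 * s))) * boundary_area \<Omega> q s"
proof -
  let ?A = "frontier \<Omega> \<inter> cball q s"
  have K: "compact ?A" using \<Omega>(2) by (intro compact_Int_closed compact_frontier_bounded) auto
  have v: "0 \<le> inner_volume \<Omega> q s" "inner_volume \<Omega> q s \<le> unit_ball_vol (DIM('a)) * s ^ DIM('a)"
    using inner_volume_nonneg inner_volume_le_ball[OF \<Omega>(1)] s by auto
  have "ennreal (inner_volume \<Omega> q s * (unit_ball_vol (DIM('a)) * s ^ DIM('a) - inner_volume \<Omega> q s))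
      = emeasure lborel (cball q s - \<Omega>) * emeasure lborel (\<Omega> \<inter> cball q s)"
    using v s by (simp add: outer_volume[OF \<Omega>(1)] emeasure_inner_volume ennreal_mult[symmetric] mult.commute)
  also have "... = (\<integral>\<^sup>+x\<in>\<Omega> \<inter> cball q s. emeasure lborel (cball q s - \<Omega>) \<partial>lborel)"
    using \<Omega>(1) by (subst nn_integral_cmult_indicator) auto
  also have "... \<le> (\<integral>\<^sup>+x\<in>\<Omega> \<inter> cball q s. emeasure lborel ((cball q s - \<Omega>) \<inter> cball x (2 * s)) \<partial>lborel)"
  proof (rule nn_integral_mono)
    fix x
    have "cball q s \<subseteq> cball x (2 * s)" if x: "x \<in> cball q s"
    proof
      fix y assume "y \<in> cball q s"
      then show "y \<in> cball x (2 * s)" using x dist_triangle[of x y q] by (auto simp: dist_commute)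
    qed
    then show "emeasure lborel (cball q s - \<Omega>) * indicator (\<Omega> \<inter> cball q s) x
        \<le> emeasure lborel ((cball q s - \<Omega>) \<inter> cball x (2 * s)) * indicator (\<Omega> \<inter> cball q s) x"
      using \<Omega>(1) by (auto simp: indicator_def intro!: emeasure_mono)
  qed
  also have "... \<le> ennreal (unit_ball_vol (DIM('a)) * (2 * s) ^ DIM('a)) * (ennreal (proj_const (DIM('a)) * (2 * s)) * boundary_area \<Omega> q s)"
    unfolding boundary_area_def
    by (rule crossing_pairs[OF n _ K]) (use s \<Omega> frontier_crossing[OF \<Omega>(1)] in auto)
  also have "... = ennreal (unit_ball_vol (DIM('a)) * (2 * s) ^ DIM('a) * (proj_const (DIM('a)) * (2 * s))) * boundary_area \<Omega> q s"
    using s proj_const_pos[of "DIM('a)"] by (subst ennreal_mult) (auto simp: mult.assoc less_imp_le)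
  finally show ?thesis .
qed

text \<open>The shifted ball lies in a concentric enlargement of the old one, and the enlargement
  adds at most the volume of a shell. Exchanging the roles bounds the difference in both directions,
  as the intermediate value theorem requires.\<close>

lemma inner_volume_translate_continuous:
  fixes \<Omega> :: "'a::euclidean_space set"
  assumes \<Omega>: "open \<Omega>" and e: "norm e = 1" and R: "0 \<le> R"
  shows "continuous_on UNIV (\<lambda>\<tau>. inner_volume \<Omega> (p + \<tau> *\<^sub>R e) R)"
proof -
  let ?v = "\<lambda>\<tau>. inner_volume \<Omega> (p + \<tau> *\<^sub>R e) R"
  let ?g = "\<lambda>d. unit_ball_vol (DIM('a)) * ((R + d) ^ DIM('a) - R ^ DIM('a))"
  have one: "?v \<sigma> - ?v \<tau> \<le> ?g \<bar>\<sigma> - \<tau>\<bar>" for \<sigma> \<tau>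
  proof -
    let ?q = "p + \<tau> *\<^sub>R e" and ?d = "\<bar>\<sigma> - \<tau>\<bar>"
    have "cball (p + \<sigma> *\<^sub>R e) R \<subseteq> cball ?q (R + ?d)"
    proof
      fix y assume y: "y \<in> cball (p + \<sigma> *\<^sub>R e) R"
      have "dist ?q (p + \<sigma> *\<^sub>R e) = norm ((\<tau> - \<sigma>) *\<^sub>R e)" by (simp add: dist_norm algebra_simps)
      also have "... = ?d" using e by simp
      finally show "y \<in> cball ?q (R + ?d)" using y dist_triangle[of ?q y "p + \<sigma> *\<^sub>R e"] by simp
    qed
    then have "?v \<sigma> \<le> inner_volume \<Omega> ?q (R + ?d)" by (rule inner_volume_mono[OF \<Omega>])
    moreover have "unit_ball_vol (DIM('a)) * R ^ DIM('a) - ?v \<tau>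
        \<le> unit_ball_vol (DIM('a)) * (R + ?d) ^ DIM('a) - inner_volume \<Omega> ?q (R + ?d)"
    proof -
      have "emeasure lborel (cball ?q R - \<Omega>) \<le> emeasure lborel (cball ?q (R + ?d) - \<Omega>)"
        using \<Omega> by (intro emeasure_mono) auto
      then show ?thesis
        using R \<Omega> inner_volume_le_ball[OF \<Omega>, of "R + ?d" ?q] by (simp add: outer_volume ennreal_le_iff)
    qed
    ultimately show ?thesis by (simp add: algebra_simps)
  qed
  have "isCont ?v \<tau>" for \<tau>
  proof -
    have "((\<lambda>\<sigma>. ?g \<bar>\<sigma> - \<tau>\<bar>) \<longlongrightarrow> ?g \<bar>\<tau> - \<tau>\<bar>) (at \<tau>)" by (intro tendsto_intros)
    then have g0: "((\<lambda>\<sigma>. ?g \<bar>\<sigma> - \<tau>\<bar>) \<longlongrightarrow> 0) (at \<tau>)" by simp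
    have "((\<lambda>\<sigma>. ?v \<sigma> - ?v \<tau>) \<longlongrightarrow> 0) (at \<tau>)"
    proof (rule Lim_null_comparison[OF _ g0])
      show "\<forall>\<^sub>F \<sigma> in at \<tau>. norm (?v \<sigma> - ?v \<tau>) \<le> ?g \<bar>\<sigma> - \<tau>\<bar>"
      proof (intro always_eventually allI)
        fix \<sigma>
        show "norm (?v \<sigma> - ?v \<tau>) \<le> ?g \<bar>\<sigma> - \<tau>\<bar>"
          using one[of \<sigma> \<tau>] one[of \<tau> \<sigma>] by (simp add: abs_le_iff abs_minus_commute)
      qed
    qed
    then show ?thesis by (simp add: isCont_def LIM_zero_iff)
  qed
  then show ?thesis by (intro continuous_at_imp_continuous_on) auto
qed

lemma inner_volume_pos:
  fixes \<Omega> :: "'a::euclidean_space set"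
  assumes "open \<Omega>" "p \<in> \<Omega>" "0 < s"
  shows "0 < inner_volume \<Omega> p s"
proof -
  obtain r where r: "0 < r" "cball p r \<subseteq> \<Omega>" using assms open_contains_cball by blast
  define t where "t = min r s"
  have t: "0 < t" "cball p t \<subseteq> \<Omega> \<inter> cball p s" using r assms(3) by (auto simp: t_def)
  have "ennreal (unit_ball_vol (DIM('a)) * t ^ DIM('a)) \<le> ennreal (inner_volume \<Omega> p s)"
  proof -
    have "emeasure lborel (cball p t) \<le> emeasure lborel (\<Omega> \<inter> cball p s)" using t(2) assms by (intro emeasure_mono) auto
    then show ?thesis using t(1) by (simp add: emeasure_inner_volume emeasure_cball)
  qed
  moreover have "0 < unit_ball_vol (DIM('a)) * t ^ DIM('a)" using t by simp
  ultimately show ?thesis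
    by (metis ennreal_eq_0_iff inner_volume_nonneg le_zero_eq less_le not_le)
qed

text \<open>The value comes from the ball with volume fraction exactly \<theta> in
  \<open>good_ball_exists\<close>. The same value makes the volume drop by at least 16^n from one
  scale to the next in the other case.\<close>

definition capacity_const :: "nat \<Rightarrow> real" where
  "capacity_const n = 4 * 16 ^ n * proj_const n"

lemma capacity_const_pos: "0 < capacity_const n"
  using proj_const_pos[of n] by (simp add: capacity_const_def)

text \<open>Either the centre can be moved so that \<open>\<Omega>\<close> occupies a fixed proportion of the ball, or the
  volume near \<open>p\<close> would decay so fast along the scales \<open>4\<^sup>-\<^sup>i r\<close> that \<open>p\<close> is not interior.\<close>

lemma good_ball_exists:
  fixes \<Omega> :: "'a::euclidean_space set"
  assumes n: "2 \<le> DIM('a)" and \<Omega>: "open \<Omega>" "bounded \<Omega>" and p: "p \<in> \<Omega>" and e: "norm e = 1" and r: "0 < r"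
  shows "\<exists>\<tau> s. 0 < s \<and> s \<le> r \<and> 0 < inner_volume \<Omega> (p + \<tau> *\<^sub>R e) s \<and>
    ennreal (r * inner_volume \<Omega> (p + \<tau> *\<^sub>R e) s / s\<^sup>2)
      \<le> ennreal (capacity_const (DIM('a))) * boundary_area \<Omega> (p + \<tau> *\<^sub>R e) (s / 2)"
proof -
  define N where "N = DIM('a)"
  define w where "w = unit_ball_vol (real N)"
  define pc where "pc = proj_const N"
  define C where "C = capacity_const N"
  have w: "0 < w" by (simp add: w_def)
  have pc: "0 < pc" unfolding pc_def by (rule proj_const_pos)
  have C: "C = 4 * 16 ^ N * pc" by (simp add: C_def capacity_const_def pc_def)
  have C0: "0 < C" unfolding C using pc by simp
  \<comment> \<open>Chosen so that a volume fraction \<theta> in a ball is half the volume of a ball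
    four times smaller, as \<open>isoperimetric_small\<close> demands; in particular \<theta> is at
    most half of w.\<close>
  define \<theta> where "\<theta> = w / (2 * 4 ^ N)"
  have \<theta>: "0 < \<theta>" using w by (simp add: \<theta>_def)
  have \<theta>w: "\<theta> \<le> w / 2"
  proof -
    have "(1::real) \<le> 4 ^ N" by simp
    then have "w / (2 * 4 ^ N) \<le> w / (2 * 1)" using w by (intro divide_left_mono mult_left_mono) auto
    then show ?thesis by (simp add: \<theta>_def)
  qed
  \<comment> \<open>The ball finally chosen in the first case has radius s = r, whose boundary area
    is measured in the half ball, of radius R.\<close>
  define R where "R = r / 2"
  have R: "0 < R" using r by (simp add: R_def)
  define V where "V q s = inner_volume \<Omega> q s" for q s
  show ?thesis
  proof (cases "\<theta> * R ^ N \<le> V p R")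
    case True
    obtain B where B: "\<And>x. x \<in> \<Omega> \<Longrightarrow> norm x \<le> B" using \<Omega>(2) by (auto simp: bounded_iff)
    define t1 where "t1 = norm p + B + R + 1"
    have "0 \<le> B" using B[OF p] norm_ge_zero[of p] by (rule order_trans[rotated])
    then have t1: "0 \<le> t1" using R by (simp add: t1_def)
    have "\<Omega> \<inter> cball (p + t1 *\<^sub>R e) R = {}"
    proof (rule ccontr)
      assume "\<not> ?thesis"
      then obtain x where x: "x \<in> \<Omega>" "norm (p + t1 *\<^sub>R e - x) \<le> R" by (auto simp: dist_norm)
      have "norm (t1 *\<^sub>R e) \<le> norm (p + t1 *\<^sub>R e - x) + norm (x - p)"
        using norm_triangle_ineq[of "p + t1 *\<^sub>R e - x" "x - p"] by simp
      moreover have "norm (x - p) \<le> norm x + norm p" by (rule norm_triangle_ineq4)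
      moreover have "norm (t1 *\<^sub>R e) = t1" using e t1 by simp
      ultimately show False using x(2) B[OF x(1)] by (simp add: t1_def)
    qed
    then have V1: "V (p + t1 *\<^sub>R e) R = 0" by (simp add: V_def inner_volume_def)
    \<comment> \<open>At p the fraction is at least \<theta>, after the shift it is 0, so somewhere
      between it equals \<theta>. There both \<Omega> and its complement fill a definite part of the
      ball.\<close>
    have "\<exists>\<tau>. 0 \<le> \<tau> \<and> \<tau> \<le> t1 \<and> V (p + \<tau> *\<^sub>R e) R = \<theta> * R ^ N"
    proof (rule IVT2')
      show "V (p + t1 *\<^sub>R e) R \<le> \<theta> * R ^ N" using V1 \<theta> R by simp
      show "\<theta> * R ^ N \<le> V (p + 0 *\<^sub>R e) R" using True by simp
      show "continuous_on {0..t1} (\<lambda>\<tau>. V (p + \<tau> *\<^sub>R e) R)"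
        unfolding V_def using inner_volume_translate_continuous[OF \<Omega>(1) e, of R p] R
        by (auto intro: continuous_on_subset)
    qed (rule t1)
    then obtain \<tau> where \<tau>: "V (p + \<tau> *\<^sub>R e) R = \<theta> * R ^ N" by blast
    let ?q = "p + \<tau> *\<^sub>R e"
    let ?H = "boundary_area \<Omega> ?q R"
    have RN: "0 < R ^ N" using R by simp
    have "ennreal (\<theta> * R ^ N * (w * R ^ N / 2)) \<le> ennreal (\<theta> * R ^ N * (w * R ^ N - \<theta> * R ^ N))"
    proof (intro ennreal_leI mult_left_mono)
      show "w * R ^ N / 2 \<le> w * R ^ N - \<theta> * R ^ N"
        using mult_right_mono[OF \<theta>w, of "R ^ N"] RN by simp
    qed (use \<theta> RN in simp)
    also have "... \<le> ennreal (w * (2 * R) ^ N * (pc * (2 * R))) * ?H"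
      using isoperimetric_half[OF n \<Omega> R, of ?q] \<tau> unfolding V_def w_def pc_def N_def by simp
    finally have iso: "ennreal (\<theta> * R ^ N * (w * R ^ N / 2)) \<le> ennreal (w * (2 * R) ^ N * (pc * (2 * R))) * ?H" .
    define k where "k = w * 2 ^ N / (2 * R) / (\<theta> * (w * R ^ N / 2))"
    have k: "0 \<le> k" unfolding k_def using w R \<theta> by simp
    have "r * V ?q r / r\<^sup>2 \<le> r * (w * r ^ N) / r\<^sup>2"
      unfolding V_def w_def N_def using r inner_volume_le_ball[OF \<Omega>(1), of r ?q] by (intro divide_right_mono mult_left_mono) auto
    also have "... = k * (\<theta> * R ^ N * (w * R ^ N / 2))"
      using r \<theta> w unfolding k_def R_def by (simp add: field_simps power2_eq_square power_divide)
    finally have "ennreal (r * V ?q r / r\<^sup>2) \<le> ennreal (k * (\<theta> * R ^ N * (w * R ^ N / 2)))" by (rule ennreal_leI)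
    also have "... \<le> ennreal (k * (w * (2 * R) ^ N * (pc * (2 * R)))) * ?H"
      using w pc R by (intro ennreal_scale_le[OF k _ iso]) simp
    also have "k * (w * (2 * R) ^ N * (pc * (2 * R))) = C"
    proof -
      have "(16::real) ^ N = 4 ^ N * (2 ^ N * 2 ^ N)" by (simp add: power_mult_distrib[symmetric])
      then show ?thesis using w R unfolding k_def C \<theta>_def by (simp add: field_simps power_mult_distrib)
    qed
    finally have "ennreal (r * V ?q r / r\<^sup>2) \<le> ennreal C * ?H" .
    moreover have "0 < V ?q r"
    proof -
      have "V ?q R \<le> V ?q r" unfolding V_def using r by (intro inner_volume_mono[OF \<Omega>(1)] subset_cball) (simp add: R_def)
      then show ?thesis using \<tau> \<theta> RN by (metis less_le_trans mult_pos_pos)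
    qed
    ultimately show ?thesis
      using r unfolding V_def C_def R_def N_def by (intro exI[of _ \<tau>] exI[of _ r]) auto
  next
    case False
    \<comment> \<open>Here \<Omega> is already sparse near p at scale R; the centre stays at p and
      the radius is looked for among the scales R / 4^i.\<close>
    define \<rho> where "\<rho> i = R / 4 ^ i" for i :: nat
    have \<rho>0: "0 < \<rho> i" for i using R by (simp add: \<rho>_def)
    have \<rho>R: "\<rho> i \<le> R" for i
    proof -
      have "R / 4 ^ i \<le> R / 1" using R by (intro divide_left_mono) auto
      then show ?thesis by (simp add: \<rho>_def)
    qed
    have \<rho>S: "\<rho> (Suc i) = \<rho> i / 4" for i by (simp add: \<rho>_def)
    have "\<exists>i. ennreal (r * V p (\<rho> i) / (\<rho> i)\<^sup>2) \<le> ennreal C * boundary_area \<Omega> p (\<rho> i / 2)"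
    proof (rule ccontr)
      assume neg: "\<not> ?thesis"
      \<comment> \<open>If every scale fails, the volume fraction at scale i is at most \<theta>
        4^(-i n), by induction.\<close>
      have dec: "V p (\<rho> i) \<le> \<theta> * (\<rho> i / 4 ^ i) ^ N" for i
      proof (induction i)
        case 0
        then show ?case using False by (simp add: \<rho>_def)
      next
        case (Suc i)
        \<comment> \<open>Twice the inductive volume bound is exactly the volume of a ball of radius
          d, the largest bound that can be fed into \<open>isoperimetric_small\<close>.\<close>
        define d where "d = \<rho> i / 4 ^ Suc i"
        have d0: "0 < d" using \<rho>0[of i] by (simp add: d_def)
        have "(1::real) \<le> 4 ^ i" by simp
        then have d2: "d \<le> \<rho> i / 2 / 2" using \<rho>0[of i] by (simp add: d_def field_simps)
        have half: "V p (\<rho> i / 2) \<le> V p (\<rho> i)"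
          unfolding V_def using \<rho>0[of i] by (intro inner_volume_mono[OF \<Omega>(1)] subset_cball) simp
        have "2 * (\<theta> * (\<rho> i / 4 ^ i) ^ N) = w * d ^ N"
          unfolding \<theta>_def d_def by (simp add: power_divide power_mult_distrib)
        then have small: "2 * inner_volume \<Omega> p (\<rho> i / 2) \<le> unit_ball_vol (DIM('a)) * d ^ DIM('a)"
          using Suc half unfolding V_def w_def N_def by linarith
        have iso: "ennreal (V p (\<rho> (Suc i))) \<le> ennreal (2 * pc * d) * boundary_area \<Omega> p (\<rho> i / 2)"
          using isoperimetric_small[OF n \<Omega> d0 d2 small] unfolding V_def pc_def N_def \<rho>S by simp
        define k where "k = C / (2 * pc * d)"
        have k: "0 < k" unfolding k_def using C0 pc d0 by simp
        have "ennreal (k * V p (\<rho> (Suc i))) \<le> ennreal (k * (2 * pc * d)) * boundary_area \<Omega> p (\<rho> i / 2)"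
          using k pc d0 by (intro ennreal_scale_le iso) auto
        also have "k * (2 * pc * d) = C" using pc d0 by (simp add: k_def)
        also have "ennreal C * boundary_area \<Omega> p (\<rho> i / 2) < ennreal (r * V p (\<rho> i) / (\<rho> i)\<^sup>2)"
          using neg by (simp add: not_le)
        finally have "k * V p (\<rho> (Suc i)) < r * V p (\<rho> i) / (\<rho> i)\<^sup>2"
          using k inner_volume_nonneg[of \<Omega> p "\<rho> (Suc i)"] by (subst (asm) ennreal_less_iff) (auto simp: V_def)
        \<comment> \<open>As r = 2 * 4^i * \<rho> i, the scales cancel in d r / (\<rho> i)^2 = 1/2,
          and the drop in volume is the same at every step.\<close>
        also have "r * V p (\<rho> i) / (\<rho> i)\<^sup>2 = k * (V p (\<rho> i) / (4 * 16 ^ N))"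
        proof -
          have "r = 2 * (\<rho> i * 4 ^ i)" by (simp add: \<rho>_def R_def)
          then show ?thesis
            using pc \<rho>0[of i] unfolding k_def C d_def by (simp add: field_simps power2_eq_square)
        qed
        finally have "V p (\<rho> (Suc i)) \<le> V p (\<rho> i) / (4 * 16 ^ N)"
          using mult_less_cancel_left_pos[OF k] less_imp_le by blast
        also have "... \<le> V p (\<rho> i) / 16 ^ N"
          using inner_volume_nonneg[of \<Omega> p "\<rho> i"] by (intro divide_left_mono) (auto simp: V_def)
        also have "... \<le> \<theta> * (\<rho> i / 4 ^ i) ^ N / 16 ^ N" using Suc by (intro divide_right_mono) auto
        also have "... = \<theta> * (\<rho> (Suc i) / 4 ^ Suc i) ^ N"
        proof -
          have "\<rho> i / 4 / 4 ^ Suc i = (\<rho> i / 4 ^ i) / 16" by simp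
          then show ?thesis unfolding \<rho>S by (simp only: power_divide[of "\<rho> i / 4 ^ i" 16] times_divide_eq_right)
        qed
        finally show ?case .
      qed
      \<comment> \<open>A small ball around p lies in \<Omega> and has full volume, which
        contradicts the decay because \<theta> < w.\<close>
      obtain a where a: "0 < a" "cball p a \<subseteq> \<Omega>" using \<Omega>(1) p open_contains_cball by blast
      obtain i where i: "\<rho> i < a"
      proof -
        have "R / a < 4 ^ i" if "R / a < real i" for i
        proof -
          have "real i < 2 ^ i" by (rule of_nat_less_two_power)
          also have "(2::real) ^ i \<le> 4 ^ i" by (rule power_mono) auto
          finally show ?thesis using that by linarith
        qed
        then obtain i :: nat where "R / a < 4 ^ i" using reals_Archimedean2 by blast
        then show ?thesis using that[of i] a(1) by (simp add: \<rho>_def field_simps)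
      qed
      then have "cball p (\<rho> i) \<subseteq> \<Omega>" using a(2) by (meson less_imp_le order_trans subset_cball)
      then have Vi: "V p (\<rho> i) = w * \<rho> i ^ N"
        using \<rho>0[of i] by (simp add: V_def inner_volume_def Int_absorb1 content_cball w_def N_def)
      have "(\<rho> i / 4 ^ i) ^ N \<le> \<rho> i ^ N"
        using \<rho>0[of i] divide_left_mono[of 1 "4 ^ i" "\<rho> i"] by (intro power_mono) auto
      then have "w * (\<rho> i / 4 ^ i) ^ N \<le> w * \<rho> i ^ N" using w by (intro mult_left_mono) auto
      also have "... \<le> \<theta> * (\<rho> i / 4 ^ i) ^ N" using dec[of i] unfolding Vi .
      finally have "w * (\<rho> i / 4 ^ i) ^ N \<le> \<theta> * (\<rho> i / 4 ^ i) ^ N" .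
      then have "w \<le> \<theta>" using \<rho>0[of i] by simp
      then show False using \<theta>w w by simp
    qed
    then obtain i where i: "ennreal (r * V p (\<rho> i) / (\<rho> i)\<^sup>2) \<le> ennreal C * boundary_area \<Omega> p (\<rho> i / 2)" by blast
    have "\<rho> i \<le> r" using \<rho>R[of i] r by (simp add: R_def)
    then show ?thesis
      using i \<rho>0[of i] inner_volume_pos[OF \<Omega>(1) p \<rho>0[of i]] unfolding V_def C_def N_def
      by (intro exI[of _ 0] exI[of _ "\<rho> i"]) auto
  qed
qed

section \<open>Rayleigh quotients of bumps and a disjoint family of them\<close>

lemma pos_ball_energy:
  fixes \<Omega> :: "'a::euclidean_space set"
  assumes \<Omega>: "open \<Omega>" and s: "0 < s"
  shows "dirichlet_int \<Omega> (pos_ball_gradient q s) \<le> ennreal (16 * s ^ 6 * inner_volume \<Omega> q s)"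
proof -
  have B: "(norm (pos_ball_gradient q s x))\<^sup>2 \<le> 16 * s ^ 6 * indicator (cball q s) x" for x
  proof (cases "x \<in> cball q s")
    case True
    then have d: "norm (x - q) \<le> s" by (simp add: dist_norm norm_minus_commute)
    have m: "max 0 (s\<^sup>2 - (norm (x - q))\<^sup>2) \<le> s\<^sup>2" by simp
    have "norm (pos_ball_gradient q s x) = 4 * max 0 (s\<^sup>2 - (norm (x - q))\<^sup>2) * norm (x - q)"
      unfolding pos_ball_gradient_def by (simp add: abs_mult)
    also have "... \<le> 4 * s\<^sup>2 * s" using m d by (intro mult_mono) auto
    finally have "norm (pos_ball_gradient q s x) \<le> 4 * s ^ 3" by (simp add: power2_eq_square power3_eq_cube)
    then have "(norm (pos_ball_gradient q s x))\<^sup>2 \<le> (4 * s ^ 3)\<^sup>2" by (intro power_mono) auto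
    also have "... = 16 * s ^ 6" by (simp add: power_mult_distrib power_mult[symmetric])
    finally show ?thesis using True by simp
  next
    case False
    then have "s \<le> norm (x - q)" by (simp add: dist_norm norm_minus_commute)
    then have "s\<^sup>2 \<le> (norm (x - q))\<^sup>2" using s by (intro power_mono) auto
    then show ?thesis using False by (simp add: pos_ball_gradient_def)
  qed
  have "ennreal ((norm (pos_ball_gradient q s x))\<^sup>2) * indicator \<Omega> x \<le> ennreal (16 * s ^ 6) * indicator (\<Omega> \<inter> cball q s) x" for x
    using ennreal_leI[OF B[of x]] by (cases "x \<in> \<Omega>"; cases "x \<in> cball q s") (auto simp del: mem_cball)
  then have "dirichlet_int \<Omega> (pos_ball_gradient q s)
      \<le> (\<integral>\<^sup>+x. ennreal (16 * s ^ 6) * indicator (\<Omega> \<inter> cball q s) x \<partial>lborel)"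
    by (intro nn_integral_mono)
  also have "... = ennreal (16 * s ^ 6 * inner_volume \<Omega> q s)"
    using \<Omega> s by (subst nn_integral_cmult_indicator) (auto simp: emeasure_inner_volume ennreal_mult inner_volume_nonneg)
  finally show ?thesis .
qed

lemma pos_ball_boundary:
  fixes \<Omega> :: "'a::euclidean_space set"
  assumes s: "0 < s"
  shows "ennreal (s ^ 8 / 4) * boundary_area \<Omega> q (s / 2)
    \<le> surface_int (frontier \<Omega>) (pos_ball q s)"
proof -
  let ?K = "frontier \<Omega> \<inter> cball q (s / 2)"
  have low: "s ^ 8 / 4 \<le> (pos_ball q s y)\<^sup>2" if "y \<in> cball q (s / 2)" for y
  proof -
    have "norm (y - q) \<le> s / 2" using that by (simp add: dist_norm norm_minus_commute)
    then have "(norm (y - q))\<^sup>2 \<le> (s / 2)\<^sup>2" by (intro power_mono) auto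
    moreover have "(s / 2)\<^sup>2 = s\<^sup>2 / 4" by (simp add: power_divide)
    moreover have "s\<^sup>2 - (norm (y - q))\<^sup>2 \<le> max 0 (s\<^sup>2 - (norm (y - q))\<^sup>2)" by simp
    ultimately have m: "3 / 4 * s\<^sup>2 \<le> max 0 (s\<^sup>2 - (norm (y - q))\<^sup>2)" by linarith
    \<comment> \<open>In the half ball the bump is at least (3/4 s^2)^2; its square is rounded down
      to s^8 / 4.\<close>
    have "s ^ 8 / 4 \<le> 81 / 256 * s ^ 8" using s by simp
    also have "... = ((3 / 4 * s\<^sup>2)\<^sup>2)\<^sup>2" by (simp add: power_mult_distrib power_mult[symmetric] power_divide)
    also have "... \<le> (pos_ball q s y)\<^sup>2" unfolding pos_ball_def using m s by (intro power_mono) auto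
    finally show ?thesis .
  qed
  have "ennreal (s ^ 8 / 4) * boundary_area \<Omega> q (s / 2) = (\<integral>\<^sup>+y. ennreal (s ^ 8 / 4) * indicator ?K y \<partial>hausdorff_measure (DIM('a) - 1))"
    unfolding boundary_area_def by (subst nn_integral_cmult_indicator) (auto intro!: borel_closed closed_Int)
  also have "... \<le> surface_int (frontier \<Omega>) (pos_ball q s)"
    using low by (intro nn_integral_mono) (auto simp: indicator_def ennreal_leI)
  finally show ?thesis .
qed

text \<open>Energy is at most 16 s^6 times the volume and boundary mass at least s^8 / 4 times the
  area, whence the factor 64 and the quotient volume / (s^2 area) that
  \<open>good_ball_exists\<close> controls.\<close>

lemma bump_quotient:
  fixes \<Omega> :: "'a::euclidean_space set"
  assumes n: "2 \<le> DIM('a)" and \<Omega>: "open \<Omega>" "bounded \<Omega>" and p: "p \<in> \<Omega>" and e: "norm e = 1" and r: "0 < r"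
  shows "\<exists>\<tau> s. 0 < s \<and> s \<le> r \<and>
    0 < surface_int (frontier \<Omega>) (pos_ball (p + \<tau> *\<^sub>R e) s) \<and>
    ennreal r * dirichlet_int \<Omega> (pos_ball_gradient (p + \<tau> *\<^sub>R e) s)
      \<le> ennreal (64 * capacity_const (DIM('a))) *
        surface_int (frontier \<Omega>) (pos_ball (p + \<tau> *\<^sub>R e) s)"
proof -
  let ?C = "capacity_const (DIM('a))"
  obtain \<tau> s where s: "0 < s" "s \<le> r" "0 < inner_volume \<Omega> (p + \<tau> *\<^sub>R e) s"
    and le: "ennreal (r * inner_volume \<Omega> (p + \<tau> *\<^sub>R e) s / s\<^sup>2) \<le> ennreal ?C * boundary_area \<Omega> (p + \<tau> *\<^sub>R e) (s / 2)"
    using good_ball_exists[OF n \<Omega> p e r] by blast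
  let ?q = "p + \<tau> *\<^sub>R e"
  let ?V = "inner_volume \<Omega> ?q s" and ?a = "boundary_area \<Omega> ?q (s / 2)"
  let ?B = "surface_int (frontier \<Omega>) (pos_ball ?q s)"
  have C0: "0 < ?C" by (rule capacity_const_pos)
  have "0 < ennreal (r * ?V / s\<^sup>2)" using r s by simp
  then have "ennreal ?C * ?a \<noteq> 0" using le by (metis le_zero_eq not_gr_zero)
  then have "0 < ennreal (s ^ 8 / 4) * ?a" using s by (auto simp: zero_less_iff_neq_zero ennreal_eq_0_iff)
  then have pos: "0 < ?B" using pos_ball_boundary[OF s(1), of \<Omega> ?q] by (rule less_le_trans)
  have "ennreal r * dirichlet_int \<Omega> (pos_ball_gradient ?q s) \<le> ennreal r * ennreal (16 * s ^ 6 * ?V)"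
    by (intro mult_left_mono pos_ball_energy \<Omega> s) simp
  also have "... = ennreal ((16 * s ^ 8) * (r * ?V / s\<^sup>2))"
  proof -
    have s6: "s ^ 6 = s ^ 8 / s\<^sup>2"
      by (rule eq_divide_imp) (use s in \<open>simp_all add: power_add[symmetric]\<close>)
    have "r * (16 * s ^ 6 * ?V) = (16 * s ^ 8) * (r * ?V / s\<^sup>2)" unfolding s6 by simp
    then show ?thesis using r s by (simp add: ennreal_mult[symmetric])
  qed
  also have "... \<le> ennreal ((16 * s ^ 8) * ?C) * ?a"
    using C0 s by (intro ennreal_scale_le le) auto
  also have "ennreal ((16 * s ^ 8) * ?C) = ennreal (64 * ?C) * ennreal (s ^ 8 / 4)"
    using C0 s by (subst ennreal_mult[symmetric]) (auto simp: ac_simps)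
  also have "ennreal (64 * ?C) * ennreal (s ^ 8 / 4) * ?a \<le> ennreal (64 * ?C) * ?B"
    unfolding mult.assoc by (intro mult_left_mono pos_ball_boundary s) simp
  finally show ?thesis using s pos by blast
qed

text \<open>The obstacle is that \<open>good_ball_exists\<close> moves centres by an uncontrolled
  amount. They are moved in a direction orthogonal to the axis of the slabs, so each ball stays in
  its slab and the balls remain disjoint.\<close>

lemma bump_family:
  fixes \<Omega> :: "'a::euclidean_space set"
  assumes n: "2 \<le> DIM('a)" and \<Omega>: "open \<Omega>" "bounded \<Omega>" "connected \<Omega>" "\<Omega> \<noteq> {}" and k: "1 \<le> k"
  shows "\<exists>q s. (\<forall>j\<le>k. 0 < s j \<and>
      0 < surface_int (frontier \<Omega>) (pos_ball (q j) (s j)) \<and>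
      ennreal (diameter \<Omega>) * dirichlet_int \<Omega> (pos_ball_gradient (q j) (s j))
        \<le> ennreal (512 * capacity_const (DIM('a)) * real k) *
          surface_int (frontier \<Omega>) (pos_ball (q j) (s j))) \<and>
    (\<forall>i\<le>k. \<forall>j\<le>k. i \<noteq> j \<longrightarrow> ball (q i) (s i) \<inter> ball (q j) (s j) = {})"
proof -
  let ?D = "diameter \<Omega>" and ?C = "capacity_const (DIM('a))"
  have D: "0 < ?D"
  proof -
    obtain x r where x: "x \<in> \<Omega>" "0 < r" "cball x r \<subseteq> \<Omega>" using \<Omega>(1,4) open_contains_cball by blast
    have "2 * r = diameter (cball x r)" using x by simp
    also have "... \<le> ?D" using x \<Omega>(2) by (intro diameter_subset)
    finally show ?thesis using x by simp
  qed
  \<comment> \<open>The supremum defining the diameter need not be attained in the open set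
    \<Omega>; half of it is enough.\<close>
  obtain a b where ab: "a \<in> \<Omega>" "b \<in> \<Omega>" "?D / 2 < dist a b"
    using diameter_lower_bounded[OF \<Omega>(2), of "?D / 2"] D by auto
  define d where "d = norm (b - a)"
  have d: "?D / 2 < d" "0 < d" using ab(3) D by (auto simp: d_def dist_norm norm_minus_commute)
  define e where "e = (1 / d) *\<^sub>R (b - a)"
  have e: "norm e = 1" using d by (simp add: e_def d_def)
  have ebe: "b \<bullet> e = a \<bullet> e + d"
  proof -
    have "(b - a) \<bullet> e = d" using d by (simp add: e_def d_def dot_square_norm power2_eq_square)
    then show ?thesis by (simp add: inner_diff_left)
  qed
  \<comment> \<open>A direction inside the slabs exists because the dimension is at least 2.\<close>
  obtain e0 where "e0 \<noteq> 0" "orthogonal e e0" using orthogonal_to_vector_exists[OF n, of e] by blast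
  then obtain e' where e': "norm e' = 1" "e' \<bullet> e = 0"
    by (intro that[of "(1 / norm e0) *\<^sub>R e0"]) (auto simp: orthogonal_def inner_commute)
  define r where "r = d / (2 * (real k + 1))"
  have r: "0 < r" using d by (simp add: r_def)
  \<comment> \<open>Midpoints of the k + 1 slabs of width 2 r between a and b; connectedness
    provides a point of \<Omega> on each of these levels.\<close>
  define t where "t j = a \<bullet> e + d * (real j + 1 / 2) / (real k + 1)" for j :: nat
  have "\<exists>p\<in>\<Omega>. p \<bullet> e = t j" if "j \<le> k" for j
  proof -
    have "real j + 1 / 2 \<le> real k + 1" using that by simp
    then have "d * ((real j + 1 / 2) / (real k + 1)) \<le> d * 1"
      using d by (intro mult_left_mono) (auto simp: divide_le_eq)
    then have "a \<bullet> e \<le> t j" "t j \<le> b \<bullet> e" using d unfolding t_def ebe by auto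
    moreover have "connected ((\<lambda>x. x \<bullet> e) ` \<Omega>)" by (intro connected_continuous_image continuous_intros \<Omega>)
    ultimately have "t j \<in> (\<lambda>x. x \<bullet> e) ` \<Omega>"
      using connectedD_interval[of "(\<lambda>x. x \<bullet> e) ` \<Omega>" "a \<bullet> e" "b \<bullet> e"] ab by auto
    then show ?thesis by auto
  qed
  then obtain p where p: "\<And>j. j \<le> k \<Longrightarrow> p j \<in> \<Omega>" "\<And>j. j \<le> k \<Longrightarrow> p j \<bullet> e = t j" by metis
  define good where "good j \<tau> s \<longleftrightarrow> 0 < s \<and> s \<le> r \<and>
    0 < surface_int (frontier \<Omega>) (pos_ball (p j + \<tau> *\<^sub>R e') s) \<and>
    ennreal r * dirichlet_int \<Omega> (pos_ball_gradient (p j + \<tau> *\<^sub>R e') s)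
      \<le> ennreal (64 * ?C) *
        surface_int (frontier \<Omega>) (pos_ball (p j + \<tau> *\<^sub>R e') s)" for j \<tau> s
  have "\<exists>\<tau> s. good j \<tau> s" if "j \<le> k" for j
    unfolding good_def by (rule bump_quotient[OF n \<Omega>(1,2) p(1)[OF that] e'(1) r])
  then obtain \<tau> s where good: "\<And>j. j \<le> k \<Longrightarrow> good j (\<tau> j) (s j)" by metis
  define q where "q j = p j + \<tau> j *\<^sub>R e'" for j
  have C0: "0 < ?C" by (rule capacity_const_pos)
  \<comment> \<open>The diameter is at most 2 d = 4 (k + 1) r, and k + 1 \<le> 2 k. With the 64 of
    \<open>bump_quotient\<close> this gives 512.\<close>
  have Dr: "?D \<le> 8 * real k * r"
  proof -
    have "?D \<le> 2 * d" using d by simp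
    also have "2 * d = 4 * (real k + 1) * r"
    proof -
      have "0 < 2 * (real k + 1)" by simp
      then have "r * (2 * (real k + 1)) = d" using nonzero_eq_divide_eq[of "2 * (real k + 1)" r d] r_def by simp
      moreover have "4 * (real k + 1) * r = 2 * (r * (2 * (real k + 1)))" by (simp add: algebra_simps)
      ultimately show ?thesis by (simp only:)
    qed
    also have "... \<le> 8 * real k * r" using r k by (intro mult_right_mono) auto
    finally show ?thesis .
  qed
  have a1: "ennreal ?D * dirichlet_int \<Omega> (pos_ball_gradient (q j) (s j))
        \<le> ennreal (512 * ?C * real k) *
          surface_int (frontier \<Omega>) (pos_ball (q j) (s j))"
    (is "ennreal ?D * ?E \<le> _ * ?B") if j: "j \<le> k" for j
  proof -
    have "ennreal ?D * ?E \<le> ennreal (8 * real k * r) * ?E" using Dr by (intro mult_right_mono ennreal_leI) auto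
    also have "... = ennreal (8 * real k) * (ennreal r * ?E)" using r by (simp add: ennreal_mult mult.assoc)
    also have "... \<le> ennreal (8 * real k) * (ennreal (64 * ?C) * ?B)"
      using good[OF j] unfolding good_def q_def by (intro mult_left_mono) auto
    also have "... = ennreal (512 * ?C * real k) * ?B"
    proof -
      have "ennreal (8 * real k) * ennreal (64 * ?C) = ennreal (512 * ?C * real k)"
        by (rule trans[OF ennreal_mult[symmetric]]) (use C0 in auto)
      then show ?thesis by (simp only: mult.assoc[symmetric])
    qed
    finally show ?thesis .
  qed
  have a2: "ball (q i) (s i) \<inter> ball (q j) (s j) = {}" if ij: "i \<le> k" "j \<le> k" "i \<noteq> j" for i j
  proof (rule disjoint_ballI)
    have qe: "q j \<bullet> e = t j" if "j \<le> k" for j using p(2)[OF that] e' by (simp add: q_def inner_add_left)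
    have "1 \<le> \<bar>real i - real j\<bar>" using ij(3) by linarith
    then have "2 * r * 1 \<le> 2 * r * \<bar>real i - real j\<bar>" using r by (intro mult_left_mono) auto
    also have "... = \<bar>2 * r * (real i - real j)\<bar>" using r by (simp add: abs_mult)
    also have "2 * r * (real i - real j) = t i - t j"
    proof -
      have "2 * (d / (2 * c)) = d / c" for c :: real by simp
      then have "2 * r = d / (real k + 1)" unfolding r_def .
      moreover have "t m = a \<bullet> e + d / (real k + 1) * (real m + 1 / 2)" for m by (simp add: t_def)
      ultimately have "t i - t j = 2 * r * (real i + 1 / 2) - 2 * r * (real j + 1 / 2)" by (simp only:)
      also have "... = 2 * r * (real i - real j)" by (simp add: algebra_simps)
      finally show ?thesis ..
    qed
    also have "t i - t j = (q i - q j) \<bullet> e" by (simp only: inner_diff_left qe[OF ij(1)] qe[OF ij(2)])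
    also have "\<bar>(q i - q j) \<bullet> e\<bar> \<le> norm (q i - q j) * norm e" by (rule Cauchy_Schwarz_ineq2)
    finally have "2 * r \<le> dist (q i) (q j)" using e by (simp add: dist_norm)
    moreover have "s i \<le> r" "s j \<le> r" using good ij by (auto simp: good_def)
    ultimately show "s i + s j \<le> dist (q i) (q j)" by simp
  qed
  have a3: "0 < s j \<and> 0 < surface_int (frontier \<Omega>) (pos_ball (q j) (s j))"
    if "j \<le> k" for j using good[OF that] by (auto simp: good_def q_def)
  show ?thesis
  proof (rule exI[of _ q], rule exI[of _ s], intro conjI allI impI)
    fix j assume j: "j \<le> k"
    show "0 < s j" using a3[OF j] by (rule conjunct1)
    show "0 < surface_int (frontier \<Omega>) (pos_ball (q j) (s j))"
      using a3[OF j] by (rule conjunct2)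
  next
    fix j assume j: "j \<le> k"
    from a1[OF j] show "ennreal ?D * dirichlet_int \<Omega> (pos_ball_gradient (q j) (s j))
        \<le> ennreal (512 * ?C * real k) *
          surface_int (frontier \<Omega>) (pos_ball (q j) (s j))" .
  next
    fix i j assume "i \<le> k" "j \<le> k" "i \<noteq> j"
    then show "ball (q i) (s i) \<inter> ball (q j) (s j) = {}" by (rule a2)
  qed
qed

subsection \<open>The variational form of the Steklov problem\<close>

text \<open>Pointwise scaling makes triples of functions a real vector space, as the locales for
  forms require.\<close>

instantiation "fun" :: (type, real_vector) real_vector
begin

definition scaleR_fun :: "real \<Rightarrow> ('a \<Rightarrow> 'b) \<Rightarrow> 'a \<Rightarrow> 'b" where
  "scaleR_fun c f = (\<lambda>x. c *\<^sub>R f x)"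

instance
  by standard (auto simp: scaleR_fun_def plus_fun_def scaleR_add_right scaleR_add_left)

end

lemma psd_form_subset: "psd_form W A \<Longrightarrow> subspace W' \<Longrightarrow> W' \<subseteq> W \<Longrightarrow> psd_form W' A"
  unfolding psd_form_def by (meson subsetD)

lemma psd_form_plus:
  assumes A: "psd_form W A" and B: "psd_form W B"
  shows "psd_form W (\<lambda>x y. A x y + B x y)"
proof -
  interpret A: psd_form W A by fact
  interpret B: psd_form W B by fact
  show ?thesis
    using A.add_left B.add_left A.scale_left B.scale_left A.sym B.sym A.nonneg B.nonneg
    by unfold_locales (auto simp: A.W algebra_simps)
qed

lemma (in psd_form) quad_add_le:
  assumes "x \<in> W" "y \<in> W"
  shows "A (x + y) (x + y) \<le> 2 * A x x + 2 * A y y"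
  using quad_add[OF assms] quad_diff[OF assms] nonneg[of "x - y"] in_W(3)[OF assms] by simp

lemma (in psd_form) quad_diff_le:
  assumes "x \<in> W" "y \<in> W"
  shows "A (x - y) (x - y) \<le> 2 * A x x + 2 * A y y"
  using quad_add[OF assms] quad_diff[OF assms] nonneg[of "x + y"] in_W(2)[OF assms] by simp

lemma (in psd_form) null_left:
  assumes "x \<in> W" "y \<in> W" "A x x = 0"
  shows "A x y = 0"
  using Cauchy_Schwarz[OF assms(1,2)] assms(3) by simp

lemma (in psd_form) sum_right:
  assumes "finite I" "\<And>i. i \<in> I \<Longrightarrow> f i \<in> W" "y \<in> W"
  shows "A y (\<Sum>i\<in>I. c i *\<^sub>R f i) = (\<Sum>i\<in>I. c i * A y (f i))"
proof -
  have "(\<Sum>i\<in>I. c i *\<^sub>R f i) \<in> W" using assms by (intro subspace_sum W subspace_scale) auto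
  then have "A y (\<Sum>i\<in>I. c i *\<^sub>R f i) = A (\<Sum>i\<in>I. c i *\<^sub>R f i) y" using assms sym by blast
  also have "... = (\<Sum>i\<in>I. c i * A (f i) y)" by (rule sum_left) (use assms in auto)
  also have "... = (\<Sum>i\<in>I. c i * A y (f i))" using assms sym by (intro sum.cong) auto
  finally show ?thesis .
qed

lemma (in psd_form) orthogonal_sum:
  assumes "finite I" "\<And>i. i \<in> I \<Longrightarrow> f i \<in> W" "\<And>i j. i \<in> I \<Longrightarrow> j \<in> I \<Longrightarrow> i \<noteq> j \<Longrightarrow> A (f i) (f j) = 0"
  shows "A (\<Sum>i\<in>I. c i *\<^sub>R f i) (\<Sum>i\<in>I. c i *\<^sub>R f i) = (\<Sum>i\<in>I. (c i)\<^sup>2 * A (f i) (f i))"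
proof -
  have w: "(\<Sum>i\<in>I. c i *\<^sub>R f i) \<in> W" using assms by (intro subspace_sum W subspace_scale) auto
  have "A (\<Sum>i\<in>I. c i *\<^sub>R f i) (\<Sum>i\<in>I. c i *\<^sub>R f i) = (\<Sum>i\<in>I. c i * A (f i) (\<Sum>i\<in>I. c i *\<^sub>R f i))"
    by (rule sum_left) (use assms w in auto)
  also have "... = (\<Sum>i\<in>I. c i * (c i * A (f i) (f i)))"
  proof (rule sum.cong[OF refl])
    fix i assume i: "i \<in> I"
    have "A (f i) (\<Sum>j\<in>I. c j *\<^sub>R f j) = (\<Sum>j\<in>I. c j * A (f i) (f j))"
      by (rule sum_right) (use assms i in auto)
    also have "... = (\<Sum>j\<in>I. if j = i then c i * A (f i) (f i) else 0)"
      using assms(3)[OF i] by (intro sum.cong) auto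
    also have "... = c i * A (f i) (f i)" using assms(1) i by simp
    finally show "c i * A (f i) (\<Sum>j\<in>I. c j *\<^sub>R f j) = c i * (c i * A (f i) (f i))" by simp
  qed
  also have "... = (\<Sum>i\<in>I. (c i)\<^sup>2 * A (f i) (f i))" by (simp add: power2_eq_square mult.assoc)
  finally show ?thesis .
qed

lemma psd_form_square_integrable:
  fixes F :: "'v::real_vector \<Rightarrow> 'x \<Rightarrow> 'b::euclidean_space"
  assumes W: "subspace W" and F: "\<And>w. w \<in> W \<Longrightarrow> square_integrable M (F w)"
    and add: "\<And>w v x. F (w + v) x = F w x + F v x" and scale: "\<And>c w x. F (c *\<^sub>R w) x = c *\<^sub>R F w x"
  shows "psd_form W (\<lambda>w v. \<integral>x. F w x \<bullet> F v x \<partial>M)"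
proof
  show "subspace W" by fact
  fix x y z assume xyz: "x \<in> W" "y \<in> W" "z \<in> W"
  show "(\<integral>t. F (x + y) t \<bullet> F z t \<partial>M) = (\<integral>t. F x t \<bullet> F z t \<partial>M) + (\<integral>t. F y t \<bullet> F z t \<partial>M)"
    unfolding add inner_add_left using xyz F by (intro Bochner_Integration.integral_add square_integrable_inner) auto
next
  fix c and x y :: 'v
  show "(\<integral>t. F (c *\<^sub>R x) t \<bullet> F y t \<partial>M) = c * (\<integral>t. F x t \<bullet> F y t \<partial>M)" unfolding scale by simp
next
  fix x y :: 'v
  show "(\<integral>t. F x t \<bullet> F y t \<partial>M) = (\<integral>t. F y t \<bullet> F x t \<partial>M)" by (simp only: inner_commute)
  show "0 \<le> (\<integral>t. F x t \<bullet> F x t \<partial>M)" by simp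
qed

section \<open>Min-max bounds and uniqueness of the listing\<close>

context compact_form_pair
begin

text \<open>Among the combinations of the k + 1 orthogonal fields f i one is B-orthogonal to v 0,
  ..., v (k - 1), and the minimality of s k applies to it. The factor d lets the diameter be carried
  along without division.\<close>

lemma eigenvalue_le:
  assumes v: "\<And>k::nat. v k \<in> W" and low: "\<And>k w. w \<in> W \<Longrightarrow> (\<And>i. i < k \<Longrightarrow> B w (v i) = 0) \<Longrightarrow> s k * B w w \<le> A w w"
    and f: "\<And>i. i \<le> k \<Longrightarrow> f i \<in> W" "\<And>i. i \<le> k \<Longrightarrow> 0 < B (f i) (f i)"
      "\<And>i j. i \<le> k \<Longrightarrow> j \<le> k \<Longrightarrow> i \<noteq> j \<Longrightarrow> A (f i) (f j) = 0"
      "\<And>i j. i \<le> k \<Longrightarrow> j \<le> k \<Longrightarrow> i \<noteq> j \<Longrightarrow> B (f i) (f j) = 0"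
      "\<And>i. i \<le> k \<Longrightarrow> d * A (f i) (f i) \<le> c * B (f i) (f i)" and d: "0 \<le> d"
  shows "d * s k \<le> c"
proof -
  have "card {..<k} < card {..k}" by simp
  then obtain a :: "nat \<Rightarrow> real" where a: "\<exists>i\<in>{..k}. a i \<noteq> 0" "\<And>j. j < k \<Longrightarrow> (\<Sum>i\<in>{..k}. a i * B (f i) (v j)) = 0"
    using homogeneous_system_solution[of "{..<k}" "{..k}" "\<lambda>j i. B (f i) (v j)"] by blast
  define w where "w = (\<Sum>i\<in>{..k}. a i *\<^sub>R f i)"
  have w: "w \<in> W" unfolding w_def using f(1) by (intro subspace_sum A.W subspace_scale) auto
  have Bw: "B w w = (\<Sum>i\<in>{..k}. (a i)\<^sup>2 * B (f i) (f i))"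
    unfolding w_def by (rule B.orthogonal_sum) (use f in auto)
  have Aw: "A w w = (\<Sum>i\<in>{..k}. (a i)\<^sup>2 * A (f i) (f i))"
    unfolding w_def by (rule A.orthogonal_sum) (use f in auto)
  have pos: "0 < B w w"
  proof -
    obtain i where i: "i \<le> k" "a i \<noteq> 0" using a(1) by blast
    have "0 < (a i)\<^sup>2 * B (f i) (f i)" using i f(2)[OF i(1)] by simp
    also have "... \<le> B w w" unfolding Bw
    proof (rule member_le_sum)
      show "0 \<le> (a j)\<^sup>2 * B (f j) (f j)" if "j \<in> {..k} - {i}" for j
        using that f(2)[of j] by (intro mult_nonneg_nonneg) auto
    qed (use i in auto)
    finally show ?thesis .
  qed
  have "s k * B w w \<le> A w w"
  proof (rule low[OF w])
    fix j assume "j < k"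
    have "B w (v j) = (\<Sum>i\<in>{..k}. a i * B (f i) (v j))" unfolding w_def by (rule B.sum_left) (use f v in auto)
    then show "B w (v j) = 0" using a(2)[OF \<open>j < k\<close>] by simp
  qed
  then have "d * (s k * B w w) \<le> d * A w w" using d by (rule mult_left_mono)
  also have "d * A w w = (\<Sum>i\<in>{..k}. (a i)\<^sup>2 * (d * A (f i) (f i)))"
    unfolding Aw sum_distrib_left by (rule sum.cong) (simp_all add: mult.left_commute)
  also have "... \<le> (\<Sum>i\<in>{..k}. (a i)\<^sup>2 * (c * B (f i) (f i)))"
    using f(5) by (intro sum_mono mult_left_mono) auto
  also have "... = c * B w w" unfolding Bw sum_distrib_left by (rule sum.cong) (simp_all add: mult.left_commute)
  finally have "d * s k * B w w \<le> c * B w w" by simp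
  then show ?thesis using pos by simp
qed

text \<open>The dual count: at most k functionals cannot separate the span of v 0, ..., v k, so some
  combination is annihilated by all of them, and on that span A is at most s k * B.\<close>

lemma eigenvalue_ge:
  assumes v: "\<And>k::nat. v k \<in> W" and orth: "\<And>i j. B (v i) (v j) = (if i = j then 1 else 0)"
    and eig: "\<And>k w. w \<in> W \<Longrightarrow> A (v k) w = s k * B (v k) w" and s: "incseq s"
    and I: "finite I" "card I \<le> k"
      "\<And>j a. j \<in> I \<Longrightarrow> l j (\<Sum>i\<in>{..k}. a i *\<^sub>R v i) = (\<Sum>i\<in>{..k}. a i * l j (v i))"
    and low: "\<And>w. w \<in> W \<Longrightarrow> (\<And>j. j \<in> I \<Longrightarrow> l j w = 0) \<Longrightarrow> B w w \<le> c * A w w" and c: "0 \<le> c"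
  shows "1 \<le> c * s k"
proof -
  have "card I < card {..k}" using I by simp
  then obtain a :: "nat \<Rightarrow> real" where a: "\<exists>i\<in>{..k}. a i \<noteq> 0" "\<And>j. j \<in> I \<Longrightarrow> (\<Sum>i\<in>{..k}. a i * l j (v i)) = 0"
    using homogeneous_system_solution[OF I(1), of "{..k}" "\<lambda>j i. l j (v i)"] by blast
  define w where "w = (\<Sum>i\<in>{..k}. a i *\<^sub>R v i)"
  have w: "w \<in> W" unfolding w_def using v by (intro subspace_sum A.W subspace_scale) auto
  have Bw: "B w w = (\<Sum>i\<in>{..k}. (a i)\<^sup>2)"
  proof -
    have "B w w = (\<Sum>i\<in>{..k}. (a i)\<^sup>2 * B (v i) (v i))"
      unfolding w_def by (rule B.orthogonal_sum) (use v orth in auto)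
    then show ?thesis by (simp add: orth)
  qed
  have "A w w = (\<Sum>i\<in>{..k}. (a i)\<^sup>2 * A (v i) (v i))"
    unfolding w_def by (rule A.orthogonal_sum) (use v orth eig in auto)
  also have "... = (\<Sum>i\<in>{..k}. (a i)\<^sup>2 * s i)" using v by (simp add: eig orth)
  also have "... \<le> (\<Sum>i\<in>{..k}. (a i)\<^sup>2 * s k)"
    using s by (intro sum_mono mult_left_mono) (auto dest: incseqD)
  also have "... = s k * B w w" unfolding Bw sum_distrib_left by (simp add: mult.commute)
  finally have Aw: "A w w \<le> s k * B w w" .
  obtain i where i: "i \<le> k" "a i \<noteq> 0" using a(1) by blast
  have "0 < (a i)\<^sup>2" using i by simp
  also have "... \<le> B w w" unfolding Bw by (rule member_le_sum) (use i in auto)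
  finally have pos: "0 < B w w" .
  have "B w w \<le> c * A w w"
  proof (rule low[OF w])
    fix j assume j: "j \<in> I"
    show "l j w = 0" unfolding w_def I(3)[OF j] by (rule a(2)[OF j])
  qed
  also have "... \<le> c * (s k * B w w)" using Aw c by (rule mult_left_mono)
  finally have "1 * B w w \<le> c * s k * B w w" by simp
  then show ?thesis using pos mult_le_cancel_right_pos[OF pos, of 1 "c * s k"] by blast
qed

end

lemma finite_level:
  fixes s :: "nat \<Rightarrow> real"
  assumes "filterlim s at_top sequentially"
  shows "finite {k. s k = t}"
proof -
  have "eventually (\<lambda>k. t + 1 \<le> s k) sequentially" using assms by (simp add: filterlim_at_top)
  then obtain N where N: "\<And>k. N \<le> k \<Longrightarrow> t + 1 \<le> s k" by (auto simp: eventually_sequentially)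
  have "{k. s k = t} \<subseteq> {..<N}"
  proof
    fix k assume "k \<in> {k. s k = t}"
    then show "k \<in> {..<N}" using N[of k] by (cases "N \<le> k") auto
  qed
  then show ?thesis by (rule finite_subset) simp
qed

text \<open>At the first index where the sequences differ, the smaller of the two values can occur
  in the other sequence only earlier, hence once less often.\<close>

lemma listing_unique:
  fixes s s' :: "nat \<Rightarrow> real"
  assumes s: "incseq s" "filterlim s at_top sequentially" and s': "incseq s'" "filterlim s' at_top sequentially"
    and eq: "\<And>t. card {k. s k = t} = card {k. s' k = t}"
  shows "s = s'"
proof -
  have less: False if r: "filterlim r at_top sequentially" "incseq r'" and eq: "card {k. r k = r m} = card {k. r' k = r m}"
    and before: "\<And>i. i < m \<Longrightarrow> r i = r' i" and lt: "r m < r' m" for r r' :: "nat \<Rightarrow> real" and m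
  proof -
    have "{k. r' k = r m} \<subseteq> {k. r k = r m} - {m}"
    proof
      fix k assume k: "k \<in> {k. r' k = r m}"
      then have "k < m" using incseqD[OF r(2), of m k] lt by (cases "m \<le> k") auto
      then show "k \<in> {k. r k = r m} - {m}" using before k by auto
    qed
    then have "card {k. r' k = r m} \<le> card ({k. r k = r m} - {m})"
      using finite_level[OF r(1)] by (intro card_mono) auto
    also have "... < card {k. r k = r m}" using finite_level[OF r(1)] by (intro card_Diff1_less) auto
    finally show False using eq by simp
  qed
  show ?thesis
  proof (rule ccontr)
    assume "s \<noteq> s'"
    then have ex: "\<exists>k. s k \<noteq> s' k" by auto
    define m where "m = (LEAST k. s k \<noteq> s' k)"
    have m: "s m \<noteq> s' m" unfolding m_def using ex by (rule LeastI_ex)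
    have before: "s i = s' i" if "i < m" for i using not_less_Least[OF that[unfolded m_def]] by simp
    consider "s m < s' m" | "s' m < s m" using m by linarith
    then show False
    proof cases
      case 1
      show False by (rule less[OF s(2) s'(1) eq before 1])
    next
      case 2
      show False by (rule less[OF s'(2) s(1) eq[symmetric] before[symmetric] 2])
    qed
  qed
qed

section \<open>Fields: functions carried together with gradient and trace\<close>

text \<open>A function, a candidate for its weak gradient and a candidate for its trace. Keeping the
  three as independent components makes every form a plain integral and reduces completeness to
  three applications of Riesz-Fischer.\<close>

type_synonym 'a field = "('a \<Rightarrow> real) \<times> ('a \<Rightarrow> 'a) \<times> ('a \<Rightarrow> real)"

definition mass_form :: "'a::euclidean_space set \<Rightarrow> 'a field \<Rightarrow> 'a field \<Rightarrow> real" where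
  "mass_form \<Omega> w v = (\<integral>x. fst w x \<bullet> fst v x \<partial>lebesgue_on \<Omega>)"

definition energy_form :: "'a::euclidean_space set \<Rightarrow> 'a field \<Rightarrow> 'a field \<Rightarrow> real" where
  "energy_form \<Omega> w v = (\<integral>x. fst (snd w) x \<bullet> fst (snd v) x \<partial>lebesgue_on \<Omega>)"

definition boundary_form :: "'a::euclidean_space set \<Rightarrow> 'a field \<Rightarrow> 'a field \<Rightarrow> real" where
  "boundary_form \<Omega> w v = (\<integral>x. snd (snd w) x \<bullet> snd (snd v) x \<partial>surface_measure \<Omega>)"

definition total_form :: "'a::euclidean_space set \<Rightarrow> 'a field \<Rightarrow> 'a field \<Rightarrow> real" where
  "total_form \<Omega> w v = mass_form \<Omega> w v + energy_form \<Omega> w v + boundary_form \<Omega> w v"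

definition L2_fields :: "'a::euclidean_space set \<Rightarrow> 'a field set" where
  "L2_fields \<Omega> = {w. square_integrable (lebesgue_on \<Omega>) (fst w) \<and>
     square_integrable (lebesgue_on \<Omega>) (fst (snd w)) \<and> square_integrable (surface_measure \<Omega>) (snd (snd w))}"

definition smooth_field :: "('a::euclidean_space \<Rightarrow> real) \<Rightarrow> ('a \<Rightarrow> 'a) \<Rightarrow> 'a field" where
  "smooth_field \<phi> D = (\<phi>, D, \<phi>)"

text \<open>The closure of C^1 fields in all three L^2 norms at once. Closure ties the components
  together: the second becomes the weak gradient of the first, and the third its trace.\<close>

definition trace_fields :: "'a::euclidean_space set \<Rightarrow> 'a field set" where
  "trace_fields \<Omega> = {w \<in> L2_fields \<Omega>. \<forall>e>0. \<exists>\<phi> D. C1_with_gradient \<phi> D \<and>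
     total_form \<Omega> (w - smooth_field \<phi> D) (w - smooth_field \<phi> D) < e}"

lemma field_simps_pointwise:
  "fst (w + v) x = fst w x + fst v x" "fst (snd (w + v)) x = fst (snd w) x + fst (snd v) x"
  "snd (snd (w + v)) x = snd (snd w) x + snd (snd v) x"
  "fst (w - v) x = fst w x - fst v x" "fst (snd (w - v)) x = fst (snd w) x - fst (snd v) x"
  "snd (snd (w - v)) x = snd (snd w) x - snd (snd v) x"
  "fst (c *\<^sub>R w) x = c *\<^sub>R fst w x" "fst (snd (c *\<^sub>R w)) x = c *\<^sub>R fst (snd w) x"
  "snd (snd (c *\<^sub>R w)) x = c *\<^sub>R snd (snd w) x"
  for w v :: "'a::euclidean_space field"
  by (simp_all add: scaleR_fun_def plus_fun_def fun_diff_def)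

lemma field_simps_fun:
  "fst (w + v) = (\<lambda>x. fst w x + fst v x)" "fst (snd (w + v)) = (\<lambda>x. fst (snd w) x + fst (snd v) x)"
  "snd (snd (w + v)) = (\<lambda>x. snd (snd w) x + snd (snd v) x)"
  "fst (c *\<^sub>R w) = (\<lambda>x. c *\<^sub>R fst w x)" "fst (snd (c *\<^sub>R w)) = (\<lambda>x. c *\<^sub>R fst (snd w) x)"
  "snd (snd (c *\<^sub>R w)) = (\<lambda>x. c *\<^sub>R snd (snd w) x)"
  for w v :: "'a::euclidean_space field"
  by (simp_all add: scaleR_fun_def plus_fun_def)

lemma field_sum_pointwise:
  "fst (\<Sum>i\<in>I. c i *\<^sub>R w i) x = (\<Sum>i\<in>I. c i * fst (w i) x)"
  for w :: "'i \<Rightarrow> 'a::euclidean_space field"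
  by (induction I rule: infinite_finite_induct) (simp_all add: field_simps_pointwise zero_fun_def scaleR_fun_def)

lemma subspace_L2_fields: "subspace (L2_fields \<Omega>)"
  unfolding subspace_def
proof (intro conjI ballI allI)
  show "0 \<in> L2_fields \<Omega>" by (simp add: L2_fields_def square_integrable_zero zero_fun_def)
next
  fix w v assume "w \<in> L2_fields \<Omega>" "v \<in> L2_fields \<Omega>"
  then show "w + v \<in> L2_fields \<Omega>"
    unfolding L2_fields_def mem_Collect_eq field_simps_fun by (blast intro: square_integrable_add)
next
  fix c :: real and w assume "w \<in> L2_fields \<Omega>"
  then show "c *\<^sub>R w \<in> L2_fields \<Omega>"
    unfolding L2_fields_def mem_Collect_eq field_simps_fun by (blast intro: square_integrable_scaleR)
qed

lemma psd_mass: "psd_form (L2_fields \<Omega>) (mass_form \<Omega>)"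
  unfolding mass_form_def
  by (rule psd_form_square_integrable[OF subspace_L2_fields]) (simp_all only: field_simps_pointwise, simp add: L2_fields_def)

lemma psd_energy: "psd_form (L2_fields \<Omega>) (energy_form \<Omega>)"
  unfolding energy_form_def
  by (rule psd_form_square_integrable[OF subspace_L2_fields]) (simp_all only: field_simps_pointwise, simp add: L2_fields_def)

lemma psd_boundary: "psd_form (L2_fields \<Omega>) (boundary_form \<Omega>)"
  unfolding boundary_form_def
  by (rule psd_form_square_integrable[OF subspace_L2_fields]) (simp_all only: field_simps_pointwise, simp add: L2_fields_def)

lemma psd_total: "psd_form (L2_fields \<Omega>) (total_form \<Omega>)"
  unfolding total_form_def by (intro psd_form_plus psd_mass psd_energy psd_boundary)

lemma form_le_total:
  assumes "w \<in> L2_fields \<Omega>"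
  shows "mass_form \<Omega> w w \<le> total_form \<Omega> w w" "energy_form \<Omega> w w \<le> total_form \<Omega> w w"
    "boundary_form \<Omega> w w \<le> total_form \<Omega> w w"
  using psd_form.nonneg[OF psd_mass assms] psd_form.nonneg[OF psd_energy assms] psd_form.nonneg[OF psd_boundary assms]
  by (simp_all add: total_form_def)

lemma total_tendsto_zero:
  assumes w: "\<And>m::nat. w m \<in> L2_fields \<Omega>" and lim: "(\<lambda>m. total_form \<Omega> (w m) (w m)) \<longlonglongrightarrow> 0"
  shows "(\<lambda>m. mass_form \<Omega> (w m) (w m)) \<longlonglongrightarrow> 0" "(\<lambda>m. energy_form \<Omega> (w m) (w m)) \<longlonglongrightarrow> 0"
    "(\<lambda>m. boundary_form \<Omega> (w m) (w m)) \<longlonglongrightarrow> 0"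
proof -
  show "(\<lambda>m. mass_form \<Omega> (w m) (w m)) \<longlonglongrightarrow> 0"
    by (rule tendsto_sandwich[OF _ _ tendsto_const lim]; intro always_eventually allI form_le_total psd_form.nonneg[OF psd_mass] w)
  show "(\<lambda>m. energy_form \<Omega> (w m) (w m)) \<longlonglongrightarrow> 0"
    by (rule tendsto_sandwich[OF _ _ tendsto_const lim]; intro always_eventually allI form_le_total psd_form.nonneg[OF psd_energy] w)
  show "(\<lambda>m. boundary_form \<Omega> (w m) (w m)) \<longlonglongrightarrow> 0"
    by (rule tendsto_sandwich[OF _ _ tendsto_const lim]; intro always_eventually allI form_le_total psd_form.nonneg[OF psd_boundary] w)
qed

lemma L2_fields_complete:
  assumes w: "\<And>m::nat. w m \<in> L2_fields \<Omega>"
    and cauchy: "\<And>e. 0 < e \<Longrightarrow> \<exists>N. \<forall>i\<ge>N. \<forall>j\<ge>N. total_form \<Omega> (w i - w j) (w i - w j) < e"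
  shows "\<exists>l\<in>L2_fields \<Omega>. (\<lambda>m. total_form \<Omega> (w m - l) (w m - l)) \<longlonglongrightarrow> 0"
proof -
  have d: "w i - w j \<in> L2_fields \<Omega>" for i j using w by (intro subspace_diff subspace_L2_fields)
  have comp: "\<exists>f. square_integrable R f \<and> (\<lambda>m. \<integral>x. (norm (F (w m) x - f x))\<^sup>2 \<partial>R) \<longlonglongrightarrow> 0"
    if sq: "\<And>m. square_integrable R (F (w m))"
      and le: "\<And>i j. (\<integral>x. (norm (F (w i) x - F (w j) x))\<^sup>2 \<partial>R) \<le> total_form \<Omega> (w i - w j) (w i - w j)"
    for R and F :: "'a field \<Rightarrow> 'a \<Rightarrow> 'b::euclidean_space"
  proof (rule square_integrable_complete[OF sq])
    fix e :: real assume "0 < e"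
    then obtain N where N: "\<And>i j. N \<le> i \<Longrightarrow> N \<le> j \<Longrightarrow> total_form \<Omega> (w i - w j) (w i - w j) < e"
      using cauchy[of e] by blast
    show "\<exists>N. \<forall>i\<ge>N. \<forall>j\<ge>N. (\<integral>x. (norm (F (w i) x - F (w j) x))\<^sup>2 \<partial>R) < e"
      by (intro exI[of _ N] allI impI) (rule le_less_trans[OF le N])
  qed
  have sq: "square_integrable (lebesgue_on \<Omega>) (fst (w m))" "square_integrable (lebesgue_on \<Omega>) (fst (snd (w m)))"
    "square_integrable (surface_measure \<Omega>) (snd (snd (w m)))" for m using w[of m] by (auto simp: L2_fields_def)
  note le = form_le_total[OF d, unfolded mass_form_def energy_form_def boundary_form_def field_simps_pointwise dot_square_norm]
  obtain f F g where f: "square_integrable (lebesgue_on \<Omega>) f"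
      "(\<lambda>m. \<integral>x. (norm (fst (w m) x - f x))\<^sup>2 \<partial>lebesgue_on \<Omega>) \<longlonglongrightarrow> 0"
    and F: "square_integrable (lebesgue_on \<Omega>) F"
      "(\<lambda>m. \<integral>x. (norm (fst (snd (w m)) x - F x))\<^sup>2 \<partial>lebesgue_on \<Omega>) \<longlonglongrightarrow> 0"
    and g: "square_integrable (surface_measure \<Omega>) g"
      "(\<lambda>m. \<integral>x. (norm (snd (snd (w m)) x - g x))\<^sup>2 \<partial>surface_measure \<Omega>) \<longlonglongrightarrow> 0"
    using comp[of _ fst, OF sq(1) le(1)] comp[of _ "\<lambda>w. fst (snd w)", OF sq(2) le(2)]
      comp[of _ "\<lambda>w. snd (snd w)", OF sq(3) le(3)] by blast
  let ?l = "(f, F, g)"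
  have "(\<lambda>m. total_form \<Omega> (w m - ?l) (w m - ?l)) \<longlonglongrightarrow> 0 + 0 + 0"
    unfolding total_form_def mass_form_def energy_form_def boundary_form_def field_simps_pointwise dot_square_norm fst_conv snd_conv
    by (intro tendsto_add f F g)
  moreover have "?l \<in> L2_fields \<Omega>" using f F g by (simp add: L2_fields_def)
  ultimately show ?thesis by auto
qed

lemma smooth_field_diff_distrib:
  "smooth_field \<phi> D + smooth_field \<psi> E = smooth_field (\<lambda>x. \<phi> x + \<psi> x) (\<lambda>x. D x + E x)"
  "c *\<^sub>R smooth_field \<phi> D = smooth_field (\<lambda>x. c * \<phi> x) (\<lambda>x. c *\<^sub>R D x)"
  by (simp_all add: smooth_field_def scaleR_fun_def plus_fun_def)

lemma (in psd_form) quad_diff_swap: "x \<in> W \<Longrightarrow> y \<in> W \<Longrightarrow> A (x - y) (x - y) = A (y - x) (y - x)"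
  using quad_diff[of x y] quad_diff[of y x] sym[of x y] by simp

lemma square_integrable_scaleR_integrable:
  fixes f :: "'x \<Rightarrow> real" and G :: "'x \<Rightarrow> 'b::euclidean_space"
  assumes f: "square_integrable M f" and G: "square_integrable M G"
  shows "integrable M (\<lambda>x. f x *\<^sub>R G x)"
proof (rule Bochner_Integration.integrable_bound)
  show "integrable M (\<lambda>x. (norm (f x))\<^sup>2 + (norm (G x))\<^sup>2)"
    using f G unfolding square_integrable_def by (intro Bochner_Integration.integrable_add) auto
  show "(\<lambda>x. f x *\<^sub>R G x) \<in> borel_measurable M"
    using f G unfolding square_integrable_def by (intro borel_measurable_scaleR) auto
  show "AE x in M. norm (f x *\<^sub>R G x) \<le> norm ((norm (f x))\<^sup>2 + (norm (G x))\<^sup>2)"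
  proof (intro always_eventually allI)
    fix x
    have "2 * \<bar>f x\<bar> * norm (G x) \<le> \<bar>f x\<bar>\<^sup>2 + (norm (G x))\<^sup>2" by (rule sum_squares_bound)
    moreover have "0 \<le> \<bar>f x\<bar> * norm (G x)" by simp
    ultimately have "\<bar>f x\<bar> * norm (G x) \<le> \<bar>f x\<bar>\<^sup>2 + (norm (G x))\<^sup>2" by linarith
    then show "norm (f x *\<^sub>R G x) \<le> norm ((norm (f x))\<^sup>2 + (norm (G x))\<^sup>2)" by simp
  qed
qed

locale lipschitz_domain =
  fixes \<Omega> :: "'a::euclidean_space set"
  assumes n: "2 \<le> DIM('a)" and dom: "bounded_lipschitz_domain \<Omega>"
begin

abbreviation "M \<equiv> mass_form \<Omega>"
abbreviation "A \<equiv> energy_form \<Omega>"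
abbreviation "B \<equiv> boundary_form \<Omega>"
abbreviation "N \<equiv> total_form \<Omega>"
abbreviation "W \<equiv> trace_fields \<Omega>"
abbreviation "H \<equiv> hausdorff_measure (DIM('a) - 1) :: 'a measure"

lemma dom': "open \<Omega>" "bounded \<Omega>" "connected \<Omega>" "\<Omega> \<noteq> {}" "\<Omega> \<in> sets borel"
  using dom by (auto simp: bounded_lipschitz_domain_def)

sublocale M: psd_form "L2_fields \<Omega>" M by (rule psd_mass)
sublocale A: psd_form "L2_fields \<Omega>" A by (rule psd_energy)
sublocale B: psd_form "L2_fields \<Omega>" B by (rule psd_boundary)
sublocale N: psd_form "L2_fields \<Omega>" N by (rule psd_total)

lemma W_L2: "w \<in> W \<Longrightarrow> w \<in> L2_fields \<Omega>" by (simp add: trace_fields_def)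

lemma nn_integral_surface: "(\<integral>\<^sup>+x. f x \<partial>surface_measure \<Omega>) = (\<integral>\<^sup>+x\<in>frontier \<Omega>. f x \<partial>H)"
  unfolding surface_measure_def by (subst nn_integral_restrict_space) auto

text \<open>On the boundary, square integrability is read off from \<open>lipschitz_trace\<close>,
  whose right side is finite for C^1 functions on a bounded set.\<close>

lemma C1_L2:
  assumes C1: "C1_with_gradient \<phi> D"
  shows "smooth_field \<phi> D \<in> L2_fields \<Omega>"
proof -
  have leb: "square_integrable (lebesgue_on \<Omega>) \<phi>" "square_integrable (lebesgue_on \<Omega>) D"
    by (intro continuous_square_integrable dom' C1_continuous[OF C1] C1_gradient_continuous[OF C1])+
  have "square_integrable (surface_measure \<Omega>) \<phi>"
    unfolding square_integrable_iff_nn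
  proof
    have "\<phi> \<in> borel_measurable H" by (rule C1_measurable_hausdorff[OF C1])
    then show "\<phi> \<in> borel_measurable (surface_measure \<Omega>)"
      unfolding surface_measure_def by (rule measurable_restrict_space1)
    obtain C h0 where C: "0 < C" "0 < h0" and tr:
      "\<And>h. 0 < h \<Longrightarrow> h \<le> h0 \<Longrightarrow> \<exists>T. compact T \<and> T \<subseteq> \<Omega> \<and> (\<forall>\<phi> D. C1_with_gradient \<phi> D \<longrightarrow>
        surface_int (frontier \<Omega>) \<phi>
        \<le> ennreal (C / h) * square_int T \<phi>
          + ennreal (C * h) * dirichlet_int \<Omega> D)"
      by (rule lipschitz_trace[OF n dom]) blast
    obtain T where T: "T \<subseteq> \<Omega>" and le: "surface_int (frontier \<Omega>) \<phi>
        \<le> ennreal (C / h0) * square_int T \<phi>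
          + ennreal (C * h0) * dirichlet_int \<Omega> D"
      using tr[OF C(2) order_refl] C1 by blast
    have "square_int T \<phi> \<le> square_int \<Omega> \<phi>"
      by (rule nn_integral_mono) (use T in \<open>auto split: split_indicator\<close>)
    also have "... < \<infinity>"
      using leb(1) unfolding square_integrable_iff_nn nn_integral_lebesgue_on[OF dom'(5)] by simp
    finally have 1: "square_int T \<phi> < \<infinity>" .
    have 2: "dirichlet_int \<Omega> D < \<infinity>"
      using leb(2) unfolding square_integrable_iff_nn nn_integral_lebesgue_on[OF dom'(5)] by simp
    have "surface_int (frontier \<Omega>) \<phi> < \<infinity>"
      using le 1 2 by (auto simp: ennreal_mult_less_top le_less_trans)
    then show "(\<integral>\<^sup>+x. ennreal ((norm (\<phi> x))\<^sup>2) \<partial>surface_measure \<Omega>) < \<infinity>"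
      unfolding nn_integral_surface by simp
  qed
  then show ?thesis using leb by (simp add: L2_fields_def smooth_field_def)
qed

lemma C1_nn:
  assumes C1: "C1_with_gradient \<phi> D"
  shows "square_int \<Omega> \<phi> = ennreal (M (smooth_field \<phi> D) (smooth_field \<phi> D))"
    "dirichlet_int \<Omega> D = ennreal (A (smooth_field \<phi> D) (smooth_field \<phi> D))"
    "surface_int (frontier \<Omega>) \<phi> = ennreal (B (smooth_field \<phi> D) (smooth_field \<phi> D))"
proof -
  have sq: "square_integrable (lebesgue_on \<Omega>) \<phi>" "square_integrable (lebesgue_on \<Omega>) D" "square_integrable (surface_measure \<Omega>) \<phi>"
    using C1_L2[OF C1] by (auto simp: L2_fields_def smooth_field_def)
  show "square_int \<Omega> \<phi> = ennreal (M (smooth_field \<phi> D) (smooth_field \<phi> D))"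
    using square_integrable_nn_eq[OF sq(1)] unfolding nn_integral_lebesgue_on[OF dom'(5)]
    by (simp add: mass_form_def smooth_field_def power2_eq_square)
  show "dirichlet_int \<Omega> D = ennreal (A (smooth_field \<phi> D) (smooth_field \<phi> D))"
    using square_integrable_nn_eq[OF sq(2)] unfolding nn_integral_lebesgue_on[OF dom'(5)]
    by (simp add: energy_form_def smooth_field_def dot_square_norm)
  show "surface_int (frontier \<Omega>) \<phi> = ennreal (B (smooth_field \<phi> D) (smooth_field \<phi> D))"
    using square_integrable_nn_eq[OF sq(3)] unfolding nn_integral_surface
    by (simp add: boundary_form_def smooth_field_def power2_eq_square)
qed

lemma subspace_W: "subspace W"
  unfolding subspace_def
proof (intro conjI ballI allI)
  show "0 \<in> W"
    unfolding trace_fields_def mem_Collect_eq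
  proof (intro conjI allI impI N.in_W)
    fix e :: real assume "0 < e"
    moreover have "0 - smooth_field (\<lambda>x. 0) (\<lambda>x. 0) = (0 :: 'a field)"
      by (simp add: smooth_field_def zero_prod_def zero_fun_def fun_diff_def)
    ultimately have "N (0 - smooth_field (\<lambda>x. 0) (\<lambda>x. 0)) (0 - smooth_field (\<lambda>x. 0) (\<lambda>x. 0)) < e"
      using N.zero_left[OF N.in_W(1)] by simp
    then show "\<exists>\<phi> D. C1_with_gradient \<phi> D \<and> N (0 - smooth_field \<phi> D) (0 - smooth_field \<phi> D) < e"
      using C1_const[of 0] by blast
  qed
next
  fix w v assume wv: "w \<in> W" "v \<in> W"
  show "w + v \<in> W"
    unfolding trace_fields_def mem_Collect_eq
  proof (intro conjI allI impI N.in_W W_L2 wv)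
    fix e :: real assume "0 < e"
    then have e: "0 < e / 4" by simp
    obtain \<phi> D where 1: "C1_with_gradient \<phi> D" "N (w - smooth_field \<phi> D) (w - smooth_field \<phi> D) < e / 4"
      using wv(1) e unfolding trace_fields_def by blast
    obtain \<psi> E where 2: "C1_with_gradient \<psi> E" "N (v - smooth_field \<psi> E) (v - smooth_field \<psi> E) < e / 4"
      using wv(2) e unfolding trace_fields_def by blast
    have L: "w - smooth_field \<phi> D \<in> L2_fields \<Omega>" "v - smooth_field \<psi> E \<in> L2_fields \<Omega>"
      using N.in_W(3)[OF W_L2[OF wv(1)] C1_L2[OF 1(1)]] N.in_W(3)[OF W_L2[OF wv(2)] C1_L2[OF 2(1)]] by auto
    let ?s = "smooth_field (\<lambda>x. \<phi> x + \<psi> x) (\<lambda>x. D x + E x)"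
    have eq: "(w - smooth_field \<phi> D) + (v - smooth_field \<psi> E) = w + v - ?s"
      unfolding smooth_field_diff_distrib(1)[symmetric] by (simp add: algebra_simps)
    have "N (w + v - ?s) (w + v - ?s) < e" using N.quad_add_le[OF L] 1(2) 2(2) unfolding eq by linarith
    then show "\<exists>\<phi> D. C1_with_gradient \<phi> D \<and> N (w + v - smooth_field \<phi> D) (w + v - smooth_field \<phi> D) < e"
      using C1_add[OF 1(1) 2(1)] by blast
  qed
next
  fix c :: real and w assume w: "w \<in> W"
  show "c *\<^sub>R w \<in> W"
    unfolding trace_fields_def mem_Collect_eq
  proof (intro conjI allI impI subspace_scale[OF subspace_L2_fields] W_L2 w)
    fix e :: real assume "0 < e"
    then have e: "0 < e / (c\<^sup>2 + 1)" by (simp add: add_nonneg_pos)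
    obtain \<phi> D where 1: "C1_with_gradient \<phi> D" "N (w - smooth_field \<phi> D) (w - smooth_field \<phi> D) < e / (c\<^sup>2 + 1)"
      using w e unfolding trace_fields_def by blast
    have L: "w - smooth_field \<phi> D \<in> L2_fields \<Omega>" by (rule N.in_W(3)[OF W_L2[OF w] C1_L2[OF 1(1)]])
    let ?s = "smooth_field (\<lambda>x. c * \<phi> x) (\<lambda>x. c *\<^sub>R D x)"
    have eq: "c *\<^sub>R w - ?s = c *\<^sub>R (w - smooth_field \<phi> D)"
      unfolding smooth_field_diff_distrib(2)[symmetric] by (simp only: scaleR_diff_right)
    have "N (c *\<^sub>R w - ?s) (c *\<^sub>R w - ?s) = c\<^sup>2 * N (w - smooth_field \<phi> D) (w - smooth_field \<phi> D)"
      unfolding eq by (rule N.quad_scale[OF L])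
    also have "... \<le> (c\<^sup>2 + 1) * N (w - smooth_field \<phi> D) (w - smooth_field \<phi> D)"
      using N.nonneg[OF L] by (intro mult_right_mono) auto
    also have "... < (c\<^sup>2 + 1) * (e / (c\<^sup>2 + 1))" using 1(2) by (intro mult_strict_left_mono) (auto simp: add_nonneg_pos)
    also have "... = e" using add_nonneg_pos[of "c\<^sup>2" 1] by simp
    finally show "\<exists>\<phi> D. C1_with_gradient \<phi> D \<and> N (c *\<^sub>R w - smooth_field \<phi> D) (c *\<^sub>R w - smooth_field \<phi> D) < e"
      using C1_scale[OF 1(1), of c] by blast
  qed
qed

lemma C1_W:
  assumes "C1_with_gradient \<phi> D"
  shows "smooth_field \<phi> D \<in> W"
  unfolding trace_fields_def mem_Collect_eq
proof (intro conjI allI impI C1_L2 assms)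
  fix e :: real assume "0 < e"
  then have "N (smooth_field \<phi> D - smooth_field \<phi> D) (smooth_field \<phi> D - smooth_field \<phi> D) < e"
    using N.zero_left[OF N.in_W(1)] by simp
  then show "\<exists>\<psi> E. C1_with_gradient \<psi> E \<and> N (smooth_field \<phi> D - smooth_field \<psi> E) (smooth_field \<phi> D - smooth_field \<psi> E) < e"
    using assms by blast
qed

lemma W_closed:
  assumes x: "\<And>m::nat. x m \<in> W" and l: "l \<in> L2_fields \<Omega>" and lim: "(\<lambda>m. N (x m - l) (x m - l)) \<longlonglongrightarrow> 0"
  shows "l \<in> W"
  unfolding trace_fields_def mem_Collect_eq
proof (intro conjI l allI impI)
  fix e :: real assume e: "0 < e"
  have "eventually (\<lambda>m. N (x m - l) (x m - l) < e / 4) sequentially" using lim e by (intro order_tendstoD) auto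
  then obtain m where m: "N (x m - l) (x m - l) < e / 4" using eventually_sequentially by auto
  have "0 < e / 4" using e by simp
  then obtain \<phi> D where C1: "C1_with_gradient \<phi> D" and s: "N (x m - smooth_field \<phi> D) (x m - smooth_field \<phi> D) < e / 4"
    using x[of m] unfolding trace_fields_def by blast
  have xL: "x m \<in> L2_fields \<Omega>" using x by (rule W_L2)
  have "l - smooth_field \<phi> D = (l - x m) + (x m - smooth_field \<phi> D)" by simp
  then have "N (l - smooth_field \<phi> D) (l - smooth_field \<phi> D)
      \<le> 2 * N (l - x m) (l - x m) + 2 * N (x m - smooth_field \<phi> D) (x m - smooth_field \<phi> D)"
    using N.quad_add_le[of "l - x m" "x m - smooth_field \<phi> D"] N.in_W(3)[OF l xL] N.in_W(3)[OF xL C1_L2[OF C1]] by simp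
  also have "N (l - x m) (l - x m) = N (x m - l) (x m - l)" by (rule N.quad_diff_swap[OF l xL])
  finally have "N (l - smooth_field \<phi> D) (l - smooth_field \<phi> D) < e" using m s by linarith
  then show "\<exists>\<phi> D. C1_with_gradient \<phi> D \<and> N (l - smooth_field \<phi> D) (l - smooth_field \<phi> D) < e" using C1 by blast
qed

lemma W_smooth_limit:
  assumes "w \<in> W"
  shows "\<exists>\<phi> D. (\<forall>m::nat. C1_with_gradient (\<phi> m) (D m)) \<and>
    (\<lambda>m. N (w - smooth_field (\<phi> m) (D m)) (w - smooth_field (\<phi> m) (D m))) \<longlonglongrightarrow> 0"
proof -
  have "\<exists>\<phi> D. C1_with_gradient \<phi> D \<and> N (w - smooth_field \<phi> D) (w - smooth_field \<phi> D) < inverse (real (Suc m))" for m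
    using assms unfolding trace_fields_def by simp
  then obtain \<phi> D where *: "\<And>m. C1_with_gradient (\<phi> m) (D m)"
      "\<And>m. N (w - smooth_field (\<phi> m) (D m)) (w - smooth_field (\<phi> m) (D m)) < inverse (real (Suc m))"
    by metis
  have L: "w - smooth_field (\<phi> m) (D m) \<in> L2_fields \<Omega>" for m by (rule N.in_W(3)[OF W_L2[OF assms] C1_L2[OF *(1)]])
  have "(\<lambda>m. N (w - smooth_field (\<phi> m) (D m)) (w - smooth_field (\<phi> m) (D m))) \<longlonglongrightarrow> 0"
  proof (rule tendsto_sandwich[OF _ _ tendsto_const LIMSEQ_inverse_real_of_nat])
    show "\<forall>\<^sub>F m in sequentially. 0 \<le> N (w - smooth_field (\<phi> m) (D m)) (w - smooth_field (\<phi> m) (D m))"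
      by (intro always_eventually allI N.nonneg L)
    show "\<forall>\<^sub>F m in sequentially. N (w - smooth_field (\<phi> m) (D m)) (w - smooth_field (\<phi> m) (D m)) \<le> inverse (real (Suc m))"
      by (intro always_eventually allI less_imp_le *(2))
  qed
  then show ?thesis using *(1) by blast
qed

lemma W_approx:
  assumes w: "w \<in> W"
  obtains \<phi> D where "\<And>m::nat. C1_with_gradient (\<phi> m) (D m)"
    "(\<lambda>m. M (smooth_field (\<phi> m) (D m)) (smooth_field (\<phi> m) (D m))) \<longlonglongrightarrow> M w w"
    "(\<lambda>m. A (smooth_field (\<phi> m) (D m)) (smooth_field (\<phi> m) (D m))) \<longlonglongrightarrow> A w w"
    "(\<lambda>m. B (smooth_field (\<phi> m) (D m)) (smooth_field (\<phi> m) (D m))) \<longlonglongrightarrow> B w w"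
    "\<And>v. v \<in> L2_fields \<Omega> \<Longrightarrow> (\<lambda>m. M (smooth_field (\<phi> m) (D m)) v) \<longlonglongrightarrow> M w v"
    "\<And>v. v \<in> L2_fields \<Omega> \<Longrightarrow> (\<lambda>m. A (smooth_field (\<phi> m) (D m)) v) \<longlonglongrightarrow> A w v"
proof -
  obtain \<phi> D where C1: "\<And>m::nat. C1_with_gradient (\<phi> m) (D m)" and
    lim: "(\<lambda>m. N (w - smooth_field (\<phi> m) (D m)) (w - smooth_field (\<phi> m) (D m))) \<longlonglongrightarrow> 0"
    using W_smooth_limit[OF w] by blast
  let ?x = "\<lambda>m. smooth_field (\<phi> m) (D m)"
  have wL: "w \<in> L2_fields \<Omega>" by (rule W_L2[OF w])
  have xL: "?x m \<in> L2_fields \<Omega>" for m by (rule C1_L2[OF C1])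
  have dL: "?x m - w \<in> L2_fields \<Omega>" for m by (rule N.in_W(3)[OF xL wL])
  have "(\<lambda>m. N (?x m - w) (?x m - w)) \<longlonglongrightarrow> 0" using lim unfolding N.quad_diff_swap[OF wL xL] .
  note l = total_tendsto_zero[OF dL this]
  show ?thesis
    by (rule that[OF C1 M.tendsto_quad[OF xL wL l(1)] A.tendsto_quad[OF xL wL l(2)] B.tendsto_quad[OF xL wL l(3)]
        M.tendsto_form[OF xL wL l(1)] A.tendsto_form[OF xL wL l(2)]])
qed

text \<open>Every term is continuous along the approximation by C^1 fields, products with the fixed
  fields q i included, so inequalities need to be proved for C^1 functions only.\<close>

lemma form_inequality_W:
  assumes q: "\<And>i. i \<in> I \<Longrightarrow> q i \<in> L2_fields \<Omega>"
    and C1: "\<And>\<phi> D. C1_with_gradient \<phi> D \<Longrightarrow> B (smooth_field \<phi> D) (smooth_field \<phi> D) \<le>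
       a * A (smooth_field \<phi> D) (smooth_field \<phi> D) + b * M (smooth_field \<phi> D) (smooth_field \<phi> D)
         + c * (\<Sum>i\<in>I. (M (smooth_field \<phi> D) (q i))\<^sup>2)"
    and w: "w \<in> W"
  shows "B w w \<le> a * A w w + b * M w w + c * (\<Sum>i\<in>I. (M w (q i))\<^sup>2)"
proof -
  obtain \<phi> D where x: "\<And>m::nat. C1_with_gradient (\<phi> m) (D m)"
    "(\<lambda>m. M (smooth_field (\<phi> m) (D m)) (smooth_field (\<phi> m) (D m))) \<longlonglongrightarrow> M w w"
    "(\<lambda>m. A (smooth_field (\<phi> m) (D m)) (smooth_field (\<phi> m) (D m))) \<longlonglongrightarrow> A w w"
    "(\<lambda>m. B (smooth_field (\<phi> m) (D m)) (smooth_field (\<phi> m) (D m))) \<longlonglongrightarrow> B w w"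
    "\<And>v. v \<in> L2_fields \<Omega> \<Longrightarrow> (\<lambda>m. M (smooth_field (\<phi> m) (D m)) v) \<longlonglongrightarrow> M w v"
    by (rule W_approx[OF w]) blast
  show ?thesis
  proof (rule LIMSEQ_le[OF x(4)])
    show "(\<lambda>m. a * A (smooth_field (\<phi> m) (D m)) (smooth_field (\<phi> m) (D m))
        + b * M (smooth_field (\<phi> m) (D m)) (smooth_field (\<phi> m) (D m))
        + c * (\<Sum>i\<in>I. (M (smooth_field (\<phi> m) (D m)) (q i))\<^sup>2))
      \<longlonglongrightarrow> a * A w w + b * M w w + c * (\<Sum>i\<in>I. (M w (q i))\<^sup>2)"
      by (intro tendsto_add tendsto_mult_left tendsto_sum tendsto_power x(2,3) x(5) q)
  qed (use C1[OF x(1)] in blast)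
qed

text \<open>Interior mass is not one of the two forms of the pair. This bound makes A + B equivalent
  to the total form, so that W is complete for A + B and bounded sequences have bounded
  mass.\<close>

lemma friedrichs_W: "\<exists>a b. 0 \<le> a \<and> 0 \<le> b \<and> (\<forall>w\<in>W. M w w \<le> a * B w w + b * A w w)"
proof -
  obtain z :: 'a where z: "norm z = diameter \<Omega> + 1" using diameter_ge_0[OF dom'(2)] vector_choose_size[of "diameter \<Omega> + 1"] by auto
  let ?a = "proj_const (DIM('a)) * norm z * 2" and ?b = "2 * (norm z)\<^sup>2"
  have p: "0 < proj_const (DIM('a))" by (rule proj_const_pos)
  have smooth: "M x x \<le> ?a * B x x + ?b * A x x" if C1: "C1_with_gradient \<phi> D" and x: "x = smooth_field \<phi> D" for x \<phi> D
  proof -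
    have xL: "x \<in> L2_fields \<Omega>" unfolding x by (rule C1_L2[OF C1])
    have 2: "(\<integral>\<^sup>+y\<in>frontier \<Omega>. ennreal (2 * (\<phi> y)\<^sup>2) \<partial>H) = 2 * ennreal (B x x)"
    proof -
      have [measurable]: "\<phi> \<in> borel_measurable H" by (rule C1_measurable_hausdorff[OF C1])
      have [measurable]: "frontier \<Omega> \<in> sets H" by simp
      have "(\<integral>\<^sup>+y\<in>frontier \<Omega>. ennreal (2 * (\<phi> y)\<^sup>2) \<partial>H) = (\<integral>\<^sup>+y. 2 * (ennreal ((\<phi> y)\<^sup>2) * indicator (frontier \<Omega>) y) \<partial>H)"
        by (intro nn_integral_cong) (simp add: ennreal_mult mult.assoc)
      also have "... = 2 * (\<integral>\<^sup>+y. ennreal ((\<phi> y)\<^sup>2) * indicator (frontier \<Omega>) y \<partial>H)" by (rule nn_integral_cmult) measurable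
      finally show ?thesis unfolding x C1_nn(3)[OF C1] .
    qed
    have "ennreal (M x x) \<le> ennreal (proj_const (DIM('a)) * norm z) * (2 * ennreal (B x x)) + ennreal ?b * ennreal (A x x)"
      using friedrichs[OF n dom'(1,2) C1 z] unfolding 2 unfolding C1_nn[OF C1] x .
    also have "ennreal (proj_const (DIM('a)) * norm z) * (2 * ennreal (B x x)) = ennreal (?a * B x x)"
      using p B.nonneg[OF xL] by (simp add: ennreal_mult mult.assoc)
    also have "ennreal ?b * ennreal (A x x) = ennreal (?b * A x x)" by (rule ennreal_mult[symmetric]) (use A.nonneg[OF xL] in auto)
    also have "ennreal (?a * B x x) + ennreal (?b * A x x) = ennreal (?a * B x x + ?b * A x x)"
      by (rule ennreal_plus[symmetric]) (use p A.nonneg[OF xL] B.nonneg[OF xL] in auto)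
    finally show ?thesis using p A.nonneg[OF xL] B.nonneg[OF xL] by (subst (asm) ennreal_le_iff) (auto intro!: add_nonneg_nonneg mult_nonneg_nonneg)
  qed
  have "M w w \<le> ?a * B w w + ?b * A w w" if w: "w \<in> W" for w
  proof -
    obtain \<phi> D where x: "\<And>m::nat. C1_with_gradient (\<phi> m) (D m)"
      "(\<lambda>m. M (smooth_field (\<phi> m) (D m)) (smooth_field (\<phi> m) (D m))) \<longlonglongrightarrow> M w w"
      "(\<lambda>m. A (smooth_field (\<phi> m) (D m)) (smooth_field (\<phi> m) (D m))) \<longlonglongrightarrow> A w w"
      "(\<lambda>m. B (smooth_field (\<phi> m) (D m)) (smooth_field (\<phi> m) (D m))) \<longlonglongrightarrow> B w w"
      by (rule W_approx[OF w]) blast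
    show ?thesis
    proof (rule LIMSEQ_le[OF x(2)])
      show "(\<lambda>m. ?a * B (smooth_field (\<phi> m) (D m)) (smooth_field (\<phi> m) (D m))
          + ?b * A (smooth_field (\<phi> m) (D m)) (smooth_field (\<phi> m) (D m))) \<longlonglongrightarrow> ?a * B w w + ?b * A w w"
        by (intro tendsto_add tendsto_mult_left x(3,4))
    qed (use smooth[OF x(1) refl] in blast)
  qed
  moreover have "0 \<le> ?a" "0 \<le> ?b" using p by auto
  ultimately show ?thesis by blast
qed


section \<open>Fields and the Sobolev space with traces\<close>

text \<open>The identity defining a weak gradient is linear and continuous in the field, holds for
  C^1 fields, and survives the limit.\<close>

lemma W_H1:
  assumes w: "w \<in> W"
  shows "H1_with_gradient \<Omega> (fst w) (fst (snd w))"
  unfolding H1_with_gradient_def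
proof (intro conjI allI impI)
  let ?l = "lebesgue_on \<Omega>"
  show sq: "square_integrable ?l (fst w)" "square_integrable ?l (fst (snd w))"
    using W_L2[OF w] by (auto simp: L2_fields_def)
  fix \<psi> E assume t: "test_function \<Omega> \<psi> E"
  then have C1: "C1_with_gradient \<psi> E" by (simp add: test_function_def)
  have sqt: "square_integrable ?l \<psi>" "square_integrable ?l E"
    by (intro continuous_square_integrable dom' C1_continuous[OF C1] C1_gradient_continuous[OF C1])+
  show "(\<integral>x. fst w x *\<^sub>R E x \<partial>?l) = - (\<integral>x. \<psi> x *\<^sub>R fst (snd w) x \<partial>?l)"
  proof (rule euclidean_eqI)
    fix b :: 'a assume "b \<in> Basis"
    \<comment> \<open>Two auxiliary fields that turn one coordinate of each side of the identity
      into a product in M and in A, where convergence is known.\<close>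
    let ?a = "(\<lambda>x. E x \<bullet> b, \<lambda>x. 0, \<lambda>x. 0) :: 'a field" and ?c = "(\<lambda>x. 0, \<lambda>x. \<psi> x *\<^sub>R b, \<lambda>x. 0) :: 'a field"
    have "continuous_on UNIV (\<lambda>x. E x \<bullet> b)" by (intro continuous_intros C1_gradient_continuous[OF C1])
    moreover have "continuous_on UNIV (\<lambda>x. \<psi> x *\<^sub>R b)" by (intro continuous_intros C1_continuous[OF C1])
    ultimately have aL: "?a \<in> L2_fields \<Omega>" and cL: "?c \<in> L2_fields \<Omega>"
      by (simp_all add: L2_fields_def square_integrable_zero continuous_square_integrable dom')
    have parts: "M v ?a = (\<integral>x. fst v x *\<^sub>R E x \<partial>?l) \<bullet> b" "A v ?c = (\<integral>x. \<psi> x *\<^sub>R fst (snd v) x \<partial>?l) \<bullet> b"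
      if v: "v \<in> L2_fields \<Omega>" for v
    proof -
      have sqv: "square_integrable ?l (fst v)" "square_integrable ?l (fst (snd v))" using v by (auto simp: L2_fields_def)
      have "integrable ?l (\<lambda>x. fst v x *\<^sub>R E x)" by (rule square_integrable_scaleR_integrable[OF sqv(1) sqt(2)])
      then have "(\<integral>x. (fst v x *\<^sub>R E x) \<bullet> b \<partial>?l) = (\<integral>x. fst v x *\<^sub>R E x \<partial>?l) \<bullet> b" by (intro integral_inner_left)
      then show "M v ?a = (\<integral>x. fst v x *\<^sub>R E x \<partial>?l) \<bullet> b" by (simp add: mass_form_def)
      have "integrable ?l (\<lambda>x. \<psi> x *\<^sub>R fst (snd v) x)" by (rule square_integrable_scaleR_integrable[OF sqt(1) sqv(2)])
      then have "(\<integral>x. (\<psi> x *\<^sub>R fst (snd v) x) \<bullet> b \<partial>?l) = (\<integral>x. \<psi> x *\<^sub>R fst (snd v) x \<partial>?l) \<bullet> b" by (intro integral_inner_left)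
      then show "A v ?c = (\<integral>x. \<psi> x *\<^sub>R fst (snd v) x \<partial>?l) \<bullet> b" by (simp add: energy_form_def)
    qed
    obtain \<phi> D where x: "\<And>m::nat. C1_with_gradient (\<phi> m) (D m)"
      "\<And>v. v \<in> L2_fields \<Omega> \<Longrightarrow> (\<lambda>m. M (smooth_field (\<phi> m) (D m)) v) \<longlonglongrightarrow> M w v"
      "\<And>v. v \<in> L2_fields \<Omega> \<Longrightarrow> (\<lambda>m. A (smooth_field (\<phi> m) (D m)) v) \<longlonglongrightarrow> A w v"
      by (rule W_approx[OF w]) blast
    have "M (smooth_field (\<phi> m) (D m)) ?a + A (smooth_field (\<phi> m) (D m)) ?c = 0" for m
    proof -
      have "(\<integral>x. \<phi> m x *\<^sub>R E x \<partial>?l) = - (\<integral>x. \<psi> x *\<^sub>R D m x \<partial>?l)"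
        by (rule test_function_integration_by_parts[OF dom'(1) x(1) t])
      then show ?thesis unfolding parts[OF C1_L2[OF x(1)]] by (simp add: smooth_field_def)
    qed
    moreover have "(\<lambda>m. M (smooth_field (\<phi> m) (D m)) ?a + A (smooth_field (\<phi> m) (D m)) ?c) \<longlonglongrightarrow> M w ?a + A w ?c"
      by (intro tendsto_add x(2)[OF aL] x(3)[OF cL])
    ultimately have "M w ?a + A w ?c = 0" using LIMSEQ_unique[OF tendsto_const[of 0]] by simp
    then show "(\<integral>x. fst w x *\<^sub>R E x \<partial>?l) \<bullet> b = (- (\<integral>x. \<psi> x *\<^sub>R fst (snd w) x \<partial>?l)) \<bullet> b"
      unfolding parts[OF W_L2[OF w]] by simp
  qed
qed

lemma interior_nn:
  assumes C1: "C1_with_gradient \<phi> D" and w: "(u, G, g) \<in> L2_fields \<Omega>"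
  shows "(\<integral>\<^sup>+x. ennreal ((u x - \<phi> x)\<^sup>2 + (norm (G x - D x))\<^sup>2) \<partial>lebesgue_on \<Omega>) =
      ennreal (M ((u, G, g) - smooth_field \<phi> D) ((u, G, g) - smooth_field \<phi> D)
        + A ((u, G, g) - smooth_field \<phi> D) ((u, G, g) - smooth_field \<phi> D))"
    "(\<integral>\<^sup>+x. ennreal ((g x - \<phi> x)\<^sup>2) \<partial>surface_measure \<Omega>) =
      ennreal (B ((u, G, g) - smooth_field \<phi> D) ((u, G, g) - smooth_field \<phi> D))"
proof -
  let ?w = "(u, G, g) - smooth_field \<phi> D"
  have L: "?w \<in> L2_fields \<Omega>" by (rule N.in_W(3)[OF w C1_L2[OF C1]])
  have f: "fst ?w = (\<lambda>x. u x - \<phi> x)" "fst (snd ?w) = (\<lambda>x. G x - D x)" "snd (snd ?w) = (\<lambda>x. g x - \<phi> x)"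
    by (simp_all add: smooth_field_def fun_diff_def)
  have sq: "square_integrable (lebesgue_on \<Omega>) (\<lambda>x. u x - \<phi> x)" "square_integrable (lebesgue_on \<Omega>) (\<lambda>x. G x - D x)"
    "square_integrable (surface_measure \<Omega>) (\<lambda>x. g x - \<phi> x)" using L unfolding L2_fields_def mem_Collect_eq f by auto
  have int: "integrable (lebesgue_on \<Omega>) (\<lambda>x. (u x - \<phi> x)\<^sup>2)" "integrable (lebesgue_on \<Omega>) (\<lambda>x. (norm (G x - D x))\<^sup>2)"
    using sq(1,2) by (auto simp: square_integrable_def)
  have "(\<integral>\<^sup>+x. ennreal ((u x - \<phi> x)\<^sup>2 + (norm (G x - D x))\<^sup>2) \<partial>lebesgue_on \<Omega>)
      = ennreal (\<integral>x. (u x - \<phi> x)\<^sup>2 + (norm (G x - D x))\<^sup>2 \<partial>lebesgue_on \<Omega>)"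
    by (intro nn_integral_eq_integral Bochner_Integration.integrable_add int) auto
  also have "(\<integral>x. (u x - \<phi> x)\<^sup>2 + (norm (G x - D x))\<^sup>2 \<partial>lebesgue_on \<Omega>) = M ?w ?w + A ?w ?w"
    unfolding mass_form_def energy_form_def f dot_square_norm Bochner_Integration.integral_add[OF int] by simp
  finally show "(\<integral>\<^sup>+x. ennreal ((u x - \<phi> x)\<^sup>2 + (norm (G x - D x))\<^sup>2) \<partial>lebesgue_on \<Omega>) = ennreal (M ?w ?w + A ?w ?w)" .
  show "(\<integral>\<^sup>+x. ennreal ((g x - \<phi> x)\<^sup>2) \<partial>surface_measure \<Omega>) = ennreal (B ?w ?w)"
    using square_integrable_nn_eq[OF sq(3)] unfolding boundary_form_def f dot_square_norm by simp
qed

text \<open>The approximation demanded by \<open>has_trace\<close> is convergence in the total form,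
  split into interior and boundary parts; this translates the definition into membership in the
  closure.\<close>

lemma has_trace_iff: "has_trace \<Omega> u g \<longleftrightarrow> (\<exists>G. (u, G, g) \<in> W)"
proof
  assume "has_trace \<Omega> u g"
  then obtain G \<phi> D where g: "square_integrable (surface_measure \<Omega>) g" and H1: "H1_with_gradient \<Omega> u G"
    and C1: "\<And>j::nat. C1_with_gradient (\<phi> j) (D j)" and
    l1: "(\<lambda>j. \<integral>\<^sup>+x. ennreal ((u x - \<phi> j x)\<^sup>2 + (norm (G x - D j x))\<^sup>2) \<partial>lebesgue_on \<Omega>) \<longlonglongrightarrow> 0" and
    l2: "(\<lambda>j. \<integral>\<^sup>+x. ennreal ((g x - \<phi> j x)\<^sup>2) \<partial>surface_measure \<Omega>) \<longlonglongrightarrow> 0"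
    unfolding has_trace_def by blast
  let ?w = "(u, G, g)"
  have L: "?w \<in> L2_fields \<Omega>" using g H1 by (simp add: L2_fields_def H1_with_gradient_def)
  let ?d = "\<lambda>j. ?w - smooth_field (\<phi> j) (D j)"
  have dL: "?d j \<in> L2_fields \<Omega>" for j by (rule N.in_W(3)[OF L C1_L2[OF C1]])
  have "(\<lambda>j. ennreal (M (?d j) (?d j) + A (?d j) (?d j))) \<longlonglongrightarrow> ennreal 0"
    using l1 unfolding interior_nn(1)[OF C1 L] by simp
  then have r1: "(\<lambda>j. M (?d j) (?d j) + A (?d j) (?d j)) \<longlonglongrightarrow> 0"
    using M.nonneg[OF dL] A.nonneg[OF dL] by (subst (asm) tendsto_ennreal_iff) auto
  have "(\<lambda>j. ennreal (B (?d j) (?d j))) \<longlonglongrightarrow> ennreal 0"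
    using l2 unfolding interior_nn(2)[OF C1 L] by simp
  then have r2: "(\<lambda>j. B (?d j) (?d j)) \<longlonglongrightarrow> 0"
    using B.nonneg[OF dL] by (subst (asm) tendsto_ennreal_iff) auto
  have lim: "(\<lambda>j. N (?d j) (?d j)) \<longlonglongrightarrow> 0" using tendsto_add[OF r1 r2] by (simp add: total_form_def)
  have "(\<lambda>j. N (smooth_field (\<phi> j) (D j) - ?w) (smooth_field (\<phi> j) (D j) - ?w)) \<longlonglongrightarrow> 0"
    using lim unfolding N.quad_diff_swap[OF L C1_L2[OF C1]] .
  then have "?w \<in> W" by (rule W_closed[OF C1_W[OF C1] L])
  then show "\<exists>G. (u, G, g) \<in> W" by blast
next
  assume "\<exists>G. (u, G, g) \<in> W"
  then obtain G where w: "(u, G, g) \<in> W" by blast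
  let ?w = "(u, G, g)"
  have L: "?w \<in> L2_fields \<Omega>" by (rule W_L2[OF w])
  have H1: "H1_with_gradient \<Omega> u G" using W_H1[OF w] by simp
  obtain \<phi> D where C1: "\<And>m::nat. C1_with_gradient (\<phi> m) (D m)" and
    lim: "(\<lambda>m. N (?w - smooth_field (\<phi> m) (D m)) (?w - smooth_field (\<phi> m) (D m))) \<longlonglongrightarrow> 0"
    using W_smooth_limit[OF w] by blast
  let ?d = "\<lambda>j. ?w - smooth_field (\<phi> j) (D j)"
  have dL: "?d j \<in> L2_fields \<Omega>" for j by (rule N.in_W(3)[OF L C1_L2[OF C1]])
  note l = total_tendsto_zero[OF dL lim]
  have 1: "(\<lambda>j. ennreal (M (?d j) (?d j) + A (?d j) (?d j))) \<longlonglongrightarrow> 0"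
    using tendsto_ennrealI[OF tendsto_add[OF l(1,2)]] by simp
  have 2: "(\<lambda>j. ennreal (B (?d j) (?d j))) \<longlonglongrightarrow> 0"
    using tendsto_ennrealI[OF l(3)] by simp
  have g: "square_integrable (surface_measure \<Omega>) g" using L by (simp add: L2_fields_def)
  show "has_trace \<Omega> u g"
    unfolding has_trace_def
    by (intro conjI g exI[of _ G] exI[of _ \<phi>] exI[of _ D] H1 allI C1 1[folded interior_nn(1)[OF C1 L]] 2[folded interior_nn(2)[OF C1 L]])
qed

section \<open>Compactness of the boundary form\<close>

lemma indicator_L2:
  assumes Q: "Q \<in> sets borel"
  shows "(indicator Q, \<lambda>_. 0, \<lambda>_. 0) \<in> L2_fields \<Omega>"
proof -
  interpret finite_measure "lebesgue_on \<Omega>" by (rule finite_measure_lebesgue_on[OF dom'(1,2)])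
  have m: "(indicator Q :: 'a \<Rightarrow> real) \<in> borel_measurable (lebesgue_on \<Omega>)"
    by (intro borel_measurable_lebesgue_on borel_measurable_indicator Q)
  have "integrable (lebesgue_on \<Omega>) (\<lambda>x. (norm (indicator Q x :: real))\<^sup>2)"
    by (rule integrable_const_bound[of _ 1]) (use m in \<open>auto split: split_indicator\<close>)
  then show ?thesis using m by (simp add: L2_fields_def square_integrable_def)
qed

lemma mass_indicator:
  assumes C1: "C1_with_gradient \<phi> D" and Q: "Q \<in> sets borel" "Q \<subseteq> \<Omega>"
  shows "M (smooth_field \<phi> D) (indicator Q, \<lambda>_. 0, \<lambda>_. 0) = (\<integral>x. indicator Q x * \<phi> x \<partial>lborel)"
proof -
  have m: "(\<lambda>x. \<phi> x * indicator Q x) \<in> borel_measurable borel"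
    by (intro borel_measurable_times C1_measurable[OF C1] borel_measurable_indicator Q)
  have "M (smooth_field \<phi> D) (indicator Q, \<lambda>_. 0, \<lambda>_. 0) = (\<integral>x. \<phi> x * indicator Q x \<partial>lebesgue_on \<Omega>)"
    by (simp add: mass_form_def smooth_field_def)
  also have "... = (\<integral>x. indicator \<Omega> x *\<^sub>R (\<phi> x * indicator Q x) \<partial>lborel)"
    by (rule integral_lebesgue_on_lborel[OF dom'(5) m])
  also have "... = (\<integral>x. indicator Q x * \<phi> x \<partial>lborel)"
    by (rule Bochner_Integration.integral_cong) (use Q in \<open>auto split: split_indicator\<close>)
  finally show ?thesis .
qed

text \<open>The common shape of the Ehrling inequality and of the trace estimate on thin boxes.
  Integrals of \<phi> over Q become mass products with an indicator field, which are defined for all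
  of W.\<close>

lemma functional_inequality_W:
  assumes I: "\<And>Q. Q \<in> I \<Longrightarrow> Q \<in> sets borel \<and> Q \<subseteq> \<Omega>" and ac: "0 \<le> a" "0 \<le> c"
    and le: "\<And>\<phi> D. C1_with_gradient \<phi> D \<Longrightarrow> (surface_int (frontier \<Omega>) \<phi>)
      \<le> ennreal a * dirichlet_int \<Omega> D
        + ennreal (c * (\<Sum>Q\<in>I. (\<integral>x. indicator Q x * \<phi> x \<partial>lborel)\<^sup>2))"
    and w: "w \<in> W"
  shows "B w w \<le> a * A w w + c * (\<Sum>Q\<in>I. (M w (indicator Q, \<lambda>_. 0, \<lambda>_. 0))\<^sup>2)"
proof -
  have "B w w \<le> a * A w w + 0 * M w w + c * (\<Sum>Q\<in>I. (M w (indicator Q, \<lambda>_. 0, \<lambda>_. 0))\<^sup>2)"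
  proof (rule form_inequality_W[OF _ _ w])
    show "(indicator Q, \<lambda>_. 0, \<lambda>_. 0) \<in> L2_fields \<Omega>" if "Q \<in> I" for Q using I[OF that] by (intro indicator_L2) simp
  next
    fix \<phi> :: "'a \<Rightarrow> real" and D assume C1: "C1_with_gradient \<phi> D"
    let ?x = "smooth_field \<phi> D"
    let ?S = "\<Sum>Q\<in>I. (M ?x (indicator Q, \<lambda>_. 0, \<lambda>_. 0))\<^sup>2"
    have xL: "?x \<in> L2_fields \<Omega>" by (rule C1_L2[OF C1])
    have S: "(\<Sum>Q\<in>I. (\<integral>x. indicator Q x * \<phi> x \<partial>lborel)\<^sup>2) = ?S"
      using I by (intro sum.cong refl) (simp add: mass_indicator[OF C1])
    have S0: "0 \<le> ?S" by (intro sum_nonneg) simp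
    have "ennreal (B ?x ?x) \<le> ennreal a * ennreal (A ?x ?x) + ennreal (c * ?S)"
      using le[OF C1] unfolding C1_nn[OF C1] S .
    also have "ennreal a * ennreal (A ?x ?x) = ennreal (a * A ?x ?x)"
      by (rule ennreal_mult[symmetric]) (use ac A.nonneg[OF xL] in auto)
    also have "ennreal (a * A ?x ?x) + ennreal (c * ?S) = ennreal (a * A ?x ?x + c * ?S)"
      by (rule ennreal_plus[symmetric]) (use ac A.nonneg[OF xL] S0 in auto)
    finally show "B ?x ?x \<le> a * A ?x ?x + 0 * M ?x ?x + c * ?S"
      using ac A.nonneg[OF xL] S0 by (subst (asm) ennreal_le_iff) auto
  qed
  then show ?thesis by simp
qed

text \<open>The trace is bounded by a small multiple of the energy plus a large multiple of the mass
  on a compact set, and that mass by a much smaller multiple of the energy plus finitely many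
  means.\<close>

lemma ehrling_W:
  assumes \<epsilon>: "0 < \<epsilon>"
  shows "\<exists>I c. finite I \<and> I \<subseteq> {Q. Q \<in> sets borel \<and> Q \<subseteq> \<Omega>} \<and> 0 \<le> c \<and>
    (\<forall>w\<in>W. B w w \<le> \<epsilon> * A w w + c * (\<Sum>Q\<in>I. (M w (indicator Q, \<lambda>_. 0, \<lambda>_. 0))\<^sup>2))"
proof -
  obtain C h0 where C: "0 < C" "0 < h0" and tr:
    "\<And>h. 0 < h \<Longrightarrow> h \<le> h0 \<Longrightarrow> \<exists>T. compact T \<and> T \<subseteq> \<Omega> \<and> (\<forall>\<phi> D. C1_with_gradient \<phi> D \<longrightarrow>
      surface_int (frontier \<Omega>) \<phi>
      \<le> ennreal (C / h) * square_int T \<phi>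
        + ennreal (C * h) * dirichlet_int \<Omega> D)"
    by (rule lipschitz_trace[OF n dom]) blast
  \<comment> \<open>Half of \<epsilon> is spent on the energy term C h of the trace inequality. The
    other half is C / h times the accuracy \<epsilon> h / (2 C) used in the interior.\<close>
  define h where "h = min h0 (\<epsilon> / (2 * C))"
  have h: "0 < h" "h \<le> h0" using C \<epsilon> by (auto simp: h_def)
  have Ch: "C * h \<le> \<epsilon> / 2"
  proof -
    have "C * h \<le> C * (\<epsilon> / (2 * C))" using C by (intro mult_left_mono) (auto simp: h_def)
    then show ?thesis using C by simp
  qed
  obtain T where T: "compact T" "T \<subseteq> \<Omega>" and trT: "\<And>\<phi> D. C1_with_gradient \<phi> D \<Longrightarrow>
      surface_int (frontier \<Omega>) \<phi>
      \<le> ennreal (C / h) * square_int T \<phi>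
        + ennreal (C * h) * dirichlet_int \<Omega> D"
    using tr[OF h] by blast
  have e': "0 < \<epsilon> * h / (2 * C)" using \<epsilon> C h by simp
  obtain I :: "'a set set" and c :: real where I: "finite I" "0 \<le> c"
    "\<And>Q. Q \<in> I \<Longrightarrow> Q \<in> sets borel \<and> bounded Q \<and> Q \<subseteq> \<Omega>" and int:
    "\<And>\<phi> D. C1_with_gradient \<phi> D \<Longrightarrow> (square_int T \<phi>)
      \<le> ennreal (\<epsilon> * h / (2 * C)) * dirichlet_int \<Omega> D
        + ennreal (c * (\<Sum>Q\<in>I. (\<integral>x. indicator Q x * \<phi> x \<partial>lborel)\<^sup>2))"
    by (rule interior_ehrling[OF T dom'(1) e']) blast
  have "B w w \<le> \<epsilon> * A w w + (C / h * c) * (\<Sum>Q\<in>I. (M w (indicator Q, \<lambda>_. 0, \<lambda>_. 0))\<^sup>2)" if w: "w \<in> W" for w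
  proof (rule functional_inequality_W[OF _ _ _ _ w])
    show "Q \<in> sets borel \<and> Q \<subseteq> \<Omega>" if "Q \<in> I" for Q using I(3)[OF that] by blast
    show "0 \<le> \<epsilon>" "0 \<le> C / h * c" using \<epsilon> C h I by auto
  next
    fix \<phi> :: "'a \<Rightarrow> real" and D assume C1: "C1_with_gradient \<phi> D"
    let ?E = "dirichlet_int \<Omega> D"
    let ?S = "\<Sum>Q\<in>I. (\<integral>x. indicator Q x * \<phi> x \<partial>lborel)\<^sup>2"
    have S0: "0 \<le> ?S" by (intro sum_nonneg) simp
    have "surface_int (frontier \<Omega>) \<phi>
        \<le> ennreal (C / h) * (ennreal (\<epsilon> * h / (2 * C)) * ?E + ennreal (c * ?S)) + ennreal (C * h) * ?E"
      by (rule order_trans[OF trT[OF C1]]) (intro add_right_mono mult_left_mono int[OF C1] zero_le)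
    also have "... = (ennreal (C / h) * ennreal (\<epsilon> * h / (2 * C)) + ennreal (C * h)) * ?E + ennreal (C / h) * ennreal (c * ?S)"
      by (simp only: distrib_left distrib_right mult.assoc add.assoc add.commute add.left_commute)
    also have "ennreal (C / h) * ennreal (\<epsilon> * h / (2 * C)) = ennreal (\<epsilon> / 2)"
    proof -
      have "C / h * (\<epsilon> * h / (2 * C)) = \<epsilon> / 2" using C h by simp
      moreover have "ennreal (C / h) * ennreal (\<epsilon> * h / (2 * C)) = ennreal (C / h * (\<epsilon> * h / (2 * C)))"
        by (rule ennreal_mult[symmetric]) (use C h \<epsilon> in auto)
      ultimately show ?thesis by (simp only:)
    qed
    also have "ennreal (\<epsilon> / 2) + ennreal (C * h) = ennreal (\<epsilon> / 2 + C * h)"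
      by (rule ennreal_plus[symmetric]) (use C h \<epsilon> in auto)
    also have "ennreal (C / h) * ennreal (c * ?S) = ennreal (C / h * (c * ?S))"
      by (rule ennreal_mult[symmetric]) (use C h I S0 in auto)
    also have "C / h * (c * ?S) = C / h * c * ?S" by (simp only: mult.assoc)
    also have "ennreal (\<epsilon> / 2 + C * h) * ?E + ennreal (C / h * c * ?S) \<le> ennreal \<epsilon> * ?E + ennreal (C / h * c * ?S)"
      using Ch by (intro add_right_mono mult_right_mono ennreal_leI) auto
    finally show "surface_int (frontier \<Omega>) \<phi> \<le> ennreal \<epsilon> * ?E + ennreal (C / h * c * ?S)" .
  qed
  moreover have "0 \<le> C / h * c" using C h I by auto
  ultimately show ?thesis using I by blast
qed

lemma psd_W: "psd_form W M" "psd_form W A" "psd_form W B"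
  using W_L2 by (auto intro!: psd_form_subset[OF _ subspace_W] psd_mass psd_energy psd_boundary)

text \<open>The Ehrling inequalities for \<epsilon> = 1 / (p + 1) involve countably many means in
  all. They are bounded along w by the Friedrichs inequality, so a diagonal subsequence makes all of
  them converge; for given e one p then controls B.\<close>

lemma compact_W:
  assumes w: "\<And>m::nat. w m \<in> W" and bound: "\<And>m. A (w m) (w m) + B (w m) (w m) \<le> C"
  shows "\<exists>r :: nat \<Rightarrow> nat. strict_mono r \<and> (\<forall>e>0. \<exists>N. \<forall>i\<ge>N. \<forall>j\<ge>N. B (w (r i) - w (r j)) (w (r i) - w (r j)) < e)"
proof -
  define ind :: "'a set \<Rightarrow> 'a field" where "ind Q = (indicator Q, \<lambda>_. 0, \<lambda>_. 0)" for Q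
  have wL: "w m \<in> L2_fields \<Omega>" for m by (rule W_L2[OF w])
  have indL: "ind Q \<in> L2_fields \<Omega>" if "Q \<in> sets borel" for Q unfolding ind_def by (rule indicator_L2[OF that])
  have AC: "A (w m) (w m) \<le> C" for m using bound[of m] B.nonneg[OF wL[of m]] by linarith
  have BC: "B (w m) (w m) \<le> C" for m using bound[of m] A.nonneg[OF wL[of m]] by linarith
  obtain a b where ab: "0 \<le> a" "0 \<le> b" "\<And>w. w \<in> W \<Longrightarrow> M w w \<le> a * B w w + b * A w w"
    using friedrichs_W by blast
  have MC: "M (w m) (w m) \<le> a * C + b * C" for m
  proof -
    have "a * B (w m) (w m) \<le> a * C" "b * A (w m) (w m) \<le> b * C" using ab BC AC by (auto intro: mult_left_mono)
    then show ?thesis using ab(3)[OF w, of m] by linarith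
  qed
  have "\<forall>p::nat. \<exists>I c. finite I \<and> I \<subseteq> {Q. Q \<in> sets borel \<and> Q \<subseteq> \<Omega>} \<and> 0 \<le> c \<and>
    (\<forall>w\<in>W. B w w \<le> 1 / (real p + 1) * A w w + c * (\<Sum>Q\<in>I. (M w (ind Q))\<^sup>2))"
    unfolding ind_def by (rule allI, rule ehrling_W) simp
  then obtain I c where I': "\<forall>p::nat. finite (I p) \<and> I p \<subseteq> {Q. Q \<in> sets borel \<and> Q \<subseteq> \<Omega>} \<and> 0 \<le> c p \<and>
    (\<forall>w\<in>W. B w w \<le> 1 / (real p + 1) * A w w + c p * (\<Sum>Q\<in>I p. (M w (ind Q))\<^sup>2))"
    unfolding choice_iff by blast
  have I: "finite (I p)" "I p \<subseteq> {Q. Q \<in> sets borel \<and> Q \<subseteq> \<Omega>}" "0 \<le> c p" for p using I' by auto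
  have I4: "B w w \<le> 1 / (real p + 1) * A w w + c p * (\<Sum>Q\<in>I p. (M w (ind Q))\<^sup>2)" if "w \<in> W" for p w
    using I' that by blast
  \<comment> \<open>The empty set is added to make S nonempty, so that it can be enumerated by
    \<open>from_nat_into\<close>.\<close>
  define S where "S = insert {} (\<Union>p. I p)"
  have "countable S" unfolding S_def by (intro countable_insert countable_UN countableI_type countable_finite[OF I(1)])
  have SB: "Q \<in> sets borel" if "Q \<in> S" for Q using that I(2) unfolding S_def by fastforce
  define q where "q = from_nat_into S"
  have q: "q m \<in> S" for m unfolding q_def by (rule from_nat_into) (simp add: S_def)
  interpret subseqs "\<lambda>m r. convergent (\<lambda>i. M (w (r i)) (ind (q m)))"
  proof
    fix m and r :: "nat \<Rightarrow> nat" assume "strict_mono r"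
    have "\<bar>M (w (r i)) (ind (q m))\<bar> \<le> sqrt ((a * C + b * C) * M (ind (q m)) (ind (q m)))" for i
    proof -
      have qL: "ind (q m) \<in> L2_fields \<Omega>" by (rule indL[OF SB[OF q]])
      have "(M (w (r i)) (ind (q m)))\<^sup>2 \<le> M (w (r i)) (w (r i)) * M (ind (q m)) (ind (q m))"
        by (rule M.Cauchy_Schwarz[OF wL qL])
      also have "... \<le> (a * C + b * C) * M (ind (q m)) (ind (q m))" by (intro mult_right_mono MC M.nonneg qL)
      finally show ?thesis by (intro real_le_rsqrt) simp
    qed
    then have "bounded (range (\<lambda>i. M (w (r i)) (ind (q m))))" by (auto simp: bounded_iff)
    then obtain l t where t: "strict_mono (t :: nat \<Rightarrow> nat)" "((\<lambda>i. M (w (r i)) (ind (q m))) \<circ> t) \<longlonglongrightarrow> l"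
      by (rule bounded_imp_convergent_subsequence[elim_format]) blast
    have "convergent (\<lambda>i. M (w ((r \<circ> t) i)) (ind (q m)))"
      using convergentI[OF t(2)] by (simp only: o_def)
    with t(1) show "\<exists>t. strict_mono t \<and> convergent (\<lambda>i. M (w ((r \<circ> t) i)) (ind (q m)))" by blast
  qed
  have conv: "convergent (\<lambda>i. M (w (diagseq i)) (ind Q))" if QS: "Q \<in> S" for Q
  proof -
    obtain m where m: "q m = Q" using from_nat_into_surj[OF \<open>countable S\<close> QS] unfolding q_def ..
    have "convergent (\<lambda>i. M (w ((diagseq \<circ> ((+) (Suc m))) i)) (ind (q m)))"
    proof (rule diagseq_holds)
      fix r t :: "nat \<Rightarrow> nat" and k assume t: "strict_mono t" and "convergent (\<lambda>i. M (w (r i)) (ind (q k)))"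
      from convergent_subseq_convergent[OF this(2) t]
      show "convergent (\<lambda>i. M (w ((r \<circ> t) i)) (ind (q k)))" by (simp add: o_def)
    qed
    then have "convergent (\<lambda>i. M (w (diagseq (i + Suc m))) (ind Q))" by (simp add: o_def add.commute m)
    then have "(\<lambda>i. M (w (diagseq (i + Suc m))) (ind Q)) \<longlonglongrightarrow> lim (\<lambda>i. M (w (diagseq (i + Suc m))) (ind Q))"
      by (rule convergent_LIMSEQ_iff[THEN iffD1])
    then show ?thesis by (intro convergentI) (rule LIMSEQ_offset)
  qed
  show ?thesis
  proof (rule exI[of _ diagseq], rule conjI, rule subseq_diagseq, intro allI impI)
    fix e :: real assume e: "0 < e"
    obtain p :: nat where p: "8 * C / e < real p" using reals_Archimedean2 by blast
    have p1: "1 / (real p + 1) * (4 * C) \<le> e / 2"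
    proof -
      have "8 * C \<le> e * real p" using p e by (simp add: pos_divide_less_eq mult.commute)
      also have "... \<le> e * (real p + 1)" using e by simp
      finally show ?thesis by (simp add: divide_le_eq)
    qed
    have dW: "w (diagseq i) - w (diagseq j) \<in> W" for i j by (intro subspace_diff subspace_W w)
    have Cauchy: "Cauchy (\<lambda>i. M (w (diagseq i)) (ind Q))" if "Q \<in> I p" for Q
    proof -
      have "Q \<in> S" unfolding S_def using that by blast
      then show ?thesis using conv by (simp add: Cauchy_convergent_iff)
    qed
    \<comment> \<open>If each mean varies by less than \<delta>, the means contribute less than e /
      2; the added 1 avoids division by zero.\<close>
    define \<delta> where "\<delta> = sqrt (e / (2 * (c p * card (I p) + 1)))"
    have cp: "0 \<le> c p * card (I p)" using I(3) by simp
    have \<delta>: "0 < \<delta>" unfolding \<delta>_def using e cp by (simp add: add_nonneg_pos)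
    have "\<forall>Q\<in>I p. \<exists>N. \<forall>i\<ge>N. \<forall>j\<ge>N. \<bar>M (w (diagseq i)) (ind Q) - M (w (diagseq j)) (ind Q)\<bar> < \<delta>"
      using Cauchy \<delta> by (auto simp: Cauchy_iff)
    then obtain N where N: "\<And>Q i j. Q \<in> I p \<Longrightarrow> N Q \<le> i \<Longrightarrow> N Q \<le> j \<Longrightarrow>
        \<bar>M (w (diagseq i)) (ind Q) - M (w (diagseq j)) (ind Q)\<bar> < \<delta>" by metis
    define K where "K = Max (insert 0 (N ` I p))"
    have K: "N Q \<le> K" if "Q \<in> I p" for Q unfolding K_def using that I(1) by (intro Max_ge) auto
    show "\<exists>N. \<forall>i\<ge>N. \<forall>j\<ge>N. B (w (diagseq i) - w (diagseq j)) (w (diagseq i) - w (diagseq j)) < e"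
    proof (intro exI[of _ K] allI impI)
      fix i j assume ij: "K \<le> i" "K \<le> j"
      let ?d = "w (diagseq i) - w (diagseq j)"
      have "A ?d ?d \<le> 2 * A (w (diagseq i)) (w (diagseq i)) + 2 * A (w (diagseq j)) (w (diagseq j))"
        by (rule A.quad_diff_le[OF wL wL])
      then have "A ?d ?d \<le> 4 * C" using AC[of "diagseq i"] AC[of "diagseq j"] by linarith
      then have "1 / (real p + 1) * A ?d ?d \<le> 1 / (real p + 1) * (4 * C)" by (intro mult_left_mono) auto
      then have 1: "1 / (real p + 1) * A ?d ?d \<le> e / 2" using p1 by linarith
      have "(\<Sum>Q\<in>I p. (M ?d (ind Q))\<^sup>2) \<le> (\<Sum>Q\<in>I p. \<delta>\<^sup>2)"
      proof (rule sum_mono)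
        fix Q assume Q: "Q \<in> I p"
        then have "Q \<in> sets borel" using I(2) by blast
        then have "M ?d (ind Q) = M (w (diagseq i)) (ind Q) - M (w (diagseq j)) (ind Q)"
          by (intro M.diff_left wL indL)
        moreover have "\<bar>M (w (diagseq i)) (ind Q) - M (w (diagseq j)) (ind Q)\<bar> < \<delta>"
          by (rule N[OF Q order_trans[OF K[OF Q] ij(1)] order_trans[OF K[OF Q] ij(2)]])
        ultimately have "\<bar>M ?d (ind Q)\<bar> \<le> \<bar>\<delta>\<bar>" using \<delta> by simp
        then show "(M ?d (ind Q))\<^sup>2 \<le> \<delta>\<^sup>2" unfolding abs_le_square_iff .
      qed
      also have "... = card (I p) * (e / (2 * (c p * card (I p) + 1)))" using e cp by (simp add: \<delta>_def)
      finally have "c p * (\<Sum>Q\<in>I p. (M ?d (ind Q))\<^sup>2) \<le> c p * (card (I p) * (e / (2 * (c p * card (I p) + 1))))"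
        using I(3) by (rule mult_left_mono)
      also have "... = c p * card (I p) / (c p * card (I p) + 1) * (e / 2)" by (simp add: mult.assoc mult.commute[of 2])
      also have "... < 1 * (e / 2)" using cp e by (intro mult_strict_right_mono) (auto simp: divide_less_eq add_nonneg_pos)
      finally show "B ?d ?d < e" using I4[OF dW[of i j], of p] 1 by linarith
    qed
  qed
qed


lemma bump_fields:
  assumes k: "1 \<le> k"
  shows "\<exists>f. (\<forall>i\<le>k. f i \<in> W \<and> 0 < B (f i) (f i) \<and>
      diameter \<Omega> * A (f i) (f i) \<le> 512 * capacity_const (DIM('a)) * real k * B (f i) (f i)) \<and>
    (\<forall>i\<le>k. \<forall>j\<le>k. i \<noteq> j \<longrightarrow> A (f i) (f j) = 0 \<and> B (f i) (f j) = 0)"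
proof -
  let ?C = "512 * capacity_const (DIM('a)) * real k"
  have C0: "0 \<le> ?C" using capacity_const_pos[of "DIM('a)"] by simp
  obtain q s where bumps: "\<forall>j\<le>k. 0 < s j \<and>
      0 < surface_int (frontier \<Omega>) (pos_ball (q j) (s j)) \<and>
      ennreal (diameter \<Omega>) * dirichlet_int \<Omega> (pos_ball_gradient (q j) (s j))
        \<le> ennreal ?C * surface_int (frontier \<Omega>) (pos_ball (q j) (s j))"
    "\<forall>i\<le>k. \<forall>j\<le>k. i \<noteq> j \<longrightarrow> ball (q i) (s i) \<inter> ball (q j) (s j) = {}"
    using bump_family[OF n dom'(1-4) k] by (elim exE conjE) (rule that)
  note qs = bumps(1)[rule_format, THEN conjunct1] bumps(1)[rule_format, THEN conjunct2, THEN conjunct1]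
    bumps(1)[rule_format, THEN conjunct2, THEN conjunct2]
  note disj = bumps(2)[rule_format]
  define f where "f j = smooth_field (pos_ball (q j) (s j)) (pos_ball_gradient (q j) (s j))" for j
  have L: "f j \<in> L2_fields \<Omega>" for j unfolding f_def by (rule C1_L2[OF C1_pos_ball])
  note nn = C1_nn[OF C1_pos_ball, of "q j" "s j" for j, folded f_def]
  have "f i \<in> W \<and> 0 < B (f i) (f i) \<and> diameter \<Omega> * A (f i) (f i) \<le> ?C * B (f i) (f i)" if i: "i \<le> k" for i
  proof (intro conjI)
    show "f i \<in> W" unfolding f_def by (rule C1_W[OF C1_pos_ball])
    show "0 < B (f i) (f i)" using qs(2)[OF i] unfolding nn by simp
    have "ennreal (diameter \<Omega> * A (f i) (f i)) = ennreal (diameter \<Omega>) * ennreal (A (f i) (f i))"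
      by (rule ennreal_mult) (use A.nonneg[OF L] diameter_ge_0[OF dom'(2)] in auto)
    also have "... \<le> ennreal ?C * ennreal (B (f i) (f i))" using qs(3)[OF i] unfolding nn .
    also have "... = ennreal (?C * B (f i) (f i))" by (rule ennreal_mult[symmetric]) (use B.nonneg[OF L] C0 in auto)
    finally show "diameter \<Omega> * A (f i) (f i) \<le> ?C * B (f i) (f i)"
      using mult_nonneg_nonneg[OF C0 B.nonneg[OF L[of i]]] by (subst (asm) ennreal_le_iff)
  qed
  moreover have "A (f i) (f j) = 0 \<and> B (f i) (f j) = 0" if ij: "i \<le> k" "j \<le> k" "i \<noteq> j" for i j
  proof -
    have "pos_ball (q i) (s i) x = 0 \<or> pos_ball (q j) (s j) x = 0" for x
    proof (rule ccontr)
      assume "\<not> ?thesis"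
      then have "0 < pos_ball (q i) (s i) x" "0 < pos_ball (q j) (s j) x"
        using pos_ball_nonneg[of "q i" "s i" x] pos_ball_nonneg[of "q j" "s j" x] by auto
      then have "x \<in> ball (q i) (s i)" "x \<in> ball (q j) (s j)"
        using pos_ball_pos_iff[OF less_imp_le[OF qs(1)[OF ij(1)]]] pos_ball_pos_iff[OF less_imp_le[OF qs(1)[OF ij(2)]]] by blast+
      then show False using disj[OF ij] by blast
    qed
    then have p: "pos_ball (q i) (s i) x * pos_ball (q j) (s j) x = 0"
      "pos_ball_gradient (q i) (s i) x \<bullet> pos_ball_gradient (q j) (s j) x = 0" for x
      by (metis mult_eq_0_iff, metis mult_eq_0_iff mult_zero_right power_eq_0_iff pos_ball_def pos_ball_gradient_def scaleR_zero_left inner_zero_left inner_zero_right)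
    show ?thesis
      unfolding energy_form_def boundary_form_def f_def smooth_field_def fst_conv snd_conv inner_real_def p by simp
  qed
  ultimately show ?thesis by blast
qed

text \<open>The Friedrichs bound turns Cauchy for A + B into Cauchy for the total form, and the
  limit stays in the closure W. Infinite rank of B comes from the same disjoint bumps that prove the
  upper bound.\<close>

sublocale compact_form_pair W A B
proof (intro compact_form_pair.intro psd_W compact_form_pair_axioms.intro)
  fix w :: "nat \<Rightarrow> 'a field" assume w: "\<And>m. w m \<in> W" and cauchy:
    "\<And>e. 0 < e \<Longrightarrow> \<exists>N. \<forall>i\<ge>N. \<forall>j\<ge>N. A (w i - w j) (w i - w j) + B (w i - w j) (w i - w j) < e"
  obtain a b where ab: "0 \<le> a" "0 \<le> b" "\<And>w. w \<in> W \<Longrightarrow> M w w \<le> a * B w w + b * A w w"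
    using friedrichs_W by blast
  have wL: "w m \<in> L2_fields \<Omega>" for m by (rule W_L2[OF w])
  have dW: "w i - w j \<in> W" for i j by (intro subspace_diff subspace_W w)
  have dL: "w i - w j \<in> L2_fields \<Omega>" for i j by (rule W_L2[OF dW])
  have "\<exists>l\<in>L2_fields \<Omega>. (\<lambda>m. N (w m - l) (w m - l)) \<longlonglongrightarrow> 0"
  proof (rule L2_fields_complete[OF wL])
    fix e :: real assume "0 < e"
    then have "0 < e / (a + b + 1)" using ab by simp
    then obtain K where K: "\<And>i j. K \<le> i \<Longrightarrow> K \<le> j \<Longrightarrow> A (w i - w j) (w i - w j) + B (w i - w j) (w i - w j) < e / (a + b + 1)"
      using cauchy by blast
    have "N (w i - w j) (w i - w j) < e" if ij: "K \<le> i" "K \<le> j" for i j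
    proof -
      let ?A = "A (w i - w j) (w i - w j)" and ?B = "B (w i - w j) (w i - w j)"
      have "0 \<le> a * ?A" "0 \<le> b * ?B" using ab A.nonneg[OF dL] B.nonneg[OF dL] by auto
      then have "N (w i - w j) (w i - w j) \<le> (a + b + 1) * (?A + ?B)"
        using ab(3)[OF dW, of i j] unfolding total_form_def by (simp add: distrib_left distrib_right)
      also have "... < (a + b + 1) * (e / (a + b + 1))" using K[OF ij] ab by (intro mult_strict_left_mono) auto
      also have "... = e" using ab by simp
      finally show ?thesis .
    qed
    then show "\<exists>K. \<forall>i\<ge>K. \<forall>j\<ge>K. N (w i - w j) (w i - w j) < e" by blast
  qed
  then obtain l where l: "l \<in> L2_fields \<Omega>" "(\<lambda>m. N (w m - l) (w m - l)) \<longlonglongrightarrow> 0" by blast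
  have "l \<in> W" by (rule W_closed[OF w l])
  moreover have "w m - l \<in> L2_fields \<Omega>" for m by (rule N.in_W(3)[OF wL l(1)])
  ultimately show "\<exists>l\<in>W. (\<lambda>m. A (w m - l) (w m - l)) \<longlonglongrightarrow> 0 \<and> (\<lambda>m. B (w m - l) (w m - l)) \<longlonglongrightarrow> 0"
    using total_tendsto_zero[of "\<lambda>m. w m - l" \<Omega>] l(2) by blast
next
  fix w :: "nat \<Rightarrow> 'a field" and C assume "\<And>m. w m \<in> W" "\<And>m. A (w m) (w m) + B (w m) (w m) \<le> C"
  then show "\<exists>r :: nat \<Rightarrow> nat. strict_mono r \<and> (\<forall>e>0. \<exists>N. \<forall>i\<ge>N. \<forall>j\<ge>N. B (w (r i) - w (r j)) (w (r i) - w (r j)) < e)"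
    by (rule compact_W)
next
  fix k :: nat
  \<comment> \<open>The bumps are constructed for at least one slab cut, while the locale also asks
    for k = 0.\<close>
  have "1 \<le> max 1 k" by simp
  then obtain f where f: "\<forall>i\<le>max 1 k. f i \<in> W \<and> 0 < B (f i) (f i) \<and>
      diameter \<Omega> * A (f i) (f i) \<le> 512 * capacity_const (DIM('a)) * real (max 1 k) * B (f i) (f i)"
    "\<forall>i\<le>max 1 k. \<forall>j\<le>max 1 k. i \<noteq> j \<longrightarrow> A (f i) (f j) = 0 \<and> B (f i) (f j) = 0"
    by (elim exE conjE bump_fields[elim_format]) (rule that)
  show "\<exists>f. \<forall>i\<le>k. f i \<in> W \<and> 0 < B (f i) (f i) \<and> (\<forall>j\<le>k. i \<noteq> j \<longrightarrow> B (f i) (f j) = 0)"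
  proof (intro exI[of _ f] allI impI conjI)
    fix i assume i: "i \<le> k"
    then have i': "i \<le> max 1 k" by simp
    show "f i \<in> W" "0 < B (f i) (f i)" using f(1)[rule_format, OF i'] by (rule conjunct1, elim conjE)
    fix j assume "j \<le> k" "i \<noteq> j"
    then have j': "j \<le> max 1 k" and ne: "i \<noteq> j" by simp_all
    show "B (f i) (f j) = 0" using f(2)[rule_format, OF i' j' ne] by (rule conjunct2)
  qed
qed

section \<open>Steklov solutions as eigenfields, and the two eigenvalue bounds\<close>

lemma gradient_unique: "H1_with_gradient \<Omega> u D \<Longrightarrow> H1_with_gradient \<Omega> u E \<Longrightarrow> AE x in lebesgue_on \<Omega>. D x = E x"
  by (rule weak_gradient_unique[OF dom'(1,2)]) auto

lemma energy_cong:
  assumes "AE x in lebesgue_on \<Omega>. D x = E x" "AE x in lebesgue_on \<Omega>. F x = G x"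
    "square_integrable (lebesgue_on \<Omega>) D" "square_integrable (lebesgue_on \<Omega>) E"
    "square_integrable (lebesgue_on \<Omega>) F" "square_integrable (lebesgue_on \<Omega>) G"
  shows "(\<integral>x. D x \<bullet> F x \<partial>lebesgue_on \<Omega>) = (\<integral>x. E x \<bullet> G x \<partial>lebesgue_on \<Omega>)"
  by (rule integral_cong_AE)
    (use assms in \<open>auto simp: square_integrable_def intro!: borel_measurable_inner elim: AE_mp\<close>)

text \<open>Green's formula tested against W is the eigenvalue equation; tested against compactly
  supported functions, whose trace vanishes, it gives harmonicity. The definitions allow different
  representatives of the gradient in different places, which agree almost everywhere by
  uniqueness.\<close>

lemma steklov_solution_iff:
  "steklov_solution \<Omega> t u \<longleftrightarrow> (\<exists>G g. (u, G, g) \<in> W \<and> (\<forall>v\<in>W. A (u, G, g) v = t * B (u, G, g) v))"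
proof
  let ?l = "lebesgue_on \<Omega>"
  assume "steklov_solution \<Omega> t u"
  then obtain g G where tr: "has_trace \<Omega> u g" and G: "H1_with_gradient \<Omega> u G" and
    eq: "\<And>v E h. H1_with_gradient \<Omega> v E \<Longrightarrow> has_trace \<Omega> v h \<Longrightarrow>
      (\<integral>x. G x \<bullet> E x \<partial>?l) = (\<integral>x. t * g x * h x \<partial>surface_measure \<Omega>)"
    unfolding steklov_solution_def harmonic_normal_derivative_def by blast
  obtain G' where w: "(u, G', g) \<in> W" using tr unfolding has_trace_iff by blast
  have G': "H1_with_gradient \<Omega> u G'" using W_H1[OF w] by simp
  have "A (u, G', g) v = t * B (u, G', g) v" if v: "v \<in> W" for v
  proof -
    have Hv: "H1_with_gradient \<Omega> (fst v) (fst (snd v))" by (rule W_H1[OF v])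
    have "A (u, G', g) v = (\<integral>x. G x \<bullet> fst (snd v) x \<partial>?l)"
      unfolding energy_form_def fst_conv snd_conv
      by (rule energy_cong[OF gradient_unique[OF G' G]]) (use G G' Hv in \<open>auto simp: H1_with_gradient_def\<close>)
    also have "... = (\<integral>x. t * g x * snd (snd v) x \<partial>surface_measure \<Omega>)"
    proof (rule eq[OF Hv])
      show "has_trace \<Omega> (fst v) (snd (snd v))" unfolding has_trace_iff using v by (intro exI[of _ "fst (snd v)"]) simp
    qed
    also have "... = t * B (u, G', g) v" by (simp add: boundary_form_def mult.assoc)
    finally show ?thesis .
  qed
  then show "\<exists>G g. (u, G, g) \<in> W \<and> (\<forall>v\<in>W. A (u, G, g) v = t * B (u, G, g) v)" using w by blast
next
  let ?l = "lebesgue_on \<Omega>"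
  assume "\<exists>G g. (u, G, g) \<in> W \<and> (\<forall>v\<in>W. A (u, G, g) v = t * B (u, G, g) v)"
  then obtain G g where w: "(u, G, g) \<in> W" and eig: "\<And>v. v \<in> W \<Longrightarrow> A (u, G, g) v = t * B (u, G, g) v" by blast
  have H1: "H1_with_gradient \<Omega> u G" using W_H1[OF w] by simp
  have g: "square_integrable (surface_measure \<Omega>) g" using W_L2[OF w] by (simp add: L2_fields_def)
  have tr: "has_trace \<Omega> u g" unfolding has_trace_iff using w by blast
  have "(\<integral>x. G x \<bullet> E x \<partial>?l) = 0" if t: "test_function \<Omega> \<psi> E" for \<psi> E
  proof -
    obtain K where K: "compact K" "K \<subseteq> \<Omega>" "\<And>x. x \<notin> K \<Longrightarrow> \<psi> x = 0" and C1: "C1_with_gradient \<psi> E"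
      using t by (auto simp: test_function_def)
    have "\<psi> x = 0" if "x \<in> frontier \<Omega>" for x
    proof (rule K(3))
      show "x \<notin> K" using that K(2) dom'(1) by (auto simp: frontier_def interior_open)
    qed
    then have "B (u, G, g) (smooth_field \<psi> E) = (\<integral>x. 0 \<partial>surface_measure \<Omega>)"
      unfolding boundary_form_def by (intro Bochner_Integration.integral_cong refl) (simp add: surface_measure_def smooth_field_def space_restrict_space)
    then have "A (u, G, g) (smooth_field \<psi> E) = 0" using eig[OF C1_W[OF C1]] by simp
    then show ?thesis by (simp add: energy_form_def smooth_field_def)
  qed
  then have wh: "weakly_harmonic \<Omega> u" unfolding weakly_harmonic_def using H1 by blast
  have "(\<integral>x. G x \<bullet> E x \<partial>?l) = (\<integral>x. t * g x * h x \<partial>surface_measure \<Omega>)"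
    if v: "H1_with_gradient \<Omega> v E" "has_trace \<Omega> v h" for v E h
  proof -
    obtain E' where v': "(v, E', h) \<in> W" using v(2) unfolding has_trace_iff by blast
    have E': "H1_with_gradient \<Omega> v E'" using W_H1[OF v'] by simp
    have "(\<integral>x. G x \<bullet> E x \<partial>?l) = (\<integral>x. G x \<bullet> E' x \<partial>?l)"
      by (rule energy_cong[OF _ gradient_unique[OF v(1) E']]) (use v(1) E' H1 in \<open>auto simp: H1_with_gradient_def\<close>)
    also have "... = A (u, G, g) (v, E', h)" by (simp add: energy_form_def)
    also have "... = t * B (u, G, g) (v, E', h)" by (rule eig[OF v'])
    also have "... = (\<integral>x. t * g x * h x \<partial>surface_measure \<Omega>)" by (simp add: boundary_form_def mult.assoc)
    finally show ?thesis .
  qed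
  then have "harmonic_normal_derivative \<Omega> u (\<lambda>x. t * g x)"
    unfolding harmonic_normal_derivative_def using wh H1 square_integrable_mult[OF g, of t] by blast
  then show "steklov_solution \<Omega> t u" unfolding steklov_solution_def using wh tr by blast
qed


lemma L2_null_ae:
  assumes w: "w \<in> L2_fields \<Omega>" and 0: "M w w = 0"
  shows "AE x in lebesgue_on \<Omega>. fst w x = 0"
proof -
  have sq: "square_integrable (lebesgue_on \<Omega>) (fst w)" using w by (simp add: L2_fields_def)
  then have "integrable (lebesgue_on \<Omega>) (\<lambda>x. (norm (fst w x))\<^sup>2)" by (simp add: square_integrable_def)
  moreover have "(\<integral>x. (norm (fst w x))\<^sup>2 \<partial>lebesgue_on \<Omega>) = 0" using 0 unfolding mass_form_def dot_square_norm .
  ultimately have "AE x in lebesgue_on \<Omega>. (norm (fst w x))\<^sup>2 = 0"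
    by (subst (asm) integral_nonneg_eq_0_iff_AE) auto
  then show ?thesis by simp
qed

text \<open>Traces depend only on the class of the function: the weak gradient is null by
  uniqueness, all means vanish, and the Ehrling inequality then leaves no boundary mass.\<close>

lemma W_null:
  assumes w: "w \<in> W" and 0: "AE x in lebesgue_on \<Omega>. fst w x = 0"
  shows "A w w = 0" "B w w = 0"
proof -
  have Z: "H1_with_gradient \<Omega> (\<lambda>x. 0) (\<lambda>x. 0)" by (rule C1_H1[OF dom'(1,2) C1_const])
  have g0: "AE x in lebesgue_on \<Omega>. fst (snd w) x = 0"
    by (rule weak_gradient_unique[OF dom'(1,2) W_H1[OF w] Z 0])
  have "A w w = (\<integral>x. 0 \<partial>lebesgue_on \<Omega>)"
    unfolding energy_form_def
    by (rule integral_cong_AE) (use W_L2[OF w] g0 in \<open>auto simp: L2_fields_def square_integrable_def\<close>)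
  then show A0: "A w w = 0" by simp
  have m: "M w v = 0" if "v \<in> L2_fields \<Omega>" for v
  proof -
    have "M w v = (\<integral>x. 0 \<partial>lebesgue_on \<Omega>)"
      unfolding mass_form_def
      by (rule integral_cong_AE) (use W_L2[OF w] that 0 in \<open>auto simp: L2_fields_def square_integrable_def\<close>)
    then show ?thesis by simp
  qed
  obtain I c where I: "I \<subseteq> {Q. Q \<in> sets borel \<and> Q \<subseteq> \<Omega>}"
    and le: "\<forall>w\<in>W. B w w \<le> 1 * A w w + c * (\<Sum>Q\<in>I. (M w (indicator Q, \<lambda>_. 0, \<lambda>_. 0))\<^sup>2)"
    using ehrling_W[of 1] by auto
  have "(\<Sum>Q\<in>I. (M w (indicator Q, \<lambda>_. 0, \<lambda>_. 0))\<^sup>2) = 0"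
  proof (rule sum.neutral, rule ballI)
    fix Q assume "Q \<in> I"
    then have "Q \<in> sets borel" using I by blast
    then show "(M w (indicator Q, \<lambda>_. 0, \<lambda>_. 0))\<^sup>2 = 0" using m[OF indicator_L2] by simp
  qed
  then have "B w w \<le> 0" using le w A0 by fastforce
  then show "B w w = 0" using B.nonneg[OF w] by linarith
qed

text \<open>The eigenfields v k with s k = t have independent classes, because a combination that is
  null in \<Omega> has null trace while the v k are B-orthonormal. Conversely, from more solutions
  some nontrivial combination is B-orthogonal to these v k; it has A = B = 0, hence zero mass by
  Friedrichs, contrary to independence.\<close>

lemma steklov_multiplicity_eq:
  assumes v: "\<And>k::nat. v k \<in> W" and orth: "\<And>i j. B (v i) (v j) = (if i = j then 1 else 0)"
    and eig: "\<And>k w. w \<in> W \<Longrightarrow> A (v k) w = s k * B (v k) w"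
    and lim: "filterlim s at_top sequentially"
    and low: "\<And>k w. w \<in> W \<Longrightarrow> (\<And>i. i < k \<Longrightarrow> B w (v i) = 0) \<Longrightarrow> s k * B w w \<le> A w w"
  shows "enat (card {k. s k = t}) = steklov_multiplicity \<Omega> t"
proof -
  let ?J = "{k. s k = t}"
  have fin: "finite ?J" by (rule finite_level[OF lim])
  have psdA: "psd_form W A" and psdB: "psd_form W B" by (rule psd_W)+
  have "\<exists>u. (\<forall>i<card ?J. steklov_solution \<Omega> t (u i)) \<and> ae_independent \<Omega> (card ?J) u"
  proof -
    obtain e where e: "bij_betw e {..<card ?J} ?J" using ex_bij_betw_nat_finite[OF fin] by (auto simp: atLeast0LessThan)
    have se: "s (e i) = t" if "i < card ?J" for i using bij_betwE[OF e] that by blast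
    have "steklov_solution \<Omega> t (fst (v (e i)))" if "i < card ?J" for i
      unfolding steklov_solution_iff
    proof (intro exI conjI ballI)
      show "(fst (v (e i)), fst (snd (v (e i))), snd (snd (v (e i)))) \<in> W" using v by simp
      show "A (fst (v (e i)), fst (snd (v (e i))), snd (snd (v (e i)))) w
        = t * B (fst (v (e i)), fst (snd (v (e i))), snd (snd (v (e i)))) w" if "w \<in> W" for w
        using eig[OF that, of "e i"] se[OF \<open>i < card ?J\<close>] by simp
    qed
    moreover have "ae_independent \<Omega> (card ?J) (\<lambda>i. fst (v (e i)))"
      unfolding ae_independent_def
    proof (intro allI impI)
      fix c :: "nat \<Rightarrow> real" and i
      assume ae: "AE x in lebesgue_on \<Omega>. (\<Sum>i<card ?J. c i * fst (v (e i)) x) = 0" and i: "i < card ?J"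
      define w where "w = (\<Sum>i<card ?J. c i *\<^sub>R v (e i))"
      have w: "w \<in> W" unfolding w_def by (intro subspace_sum subspace_W subspace_scale v)
      have "AE x in lebesgue_on \<Omega>. fst w x = 0" using ae unfolding w_def field_sum_pointwise .
      then have "B w w = 0" by (rule W_null(2)[OF w])
      then have "0 = B w (v (e i))" using psd_form.null_left[OF psdB w v] by simp
      also have "... = (\<Sum>j<card ?J. c j * B (v (e j)) (v (e i)))"
        unfolding w_def by (rule psd_form.sum_left[OF psdB]) (auto intro: v)
      also have "... = (\<Sum>j<card ?J. if j = i then c i else 0)"
      proof (rule sum.cong[OF refl])
        fix j assume "j \<in> {..<card ?J}"
        then have "e j = e i \<longleftrightarrow> j = i" using bij_betw_imp_inj_on[OF e] i by (auto simp: inj_on_def)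
        then show "c j * B (v (e j)) (v (e i)) = (if j = i then c i else 0)" by (simp add: orth)
      qed
      also have "... = c i" using i by simp
      finally show "c i = 0" by simp
    qed
    ultimately show ?thesis by (intro exI[of _ "\<lambda>i. fst (v (e i))"]) blast
  qed
  then have ge: "enat (card ?J) \<le> steklov_multiplicity \<Omega> t"
    unfolding steklov_multiplicity_def by (intro Sup_upper) blast
  have "enat m \<le> enat (card ?J)" if u: "\<forall>i<m. steklov_solution \<Omega> t (u i)" and ind: "ae_independent \<Omega> m u" for m u
  proof (rule ccontr)
    assume "\<not> enat m \<le> enat (card ?J)"
    then have lt: "card ?J < card {..<m}" by simp
    have "\<forall>i\<in>{..<m}. \<exists>w\<in>W. fst w = u i \<and> (\<forall>v\<in>W. A w v = t * B w v)"
    proof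
      fix i assume "i \<in> {..<m}"
      then obtain G g where "(u i, G, g) \<in> W" "\<forall>v\<in>W. A (u i, G, g) v = t * B (u i, G, g) v"
        using u unfolding steklov_solution_iff by blast
      then show "\<exists>w\<in>W. fst w = u i \<and> (\<forall>v\<in>W. A w v = t * B w v)" by (intro bexI[of _ "(u i, G, g)"]) auto
    qed
    then obtain w where "\<forall>i\<in>{..<m}. w i \<in> W \<and> fst (w i) = u i \<and> (\<forall>v\<in>W. A (w i) v = t * B (w i) v)"
      unfolding Bex_def bchoice_iff by blast
    then have w: "\<And>i. i \<in> {..<m} \<Longrightarrow> w i \<in> W" "\<And>i. i \<in> {..<m} \<Longrightarrow> fst (w i) = u i"
      "\<And>i v. i \<in> {..<m} \<Longrightarrow> v \<in> W \<Longrightarrow> A (w i) v = t * B (w i) v" by blast+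
    obtain c where c: "\<exists>i\<in>{..<m}. c i \<noteq> 0" "\<forall>j\<in>?J. (\<Sum>i\<in>{..<m}. c i * B (w i) (v j)) = 0"
      using homogeneous_system_solution[OF fin _ lt, of "\<lambda>j i. B (w i) (v j)"] by auto
    define z where "z = (\<Sum>i\<in>{..<m}. c i *\<^sub>R w i)"
    have z: "z \<in> W" unfolding z_def by (intro subspace_sum subspace_W subspace_scale w)
    have Bz: "B z x = (\<Sum>i\<in>{..<m}. c i * B (w i) x)" if x: "x \<in> W" for x
      unfolding z_def by (rule psd_form.sum_left[OF psdB _ w(1) x]) auto
    have Az: "A z x = (\<Sum>i\<in>{..<m}. c i * A (w i) x)" if x: "x \<in> W" for x
      unfolding z_def by (rule psd_form.sum_left[OF psdA _ w(1) x]) auto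
    have eigz: "A z x = t * B z x" if x: "x \<in> W" for x
      unfolding Bz[OF x] Az[OF x] sum_distrib_left by (intro sum.cong refl) (simp add: w(3)[OF _ x])
    have oz: "B z (v k) = 0" if "s k = t" for k using c(2) that unfolding Bz[OF v] by blast
    have zero: "B z z = 0" "A z z = 0"
      using eigenspace_complete[OF v eig lim low z eigz oz] by blast+
    obtain a b where "\<And>w. w \<in> W \<Longrightarrow> M w w \<le> a * B w w + b * A w w" using friedrichs_W by blast
    from this[OF z] have "M z z = 0" using zero M.nonneg[OF W_L2[OF z]] by simp
    then have "AE x in lebesgue_on \<Omega>. fst z x = 0" by (rule L2_null_ae[OF W_L2[OF z]])
    then have "AE x in lebesgue_on \<Omega>. (\<Sum>i\<in>{..<m}. c i * fst (w i) x) = 0" unfolding z_def field_sum_pointwise .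
    then have "AE x in lebesgue_on \<Omega>. (\<Sum>i<m. c i * u i x) = 0" by (simp add: w(2))
    then have "\<forall>i<m. c i = 0" using ind unfolding ae_independent_def by blast
    then show False using c(1) by blast
  qed
  then have "steklov_multiplicity \<Omega> t \<le> enat (card ?J)"
    unfolding steklov_multiplicity_def by (intro Sup_least) blast
  then show ?thesis using ge by (rule antisym[rotated])
qed

text \<open>The sequence s from the successive minimization is a listing, and there is only one, so
  the definite description denotes it. From here on the eigenvalues are known through their
  minimality.\<close>

lemma steklov_eigensystem:
  "\<exists>v. (\<forall>k. v k \<in> W) \<and> (\<forall>i j. B (v i) (v j) = (if i = j then 1 else 0)) \<and>
     (\<forall>k. \<forall>w\<in>W. A (v k) w = steklov_eigenvalue \<Omega> k * B (v k) w) \<and> incseq (steklov_eigenvalue \<Omega>) \<and>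
     (\<forall>k. \<forall>w\<in>W. (\<forall>i<k. B w (v i) = 0) \<longrightarrow> steklov_eigenvalue \<Omega> k * B w w \<le> A w w)"
proof -
  obtain v s where vs: "\<forall>k::nat. v k \<in> W" "\<forall>i j. B (v i) (v j) = (if i = j then 1 else 0)"
     "\<forall>k. \<forall>w\<in>W. A (v k) w = s k * B (v k) w" "incseq s" "filterlim s at_top sequentially"
     "\<forall>k. \<forall>w\<in>W. (\<forall>i<k. B w (v i) = 0) \<longrightarrow> s k * B w w \<le> A w w"
    using eigensystem_exists by (elim exE conjE) (rule that)
  have mult: "enat (card {k. s k = t}) = steklov_multiplicity \<Omega> t" for t
    by (rule steklov_multiplicity_eq[of v s]) (use vs in blast)+
  have "steklov_listing \<Omega> s" unfolding steklov_listing_def using vs mult by blast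
  moreover have "s' = s" if "steklov_listing \<Omega> s'" for s'
  proof (rule listing_unique)
    show "card {k. s' k = t} = card {k. s k = t}" for t
      using that mult[of t] unfolding steklov_listing_def by (metis enat.inject)
  qed (use that vs in \<open>auto simp: steklov_listing_def\<close>)
  ultimately have "steklov_eigenvalue \<Omega> = s" unfolding steklov_eigenvalue_def by (rule the_equality)
  then show ?thesis using vs by blast
qed

lemma steklov_eigenvalue_le:
  assumes k: "1 \<le> k"
  shows "diameter \<Omega> * steklov_eigenvalue \<Omega> k \<le> 512 * capacity_const (DIM('a)) * real k"
proof -
  obtain v where v: "\<forall>k. v k \<in> W"
    "\<forall>k. \<forall>w\<in>W. (\<forall>i<k. B w (v i) = 0) \<longrightarrow> steklov_eigenvalue \<Omega> k * B w w \<le> A w w"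
    using steklov_eigensystem by (elim exE conjE) (rule that)
  obtain f where f: "\<forall>i\<le>k. f i \<in> W \<and> 0 < B (f i) (f i) \<and>
      diameter \<Omega> * A (f i) (f i) \<le> 512 * capacity_const (DIM('a)) * real k * B (f i) (f i)"
    "\<forall>i\<le>k. \<forall>j\<le>k. i \<noteq> j \<longrightarrow> A (f i) (f j) = 0 \<and> B (f i) (f j) = 0"
    using bump_fields[OF k] by (elim exE conjE) (rule that)
  show ?thesis
    by (rule eigenvalue_le[where v = v and f = f]) (use v f diameter_ge_0[OF dom'(2)] in blast)+
qed

text \<open>At most k means are prescribed to vanish, and on the fields where they do the trace
  inequality involves energy alone. The constant c of the means may therefore be as large as
  convenient.\<close>

lemma steklov_eigenvalue_ge:
  assumes I: "finite I" "card I \<le> k" "\<And>Q. Q \<in> I \<Longrightarrow> Q \<in> sets borel \<and> Q \<subseteq> \<Omega>" and ac: "0 \<le> a" "0 \<le> c"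
    and le: "\<And>\<phi> D. C1_with_gradient \<phi> D \<Longrightarrow> (surface_int (frontier \<Omega>) \<phi>)
      \<le> ennreal a * dirichlet_int \<Omega> D
        + ennreal (c * (\<Sum>Q\<in>I. (\<integral>x. indicator Q x * \<phi> x \<partial>lborel)\<^sup>2))"
  shows "1 \<le> a * steklov_eigenvalue \<Omega> k"
proof -
  obtain v where v: "\<And>k. v k \<in> W" "\<And>i j. B (v i) (v j) = (if i = j then 1 else 0)"
    "\<And>k w. w \<in> W \<Longrightarrow> A (v k) w = steklov_eigenvalue \<Omega> k * B (v k) w" and inc: "incseq (steklov_eigenvalue \<Omega>)"
    using steklov_eigensystem by blast
  let ?l = "\<lambda>Q w. M w (indicator Q, \<lambda>_. 0, \<lambda>_. 0)"
  show ?thesis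
  proof (rule eigenvalue_ge[where l = ?l, OF v inc I(1,2) _ _ ac(1)])
    fix Q and b :: "nat \<Rightarrow> real" assume "Q \<in> I"
    then have "Q \<in> sets borel" using I(3) by blast
    then show "?l Q (\<Sum>i\<in>{..k}. b i *\<^sub>R v i) = (\<Sum>i\<in>{..k}. b i * ?l Q (v i))"
      by (intro M.sum_left W_L2 v indicator_L2) auto
  next
    fix w assume w: "w \<in> W" and 0: "\<And>Q. Q \<in> I \<Longrightarrow> ?l Q w = 0"
    have "B w w \<le> a * A w w + c * (\<Sum>Q\<in>I. (?l Q w)\<^sup>2)"
      by (rule functional_inequality_W[OF I(3) ac le w])
    also have "(\<Sum>Q\<in>I. (?l Q w)\<^sup>2) = 0" using 0 by simp
    finally show "B w w \<le> a * A w w" by simp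
  qed
qed

end

subsection \<open>Thin boxes\<close>

text \<open>Near a boundary point \<open>p\<close> the graph is the McShane extension of the boundary in the direction \<open>e\<close> of an
  interior ball; convexity gives the cone condition that makes it Lipschitz.\<close>

lemma convex_bounded_lipschitz_domain:
  fixes \<Omega> :: "'a::euclidean_space set"
  assumes \<Omega>: "open \<Omega>" "bounded \<Omega>" "convex \<Omega>" "\<Omega> \<noteq> {}"
  shows "bounded_lipschitz_domain \<Omega>"
proof -
  have "\<exists>r>0. \<exists>e L. \<exists>\<gamma> :: 'a \<Rightarrow> real. norm e = 1 \<and> lipschitz_on L {y. y \<bullet> e = 0} \<gamma> \<and>
        \<Omega> \<inter> ball p r = {x \<in> ball p r. \<gamma> (x - (x \<bullet> e) *\<^sub>R e) < x \<bullet> e}" if p: "p \<in> frontier \<Omega>" for p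
  proof -
    obtain x0 \<rho> where x0: "x0 \<in> \<Omega>" and \<rho>: "0 < \<rho>" "ball x0 \<rho> \<subseteq> \<Omega>"
      using \<Omega>(1,4) open_contains_ball by blast
    have pn: "p \<notin> \<Omega>" and pc: "p \<in> closure \<Omega>" using p \<Omega>(1) by (auto simp: frontier_def interior_open)
    define R where "R = norm (x0 - p)"
    have R: "\<rho> \<le> R" using pn \<rho>(2) by (force simp: R_def dist_norm)
    have R0: "0 < R" using R \<rho> by simp
    define e where "e = (1 / R) *\<^sub>R (x0 - p)"
    have e: "norm e = 1" using R0 by (simp add: e_def R_def)
    have x0e: "x0 = p + R *\<^sub>R e" using R0 by (simp add: e_def)
    \<comment> \<open>The slope for which a lateral deviation |w| \<le> s / L, enlarged by the
      factor R / s, is at most \<rho> / 2. The other half of \<rho> is the radius r in which z may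
      vary about p.\<close>
    define L where "L = 2 * R / \<rho>"
    have L: "0 < L" using R0 \<rho> by (simp add: L_def)
    define r where "r = \<rho> / 2"
    have r: "0 < r" using \<rho> by (simp add: r_def)
    define P where "P x = x - (x \<bullet> e) *\<^sub>R e" for x :: 'a
    \<comment> \<open>From z the ray through x is prolonged to a point y at height R above z. There
      it lies in the ball around x0, so x is a convex combination of two points of \<Omega>; the
      weight is admissible since s < 2 r = \<rho> \<le> R.\<close>
    have cone: "x \<in> \<Omega>" if z: "z \<in> \<Omega>" "z \<in> ball p r" and x: "x \<in> ball p r" and le: "z \<bullet> e + L * norm (P x - P z) < x \<bullet> e" for x z
    proof -
      define s where "s = x \<bullet> e - z \<bullet> e"
      define w where "w = P x - P z"
      have "0 \<le> L * norm w" using L by simp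
      then have s: "0 < s" "L * norm w < s" using le unfolding s_def w_def by linarith+
      have xz: "x = z + s *\<^sub>R e + w" by (simp add: s_def w_def P_def algebra_simps)
      have "s = (x - z) \<bullet> e" by (simp add: s_def inner_diff_left)
      also have "... \<le> norm (x - z)" using norm_cauchy_schwarz[of "x - z" e] e by simp
      also have "... \<le> dist p x + dist p z" unfolding dist_norm[symmetric] by (rule dist_triangle3)
      also have "... < R" using x z(2) R by (simp add: r_def)
      finally have sR: "s < R" .
      define y where "y = z + R *\<^sub>R e + (R / s) *\<^sub>R w"
      have "y - x0 = (z - p) + (R / s) *\<^sub>R w" by (simp add: y_def x0e)
      then have "norm (y - x0) \<le> norm (z - p) + R / s * norm w" using norm_triangle_ineq[of "z - p" "(R / s) *\<^sub>R w"] R0 s by simp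
      also have "R / s * norm w \<le> R / L"
      proof -
        have "R * (L * norm w) \<le> R * s" using s R0 by (intro mult_left_mono) auto
        then show ?thesis using s L by (simp add: field_simps)
      qed
      also have "R / L = \<rho> / 2" using R0 \<rho> by (simp add: L_def)
      finally have "norm (y - x0) < \<rho>" using z(2) by (simp add: r_def dist_norm norm_minus_commute)
      then have y: "y \<in> \<Omega>" using \<rho>(2) by (auto simp: dist_norm norm_minus_commute)
      have "x = (1 - s / R) *\<^sub>R z + (s / R) *\<^sub>R y"
        using R0 s by (simp add: xz y_def algebra_simps)
      also have "... \<in> \<Omega>" using convexD[OF \<Omega>(3) z(1) y, of "1 - s / R" "s / R"] s R0 sR by simp
      finally show ?thesis .
    qed
    define S where "S = \<Omega> \<inter> ball p r"
    have Sne: "S \<noteq> {}"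
    proof -
      obtain z where "z \<in> \<Omega>" "dist z p < r" using pc r unfolding closure_approachable by blast
      then have "z \<in> S" by (simp add: S_def dist_commute)
      then show ?thesis by blast
    qed
    obtain Bd where Bd: "\<And>x. x \<in> \<Omega> \<Longrightarrow> norm x \<le> Bd" using \<Omega>(2) by (auto simp: bounded_iff)
    \<comment> \<open>The largest L-Lipschitz function whose graph lies below all points of S. By
      the cone property, every point of the ball strictly above the graph lies in \<Omega>.\<close>
    define \<gamma> where "\<gamma> y = (INF z\<in>S. z \<bullet> e + L * norm (y - P z))" for y
    have bdd: "bdd_below ((\<lambda>z. z \<bullet> e + L * norm (y - P z)) ` S)" for y
    proof (rule bdd_belowI2)
      fix z assume "z \<in> S"
      then have "norm z \<le> Bd" using Bd by (simp add: S_def)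
      moreover have "- norm z \<le> z \<bullet> e" using Cauchy_Schwarz_ineq2[of z e] e by simp
      moreover have "0 \<le> L * norm (y - P z)" using L by simp
      ultimately show "- Bd \<le> z \<bullet> e + L * norm (y - P z)" by linarith
    qed
    have lower: "\<gamma> y \<le> z \<bullet> e + L * norm (y - P z)" if "z \<in> S" for y z
      unfolding \<gamma>_def by (rule cINF_lower[OF bdd that])
    have lip: "\<gamma> y \<le> \<gamma> y' + L * norm (y - y')" for y y'
    proof -
      have "\<gamma> y - L * norm (y - y') \<le> \<gamma> y'"
        unfolding \<gamma>_def[of y']
      proof (rule cINF_greatest[OF Sne])
        fix z assume z: "z \<in> S"
        have "norm (y - P z) \<le> norm (y - y') + norm (y' - P z)" using norm_triangle_ineq[of "y - y'" "y' - P z"] by simp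
        then have "L * norm (y - P z) \<le> L * (norm (y - y') + norm (y' - P z))" using L by (intro mult_left_mono) auto
        then show "\<gamma> y - L * norm (y - y') \<le> z \<bullet> e + L * norm (y' - P z)"
          using lower[OF z, of y] by (simp add: distrib_left)
      qed
      then show ?thesis by simp
    qed
    have "lipschitz_on L {y. y \<bullet> e = 0} \<gamma>"
    proof (rule lipschitz_onI)
      fix x y
      show "dist (\<gamma> x) (\<gamma> y) \<le> L * dist x y"
        using lip[of x y] lip[of y x] by (simp add: dist_norm norm_minus_commute abs_le_iff)
    qed (use L in simp)
    moreover have "\<Omega> \<inter> ball p r = {x \<in> ball p r. \<gamma> (P x) < x \<bullet> e}"
    proof (intro set_eqI iffI)
      fix x assume "x \<in> \<Omega> \<inter> ball p r"
      moreover have "open (\<Omega> \<inter> ball p r)" by (intro open_Int open_ball \<Omega>(1))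
      ultimately obtain d where d: "0 < d" "cball x d \<subseteq> \<Omega> \<inter> ball p r" using open_contains_cball by blast
      \<comment> \<open>A point of the open set slightly below x also belongs to S, which makes the
        inequality strict.\<close>
      have "x - d *\<^sub>R e \<in> cball x d" using d e by (simp add: dist_norm)
      then have x': "x - d *\<^sub>R e \<in> S" unfolding S_def using d(2) by (rule subsetD[rotated])
      have ee: "e \<bullet> e = 1" using e by (simp add: dot_square_norm)
      have "P (x - d *\<^sub>R e) = P x" by (simp add: P_def inner_diff_left ee algebra_simps)
      then have "\<gamma> (P x) \<le> (x - d *\<^sub>R e) \<bullet> e" using lower[OF x', of "P x"] by simp
      then have "\<gamma> (P x) < x \<bullet> e" using d by (simp add: inner_diff_left ee)
      then show "x \<in> {x \<in> ball p r. \<gamma> (P x) < x \<bullet> e}" using \<open>x \<in> \<Omega> \<inter> ball p r\<close> by blast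
    next
      fix x assume x: "x \<in> {x \<in> ball p r. \<gamma> (P x) < x \<bullet> e}"
      then obtain z where "z \<in> S" "z \<bullet> e + L * norm (P x - P z) < x \<bullet> e"
        unfolding \<gamma>_def using cINF_less_iff[OF Sne bdd] by auto
      then show "x \<in> \<Omega> \<inter> ball p r" using x cone[of z x] by (auto simp: S_def)
    qed
    ultimately show ?thesis using r e unfolding P_def by blast
  qed
  then show ?thesis unfolding bounded_lipschitz_domain_def using \<Omega> convex_connected by blast
qed

lemma cbox_minus_box_null: "emeasure lborel (cbox a b - box a b) = 0"
proof -
  have "emeasure lborel (cbox a b - box a b) = emeasure lborel (cbox a b) - emeasure lborel (box a b)"
    by (rule emeasure_Diff) (use box_subset_cbox emeasure_lborel_box_finite[of a b] in auto)
  then show ?thesis using emeasure_lborel_cbox_eq[of a b] emeasure_lborel_box_eq[of a b] by simp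
qed

lemma AE_cbox_box: "AE x in lborel. x \<in> cbox a b \<longleftrightarrow> x \<in> box a b"
proof (rule AE_I)
  show "{x \<in> space lborel. \<not> (x \<in> cbox a b \<longleftrightarrow> x \<in> box a b)} \<subseteq> cbox a b - box a b" using box_subset_cbox by auto
  show "emeasure lborel (cbox a b - box a b) = 0" by (rule cbox_minus_box_null)
qed simp

text \<open>Each face is flat, so \<open>trace_le_tube\<close> applies with L = 0 and the inward
  normal, and the interior mass is handled by the Poincare inequality on the cube. The energy
  coefficient scales like s, which is what makes thin boxes extremal.\<close>

lemma cube_trace:
  fixes a :: "'a::euclidean_space"
  assumes n: "2 \<le> DIM('a)" and s: "0 < s" and C1: "C1_with_gradient \<phi> D"
  defines "Q \<equiv> cbox a (a + s *\<^sub>R One)"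
  shows "surface_int (Q - box a (a + s *\<^sub>R One)) \<phi>
    \<le> ennreal (2 * real DIM('a) * graph_const (DIM('a)) 0 * s * (4 * (real DIM('a))\<^sup>2 * 2 ^ DIM('a) + 4)) *
        dirichlet_int Q D
      + ennreal (2 * real DIM('a) * (graph_const (DIM('a)) 0 * 4 / s) * ((\<integral>x. indicator Q x * \<phi> x \<partial>lborel)\<^sup>2 / measure lborel Q))"
proof -
  let ?H = "hausdorff_measure (DIM('a) - 1) :: 'a measure"
  let ?n = "DIM('a)"
  let ?g = "graph_const (DIM('a)) 0"
  let ?E = "dirichlet_int Q D"
  let ?F = "square_int Q \<phi>"
  let ?m = "(\<integral>x. indicator Q x * \<phi> x \<partial>lborel)\<^sup>2 / measure lborel Q"
  have g: "0 < ?g" by (rule graph_const_pos) simp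
  have Qb: "Q \<in> sets borel" "compact Q" "convex Q" "bounded Q" by (auto simp: Q_def)
  have mQ: "x \<in> Q \<longleftrightarrow> (\<forall>b\<in>Basis. a \<bullet> b \<le> x \<bullet> b \<and> x \<bullet> b \<le> a \<bullet> b + s)" for x
    by (simp add: Q_def mem_box inner_add_left)
  \<comment> \<open>The two values \<sigma> = 0 and \<sigma> = 1 give the opposite faces orthogonal
    to c.\<close>
  define K where "K c \<sigma> = {y \<in> Q. y \<bullet> c = a \<bullet> c + \<sigma> * s}" for c :: 'a and \<sigma> :: real
  have Kc: "compact (K c \<sigma>)" for c \<sigma>
  proof -
    have "closed {y. y \<bullet> c = a \<bullet> c + \<sigma> * s}" by (intro closed_Collect_eq continuous_intros)
    then have "compact (Q \<inter> {y. y \<bullet> c = a \<bullet> c + \<sigma> * s})" using Qb(2) by (rule compact_Int_closed[rotated])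
    moreover have "K c \<sigma> = Q \<inter> {y. y \<bullet> c = a \<bullet> c + \<sigma> * s}" by (auto simp: K_def)
    ultimately show ?thesis by simp
  qed
  have d: "norm (y - x) \<le> s * ?n" if "x \<in> Q" "y \<in> Q" for x y
  proof -
    have "norm (y - x) \<le> (\<Sum>b\<in>Basis. \<bar>(y - x) \<bullet> b\<bar>)" by (rule norm_le_l1)
    also have "... \<le> (\<Sum>b\<in>(Basis :: 'a set). s)"
      using that unfolding mQ by (intro sum_mono) (force simp: inner_diff_left abs_le_iff)
    finally show ?thesis by (simp add: mult.commute)
  qed
  have F: "?F \<le> ennreal ((s * ?n)\<^sup>2 * 2 ^ ?n) * ?E + ennreal ?m"
    by (rule poincare[OF Qb(3,1,4) d C1])
  define X where "X = ennreal (?g * s * (4 * (real ?n)\<^sup>2 * 2 ^ ?n + 4)) * ?E + ennreal (?g * 4 / s * ?m)"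
  have face: "surface_int (K c \<sigma>) \<phi> \<le> X" if c: "c \<in> Basis" and \<sigma>: "\<sigma> = 0 \<or> \<sigma> = 1" for c \<sigma>
  proof -
    \<comment> \<open>The inward normal: c on the face \<sigma> = 0 and -c on the face \<sigma> =
      1.\<close>
    define e where "e = (1 - 2 * \<sigma>) *\<^sub>R c"
    have e: "norm e = 1" using c \<sigma> by (auto simp: e_def)
    have flat: "flat_over 0 e (K c \<sigma>)"
      unfolding flat_over_def by (auto simp: K_def e_def inner_diff_left)
    have above: "y + t *\<^sub>R e \<in> Q" if y: "y \<in> K c \<sigma>" and t: "0 \<le> t" "t \<le> s" for y t
      unfolding mQ
    proof
      fix b :: 'a assume b: "b \<in> Basis"
      have yb: "a \<bullet> b \<le> y \<bullet> b \<and> y \<bullet> b \<le> a \<bullet> b + s" and yc: "y \<bullet> c = a \<bullet> c + \<sigma> * s" using y b by (auto simp: K_def mQ)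
      have "(y + t *\<^sub>R e) \<bullet> b = y \<bullet> b + t * (1 - 2 * \<sigma>) * (if b = c then 1 else 0)"
        using b c by (simp add: inner_add_left e_def inner_Basis)
      then show "a \<bullet> b \<le> (y + t *\<^sub>R e) \<bullet> b \<and> (y + t *\<^sub>R e) \<bullet> b \<le> a \<bullet> b + s"
        using yb yc t \<sigma> by (cases "b = c") auto
    qed
    have tube: "tube e (s / 2) s (K c \<sigma>) \<subseteq> Q" unfolding tube_def using above s by auto
    \<comment> \<open>The height h = s / 2 is the largest for which the tube, reaching up to 2 h,
      stays in the cube.\<close>
    have "surface_int (K c \<sigma>) \<phi> \<le> ennreal (?g / (s / 2)) *
        (2 * (square_int (tube e (s / 2) (2 * (s / 2)) (K c \<sigma>)) \<phi>) + ennreal (8 * (s / 2)\<^sup>2) * ?E)"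
      by (rule trace_le_tube[OF n e order_refl Kc flat _ C1 Qb(1)]) (use above s in auto)
    also have "... \<le> ennreal (?g / (s / 2)) * (2 * (ennreal ((s * ?n)\<^sup>2 * 2 ^ ?n) * ?E + ennreal ?m) + ennreal (8 * (s / 2)\<^sup>2) * ?E)"
    proof (rule mult_left_mono, rule add_right_mono, rule mult_left_mono)
      have "(square_int (tube e (s / 2) (2 * (s / 2)) (K c \<sigma>)) \<phi>) \<le> ?F"
        by (rule nn_integral_mono) (use tube in \<open>auto split: split_indicator\<close>)
      then show "(square_int (tube e (s / 2) (2 * (s / 2)) (K c \<sigma>)) \<phi>) \<le> ennreal ((s * ?n)\<^sup>2 * 2 ^ ?n) * ?E + ennreal ?m"
        using F by (rule order_trans)
    qed auto
    also have "... = (ennreal (?g / (s / 2)) * (2 * ennreal ((s * ?n)\<^sup>2 * 2 ^ ?n) + ennreal (8 * (s / 2)\<^sup>2))) * ?E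
        + ennreal (?g / (s / 2)) * (2 * ennreal ?m)"
      by (simp only: distrib_left distrib_right mult.assoc add.assoc add.commute add.left_commute)
    also have "ennreal (?g / (s / 2)) * (2 * ennreal ?m) = ennreal (?g * 4 / s * ?m)"
    proof -
      have "2 * ennreal ?m = ennreal (2 * ?m)" by (subst ennreal_mult) auto
      then have "ennreal (?g / (s / 2)) * (2 * ennreal ?m) = ennreal (?g / (s / 2) * (2 * ?m))"
        using g s by (simp only:) (rule ennreal_mult[symmetric], auto)
      also have "?g / (s / 2) * (2 * ?m) = ?g * 4 / s * ?m" by simp
      finally show ?thesis .
    qed
    also have "ennreal (?g / (s / 2)) * (2 * ennreal ((s * ?n)\<^sup>2 * 2 ^ ?n) + ennreal (8 * (s / 2)\<^sup>2))
        = ennreal (?g * s * (4 * (real ?n)\<^sup>2 * 2 ^ ?n + 4))"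
    proof -
      have "2 * ennreal ((s * ?n)\<^sup>2 * 2 ^ ?n) = ennreal (2 * ((s * ?n)\<^sup>2 * 2 ^ ?n))" by (subst ennreal_mult) auto
      then have "2 * ennreal ((s * ?n)\<^sup>2 * 2 ^ ?n) + ennreal (8 * (s / 2)\<^sup>2) = ennreal (2 * ((s * ?n)\<^sup>2 * 2 ^ ?n) + 8 * (s / 2)\<^sup>2)"
        by (simp only:) (rule ennreal_plus[symmetric], auto)
      then have "ennreal (?g / (s / 2)) * (2 * ennreal ((s * ?n)\<^sup>2 * 2 ^ ?n) + ennreal (8 * (s / 2)\<^sup>2))
          = ennreal (?g / (s / 2) * (2 * ((s * ?n)\<^sup>2 * 2 ^ ?n) + 8 * (s / 2)\<^sup>2))"
        using g s by (simp only:) (rule ennreal_mult[symmetric], auto)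
      also have "?g / (s / 2) * (2 * ((s * ?n)\<^sup>2 * 2 ^ ?n) + 8 * (s / 2)\<^sup>2) = ?g * s * (4 * (real ?n)\<^sup>2 * 2 ^ ?n + 4)"
        using s by (simp add: field_simps power2_eq_square)
      finally show ?thesis .
    qed
    finally show ?thesis unfolding X_def .
  qed
  have "surface_int (Q - box a (a + s *\<^sub>R One)) \<phi>
      \<le> (\<integral>\<^sup>+y. (\<Sum>(c, \<sigma>)\<in>Basis \<times> {0, 1}. ennreal ((\<phi> y)\<^sup>2) * indicator (K c \<sigma>) y) \<partial>?H)"
  proof (rule nn_integral_mono)
    fix y
    show "ennreal ((\<phi> y)\<^sup>2) * indicator (Q - box a (a + s *\<^sub>R One)) y
        \<le> (\<Sum>(c, \<sigma>)\<in>Basis \<times> {0, 1}. ennreal ((\<phi> y)\<^sup>2) * indicator (K c \<sigma>) y)"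
    proof (cases "y \<in> Q - box a (a + s *\<^sub>R One)")
      case True
      then obtain c where c: "c \<in> Basis" "\<not> (a \<bullet> c < y \<bullet> c \<and> y \<bullet> c < a \<bullet> c + s)"
        by (auto simp: mem_box inner_add_left)
      have yc: "a \<bullet> c \<le> y \<bullet> c \<and> y \<bullet> c \<le> a \<bullet> c + s" using True c(1) by (simp add: mQ)
      have "\<exists>\<sigma>\<in>{0, 1}. y \<in> K c \<sigma>"
      proof (cases "a \<bullet> c < y \<bullet> c")
        case True
        then have "y \<bullet> c = a \<bullet> c + s" using c(2) yc by linarith
        then show ?thesis using \<open>y \<in> Q - _\<close> by (intro bexI[of _ 1]) (auto simp: K_def)
      next
        case False
        then have "y \<bullet> c = a \<bullet> c" using yc by linarith
        then show ?thesis using \<open>y \<in> Q - _\<close> by (intro bexI[of _ 0]) (auto simp: K_def)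
      qed
      then obtain \<sigma> where \<sigma>: "\<sigma> \<in> {0, 1}" "y \<in> K c \<sigma>" by blast
      have "ennreal ((\<phi> y)\<^sup>2) * indicator (Q - box a (a + s *\<^sub>R One)) y = (\<lambda>(c, \<sigma>). ennreal ((\<phi> y)\<^sup>2) * indicator (K c \<sigma>) y) (c, \<sigma>)"
        using True \<sigma> by simp
      also have "... \<le> (\<Sum>(c, \<sigma>)\<in>Basis \<times> {0, 1}. ennreal ((\<phi> y)\<^sup>2) * indicator (K c \<sigma>) y)"
        by (rule member_le_sum) (use c \<sigma> in auto)
      finally show ?thesis .
    qed simp
  qed
  also have "... = (\<Sum>(c, \<sigma>)\<in>Basis \<times> {0, 1}. surface_int (K c \<sigma>) \<phi>)"
  proof -
    have [measurable]: "\<phi> \<in> borel_measurable ?H" by (rule C1_measurable_hausdorff[OF C1])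
    have [measurable]: "K c \<sigma> \<in> sets ?H" for c \<sigma> using compact_imp_closed[OF Kc] by simp
    show ?thesis unfolding case_prod_beta by (rule nn_integral_sum) measurable
  qed
  also have "... \<le> (\<Sum>(c, \<sigma>)\<in>(Basis :: 'a set) \<times> {0 :: real, 1}. X)"
    by (rule sum_mono) (use face in auto)
  also have "... = of_nat (card ((Basis :: 'a set) \<times> {0 :: real, 1})) * X" by simp
  also have "card ((Basis :: 'a set) \<times> {0 :: real, 1}) = 2 * ?n" by (simp add: card_cartesian_product)
  also have "of_nat (2 * ?n) * X = ennreal (2 * real ?n) * X"
    by (metis ennreal_of_nat_eq_real_of_nat of_nat_mult of_nat_numeral)
  also have "... = ennreal (2 * real ?n * ?g * s * (4 * (real ?n)\<^sup>2 * 2 ^ ?n + 4)) * ?E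
      + ennreal (2 * real ?n * (?g * 4 / s) * ?m)"
  proof -
    have "ennreal (2 * real ?n) * ennreal (?g * s * (4 * (real ?n)\<^sup>2 * 2 ^ ?n + 4))
        = ennreal (2 * real ?n * (?g * s * (4 * (real ?n)\<^sup>2 * 2 ^ ?n + 4)))"
      by (rule ennreal_mult[symmetric]) (use g s in auto)
    moreover have "ennreal (2 * real ?n) * ennreal (?g * 4 / s * ?m) = ennreal (2 * real ?n * (?g * 4 / s * ?m))"
      by (rule ennreal_mult[symmetric]) (use g s in auto)
    ultimately show ?thesis unfolding X_def distrib_left mult.assoc[symmetric] by (simp only: mult.assoc)
  qed
  finally show ?thesis .
qed

text \<open>A row of \<open>k\<close> cubes of side \<open>1 / k\<close>. A function whose mean vanishes on every cube satisfies a trace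
  inequality with constant of order \<open>1 / k\<close>, and these are only \<open>k\<close> conditions.\<close>

lemma thin_box_eigenvalue:
  assumes n: "2 \<le> DIM('a::euclidean_space)"
  shows "\<exists>c>0. \<forall>k\<ge>1. \<exists>\<Omega> :: 'a set. bounded_lipschitz_domain \<Omega> \<and> c * real k \<le> diameter \<Omega> * steklov_eigenvalue \<Omega> k"
proof -
  let ?n = "DIM('a)"
  let ?g = "graph_const (DIM('a)) 0"
  \<comment> \<open>The energy coefficient of \<open>cube_trace\<close> divided by s; with s = 1 / k
    the eigenvalue is at least k / C.\<close>
  define C where "C = 2 * real ?n * ?g * (4 * (real ?n)\<^sup>2 * 2 ^ ?n + 4)"
  have g: "0 < ?g" by (rule graph_const_pos) simp
  have C: "0 < C" unfolding C_def using g by (intro mult_pos_pos add_nonneg_pos) auto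
  obtain b0 :: 'a where b0: "b0 \<in> Basis" using nonempty_Basis by blast
  have "\<exists>\<Omega> :: 'a set. bounded_lipschitz_domain \<Omega> \<and> 1 / C * real k \<le> diameter \<Omega> * steklov_eigenvalue \<Omega> k"
    if k: "1 \<le> k" for k :: nat
  proof -
    define s where "s = 1 / real k"
    have s: "0 < s" "s \<le> 1" and ks: "real k * s = 1" using k by (simp_all add: s_def)
    define u where "u = s *\<^sub>R One + (1 - s) *\<^sub>R b0"
    have u: "u \<bullet> b = (if b = b0 then 1 else s)" if "b \<in> Basis" for b
      using that b0 by (simp add: u_def inner_add_left inner_Basis)
    define \<Omega> where "\<Omega> = box 0 u"
    define a where "a j = (real j * s) *\<^sub>R b0" for j :: nat
    have a: "a j \<bullet> b = (if b = b0 then real j * s else 0)" if "b \<in> Basis" for j b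
      using that b0 by (simp add: a_def inner_Basis)
    define Q where "Q j = cbox (a j) (a j + s *\<^sub>R One)" for j
    define Qo where "Qo j = box (a j) (a j + s *\<^sub>R One)" for j
    have Qo_iff: "x \<in> Qo j \<longleftrightarrow> (\<forall>b\<in>Basis. a j \<bullet> b < x \<bullet> b \<and> x \<bullet> b < a j \<bullet> b + s)" for x j
      by (simp add: Qo_def mem_box inner_add_left)
    have Q_iff: "x \<in> Q j \<longleftrightarrow> (\<forall>b\<in>Basis. a j \<bullet> b \<le> x \<bullet> b \<and> x \<bullet> b \<le> a j \<bullet> b + s)" for x j
      by (simp add: Q_def mem_box inner_add_left)
    have js: "real j * s + s \<le> 1" if "j < k" for j
    proof -
      have "(real j + 1) * s \<le> real k * s" using that s by (intro mult_right_mono) auto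
      then show ?thesis using ks by (simp add: distrib_right)
    qed
    have Qo\<Omega>: "Qo j \<subseteq> \<Omega>" if j: "j < k" for j
    proof
      fix x assume x: "x \<in> Qo j"
      have "0 < x \<bullet> b \<and> x \<bullet> b < u \<bullet> b" if b: "b \<in> Basis" for b
      proof -
        have "a j \<bullet> b < x \<bullet> b" "x \<bullet> b < a j \<bullet> b + s" using x b unfolding Qo_iff by auto
        moreover have "0 \<le> a j \<bullet> b" "a j \<bullet> b + s \<le> u \<bullet> b" using js[OF j] s by (auto simp: u[OF b] a[OF b])
        ultimately show ?thesis by linarith
      qed
      then show "x \<in> \<Omega>" by (simp add: \<Omega>_def mem_box)
    qed
    have center: "(1 / 2) *\<^sub>R u \<in> \<Omega>" using u s by (simp add: \<Omega>_def mem_box)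
    have conv: "open \<Omega>" "bounded \<Omega>" "convex \<Omega>" "\<Omega> \<noteq> {}" using center by (auto simp: \<Omega>_def)
    have dom: "bounded_lipschitz_domain \<Omega>" by (rule convex_bounded_lipschitz_domain[OF conv])
    interpret lipschitz_domain \<Omega> by unfold_locales (rule n, rule dom)
    have disj: "i = j" if ij: "x \<in> Qo i" "x \<in> Qo j" for x i j
    proof -
      have "real i * s < x \<bullet> b0 \<and> x \<bullet> b0 < real i * s + s" "real j * s < x \<bullet> b0 \<and> x \<bullet> b0 < real j * s + s"
        using ij b0 unfolding Qo_iff by (auto simp: a[OF b0])
      then have "real i * s < (real j + 1) * s" "real j * s < (real i + 1) * s" by (auto simp: distrib_right)
      then show ?thesis using s by auto
    qed
    \<comment> \<open>Every boundary point of the box lies on the surface of some cube. The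
      interfaces between neighbouring cubes only enlarge the sum of the surface integrals.\<close>
    have cover: "\<exists>j<k. x \<in> Q j - Qo j" if x: "x \<in> frontier \<Omega>" for x
    proof -
      have x': "x \<in> cbox 0 u" "x \<notin> \<Omega>" using x conv(4) by (auto simp: \<Omega>_def frontier_box split: if_splits)
      have xb: "0 \<le> x \<bullet> b \<and> x \<bullet> b \<le> u \<bullet> b" if "b \<in> Basis" for b using x'(1) that by (simp add: mem_box)
      define t where "t = real k * (x \<bullet> b0)"
      have t: "0 \<le> t" "t \<le> real k" using xb[OF b0] u[OF b0] k by (auto simp: t_def mult_le_cancel_left1)
      have xt: "x \<bullet> b0 = t * s" using ks by (simp add: t_def algebra_simps)
      \<comment> \<open>At the far end t = k rounding down would give the index k, so the last cube
        is taken there.\<close>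
      obtain j where j: "j < k" "real j \<le> t" "t \<le> real j + 1"
      proof (cases "t = real k")
        case True
        then show ?thesis using that[of "k - 1"] k by (simp add: of_nat_diff)
      next
        case False
        have "real (nat \<lfloor>t\<rfloor>) \<le> t" "t \<le> real (nat \<lfloor>t\<rfloor>) + 1" using t by linarith+
        moreover from this have "nat \<lfloor>t\<rfloor> < k" using t False by linarith
        ultimately show ?thesis using that by blast
      qed
      have "x \<in> Q j"
        unfolding Q_iff
      proof
        fix b :: 'a assume b: "b \<in> Basis"
        have "real j * s \<le> t * s" "t * s \<le> (real j + 1) * s" using j s by (auto intro: mult_right_mono)
        then show "a j \<bullet> b \<le> x \<bullet> b \<and> x \<bullet> b \<le> a j \<bullet> b + s"
          using xb[OF b] u[OF b] by (cases "b = b0") (auto simp: a[OF b] a[OF b0] xt distrib_right)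
      qed
      moreover have "x \<notin> Qo j" using Qo\<Omega>[OF j(1)] x'(2) by blast
      ultimately show ?thesis using j(1) by blast
    qed
    define \<beta> where "\<beta> = 2 * real ?n * (?g * 4 / s) / s ^ ?n"
    have \<beta>: "0 \<le> \<beta>" using g s by (simp add: \<beta>_def)
    have mQ: "measure lborel (Q j) = s ^ ?n" for j
      unfolding Q_def using s by (subst content_cbox) (simp_all add: inner_add_left)
    \<comment> \<open>The prescribed means are over open cubes, which lie in \<Omega>; the closed
      cubes of the trace estimate differ from them by null sets.\<close>
    let ?I = "Qo ` {..<k}"
    have "1 \<le> (C * s) * steklov_eigenvalue \<Omega> k"
    proof (rule steklov_eigenvalue_ge[of ?I k "C * s" "real k * \<beta>"])
      show "finite ?I" by simp
      show "card ?I \<le> k" using card_image_le[of "{..<k}" Qo] by simp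
      show "P \<in> sets borel \<and> P \<subseteq> \<Omega>" if "P \<in> ?I" for P using that Qo\<Omega> by (auto simp: Qo_def)
      show "0 \<le> C * s" "0 \<le> real k * \<beta>" using C s \<beta> by auto
    next
      fix \<phi> :: "'a \<Rightarrow> real" and D assume C1: "C1_with_gradient \<phi> D"
      let ?E = "\<lambda>P. dirichlet_int P D"
      let ?m = "\<lambda>P. (\<integral>x. indicator P x * \<phi> x \<partial>lborel)\<^sup>2"
      have [measurable]: "\<phi> \<in> borel_measurable H" by (rule C1_measurable_hausdorff[OF C1])
      have [measurable]: "D \<in> borel_measurable borel" by (rule C1_gradient_measurable[OF C1])
      have [measurable]: "\<phi> \<in> borel_measurable borel" by (rule C1_measurable[OF C1])
      have [measurable]: "Q j \<in> sets borel" "Qo j \<in> sets borel" "Q j - Qo j \<in> sets H" for j by (simp_all add: Q_def Qo_def)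
      have "surface_int (frontier \<Omega>) \<phi>
          \<le> (\<integral>\<^sup>+y. (\<Sum>j<k. ennreal ((\<phi> y)\<^sup>2) * indicator (Q j - Qo j) y) \<partial>H)"
      proof (rule nn_integral_mono)
        fix y
        show "ennreal ((\<phi> y)\<^sup>2) * indicator (frontier \<Omega>) y \<le> (\<Sum>j<k. ennreal ((\<phi> y)\<^sup>2) * indicator (Q j - Qo j) y)"
        proof (cases "y \<in> frontier \<Omega>")
          case True
          then obtain j where j: "j < k" "y \<in> Q j - Qo j" using cover by blast
          have "ennreal ((\<phi> y)\<^sup>2) * indicator (frontier \<Omega>) y = ennreal ((\<phi> y)\<^sup>2) * indicator (Q j - Qo j) y" using True j by simp
          also have "... \<le> (\<Sum>j<k. ennreal ((\<phi> y)\<^sup>2) * indicator (Q j - Qo j) y)"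
            by (rule member_le_sum) (use j in auto)
          finally show ?thesis .
        qed simp
      qed
      also have "... = (\<Sum>j<k. surface_int (Q j - Qo j) \<phi>)"
        by (rule nn_integral_sum) measurable
      also have "... \<le> (\<Sum>j<k. ennreal (C * s) * ?E (Qo j) + ennreal (\<beta> * ?m (Qo j)))"
      proof (rule sum_mono)
        fix j
        have ae: "AE x in lborel. x \<in> Q j \<longleftrightarrow> x \<in> Qo j" unfolding Q_def Qo_def by (rule AE_cbox_box)
        have E: "?E (Q j) = ?E (Qo j)"
          by (rule nn_integral_cong_AE) (use ae in \<open>auto elim!: AE_mp split: split_indicator\<close>)
        have m: "?m (Q j) = ?m (Qo j)"
        proof -
          have "(\<integral>x. indicator (Q j) x * \<phi> x \<partial>lborel) = (\<integral>x. indicator (Qo j) x * \<phi> x \<partial>lborel)"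
            by (rule integral_cong_AE) (measurable, use ae in \<open>auto elim!: AE_mp split: split_indicator\<close>)
          then show ?thesis by simp
        qed
        have c1: "2 * real ?n * ?g * s * (4 * (real ?n)\<^sup>2 * 2 ^ ?n + 4) = C * s" by (simp add: C_def)
        have c2: "2 * real ?n * (?g * 4 / s) * (?m (Qo j) / s ^ ?n) = \<beta> * ?m (Qo j)" by (simp add: \<beta>_def)
        show "surface_int (Q j - Qo j) \<phi> \<le> ennreal (C * s) * ?E (Qo j) + ennreal (\<beta> * ?m (Qo j))"
          using cube_trace[OF n s(1) C1, of "a j"] unfolding Q_def[symmetric] Qo_def[symmetric] mQ E m c1 c2 .
      qed
      also have "... = ennreal (C * s) * (\<Sum>j<k. ?E (Qo j)) + (\<Sum>j<k. ennreal (\<beta> * ?m (Qo j)))"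
        by (simp only: sum.distrib sum_distrib_left)
      also have "... \<le> ennreal (C * s) * ?E \<Omega> + ennreal (real k * \<beta> * (\<Sum>P\<in>?I. ?m P))"
      proof (rule add_mono, rule mult_left_mono)
        have "(\<Sum>j<k. ?E (Qo j)) = (\<integral>\<^sup>+x. (\<Sum>j<k. ennreal ((norm (D x))\<^sup>2) * indicator (Qo j) x) \<partial>lborel)"
          by (rule nn_integral_sum[symmetric]) measurable
        also have "... \<le> ?E \<Omega>"
        proof (rule nn_integral_mono)
          fix x
          show "(\<Sum>j<k. ennreal ((norm (D x))\<^sup>2) * indicator (Qo j) x) \<le> ennreal ((norm (D x))\<^sup>2) * indicator \<Omega> x"
          proof (cases "\<exists>i<k. x \<in> Qo i")
            case True
            then obtain i where i: "i < k" "x \<in> Qo i" by blast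
            have "(\<Sum>j<k. ennreal ((norm (D x))\<^sup>2) * indicator (Qo j) x) = (\<Sum>j<k. if j = i then ennreal ((norm (D x))\<^sup>2) else 0)"
            proof (rule sum.cong[OF refl])
              fix j
              show "ennreal ((norm (D x))\<^sup>2) * indicator (Qo j) x = (if j = i then ennreal ((norm (D x))\<^sup>2) else 0)"
              proof (cases "j = i")
                case True
                then show ?thesis using i(2) by simp
              next
                case False
                then have "x \<notin> Qo j" using disj[OF i(2), of j] by blast
                then show ?thesis using False by simp
              qed
            qed
            also have "... = ennreal ((norm (D x))\<^sup>2)" using i(1) by simp
            also have "... = ennreal ((norm (D x))\<^sup>2) * indicator \<Omega> x" using subsetD[OF Qo\<Omega>[OF i(1)] i(2)] by simp
            finally show ?thesis by (rule eq_refl)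
          next
            case False
            then have eq: "(\<Sum>j<k. ennreal ((norm (D x))\<^sup>2) * indicator (Qo j) x) = 0" by (intro sum.neutral) auto
            show ?thesis unfolding eq by (rule zero_le)
          qed
        qed
        finally show "(\<Sum>j<k. ?E (Qo j)) \<le> ?E \<Omega>" .
      next
        \<comment> \<open>Each squared mean is bounded by the sum over the whole image set, which
          costs a factor k in the coefficient of the means and nothing in the energy.\<close>
        have "(\<Sum>j<k. ennreal (\<beta> * ?m (Qo j))) = ennreal (\<Sum>j<k. \<beta> * ?m (Qo j))" using \<beta> by (intro sum_ennreal) auto
        also have "... \<le> ennreal (real k * \<beta> * (\<Sum>P\<in>?I. ?m P))"
        proof (rule ennreal_leI)
          have "(\<Sum>j<k. \<beta> * ?m (Qo j)) \<le> (\<Sum>j<k. \<beta> * (\<Sum>P\<in>?I. ?m P))"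
            using \<beta> by (intro sum_mono mult_left_mono member_le_sum) auto
          then show "(\<Sum>j<k. \<beta> * ?m (Qo j)) \<le> real k * \<beta> * (\<Sum>P\<in>?I. ?m P)" by (simp add: mult.assoc)
        qed
        finally show "(\<Sum>j<k. ennreal (\<beta> * ?m (Qo j))) \<le> ennreal (real k * \<beta> * (\<Sum>P\<in>?I. ?m P))" .
      qed simp
      finally show "surface_int (frontier \<Omega>) \<phi>
        \<le> ennreal (C * s) * ?E \<Omega> + ennreal (real k * \<beta> * (\<Sum>P\<in>?I. ?m P))" .
    qed
    then have "1 * real k \<le> (C * s) * steklov_eigenvalue \<Omega> k * real k" by (rule mult_right_mono) simp
    also have "... = C * steklov_eigenvalue \<Omega> k * (real k * s)" by (simp only: mult_ac)
    finally have \<sigma>: "1 / C * real k \<le> steklov_eigenvalue \<Omega> k" using C ks by (simp add: divide_le_eq mult.commute)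
    have diam: "1 \<le> diameter \<Omega>"
    proof -
      have "1 = u \<bullet> b0" using u[OF b0] by simp
      also have "... \<le> norm u" using Cauchy_Schwarz_ineq2[of u b0] norm_Basis[OF b0] by simp
      also have "... = diameter (cbox 0 u)" using u s by (subst diameter_cbox) auto
      also have "cbox 0 u = closure \<Omega>" using conv(4) by (simp add: \<Omega>_def closure_box)
      also have "diameter (closure \<Omega>) = diameter \<Omega>" by (rule diameter_closure[OF conv(2)])
      finally show ?thesis .
    qed
    have "0 \<le> steklov_eigenvalue \<Omega> k" using \<sigma> C by (meson divide_nonneg_pos mult_nonneg_nonneg of_nat_0_le_iff order_trans zero_le_one)
    then have "1 * steklov_eigenvalue \<Omega> k \<le> diameter \<Omega> * steklov_eigenvalue \<Omega> k" using diam by (intro mult_right_mono)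
    then have "1 / C * real k \<le> diameter \<Omega> * steklov_eigenvalue \<Omega> k" using \<sigma> by linarith
    then show ?thesis using dom by blast
  qed
  then show ?thesis using C by (intro exI[of _ "1 / C"]) simp
qed

text \<open>For \<alpha> < 1 the hypothesis bounds k^(1 - \<alpha>) by C / c, which fails for every
  k above (C / c)^(1 / (1 - \<alpha>)).\<close>

lemma powr_growth_exponent:
  fixes c C \<alpha> :: real
  assumes c: "0 < c" and C: "0 < C" and le: "\<And>k::nat. 1 \<le> k \<Longrightarrow> c * real k \<le> C * real k powr \<alpha>"
  shows "1 \<le> \<alpha>"
proof (rule ccontr)
  assume "\<not> 1 \<le> \<alpha>"
  then have \<alpha>: "0 < 1 - \<alpha>" by simp
  obtain k :: nat where k: "(C / c) powr (1 / (1 - \<alpha>)) < real k" using reals_Archimedean2 by blast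
  then have k0: "0 < real k" using powr_ge_zero[of "C / c" "1 / (1 - \<alpha>)"] by linarith
  have "C / c = ((C / c) powr (1 / (1 - \<alpha>))) powr (1 - \<alpha>)" using c C \<alpha> by (simp add: powr_powr)
  also have "... < real k powr (1 - \<alpha>)" by (rule powr_less_mono2[OF \<alpha> _ k]) simp
  also have "... = real k / real k powr \<alpha>" using k0 by (simp add: powr_diff)
  finally have "C * real k powr \<alpha> < c * real k" using c k0 by (simp add: field_simps)
  moreover have "1 \<le> k" using k0 by simp
  ultimately show False using le[of k] by linarith
qed

theorem theorem1p2:
  assumes "CARD('n::finite) \<ge> 2"
  shows "(\<exists>C>0. \<forall>\<Omega> :: (real ^ 'n) set. bounded_lipschitz_domain \<Omega> \<longrightarrow>
            (\<forall>k\<ge>1. diameter \<Omega> * steklov_eigenvalue \<Omega> k \<le> C * real k)) \<and>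
         (\<forall>\<alpha>::real.
            (\<exists>C>0. \<forall>\<Omega> :: (real ^ 'n) set. bounded_lipschitz_domain \<Omega> \<longrightarrow>
               (\<forall>k\<ge>1. diameter \<Omega> * steklov_eigenvalue \<Omega> k \<le> C * real k powr \<alpha>))
            \<longrightarrow> \<alpha> \<ge> 1)"
proof (intro conjI allI impI)
  have n: "2 \<le> DIM(real ^ 'n)" using assms by simp
  let ?C = "512 * capacity_const (DIM(real ^ 'n))"
  have "diameter \<Omega> * steklov_eigenvalue \<Omega> k \<le> ?C * real k"
    if "bounded_lipschitz_domain \<Omega>" "1 \<le> k" for \<Omega> :: "(real ^ 'n) set" and k
    by (rule lipschitz_domain.steklov_eigenvalue_le[OF lipschitz_domain.intro[OF n that(1)] that(2)])
  moreover have "0 < ?C" by (intro mult_pos_pos capacity_const_pos) simp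
  ultimately show "\<exists>C>0. \<forall>\<Omega> :: (real ^ 'n) set. bounded_lipschitz_domain \<Omega> \<longrightarrow>
      (\<forall>k\<ge>1. diameter \<Omega> * steklov_eigenvalue \<Omega> k \<le> C * real k)" by blast
  fix \<alpha> :: real
  assume "\<exists>C>0. \<forall>\<Omega> :: (real ^ 'n) set. bounded_lipschitz_domain \<Omega> \<longrightarrow>
      (\<forall>k\<ge>1. diameter \<Omega> * steklov_eigenvalue \<Omega> k \<le> C * real k powr \<alpha>)"
  then obtain C where C: "0 < C" "\<And>(\<Omega> :: (real ^ 'n) set) k. bounded_lipschitz_domain \<Omega> \<Longrightarrow> 1 \<le> k \<Longrightarrow>
      diameter \<Omega> * steklov_eigenvalue \<Omega> k \<le> C * real k powr \<alpha>" by blast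
  obtain c where c: "0 < c" "\<And>k. 1 \<le> k \<Longrightarrow> \<exists>\<Omega> :: (real ^ 'n) set. bounded_lipschitz_domain \<Omega> \<and>
      c * real k \<le> diameter \<Omega> * steklov_eigenvalue \<Omega> k" using thin_box_eigenvalue[OF n] by blast
  show "1 \<le> \<alpha>"
  proof (rule powr_growth_exponent[OF c(1) C(1)])
    fix k :: nat assume k: "1 \<le> k"
    obtain \<Omega> :: "(real ^ 'n) set" where "bounded_lipschitz_domain \<Omega>" "c * real k \<le> diameter \<Omega> * steklov_eigenvalue \<Omega> k"
      using c(2)[OF k] by blast
    then show "c * real k \<le> C * real k powr \<alpha>" using C(2)[OF _ k] by (meson order_trans)
  qed
qed

end
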